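(* Let $\alpha\in(0,2)$, $a\in(0,\infty]$, $b\in(0,\infty)$, $X_{12}\in\mathcal S_\alpha(a)$ complex-valued and $X_{11}\in\mathcal S_\alpha(b)$ real-valued, let $\vartheta_b$ be the probability measure on $\{-1,1\}$ associated to $X_{11}$, and suppose $\operatorname{supp}(\vartheta_b)=\{+1\}$. Let $\Phi:\mathcal P(\mathbb R)\to[0,\infty]$ be the associated function defined in the context, and for $\nu\in\mathcal P(\mathbb R)$ put $m_\alpha(\nu)=\int|x|^\alpha\,d\nu(x)\in[0,\infty]$. Then: (a) If $\operatorname{supp}(\nu)\subset\mathbb R_+$, then $\Phi(\nu)\le b\,m_\alpha(\nu)$. (b) Suppose $\alpha\in(1,2)$. If $\nu\in\mathcal P(\mathbb R)$ is symmetric, then $\Phi(\nu)=\frac a2\,m_\alpha(\nu)$. (c) Suppose $\alpha\in(1,2)$. If $\int x\,d\nu(x)<0$, then $\Phi(\nu)=+\infty$.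
   Context: Class $\mathcal S_\alpha(a)$: for $0<a<\infty$, a complex random variable $Y$ belongs to $\mathcal S_\alpha(a)$ if $\lim_{t\to\infty}-t^{-\alpha}\log\mathbb P(|Y|\ge t)=a$ and there exist $t_0>0$ and a probability measure $\vartheta$ on the unit circle $\mathbb S^1$ such that for all $t\ge t_0$ and all measurable $U\subset\mathbb S^1$, $\mathbb P(Y/|Y|\in U,\ |Y|\ge t)=\vartheta(U)\,\mathbb P(|Y|\ge t)$; $\vartheta$ is called the measure associated to $Y$. For $a=\infty$, $Y\in\mathcal S_\alpha(\infty)$ means only that $\lim_{t\to\infty}-t^{-\alpha}\log\mathbb P(|Y|\ge t)=\infty$. Let $\vartheta_a$ (if $a<\infty$) and $\vartheta_b$ be the measures associated to $X_{12}$ and $X_{11}$, with supports $S_a\subset\mathbb S^1$, $S_b\subset\{-1,1\}$; if $a=\infty$ put $S_a=\mathbb S^1$. Convention throughout: $\infty\times0=0$. Networks. A network $G=(V_G,\omega_G)$ is a countable set $V_G$ with a map $\omega_G:V_G^2\to\mathbb C$ that is Hermitian, $\omega_G(u,v)=\overline{\omega_G(v,u)}$, and locally finite, $\deg_G(v):=\sum_{u}|\omega_G(v,u)|^2<\infty$ for all $v$. Write $\omega_G(v)=\omega_G(v,v)$. A path from $u$ to $v$ is a sequence $u=u_0,\dots,u_k=v$ with $\omega_G(u_{i-1},u_i)\ne0$; its length is $(\sum_{i=1}^k|\omega_G(u_{i-1},u_i)|^{-2})^{1/2}$; $D(u,v)$ is the infimum of lengths of paths from $u$ to $v$ ($\infty$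 if there is none; $D(u,u)=0$). $G$ is connected if $D<\infty$ everywhere; $G(v)$ is the connected component of $v$. A rooted network $(G,o)$ is a connected network with a distinguished vertex $o$; $(G,o)_t$ is the rooted network induced on $\{u:D(o,u)\le t\}$. Rooted isomorphisms are weight-preserving bijections of vertex sets preserving roots; $\mathcal G_*$ is the set of isomorphism classes. On $\mathcal G_*$, $d_{\mathrm{loc}}((G_1,o_1),(G_2,o_2))=\frac1{1+T}$, where $T$ is the supremum of $t>0$ such that there is a bijection $\sigma:V_{(G_1,o_1)_t}\to V_{(G_2,o_2)_t}$ with $\sigma(o_1)=o_2$ and $|\omega_{G_2}\circ\sigma-\omega_{G_1}|\le1/t$ on $V_{(G_1,o_1)_t}^2$. Local weak convergence in $\mathcal P(\mathcal G_* )$ is weak convergence of probability measures on $(\mathcal G_*,d_{\mathrm{loc}})$. For a finite network $G$, $U(G)\in\mathcal P(\mathcal G_* )$ is the law of the class of $(G(o),o)$ with $o$ uniform in $V_G$. A Hermitian $n\times n$ matrix $H$ is viewed as the network on $\{1,\dots,n\}$ with $\omega(i,j)=H_{ij}$. Admissible sofic measures. $\mathcal A_n$ is the set of $n\times n$ Hermitian matrices $H$ with $H_{ij}=0$ or $H_{ij}/|H_{ij}|\in S_a$ for all $i<j$, and $H_{ii}=0$ or $H_{ii}/|H_{ii}|\in S_b$ for all $i$. $\mathcal P_s(\mathcal G_* )$ is the set of $\rho\in\mathcal P(\mathcal G_* )$ that are local weak limits of $U(H_n)$ for some sequence $H_n\in\mathcal A_n$. Truncation. For $0<\theta<1$ let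 $\chi_\theta(x)=0$ on $[0,\theta)$, $(x-\theta)/\theta$ on $[\theta,2\theta)$, $1$ on $[2\theta,\infty)$; $\tilde\chi_\theta(x)=1$ on $[0,\theta^{-2}-1)$, $\theta^{-2}-x$ on $[\theta^{-2}-1,\theta^{-2})$, $0$ on $[\theta^{-2},\infty)$. For a network $G=(V,\omega)$ put $\tilde\omega_\theta(u,v)=\omega(u,v)\tilde\chi_\theta(\deg_G(u)\vee\deg_G(v))$, $\omega_\theta(u,v)=\tilde\omega_\theta(u,v)\chi_\theta(|\tilde\omega_\theta(u,v)|)$, $G_\theta=(V,\omega_\theta)$. For $\rho\in\mathcal P(\mathcal G_* )$, $\rho_\theta$ is the law of the class of $(G_\theta(o),o)$ when $(G,o)$ has law $\rho$. Spectral measure. If $G=(V,\omega)$ has $\deg_G\le\theta^{-2}$ and all nonzero weights of modulus $\ge\theta$, the operator $Te_v=\sum_u\omega(u,v)e_u$ on $\ell^2(V)$ is bounded self-adjoint; $\mu_T^v$ is its spectral measure at $e_v$: $\int x^k\,d\mu_T^v=\langle e_v,T^ke_v\rangle$, $k\ge1$. Put $\mu_{\rho_\theta}=\mathbb E_{\rho_\theta}\mu_T^o$. For $\beta>0$ let $\xi_\beta(G,o)=\sum_{v\in V_G}|\omega_G(o,v)|^\beta$. For $\rho\in\mathcal P_s(\mathcal G_* )$ with $\mathbb E_\rho\xi_\beta<\infty$ for some $\beta\in(0,2)$, $\mu_\rho:=\lim_{\theta\to0}\mu_{\rho_\theta}$ (weak limit, which exists in $\mathcal P(\mathbb R)$);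 for all other $\rho\in\mathcal P_s(\mathcal G_* )$, $\mu_\rho:=\delta_0$. Rate function. For $\rho\in\mathcal P_s(\mathcal G_* )$, $I(\rho)=b\,\mathbb E_\rho|\omega_G(o)|^\alpha+\frac a2\,\mathbb E_\rho\sum_{v\in V_G\setminus\{o\}}|\omega_G(o,v)|^\alpha$. For $\nu\in\mathcal P(\mathbb R)$, $$\Phi(\nu)=\inf\{I(\rho):\rho\in\mathcal P_s(\mathcal G_* ),\ \mu_\rho=\nu\}\qquad(\inf\emptyset=+\infty).$$ ($\Phi$ is the function such that $J(\mu_{\mathrm{sc}}\boxplus\nu)=\Phi(\nu)$ for the rate function $J$, at speed $n^{1+\alpha/2}$, of the empirical spectral measures of $X/\sqrt n$, $X$ the Wigner matrix with off-diagonal entries distributed as $X_{12}$, of variance $1$, and diagonal entries distributed as $X_{11}$; $\mu_{\mathrm{sc}}$ is the semicircle law.) *)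

theory Defs
  imports "HOL-Probability.Probability"
begin

section \<open>Tail classes\<close>

(* minus the logarithm of a probability; the library has ln 0 = 0, whereas -log 0 = \<infinity> is meant
   (bounded variables belong to the class with exponent \<infinity>) *)
definition neg_log :: "real \<Rightarrow> ennreal" where
  "neg_log p = (if p = 0 then \<infinity> else ennreal (- ln p))"

definition angular_measure :: "'w measure \<Rightarrow> ('w \<Rightarrow> complex) \<Rightarrow> complex measure \<Rightarrow> bool" where
  "angular_measure M Y \<theta> \<longleftrightarrow>
     prob_space \<theta> \<and> sets \<theta> = sets borel \<and> measure \<theta> (sphere 0 1) = 1 \<and>
     (\<exists>t0>0. \<forall>t\<ge>t0. \<forall>U\<in>sets borel. U \<subseteq> sphere 0 1 \<longrightarrow>
        measure M {w \<in> space M. Y w / complex_of_real (norm (Y w)) \<in> U \<and> norm (Y w) \<ge> t}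
        = measure \<theta> U * measure M {w \<in> space M. norm (Y w) \<ge> t})"

definition tail_class :: "real \<Rightarrow> ennreal \<Rightarrow> 'w measure \<Rightarrow> ('w \<Rightarrow> complex) \<Rightarrow> bool" where
  "tail_class \<alpha> a M Y \<longleftrightarrow>
     Y \<in> borel_measurable M \<and>
     ((\<lambda>t. ennreal (t powr (- \<alpha>)) * neg_log (measure M {w \<in> space M. norm (Y w) \<ge> t}))
        \<longlongrightarrow> a) at_top \<and>
     (a < \<infinity> \<longrightarrow> (\<exists>\<theta>. angular_measure M Y \<theta>))"

(* for Y in a class with finite positive exponent, every tail probability is positive,
   so the angular measure is unique *)
definition assoc_measure :: "'w measure \<Rightarrow> ('w \<Rightarrow> complex) \<Rightarrow> complex measure" where
  "assoc_measure M Y = (THE \<theta>. angular_measure M Y \<theta>)"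

definition msupp :: "'x::topological_space measure \<Rightarrow> 'x set" where
  "msupp M = {x. \<forall>U. open U \<and> x \<in> U \<longrightarrow> emeasure M U > 0}"

definition dir_supp :: "ennreal \<Rightarrow> 'w measure \<Rightarrow> ('w \<Rightarrow> complex) \<Rightarrow> complex set" where
  "dir_supp a M Y = (if a = \<infinity> then sphere 0 1 else msupp (assoc_measure M Y))"


section \<open>Networks\<close>

record 'v network =
  verts :: "'v set"
  wt :: "'v \<Rightarrow> 'v \<Rightarrow> complex"

definition is_network :: "'v network \<Rightarrow> bool" where
  "is_network G \<longleftrightarrow>
     countable (verts G) \<and>
     (\<forall>u\<in>verts G. \<forall>v\<in>verts G. wt G u v = cnj (wt G v u)) \<and>
     (\<forall>v\<in>verts G. (\<lambda>u. (norm (wt G v u))\<^sup>2) summable_on verts G)"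

definition net_deg :: "'v network \<Rightarrow> 'v \<Rightarrow> real" where
  "net_deg G v = (\<Sum>\<^sub>\<infinity>u\<in>verts G. (norm (wt G v u))\<^sup>2)"

(* a path is the nonempty list of its vertices *)
definition net_path :: "'v network \<Rightarrow> 'v list \<Rightarrow> bool" where
  "net_path G p \<longleftrightarrow> p \<noteq> [] \<and> set p \<subseteq> verts G \<and>
     (\<forall>i. Suc i < length p \<longrightarrow> wt G (p ! i) (p ! Suc i) \<noteq> 0)"

definition path_len :: "'v network \<Rightarrow> 'v list \<Rightarrow> real" where
  "path_len G p = sqrt (\<Sum>i<length p - 1. inverse ((norm (wt G (p ! i) (p ! Suc i)))\<^sup>2))"

definition net_dist :: "'v network \<Rightarrow> 'v \<Rightarrow> 'v \<Rightarrow> ennreal" where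
  "net_dist G u v = Inf {ennreal (path_len G p) |p. net_path G p \<and> hd p = u \<and> last p = v}"

definition net_connected :: "'v network \<Rightarrow> bool" where
  "net_connected G \<longleftrightarrow> (\<forall>u\<in>verts G. \<forall>v\<in>verts G. net_dist G u v < \<infinity>)"

definition net_component :: "'v network \<Rightarrow> 'v \<Rightarrow> 'v network" where
  "net_component G v = G\<lparr>verts := {u \<in> verts G. net_dist G v u < \<infinity>}\<rparr>"

definition net_ball :: "'v network \<Rightarrow> 'v \<Rightarrow> real \<Rightarrow> 'v set" where
  "net_ball G r t = {u \<in> verts G. net_dist G r u \<le> ennreal t}"

definition rooted_network :: "'v network \<times> 'v \<Rightarrow> bool" where
  "rooted_network = (\<lambda>(G, r). is_network G \<and> net_connected G \<and> r \<in> verts G)"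


section \<open>Isomorphism classes of rooted networks\<close>

definition rnet_iso :: "nat network \<times> nat \<Rightarrow> nat network \<times> nat \<Rightarrow> bool" where
  "rnet_iso R1 R2 \<longleftrightarrow> rooted_network R1 \<and> rooted_network R2 \<and>
     (\<exists>\<sigma>. bij_betw \<sigma> (verts (fst R1)) (verts (fst R2)) \<and> \<sigma> (snd R1) = snd R2 \<and>
        (\<forall>u\<in>verts (fst R1). \<forall>v\<in>verts (fst R1).
           wt (fst R2) (\<sigma> u) (\<sigma> v) = wt (fst R1) u v))"

lemma rnet_iso_refl: "rooted_network R \<Longrightarrow> rnet_iso R R"
  unfolding rnet_iso_def by (auto intro!: exI[of _ id])

lemma rnet_iso_sym: assumes "rnet_iso R1 R2" shows "rnet_iso R2 R1"
proof -
  obtain \<sigma> where s: "bij_betw \<sigma> (verts (fst R1)) (verts (fst R2))" "\<sigma> (snd R1) = snd R2"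
    "\<forall>u\<in>verts (fst R1). \<forall>v\<in>verts (fst R1). wt (fst R2) (\<sigma> u) (\<sigma> v) = wt (fst R1) u v"
    and r: "rooted_network R1" "rooted_network R2"
    using assms unfolding rnet_iso_def by blast
  define \<tau> where "\<tau> = inv_into (verts (fst R1)) \<sigma>"
  have t: "bij_betw \<tau> (verts (fst R2)) (verts (fst R1))"
    unfolding \<tau>_def using s(1) by (rule bij_betw_inv_into)
  have "snd R1 \<in> verts (fst R1)"
    using r(1) by (cases R1) (simp add: rooted_network_def)
  then have "\<tau> (snd R2) = snd R1"
    unfolding \<tau>_def using s(1,2) by (metis bij_betw_inv_into_left)
  moreover have "wt (fst R1) (\<tau> u) (\<tau> v) = wt (fst R2) u v"
    if "u \<in> verts (fst R2)" "v \<in> verts (fst R2)" for u v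
  proof -
    have "\<tau> u \<in> verts (fst R1)" "\<tau> v \<in> verts (fst R1)"
      using t that by (auto dest: bij_betwE)
    moreover have "\<sigma> (\<tau> u) = u" "\<sigma> (\<tau> v) = v"
      unfolding \<tau>_def using s(1) that by (auto simp: bij_betw_inv_into_right)
    ultimately show ?thesis using s(3) by metis
  qed
  ultimately show ?thesis unfolding rnet_iso_def using r t by blast
qed

lemma rnet_iso_trans: assumes "rnet_iso R1 R2" "rnet_iso R2 R3" shows "rnet_iso R1 R3"
proof -
  obtain \<sigma> where s: "bij_betw \<sigma> (verts (fst R1)) (verts (fst R2))" "\<sigma> (snd R1) = snd R2"
    "\<forall>u\<in>verts (fst R1). \<forall>v\<in>verts (fst R1). wt (fst R2) (\<sigma> u) (\<sigma> v) = wt (fst R1) u v"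
    using assms(1) unfolding rnet_iso_def by blast
  obtain \<tau> where t: "bij_betw \<tau> (verts (fst R2)) (verts (fst R3))" "\<tau> (snd R2) = snd R3"
    "\<forall>u\<in>verts (fst R2). \<forall>v\<in>verts (fst R2). wt (fst R3) (\<tau> u) (\<tau> v) = wt (fst R2) u v"
    using assms(2) unfolding rnet_iso_def by blast
  have "bij_betw (\<tau> \<circ> \<sigma>) (verts (fst R1)) (verts (fst R3))"
    using s(1) t(1) by (rule bij_betw_trans)
  moreover have "wt (fst R3) ((\<tau> \<circ> \<sigma>) u) ((\<tau> \<circ> \<sigma>) v) = wt (fst R1) u v"
    if "u \<in> verts (fst R1)" "v \<in> verts (fst R1)" for u v
    using s t that by (auto dest: bij_betwE)
  ultimately show ?thesis
    using assms s(2) t(2) unfolding rnet_iso_def by (auto intro!: exI[of _ "\<tau> \<circ> \<sigma>"])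
qed

lemma rooted_network_singleton:
  "rooted_network (\<lparr>verts = {0::nat}, wt = \<lambda>_ _. 0\<rparr>, 0)"
proof -
  let ?G = "\<lparr>verts = {0::nat}, wt = \<lambda>_ _. 0\<rparr>"
  have "net_dist ?G 0 0 \<le> ennreal (path_len ?G [0])"
    unfolding net_dist_def by (rule Inf_lower) (auto simp: net_path_def intro!: exI[of _ "[0]"])
  then have "net_dist ?G 0 0 < \<infinity>"
    by (simp add: path_len_def)
  then show ?thesis
    by (auto simp: rooted_network_def is_network_def net_connected_def)
qed

(* the vertices are natural numbers, without loss of generality since vertex sets are countable *)
quotient_type gstar = "nat network \<times> nat" / partial: rnet_iso
proof (rule part_equivpI)
  show "\<exists>x. rnet_iso x x" using rnet_iso_refl rooted_network_singleton by blast
  show "symp rnet_iso" by (rule sympI) (rule rnet_iso_sym)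
  show "transp rnet_iso" by (rule transpI) (rule rnet_iso_trans)
qed

(* A representative of the class; everything computed from it below is invariant under rooted
   isomorphisms. *)
definition gnet :: "gstar \<Rightarrow> nat network" where "gnet c = fst (rep_gstar c)"
definition groot :: "gstar \<Rightarrow> nat" where "groot c = snd (rep_gstar c)"

(* the class of (G(v), v) *)
definition rooted_class :: "nat network \<Rightarrow> nat \<Rightarrow> gstar" where
  "rooted_class G v = abs_gstar (net_component G v, v)"

definition loc_radius :: "gstar \<Rightarrow> gstar \<Rightarrow> ennreal" where
  "loc_radius c1 c2 = Sup {ennreal t |t. t > 0 \<and>
     (\<exists>\<sigma>. bij_betw \<sigma> (net_ball (gnet c1) (groot c1) t) (net_ball (gnet c2) (groot c2) t) \<and>
        \<sigma> (groot c1) = groot c2 \<and>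
        (\<forall>u\<in>net_ball (gnet c1) (groot c1) t. \<forall>v\<in>net_ball (gnet c1) (groot c1) t.
           norm (wt (gnet c2) (\<sigma> u) (\<sigma> v) - wt (gnet c1) u v) \<le> 1 / t))}"

definition d_loc :: "gstar \<Rightarrow> gstar \<Rightarrow> real" where
  "d_loc c1 c2 = enn2real (1 / (1 + loc_radius c1 c2))"

(* the topology of d_loc, hence also its Borel sigma-algebra and its continuous functions *)
instantiation gstar :: topological_space
begin

definition open_gstar :: "gstar set \<Rightarrow> bool" where
  "open_gstar U \<longleftrightarrow> (\<forall>c\<in>U. \<exists>e>0. \<forall>c'. d_loc c c' < e \<longrightarrow> c' \<in> U)"

instance
proof
  show "open (UNIV :: gstar set)" by (auto simp: open_gstar_def intro: exI[of _ 1])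
next
  fix S T :: "gstar set"
  assume S: "open S" and T: "open T"
  show "open (S \<inter> T)" unfolding open_gstar_def
  proof
    fix c assume c: "c \<in> S \<inter> T"
    obtain e1 e2 where "e1 > 0" "e2 > 0" "\<forall>c'. d_loc c c' < e1 \<longrightarrow> c' \<in> S"
      "\<forall>c'. d_loc c c' < e2 \<longrightarrow> c' \<in> T"
      using S T c unfolding open_gstar_def by blast
    then show "\<exists>e>0. \<forall>c'. d_loc c c' < e \<longrightarrow> c' \<in> S \<inter> T"
      by (intro exI[of _ "min e1 e2"]) auto
  qed
next
  fix K :: "gstar set set"
  assume K: "\<forall>S\<in>K. open S"
  show "open (\<Union> K)" unfolding open_gstar_def
  proof
    fix c assume "c \<in> \<Union> K"
    then obtain S where S: "S \<in> K" "c \<in> S" by blast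
    then obtain e where "e > 0" "\<forall>c'. d_loc c c' < e \<longrightarrow> c' \<in> S"
      using K unfolding open_gstar_def by blast
    then show "\<exists>e>0. \<forall>c'. d_loc c c' < e \<longrightarrow> c' \<in> \<Union> K"
      using S(1) by (intro exI[of _ e]) auto
  qed
qed

end

definition weak_lim ::
  "('i \<Rightarrow> 'x::topological_space measure) \<Rightarrow> 'x measure \<Rightarrow> 'i filter \<Rightarrow> bool" where
  "weak_lim P Q F \<longleftrightarrow> (\<forall>f::'x \<Rightarrow> real. continuous_on UNIV f \<and> bounded (range f) \<longrightarrow>
     ((\<lambda>i. integral\<^sup>L (P i) f) \<longlongrightarrow> integral\<^sup>L Q f) F)"

definition unif_law :: "nat network \<Rightarrow> gstar measure" where
  "unif_law G = distr (uniform_count_measure (verts G)) borel (rooted_class G)"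


section \<open>Admissible sofic measures\<close>

definition matrix_network :: "nat \<Rightarrow> (nat \<Rightarrow> nat \<Rightarrow> complex) \<Rightarrow> nat network" where
  "matrix_network n H = \<lparr>verts = {1..n}, wt = H\<rparr>"

definition admissible ::
  "complex set \<Rightarrow> complex set \<Rightarrow> nat \<Rightarrow> (nat \<Rightarrow> nat \<Rightarrow> complex) set" where
  "admissible Sa Sb n = {H.
     (\<forall>i\<in>{1..n}. \<forall>j\<in>{1..n}. H i j = cnj (H j i)) \<and>
     (\<forall>i\<in>{1..n}. \<forall>j\<in>{1..n}. i < j \<longrightarrow>
        H i j = 0 \<or> H i j / complex_of_real (norm (H i j)) \<in> Sa) \<and>
     (\<forall>i\<in>{1..n}. H i i = 0 \<or> H i i / complex_of_real (norm (H i i)) \<in> Sb)}"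

definition sofic :: "complex set \<Rightarrow> complex set \<Rightarrow> gstar measure set" where
  "sofic Sa Sb = {\<rho>. prob_space \<rho> \<and> sets \<rho> = sets borel \<and>
     (\<exists>H. (\<forall>n. H n \<in> admissible Sa Sb n) \<and>
        weak_lim (\<lambda>n. unif_law (matrix_network n (H n))) \<rho> sequentially)}"


section \<open>Truncation\<close>

definition chi :: "real \<Rightarrow> real \<Rightarrow> real" where
  "chi \<theta> x = (if x < \<theta> then 0 else if x < 2 * \<theta> then (x - \<theta>) / \<theta> else 1)"

definition chi' :: "real \<Rightarrow> real \<Rightarrow> real" where
  "chi' \<theta> x = (if x < 1 / \<theta>\<^sup>2 - 1 then 1 else if x < 1 / \<theta>\<^sup>2 then 1 / \<theta>\<^sup>2 - x else 0)"

definition trunc_wt' :: "real \<Rightarrow> 'v network \<Rightarrow> 'v \<Rightarrow> 'v \<Rightarrow> complex" where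
  "trunc_wt' \<theta> G u v =
     wt G u v * complex_of_real (chi' \<theta> (max (net_deg G u) (net_deg G v)))"

definition trunc_wt :: "real \<Rightarrow> 'v network \<Rightarrow> 'v \<Rightarrow> 'v \<Rightarrow> complex" where
  "trunc_wt \<theta> G u v =
     trunc_wt' \<theta> G u v * complex_of_real (chi \<theta> (norm (trunc_wt' \<theta> G u v)))"

definition trunc_net :: "real \<Rightarrow> 'v network \<Rightarrow> 'v network" where
  "trunc_net \<theta> G = G\<lparr>wt := trunc_wt \<theta> G\<rparr>"

definition trunc_law :: "real \<Rightarrow> gstar measure \<Rightarrow> gstar measure" where
  "trunc_law \<theta> \<rho> = distr \<rho> borel (\<lambda>c. rooted_class (trunc_net \<theta> (gnet c)) (groot c))"


section \<open>Spectral measures\<close>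

definition unit_vec :: "'v \<Rightarrow> 'v \<Rightarrow> complex" where
  "unit_vec v = (\<lambda>u. if u = v then 1 else 0)"

definition l2_inner :: "'v network \<Rightarrow> ('v \<Rightarrow> complex) \<Rightarrow> ('v \<Rightarrow> complex) \<Rightarrow> complex" where
  "l2_inner G f g = (\<Sum>\<^sub>\<infinity>u\<in>verts G. cnj (f u) * g u)"

(* the operator T with T e_v = sum_u w(u,v) e_u *)
definition net_op :: "'v network \<Rightarrow> ('v \<Rightarrow> complex) \<Rightarrow> 'v \<Rightarrow> complex" where
  "net_op G f = (\<lambda>u. \<Sum>\<^sub>\<infinity>v\<in>verts G. wt G u v * f v)"

(* When T is bounded the moments grow at most exponentially and determine the measure.
   On networks for which this fails the value is of no significance. *)
definition spectral_measure :: "'v network \<Rightarrow> 'v \<Rightarrow> real measure" where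
  "spectral_measure G v = (THE \<mu>. real_distribution \<mu> \<and>
     (\<forall>k\<ge>1. integrable \<mu> (\<lambda>x. x ^ k) \<and>
        complex_of_real (\<integral>x. x ^ k \<partial>\<mu>) =
          l2_inner G (unit_vec v) ((net_op G ^^ k) (unit_vec v))))"

definition mean_spectral :: "gstar measure \<Rightarrow> real measure" where
  "mean_spectral \<rho> = measure_of UNIV (sets borel)
     (\<lambda>A. \<integral>\<^sup>+c. emeasure (spectral_measure (gnet c) (groot c)) A \<partial>\<rho>)"

definition xi :: "real \<Rightarrow> gstar \<Rightarrow> ennreal" where
  "xi \<beta> c = (\<Sum>\<^sub>\<infinity>v\<in>verts (gnet c). ennreal (norm (wt (gnet c) (groot c) v) powr \<beta>))"

(* used for admissible sofic measures only *)
definition net_spectral :: "gstar measure \<Rightarrow> real measure" where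
  "net_spectral \<rho> =
     (if \<exists>\<beta>. 0 < \<beta> \<and> \<beta> < 2 \<and> (\<integral>\<^sup>+c. xi \<beta> c \<partial>\<rho>) < \<infinity>
      then (THE \<mu>. real_distribution \<mu> \<and>
              weak_lim (\<lambda>\<theta>. mean_spectral (trunc_law \<theta> \<rho>)) \<mu> (at_right 0))
      else return borel 0)"


section \<open>Rate function\<close>

definition rate_I :: "real \<Rightarrow> ennreal \<Rightarrow> real \<Rightarrow> gstar measure \<Rightarrow> ennreal" where
  "rate_I \<alpha> a b \<rho> =
     ennreal b * (\<integral>\<^sup>+c. ennreal (norm (wt (gnet c) (groot c) (groot c)) powr \<alpha>) \<partial>\<rho>) +
     a / 2 * (\<integral>\<^sup>+c. (\<Sum>\<^sub>\<infinity>v\<in>verts (gnet c) - {groot c}.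
                 ennreal (norm (wt (gnet c) (groot c) v) powr \<alpha>)) \<partial>\<rho>)"

definition Phi :: "real \<Rightarrow> ennreal \<Rightarrow> real \<Rightarrow> 'w measure \<Rightarrow> ('w \<Rightarrow> complex) \<Rightarrow> ('w \<Rightarrow> real)
    \<Rightarrow> real measure \<Rightarrow> ennreal" where
  "Phi \<alpha> a b M X12 X11 \<nu> =
     Inf {rate_I \<alpha> a b \<rho> |\<rho>.
       \<rho> \<in> sofic (dir_supp a M X12) (dir_supp (ennreal b) M (\<lambda>w. complex_of_real (X11 w))) \<and>
       net_spectral \<rho> = \<nu>}"

definition abs_moment :: "real \<Rightarrow> real measure \<Rightarrow> ennreal" where
  "abs_moment \<alpha> \<nu> = (\<integral>\<^sup>+x. ennreal (\<bar>x\<bar> powr \<alpha>) \<partial>\<nu>)"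

(* The mean in [-\<infinity>,\<infinity>], as positive minus negative part (ennreal truncates at 0). When both parts
   are infinite the ereal difference is \<infinity>, so a negative value means that the integral exists and
   is negative, possibly -\<infinity>. *)
definition ext_mean :: "real measure \<Rightarrow> ereal" where
  "ext_mean \<nu> = enn2ereal (\<integral>\<^sup>+x. ennreal x \<partial>\<nu>) - enn2ereal (\<integral>\<^sup>+x. ennreal (- x) \<partial>\<nu>)"

end

theory Submission
  imports Defs
begin

text \<open>For finite Hermitian matrices a telescoping argument with powers of \<open>1 + i t A / N\<close> bounds the
  difference of the characteristic functions of two mean spectral measures by \<open>\<bar>t\<bar>\<close> times the
  average Euclidean norm of the rows of the difference of the matrices. The bound passes to sofic
  limits and compares two truncation levels. Hence, if \<open>\<alpha> > 1\<close> and the rate is finite, the limiting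
  spectral measure exists, its absolute moment of order \<open>\<alpha>\<close> is at most the expectation of \<open>xi\<close>
  (Jensen for \<open>x \<mapsto> x powr (\<alpha> / 2)\<close>), and its mean is the expected weight of the loop at the root. Loops of
  admissible matrices are nonnegative, so the mean is nonnegative, which is (c). If the measure is
  symmetric, the mean vanishes, so there are no loops and the rate is at least \<open>a / 2\<close> times the
  moment.

  The upper bounds come from explicit sofic laws: for (a) a single vertex with a loop distributed
  according to \<open>\<nu>\<close>, and for (b) a pair of vertices joined by an edge of weight \<open>\<bar>x\<bar> u\<close>, with \<open>x\<close>
  distributed according to \<open>\<nu>\<close> and \<open>u\<close> a unit vector in the support of the angular measure. The
  approximating matrices are built from the quantiles of \<open>\<nu>\<close>.\<close>

section \<open>Paths and embeddings of networks\<close>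

text \<open>Two obstacles shape the development. The degree cut-off in \<open>trunc_net\<close> uses
  the exact degree, which is not continuous for \<open>d_loc\<close>: very light edges are very
  long, so their far ends may lie outside any given ball. Hence a second parameter \<epsilon>, which
  discounts light edges in the degree (\<open>ldeg\<close>). For \<epsilon> > 0 the truncated
  quantities depend continuously on the class, and \<epsilon> = 0 is reached by limits. The other
  obstacle is measurability: \<open>mean_spectral\<close> is a bare \<open>measure_of\<close> and
  \<open>trunc_law\<close> a \<open>distr\<close>, so they have their intended meaning only once
  \<open>trunc_class\<close> is known to be Borel, and no countable base of the topology of
  \<open>gstar\<close> is at hand. But truncated networks lie in a class of uniformly bounded
  networks, where countably many templates suffice. The condition \<alpha> > 1 enters twice: the
  trace bound involves means of row norms, which are integrable because \<alpha> is at least 1, and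
  the means of the truncated spectral measures converge because a moment of order above 1 makes them
  uniformly integrable.\<close>

definition net_row :: "'v network \<Rightarrow> 'v \<Rightarrow> 'v set" where
  "net_row G u = {v \<in> verts G. wt G u v \<noteq> 0}"

definition net_edges :: "'v network \<Rightarrow> ('v \<times> 'v) set" where
  "net_edges G = {(u, v). u \<in> verts G \<and> v \<in> verts G \<and> wt G u v \<noteq> 0}"

lemma net_path_singleton [simp]: "net_path G [u] \<longleftrightarrow> u \<in> verts G"
  by (simp add: net_path_def)

lemma net_path_snoc:
  assumes "p \<noteq> []"
  shows "net_path G (p @ [w]) \<longleftrightarrow> net_path G p \<and> w \<in> verts G \<and> wt G (last p) w \<noteq> 0"
proof -
  have "(\<forall>i. Suc i < length (p @ [w]) \<longrightarrow> wt G ((p @ [w]) ! i) ((p @ [w]) ! Suc i) \<noteq> 0) \<longleftrightarrow>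
     (\<forall>i. Suc i < length p \<longrightarrow> wt G (p ! i) (p ! Suc i) \<noteq> 0) \<and> wt G (last p) w \<noteq> 0" (is "?L \<longleftrightarrow> ?R")
  proof
    assume L: ?L
    have "wt G (p ! i) (p ! Suc i) \<noteq> 0" if "Suc i < length p" for i
      using L[rule_format, of i] that by (simp add: nth_append)
    moreover have "wt G (last p) w \<noteq> 0"
      using L[rule_format, of "length p - 1"] assms by (simp add: nth_append last_conv_nth)
    ultimately show ?R by blast
  next
    assume R: ?R
    show ?L
    proof (intro allI impI)
      fix i assume i: "Suc i < length (p @ [w])"
      show "wt G ((p @ [w]) ! i) ((p @ [w]) ! Suc i) \<noteq> 0"
      proof (cases "Suc i < length p")
        case True then show ?thesis using R by (simp add: nth_append)
      next
        case False
        then have "i = length p - 1" "Suc i = length p" using i assms by auto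
        then show ?thesis using R assms by (simp add: nth_append last_conv_nth)
      qed
    qed
  qed
  then show ?thesis using assms by (auto simp: net_path_def)
qed

lemma path_len_nonneg [simp]: "0 \<le> path_len G p"
  by (simp add: path_len_def sum_nonneg)

lemma path_len_singleton [simp]: "path_len G [u] = 0"
  by (simp add: path_len_def)

lemma path_len_sq: "(path_len G p)\<^sup>2 = (\<Sum>i<length p - 1. inverse ((norm (wt G (p ! i) (p ! Suc i)))\<^sup>2))"
  by (simp add: path_len_def sum_nonneg)

lemma path_len_snoc:
  assumes "p \<noteq> []"
  shows "(path_len G (p @ [w]))\<^sup>2 = (path_len G p)\<^sup>2 + inverse ((norm (wt G (last p) w))\<^sup>2)"
proof -
  obtain l where l: "length p = Suc l" using assms by (cases "length p") auto
  have "(\<Sum>i<l. inverse ((norm (wt G ((p @ [w]) ! i) ((p @ [w]) ! Suc i)))\<^sup>2))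
      = (\<Sum>i<l. inverse ((norm (wt G (p ! i) (p ! Suc i)))\<^sup>2))"
    by (intro sum.cong refl) (simp add: nth_append l)
  then show ?thesis
    unfolding path_len_sq using l assms by (simp add: nth_append last_conv_nth)
qed

text \<open>Squared lengths add along a path, and the square root is subadditive.\<close>

lemma path_len_snoc_le:
  assumes "p \<noteq> []"
  shows "path_len G (p @ [w]) \<le> path_len G p + 1 / norm (wt G (last p) w)"
proof (rule power2_le_imp_le)
  show "(path_len G (p @ [w]))\<^sup>2 \<le> (path_len G p + 1 / norm (wt G (last p) w))\<^sup>2"
    unfolding path_len_snoc[OF assms] power2_sum
    by (simp add: power_divide inverse_eq_divide)
qed simp

lemma path_len_snoc_mono: "p \<noteq> [] \<Longrightarrow> path_len G p \<le> path_len G (p @ [w])"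
  by (rule power2_le_imp_le) (simp_all add: path_len_snoc)

lemma net_dist_le: "net_path G p \<Longrightarrow> net_dist G (hd p) (last p) \<le> ennreal (path_len G p)"
  unfolding net_dist_def by (rule Inf_lower) blast

lemma net_dist_self: "u \<in> verts G \<Longrightarrow> net_dist G u u = 0"
  using net_dist_le[of G "[u]"] by simp

lemma net_dist_lessE:
  assumes "net_dist G u v < x"
  obtains p where "net_path G p" "hd p = u" "last p = v" "ennreal (path_len G p) < x"
  using assms unfolding net_dist_def Inf_less_iff by blast

text \<open>The form in which the triangle inequality is used below: an edge of weight at least
  \<eta> costs at most 1 / \<eta> in distance, so heavy edges never lead far.\<close>

lemma net_dist_step:
  assumes "w \<in> verts G" "wt G u w \<noteq> 0"
  shows "net_dist G r w \<le> net_dist G r u + ennreal (1 / norm (wt G u w))"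
proof -
  let ?c = "ennreal (1 / norm (wt G u w))"
  \<comment> \<open>The cost of the edge is moved to the left by truncated subtraction, so that the
    infimum over paths to \<open>u\<close> can be taken afterwards, even if there is no such
    path.\<close>
  have "net_dist G r w - ?c \<le> x" if "x \<in> {ennreal (path_len G p) |p. net_path G p \<and> hd p = r \<and> last p = u}" for x
  proof -
    obtain p where p: "x = ennreal (path_len G p)" "net_path G p" "hd p = r" "last p = u"
      using \<open>x \<in> _\<close> by blast
    have ne: "p \<noteq> []" using p(2) by (simp add: net_path_def)
    have "net_path G (p @ [w])" using p assms ne by (simp add: net_path_snoc)
    from net_dist_le[OF this] have "net_dist G r w \<le> ennreal (path_len G (p @ [w]))"
      using ne p(3) by simp
    also have "\<dots> \<le> ennreal (path_len G p + 1 / norm (wt G u w))"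
      using path_len_snoc_le[OF ne, of G w] p(4) by (intro ennreal_leI) simp
    also have "\<dots> = ?c + x" using p(1) by (subst ennreal_plus) (auto simp: add.commute)
    finally show ?thesis by (simp add: ennreal_minus_le_iff)
  qed
  then have "net_dist G r w - ?c \<le> net_dist G r u"
    unfolding net_dist_def[of G r u] by (intro Inf_greatest)
  then show ?thesis by (simp add: ennreal_minus_le_iff add.commute)
qed

lemma net_path_rtrancl:
  "net_path G p \<Longrightarrow> (hd p, last p) \<in> (net_edges G)\<^sup>*"
proof (induction p rule: rev_induct)
  case (snoc w p)
  show ?case
  proof (cases "p = []")
    case False
    then have p: "net_path G p" "w \<in> verts G" "wt G (last p) w \<noteq> 0"
      using snoc.prems by (auto simp: net_path_snoc)
    then have "last p \<in> verts G" using False by (auto simp: net_path_def subset_iff)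
    then have "(last p, w) \<in> net_edges G" using p by (simp add: net_edges_def)
    moreover have "(hd p, last p) \<in> (net_edges G)\<^sup>*" using snoc.IH p(1) by blast
    ultimately show ?thesis using False by simp
  qed simp
qed (simp add: net_path_def)

text \<open>Finiteness of distances becomes reachability, so that symmetry and transitivity come
  from the reflexive transitive closure of the edge relation.\<close>

lemma net_dist_finite_iff:
  assumes "u \<in> verts G"
  shows "net_dist G u v < \<infinity> \<longleftrightarrow> (u, v) \<in> (net_edges G)\<^sup>*"
proof
  assume "net_dist G u v < \<infinity>"
  then show "(u, v) \<in> (net_edges G)\<^sup>*" by (metis net_dist_lessE net_path_rtrancl)
next
  assume "(u, v) \<in> (net_edges G)\<^sup>*"
  then show "net_dist G u v < \<infinity>"
  proof (induction rule: rtrancl_induct)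
    case base show ?case using net_dist_self[OF assms] by simp
  next
    case (step v w)
    then have "net_dist G u w \<le> net_dist G u v + ennreal (1 / norm (wt G v w))"
      by (intro net_dist_step) (auto simp: net_edges_def)
    also have "\<dots> < \<infinity>" using step.IH by (simp add: less_top)
    finally show ?case .
  qed
qed

lemma is_networkD:
  assumes "is_network G"
  shows "countable (verts G)"
    and "u \<in> verts G \<Longrightarrow> v \<in> verts G \<Longrightarrow> wt G u v = cnj (wt G v u)"
    and "v \<in> verts G \<Longrightarrow> (\<lambda>u. (norm (wt G v u))\<^sup>2) summable_on verts G"
proof -
  note n = assms[unfolded is_network_def]
  show "countable (verts G)" by (rule n[THEN conjunct1])
  show "u \<in> verts G \<Longrightarrow> v \<in> verts G \<Longrightarrow> wt G u v = cnj (wt G v u)"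
    by (rule n[THEN conjunct2, THEN conjunct1, rule_format])
  show "v \<in> verts G \<Longrightarrow> (\<lambda>u. (norm (wt G v u))\<^sup>2) summable_on verts G"
    by (rule n[THEN conjunct2, THEN conjunct2, rule_format])
qed

lemma sym_net_edges: "is_network G \<Longrightarrow> sym (net_edges G)"
proof (rule symI)
  fix u v assume G: "is_network G" and "(u, v) \<in> net_edges G"
  then have "u \<in> verts G" "v \<in> verts G" "wt G u v \<noteq> 0" by (auto simp: net_edges_def)
  then show "(v, u) \<in> net_edges G" using is_networkD(2)[OF G, of v u] by (simp add: net_edges_def)
qed

text \<open>The last clause says that no edge leaves the image, so the image is a union of connected
  components. Degrees, distances and matrix powers are therefore the same in both networks.\<close>

definition net_emb :: "('v \<Rightarrow> 'u) \<Rightarrow> 'v network \<Rightarrow> 'u network \<Rightarrow> bool" where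
  "net_emb \<sigma> G H \<longleftrightarrow> inj_on \<sigma> (verts G) \<and> \<sigma> ` verts G \<subseteq> verts H \<and>
     (\<forall>u\<in>verts G. \<forall>v\<in>verts G. wt H (\<sigma> u) (\<sigma> v) = wt G u v) \<and>
     (\<forall>u\<in>verts G. net_row H (\<sigma> u) \<subseteq> \<sigma> ` verts G)"

lemma net_embD:
  assumes "net_emb \<sigma> G H"
  shows "inj_on \<sigma> (verts G)" "u \<in> verts G \<Longrightarrow> \<sigma> u \<in> verts H"
    "u \<in> verts G \<Longrightarrow> v \<in> verts G \<Longrightarrow> wt H (\<sigma> u) (\<sigma> v) = wt G u v"
    "u \<in> verts G \<Longrightarrow> y \<in> verts H \<Longrightarrow> y \<notin> \<sigma> ` verts G \<Longrightarrow> wt H (\<sigma> u) y = 0"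
  using assms unfolding net_emb_def net_row_def by blast+

lemma net_emb_path:
  assumes "net_emb \<sigma> G H" "net_path G p"
  shows "net_path H (map \<sigma> p)" "path_len H (map \<sigma> p) = path_len G p"
proof -
  have s: "set p \<subseteq> verts G" "p \<noteq> []" using assms(2) by (auto simp: net_path_def)
  have eq: "wt H (map \<sigma> p ! i) (map \<sigma> p ! Suc i) = wt G (p ! i) (p ! Suc i)" if "Suc i < length p" for i
  proof -
    have "p ! i \<in> verts G" "p ! Suc i \<in> verts G" using that s by (auto simp: subset_iff)
    then show ?thesis using net_embD(3)[OF assms(1)] that by simp
  qed
  show "net_path H (map \<sigma> p)"
    using assms(2) eq s net_embD(2)[OF assms(1)] by (auto simp: net_path_def)
  show "path_len H (map \<sigma> p) = path_len G p"
    unfolding path_len_def using s(2) by (intro arg_cong[of _ _ sqrt] sum.cong arg_cong[of _ _ inverse])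
      (auto simp: eq simp del: nth_map)
qed

text \<open>A path that starts in the image cannot leave it, since all neighbours of an image point
  are image points.\<close>

lemma net_emb_path_lift:
  assumes "net_emb \<sigma> G H" "net_path H q" "hd q = \<sigma> u" "u \<in> verts G"
  shows "\<exists>p. q = map \<sigma> p \<and> net_path G p \<and> hd p = u"
  using assms(2,3)
proof (induction q rule: rev_induct)
  case (snoc w q)
  show ?case
  proof (cases "q = []")
    case True then show ?thesis using snoc assms(4) by (intro exI[of _ "[u]"]) simp
  next
    case False
    then have q: "net_path H q" "w \<in> verts H" "wt H (last q) w \<noteq> 0"
      using snoc.prems by (auto simp: net_path_snoc)
    then obtain p where p: "q = map \<sigma> p" "net_path G p" "hd p = u"
      using snoc.IH snoc.prems(2) False by auto
    have ne: "p \<noteq> []" and l: "last p \<in> verts G" using p(2) False p(1)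
      by (auto simp: net_path_def subset_iff)
    have "w \<in> \<sigma> ` verts G"
      using net_embD(4)[OF assms(1) l q(2)] q(3) p(1) ne by (auto simp: last_map)
    then obtain x where x: "x \<in> verts G" "w = \<sigma> x" by blast
    have "wt G (last p) x \<noteq> 0"
      using q(3) net_embD(3)[OF assms(1) l x(1)] p(1) ne x(2) by (simp add: last_map)
    then show ?thesis using p ne x by (intro exI[of _ "p @ [x]"]) (simp add: net_path_snoc)
  qed
qed (simp add: net_path_def)

lemma net_emb_dist:
  assumes "net_emb \<sigma> G H" "u \<in> verts G" "v \<in> verts G"
  shows "net_dist H (\<sigma> u) (\<sigma> v) = net_dist G u v"
proof -
  have "{ennreal (path_len H q) |q. net_path H q \<and> hd q = \<sigma> u \<and> last q = \<sigma> v} =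
        {ennreal (path_len G p) |p. net_path G p \<and> hd p = u \<and> last p = v}" (is "?A = ?B")
  proof
    show "?A \<subseteq> ?B"
    proof
      fix x assume "x \<in> ?A"
      then obtain q where q: "x = ennreal (path_len H q)" "net_path H q" "hd q = \<sigma> u" "last q = \<sigma> v" by blast
      obtain p where p: "q = map \<sigma> p" "net_path G p" "hd p = u"
        using net_emb_path_lift[OF assms(1) q(2,3) assms(2)] by blast
      have "p \<noteq> []" "last p \<in> verts G" using p(2) by (auto simp: net_path_def subset_iff)
      then have "last p = v" using q(4) p(1) net_embD(1)[OF assms(1)] assms(3)
        by (auto simp: last_map dest: inj_onD)
      then show "x \<in> ?B" using p q(1) net_emb_path[OF assms(1) p(2)] by auto
    qed
    show "?B \<subseteq> ?A"
    proof
      fix x assume "x \<in> ?B"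
      then obtain p where p: "x = ennreal (path_len G p)" "net_path G p" "hd p = u" "last p = v" by blast
      moreover have "p \<noteq> []" using p(2) by (simp add: net_path_def)
      ultimately show "x \<in> ?A"
        using net_emb_path[OF assms(1) p(2)] by (intro CollectI exI[of _ "map \<sigma> p"]) (auto simp: hd_map last_map)
    qed
  qed
  then show ?thesis unfolding net_dist_def by simp
qed

lemma net_emb_dist_finite:
  assumes "net_emb \<sigma> G H" "u \<in> verts G" "y \<in> verts H" "net_dist H (\<sigma> u) y < \<infinity>"
  shows "y \<in> \<sigma> ` verts G"
proof -
  obtain q where q: "net_path H q" "hd q = \<sigma> u" "last q = y"
    using assms(4) by (rule net_dist_lessE)
  obtain p where p: "q = map \<sigma> p" "net_path G p"
    using net_emb_path_lift[OF assms(1) q(1,2) assms(2)] by blast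
  then have "p \<noteq> []" "set p \<subseteq> verts G" by (auto simp: net_path_def)
  then have "last p \<in> verts G" "y = \<sigma> (last p)" using p(1) q(3) by (auto simp: last_map)
  then show ?thesis by blast
qed

section \<open>Connected components and classes of rooted networks\<close>

lemma net_component_simps [simp]:
  "verts (net_component G v) = {u \<in> verts G. net_dist G v u < \<infinity>}" "wt (net_component G v) = wt G"
  by (simp_all add: net_component_def)

lemma net_component_emb: "net_emb id (net_component G v) G"
proof -
  have "net_row G u \<subseteq> {u \<in> verts G. net_dist G v u < \<infinity>}" if "net_dist G v u < \<infinity>" for u
  proof
    fix y assume y: "y \<in> net_row G u"
    then have "net_dist G v y \<le> net_dist G v u + ennreal (1 / norm (wt G u y))"
      by (intro net_dist_step) (auto simp: net_row_def)
    also have "\<dots> < \<infinity>" using that by (simp add: ennreal_add_less_top)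
    finally show "y \<in> {u \<in> verts G. net_dist G v u < \<infinity>}" using y by (simp add: net_row_def)
  qed
  then show ?thesis by (simp add: net_emb_def)
qed

lemma rooted_net_component:
  assumes "is_network G" "v \<in> verts G"
  shows "rooted_network (net_component G v, v)"
proof -
  let ?C = "net_component G v"
  have "net_dist G v v < \<infinity>" unfolding net_dist_self[OF assms(2)] by simp
  then have v: "v \<in> verts ?C" unfolding net_component_simps using assms(2) by blast
  have net: "is_network ?C"
    unfolding is_network_def
  proof (intro conjI ballI)
    show "countable (verts ?C)"
      by (rule countable_subset[OF _ is_networkD(1)[OF assms(1)]]) auto
  next
    fix u w assume "u \<in> verts ?C" "w \<in> verts ?C"
    then show "wt ?C u w = cnj (wt ?C w u)" 
      using is_networkD(2)[OF assms(1), of u w] by simp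
  next
    fix u assume "u \<in> verts ?C"
    then have "(\<lambda>w. (norm (wt G u w))\<^sup>2) summable_on verts G"
      using is_networkD(3)[OF assms(1)] by simp
    then have "(\<lambda>w. (norm (wt G u w))\<^sup>2) summable_on verts ?C"
      by (rule summable_on_subset_banach) auto
    then show "(\<lambda>w. (norm (wt ?C u w))\<^sup>2) summable_on verts ?C" by simp
  qed
  have c: "net_dist ?C u w < \<infinity>" if uw: "u \<in> verts ?C" "w \<in> verts ?C" for u w
  proof -
    have vc: "(v, u) \<in> (net_edges ?C)\<^sup>*" if u: "u \<in> verts ?C" for u
    proof -
      have "net_dist ?C v u = net_dist G v u" using net_emb_dist[OF net_component_emb v u] by simp
      then have "net_dist ?C v u < \<infinity>" using u by simp
      then show ?thesis using net_dist_finite_iff[OF v] by blast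
    qed
    have "(u, v) \<in> (net_edges ?C)\<^sup>*"
      by (rule symD[OF sym_rtrancl[OF sym_net_edges[OF net]] vc[OF uw(1)]])
    then have "(u, w) \<in> (net_edges ?C)\<^sup>*" using vc[OF uw(2)] by (rule rtrancl_trans)
    then show ?thesis using net_dist_finite_iff[OF uw(1)] by blast
  qed
  have "net_connected ?C" unfolding net_connected_def using c by blast
  then show ?thesis using v net by (simp add: rooted_network_def del: net_component_simps)
qed

lemma rep_gstar_rooted: "rooted_network (gnet c, groot c)"
proof -
  have "rnet_iso (rep_gstar c) (rep_gstar c)" by (rule Quotient3_rep_reflp[OF Quotient3_gstar])
  then show ?thesis by (simp add: rnet_iso_def gnet_def groot_def)
qed

lemma groot_in [simp]: "groot c \<in> verts (gnet c)"
  and is_network_gnet [simp]: "is_network (gnet c)"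
  and gnet_connected: "u \<in> verts (gnet c) \<Longrightarrow> v \<in> verts (gnet c) \<Longrightarrow> net_dist (gnet c) u v < \<infinity>"
  using rep_gstar_rooted[of c] by (auto simp: rooted_network_def net_connected_def)

lemma rnet_iso_emb:
  assumes "rnet_iso R1 R2"
  shows "\<exists>\<sigma>. net_emb \<sigma> (fst R1) (fst R2) \<and> \<sigma> (snd R1) = snd R2"
proof -
  obtain \<sigma> where s: "bij_betw \<sigma> (verts (fst R1)) (verts (fst R2))" "\<sigma> (snd R1) = snd R2"
    "\<forall>u\<in>verts (fst R1). \<forall>v\<in>verts (fst R1). wt (fst R2) (\<sigma> u) (\<sigma> v) = wt (fst R1) u v"
    using assms unfolding rnet_iso_def by blast
  then have "net_emb \<sigma> (fst R1) (fst R2)"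
    unfolding net_emb_def bij_betw_def net_row_def by auto
  then show ?thesis using s(2) by blast
qed

lemma net_emb_comp:
  assumes "net_emb \<sigma> G H" "net_emb \<tau> H K"
  shows "net_emb (\<tau> \<circ> \<sigma>) G K"
  unfolding net_emb_def
proof (intro conjI ballI)
  note s = net_embD[OF assms(1)] and t = net_embD[OF assms(2)]
  show "inj_on (\<tau> \<circ> \<sigma>) (verts G)"
    using s(1,2) t(1) by (intro comp_inj_on) (auto intro: inj_on_subset)
  show "(\<tau> \<circ> \<sigma>) ` verts G \<subseteq> verts K" using s(2) t(2) by auto
  fix u assume u: "u \<in> verts G"
  show "wt K ((\<tau> \<circ> \<sigma>) u) ((\<tau> \<circ> \<sigma>) v) = wt G u v" if "v \<in> verts G" for v
    using u that s t by simp
  show "net_row K ((\<tau> \<circ> \<sigma>) u) \<subseteq> (\<tau> \<circ> \<sigma>) ` verts G"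
  proof
    fix y assume "y \<in> net_row K ((\<tau> \<circ> \<sigma>) u)"
    then have y: "y \<in> verts K" "wt K (\<tau> (\<sigma> u)) y \<noteq> 0" by (auto simp: net_row_def)
    then obtain z where z: "z \<in> verts H" "y = \<tau> z" using t(4)[OF s(2)[OF u] y(1)] by auto
    then have "wt H (\<sigma> u) z \<noteq> 0" using y t(3) s(2)[OF u] by metis
    then have "z \<in> \<sigma> ` verts G" using s(4)[OF u z(1)] by blast
    then show "y \<in> (\<tau> \<circ> \<sigma>) ` verts G" using z by auto
  qed
qed

text \<open>The representative chosen by the quotient is only isomorphic to the component of
  \<open>v\<close>. This embedding is how every invariant of the class is computed in
  \<open>G\<close> itself.\<close>

lemma gnet_rooted_class:
  assumes "is_network G" "v \<in> verts G"
  shows "\<exists>\<sigma>. net_emb \<sigma> (gnet (rooted_class G v)) G \<and> \<sigma> (groot (rooted_class G v)) = v"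
proof -
  let ?R = "(net_component G v, v)"
  have "rnet_iso ?R ?R" by (rule rnet_iso_refl[OF rooted_net_component[OF assms]])
  then have "rnet_iso (rep_gstar (abs_gstar ?R)) ?R"
    by (rule rep_abs_rsp_left[OF Quotient3_gstar])
  from rnet_iso_emb[OF this] obtain \<sigma> where
    s: "net_emb \<sigma> (gnet (rooted_class G v)) (net_component G v)" "\<sigma> (groot (rooted_class G v)) = v"
    by (auto simp: rooted_class_def gnet_def groot_def)
  from net_emb_comp[OF s(1) net_component_emb] show ?thesis using s(2) by auto
qed

text \<open>Embeddings preserve distances, and points at finite distance from an image point are
  image points, so the map restricts to a bijection of the two components.\<close>

lemma rooted_class_eqI:
  assumes "is_network G" "is_network H" "net_emb \<sigma> G H" "v \<in> verts G" "\<sigma> v = v'"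
  shows "rooted_class G v = rooted_class H v'"
proof -
  have v': "v' \<in> verts H" using net_embD(2)[OF assms(3,4)] assms(5) by simp
  have "rnet_iso (net_component G v, v) (net_component H v', v')"
    unfolding rnet_iso_def
  proof (intro conjI exI[of _ \<sigma>])
    show "bij_betw \<sigma> (verts (fst (net_component G v, v))) (verts (fst (net_component H v', v')))"
      unfolding bij_betw_def
    proof
      show "inj_on \<sigma> (verts (fst (net_component G v, v)))"
        using net_embD(1)[OF assms(3)] by (rule inj_on_subset) auto
      show "\<sigma> ` verts (fst (net_component G v, v)) = verts (fst (net_component H v', v'))"
      proof safe
        fix u assume "u \<in> verts (fst (net_component G v, v))"
        then show "\<sigma> u \<in> verts (fst (net_component H v', v'))"
          using net_emb_dist[OF assms(3,4), of u] net_embD(2)[OF assms(3)] assms(5) by auto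
      next
        fix y assume y: "y \<in> verts (fst (net_component H v', v'))"
        then obtain u where "u \<in> verts G" "y = \<sigma> u"
          using net_emb_dist_finite[OF assms(3,4), of y] assms(5) by auto
        then show "y \<in> \<sigma> ` verts (fst (net_component G v, v))"
          using net_emb_dist[OF assms(3,4), of u] y assms(5) by auto
      qed
    qed
  next
    show "\<forall>u\<in>verts (fst (net_component G v, v)). \<forall>w\<in>verts (fst (net_component G v, v)).
        wt (fst (net_component H v', v')) (\<sigma> u) (\<sigma> w) = wt (fst (net_component G v, v)) u w"
      using net_embD(3)[OF assms(3)] by simp
  qed (simp_all only: assms(5) snd_conv rooted_net_component[OF assms(1,4)] rooted_net_component[OF assms(2) v'])
  then show ?thesis
    unfolding rooted_class_def using Quotient3_rel_abs[OF Quotient3_gstar] by metis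
qed

lemma net_emb_infsum:
  assumes "net_emb \<sigma> G H" "\<And>y. y \<in> verts H \<Longrightarrow> y \<notin> \<sigma> ` verts G \<Longrightarrow> f y = 0"
  shows "(\<Sum>\<^sub>\<infinity>y\<in>verts H. f y) = (\<Sum>\<^sub>\<infinity>z\<in>verts G. f (\<sigma> z))"
proof -
  have "(\<Sum>\<^sub>\<infinity>y\<in>verts H. f y) = (\<Sum>\<^sub>\<infinity>y\<in>\<sigma> ` verts G. f y)"
  proof (rule infsum_cong_neutral)
    fix y assume "y \<in> \<sigma> ` verts G - verts H"
    then show "f y = 0" using net_embD(2)[OF assms(1)] by blast
  qed (use assms(2) in blast)+
  also have "\<dots> = (\<Sum>\<^sub>\<infinity>z\<in>verts G. f (\<sigma> z))"
    using infsum_reindex[OF net_embD(1)[OF assms(1)], of f] unfolding o_def .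
  finally show ?thesis .
qed

section \<open>Local convergence along correspondences of balls\<close>

definition near :: "real \<Rightarrow> gstar \<Rightarrow> gstar \<Rightarrow> (nat \<Rightarrow> nat) \<Rightarrow> bool" where
  "near t c c' \<sigma> \<longleftrightarrow> 0 < t \<and>
     bij_betw \<sigma> (net_ball (gnet c) (groot c) t) (net_ball (gnet c') (groot c') t) \<and>
     \<sigma> (groot c) = groot c' \<and>
     (\<forall>u\<in>net_ball (gnet c) (groot c) t. \<forall>v\<in>net_ball (gnet c) (groot c) t.
        norm (wt (gnet c') (\<sigma> u) (\<sigma> v) - wt (gnet c) u v) \<le> 1 / t)"

text \<open>Neighbouring classes together with a matching of balls, as the radius grows. Carrying
  the matching inside the filter lets quantities that depend on vertices be handled by ordinary
  limits. A matching at radius t need not restrict to one at a smaller radius, hence the existential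
  over t.\<close>

definition nearF :: "gstar \<Rightarrow> (gstar \<times> (nat \<Rightarrow> nat)) filter" where
  "nearF c = (INF T::real. principal {p. \<exists>t>T. near t c (fst p) (snd p)})"

lemma eventually_nearF:
  "eventually P (nearF c) \<longleftrightarrow> (\<exists>T. \<forall>t c' \<sigma>. T < t \<longrightarrow> near t c c' \<sigma> \<longrightarrow> P (c', \<sigma>))"
proof -
  have "\<exists>x\<in>UNIV. principal {p. \<exists>t>x. near t c (fst p) (snd p)}
      \<le> principal {p. \<exists>t>a. near t c (fst p) (snd p)} \<sqinter> principal {p. \<exists>t>b. near t c (fst p) (snd p)}"
    for a b :: real
    by (rule bexI[of _ "max a b"]) auto
  then have "eventually P (nearF c) \<longleftrightarrow> (\<exists>T\<in>UNIV. \<forall>p\<in>{p. \<exists>t>T. near t c (fst p) (snd p)}. P p)"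
    unfolding nearF_def by (subst eventually_INF_base) (auto simp only: eventually_principal)
  also have "\<dots> \<longleftrightarrow> (\<exists>T. \<forall>t c' \<sigma>. T < t \<longrightarrow> near t c c' \<sigma> \<longrightarrow> P (c', \<sigma>))"
    by (auto simp: Ball_def)
  finally show ?thesis .
qed

lemma loc_radius_near: "loc_radius c c' = Sup {ennreal t |t. \<exists>\<sigma>. near t c c' \<sigma>}"
  unfolding loc_radius_def near_def by (intro arg_cong[of _ _ Sup]) auto

lemma inverse_antimono_ennreal:
  fixes a b :: ennreal
  assumes "a \<le> b"
  shows "inverse b \<le> inverse a"
proof (cases "a = 0 \<or> b = top")
  case False
  then obtain x y where "a = ennreal x" "b = ennreal y" "0 < x" "0 < y"
    using assms by (cases a; cases b) (auto simp: ennreal_eq_0_iff top_unique less_le)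
  then show ?thesis using assms by (simp add: inverse_ennreal le_imp_inverse_le)
qed auto

lemma divide_left_antimono_ennreal: "a \<le> b \<Longrightarrow> c / b \<le> c / (a :: ennreal)"
  unfolding divide_ennreal_def by (intro mult_left_mono inverse_antimono_ennreal) auto

text \<open>The inequality 1 / (1 + R) < e amounts to R > 1 / e - 1, and a supremum above a value
  has a witness above it.\<close>

lemma d_loc_nearD:
  assumes "d_loc c c' < e" "0 < e" "e \<le> 1"
  shows "\<exists>t>1/e - 1. \<exists>\<sigma>. near t c c' \<sigma>"
proof -
  let ?R = "loc_radius c c'"
  have e: "0 \<le> 1 / e - 1" using assms by simp
  have "\<not> ?R \<le> ennreal (1 / e - 1)"
  proof
    assume "?R \<le> ennreal (1 / e - 1)"
    then have "1 + ?R \<le> ennreal 1 + ennreal (1 / e - 1)" by (simp add: add_left_mono)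
    also have "\<dots> = ennreal (1 / e)" using e by (subst ennreal_plus[symmetric]) auto
    finally have le: "1 + ?R \<le> ennreal (1 / e)" .
    have "ennreal e = 1 / ennreal (1 / e)"
      using assms(2) by (subst ennreal_1[symmetric], subst divide_ennreal) auto
    also have "\<dots> \<le> 1 / (1 + ?R)" using le by (intro divide_left_antimono_ennreal) auto
    finally have le2: "ennreal e \<le> 1 / (1 + ?R)" .
    have "1 / (1 + ?R) \<le> 1 / 1" by (intro divide_left_antimono_ennreal) auto
    then have "1 / (1 + ?R) < top" by (simp add: le_less_trans[of _ 1])
    then have "e \<le> enn2real (1 / (1 + ?R))"
      using le2 assms(2) by (metis enn2real_mono enn2real_ennreal less_imp_le)
    then show False using assms(1) unfolding d_loc_def by simp
  qed
  then obtain x where "x \<in> {ennreal t |t. \<exists>\<sigma>. near t c c' \<sigma>}" "ennreal (1 / e - 1) < x"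
    unfolding loc_radius_near not_le less_Sup_iff by blast
  then show ?thesis using e by (auto simp: ennreal_less_iff)
qed

lemma near_d_loc_le:
  assumes "near t c c' \<sigma>"
  shows "d_loc c c' \<le> 1 / (1 + t)"
proof -
  have t: "0 < t" using assms by (simp add: near_def)
  have "ennreal t \<le> loc_radius c c'"
    unfolding loc_radius_near using assms by (intro Sup_upper) blast
  then have "ennreal 1 + ennreal t \<le> 1 + loc_radius c c'" by (simp add: add_left_mono)
  then have "ennreal (1 + t) \<le> 1 + loc_radius c c'" using t by (subst ennreal_plus) auto
  then have "1 / (1 + loc_radius c c') \<le> 1 / ennreal (1 + t)"
    by (intro divide_left_antimono_ennreal)
  also have "\<dots> = ennreal (1 / (1 + t))"
    using t by (subst ennreal_1[symmetric], subst divide_ennreal) auto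
  finally show ?thesis
    unfolding d_loc_def using t by (intro enn2real_leI) auto
qed

text \<open>Metric axioms for \<open>d_loc\<close> are not established here; openness and continuity
  are checked directly against the definition of the topology.\<close>

lemma open_nearI:
  assumes "\<And>c. c \<in> U \<Longrightarrow> eventually (\<lambda>p. fst p \<in> U) (nearF c)"
  shows "open (U :: gstar set)"
  unfolding open_gstar_def
proof
  fix c assume "c \<in> U"
  from assms[OF this] obtain T where T: "\<And>t c' \<sigma>. T < t \<Longrightarrow> near t c c' \<sigma> \<Longrightarrow> c' \<in> U"
    unfolding eventually_nearF by auto
  define e where "e = 1 / (1 + max T 0)"
  have e: "0 < e" "e \<le> 1" "1 / e - 1 = max T 0" by (auto simp: e_def)
  show "\<exists>e>0. \<forall>c'. d_loc c c' < e \<longrightarrow> c' \<in> U"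
  proof (intro exI[of _ e] conjI allI impI e(1))
    fix c' assume "d_loc c c' < e"
    from d_loc_nearD[OF this e(1,2)] obtain t \<sigma> where "max T 0 < t" "near t c c' \<sigma>"
      unfolding e(3) by blast
    then show "c' \<in> U" using T by auto
  qed
qed

lemma continuous_nearI:
  fixes g :: "gstar \<Rightarrow> 'b::topological_space"
  assumes "\<And>c. ((\<lambda>p. g (fst p)) \<longlongrightarrow> g c) (nearF c)"
  shows "continuous_on UNIV g"
  unfolding continuous_on_open_vimage[OF open_UNIV]
proof (intro allI impI)
  fix B :: "'b set" assume B: "open B"
  have "open (g -` B)"
  proof (rule open_nearI)
    fix c assume "c \<in> g -` B"
    then have "eventually (\<lambda>p. g (fst p) \<in> B) (nearF c)"
      using topological_tendstoD[OF assms B] by auto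
    then show "eventually (\<lambda>p. fst p \<in> g -` B) (nearF c)" by simp
  qed
  then show "open (g -` B \<inter> UNIV)" by simp
qed

lemma in_net_ball:
  assumes "u \<in> verts (gnet c)"
  shows "\<exists>T. \<forall>t>T. u \<in> net_ball (gnet c) (groot c) t"
proof -
  have fin: "net_dist (gnet c) (groot c) u < \<infinity>" using assms by (intro gnet_connected) auto
  show ?thesis
  proof (intro exI allI impI)
    fix t assume "enn2real (net_dist (gnet c) (groot c) u) < t"
    then have "net_dist (gnet c) (groot c) u \<le> ennreal t"
      using fin by (metis ennreal_enn2real ennreal_leI infinity_ennreal_def less_imp_le)
    then show "u \<in> net_ball (gnet c) (groot c) t" using assms by (simp add: net_ball_def)
  qed
qed

lemma nearF_ball:
  assumes "u \<in> verts (gnet c)"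
  shows "\<exists>T. \<forall>t>T. \<forall>c' \<sigma>. near t c c' \<sigma> \<longrightarrow> u \<in> net_ball (gnet c) (groot c) t \<and> \<sigma> u \<in> net_ball (gnet c') (groot c') t"
proof -
  obtain T where T: "\<forall>t>T. u \<in> net_ball (gnet c) (groot c) t" using in_net_ball[OF assms] by blast
  then show ?thesis unfolding near_def by (blast dest: bij_betwE)
qed

lemma nearF_in:
  assumes "u \<in> verts (gnet c)"
  shows "eventually (\<lambda>p. snd p u \<in> verts (gnet (fst p))) (nearF c)"
  using nearF_ball[OF assms] unfolding eventually_nearF by (fastforce simp: net_ball_def)

lemma nearF_root: "eventually (\<lambda>p. snd p (groot c) = groot (fst p)) (nearF c)"
  unfolding eventually_nearF near_def by auto

lemma nearF_inj:
  assumes "u \<in> verts (gnet c)" "v \<in> verts (gnet c)" "u \<noteq> v"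
  shows "eventually (\<lambda>p. snd p u \<noteq> snd p v) (nearF c)"
proof -
  obtain T1 T2 where T: "\<forall>t>T1. u \<in> net_ball (gnet c) (groot c) t" "\<forall>t>T2. v \<in> net_ball (gnet c) (groot c) t"
    using in_net_ball[OF assms(1)] in_net_ball[OF assms(2)] by blast
  show ?thesis
    unfolding eventually_nearF
  proof (intro exI[of _ "max T1 T2"] allI impI)
    fix t c' \<sigma> assume t: "max T1 T2 < t" "near t c c' \<sigma>"
    then have "inj_on \<sigma> (net_ball (gnet c) (groot c) t)" by (auto simp: near_def bij_betw_def)
    then show "snd (c', \<sigma>) u \<noteq> snd (c', \<sigma>) v" using T t(1) assms(3) by (auto dest: inj_onD)
  qed
qed

lemma nearF_wt:
  assumes "u \<in> verts (gnet c)" "v \<in> verts (gnet c)"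
  shows "((\<lambda>p. wt (gnet (fst p)) (snd p u) (snd p v)) \<longlongrightarrow> wt (gnet c) u v) (nearF c)"
proof (rule tendstoI)
  fix e :: real assume e: "0 < e"
  obtain T1 T2 where T: "\<forall>t>T1. u \<in> net_ball (gnet c) (groot c) t" "\<forall>t>T2. v \<in> net_ball (gnet c) (groot c) t"
    using in_net_ball[OF assms(1)] in_net_ball[OF assms(2)] by blast
  show "eventually (\<lambda>p. dist (wt (gnet (fst p)) (snd p u) (snd p v)) (wt (gnet c) u v) < e) (nearF c)"
    unfolding eventually_nearF
  proof (intro exI[of _ "max (1/e) (max T1 T2)"] allI impI)
    fix t c' \<sigma> assume t: "max (1/e) (max T1 T2) < t" "near t c c' \<sigma>"
    then have "norm (wt (gnet c') (\<sigma> u) (\<sigma> v) - wt (gnet c) u v) \<le> 1 / t"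
      using T by (auto simp: near_def)
    also have "1 / t < e"
    proof -
      have "1 / e < t" "0 < t" using t by (auto simp: near_def)
      then show ?thesis using e by (simp add: field_simps)
    qed
    finally show "dist (wt (gnet (fst (c', \<sigma>))) (snd (c', \<sigma>) u) (snd (c', \<sigma>) v)) (wt (gnet c) u v) < e"
      by (simp add: dist_norm)
  qed
qed

text \<open>Follow a path from the root to \<open>u\<close>. The image of each edge eventually keeps
  more than half of its weight x, so it has length at most 2 / x.\<close>

lemma nearF_dist_bounded:
  assumes "u \<in> verts (gnet c)"
  shows "\<exists>d\<ge>0. eventually (\<lambda>p. net_dist (gnet (fst p)) (groot (fst p)) (snd p u) \<le> ennreal d) (nearF c)"
proof -
  have "(groot c, u) \<in> (net_edges (gnet c))\<^sup>*"
    using gnet_connected[OF groot_in assms] net_dist_finite_iff[OF groot_in] by blast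
  then show ?thesis
  proof (induction rule: rtrancl_induct)
    case base
    have "eventually (\<lambda>p. net_dist (gnet (fst p)) (groot (fst p)) (snd p (groot c)) \<le> ennreal 0) (nearF c)"
      using nearF_root by eventually_elim (simp add: net_dist_self)
    then show ?case by blast
  next
    case (step u w)
    then obtain d where d: "0 \<le> d" "eventually (\<lambda>p. net_dist (gnet (fst p)) (groot (fst p)) (snd p u) \<le> ennreal d) (nearF c)"
      by blast
    have uw: "u \<in> verts (gnet c)" "w \<in> verts (gnet c)" "0 < norm (wt (gnet c) u w)"
      using step(2) by (auto simp: net_edges_def)
    let ?x = "norm (wt (gnet c) u w)"
    have "((\<lambda>p. norm (wt (gnet (fst p)) (snd p u) (snd p w))) \<longlongrightarrow> ?x) (nearF c)"
      by (intro tendsto_norm nearF_wt uw)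
    then have ev: "eventually (\<lambda>p. ?x / 2 < norm (wt (gnet (fst p)) (snd p u) (snd p w))) (nearF c)"
      using uw(3) by (intro order_tendstoD(1)) auto
    have "eventually (\<lambda>p. net_dist (gnet (fst p)) (groot (fst p)) (snd p w) \<le> ennreal (d + 2 / ?x)) (nearF c)"
      using d(2) ev nearF_in[OF uw(2)]
    proof eventually_elim
      case (elim p)
      let ?y = "norm (wt (gnet (fst p)) (snd p u) (snd p w))"
      have "0 < ?y" using elim(2) uw(3) by linarith
      then have "net_dist (gnet (fst p)) (groot (fst p)) (snd p w) \<le>
          net_dist (gnet (fst p)) (groot (fst p)) (snd p u) + ennreal (1 / ?y)"
        using elim(3) by (intro net_dist_step) auto
      also have "\<dots> \<le> ennreal d + ennreal (2 / ?x)"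
      proof (intro add_mono elim(1) ennreal_leI)
        show "1 / ?y \<le> 2 / ?x" using elim(2) uw(3) \<open>0 < ?y\<close> by (simp add: field_simps)
      qed
      also have "\<dots> = ennreal (d + 2 / ?x)" using d(1) by (subst ennreal_plus) auto
      finally show ?case .
    qed
    then show ?case using d(1) by (intro exI[of _ "d + 2 / ?x"]) auto
  qed
qed

text \<open>A heavy edge at the image of \<open>u\<close> is short, so its far end lies in the
  matched ball and has a preimage; the weight there changes by at most \<eta> / 2.\<close>

lemma nearF_neighbours:
  assumes u: "u \<in> verts (gnet c)" and \<eta>: "0 < \<eta>"
  shows "eventually (\<lambda>p. \<forall>y\<in>verts (gnet (fst p)). \<eta> \<le> norm (wt (gnet (fst p)) (snd p u) y) \<longrightarrow>
     (\<exists>z\<in>verts (gnet c). y = snd p z \<and> \<eta> / 2 \<le> norm (wt (gnet c) u z))) (nearF c)"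
proof -
  obtain d where d: "0 \<le> d" "eventually (\<lambda>p. net_dist (gnet (fst p)) (groot (fst p)) (snd p u) \<le> ennreal d) (nearF c)"
    using nearF_dist_bounded[OF u] by blast
  then obtain T1 where T1: "\<And>t c' \<sigma>. T1 < t \<Longrightarrow> near t c c' \<sigma> \<Longrightarrow> net_dist (gnet c') (groot c') (\<sigma> u) \<le> ennreal d"
    unfolding eventually_nearF by auto
  obtain T2 where T2: "\<forall>t>T2. u \<in> net_ball (gnet c) (groot c) t" using in_net_ball[OF u] by blast
  show ?thesis
    unfolding eventually_nearF
  \<comment> \<open>Radius d + 1 / \<eta> puts \<open>y\<close> into the ball, and 2 / \<eta> makes
    the matching error at most \<eta> / 2.\<close>
  proof (intro exI[of _ "max (max T1 T2) (max (d + 1 / \<eta>) (2 / \<eta>))"] allI impI ballI)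
    fix t c' \<sigma> y
    assume t: "max (max T1 T2) (max (d + 1 / \<eta>) (2 / \<eta>)) < t" and n: "near t c c' \<sigma>"
      and "y \<in> verts (gnet (fst (c', \<sigma>)))" and "\<eta> \<le> norm (wt (gnet (fst (c', \<sigma>))) (snd (c', \<sigma>) u) y)"
    then have y: "y \<in> verts (gnet c')" "\<eta> \<le> norm (wt (gnet c') (\<sigma> u) y)" by auto
    have "net_dist (gnet c') (groot c') y \<le> net_dist (gnet c') (groot c') (\<sigma> u) + ennreal (1 / norm (wt (gnet c') (\<sigma> u) y))"
      using y \<eta> by (intro net_dist_step) auto
    also have "\<dots> \<le> ennreal d + ennreal (1 / \<eta>)"
    proof (intro add_mono ennreal_leI)
      show "net_dist (gnet c') (groot c') (\<sigma> u) \<le> ennreal d" using T1 t n by auto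
      show "1 / norm (wt (gnet c') (\<sigma> u) y) \<le> 1 / \<eta>" using y(2) \<eta> by (intro frac_le) auto
    qed
    also have "\<dots> = ennreal (d + 1 / \<eta>)" using d(1) \<eta> by (subst ennreal_plus) auto
    also have "\<dots> \<le> ennreal t" using t by (intro ennreal_leI) auto
    finally have "y \<in> net_ball (gnet c') (groot c') t" using y(1) by (simp add: net_ball_def)
    moreover have "\<sigma> ` net_ball (gnet c) (groot c) t = net_ball (gnet c') (groot c') t"
      using n by (auto simp: near_def bij_betw_def)
    ultimately obtain z where z: "z \<in> net_ball (gnet c) (groot c) t" "y = \<sigma> z" by blast
    have "norm (wt (gnet c') (\<sigma> u) (\<sigma> z) - wt (gnet c) u z) \<le> 1 / t"
      using n z(1) T2 t by (auto simp: near_def)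
    moreover have "1 / t \<le> \<eta> / 2"
    proof -
      have "0 < t" "2 / \<eta> < t" using t n by (auto simp: near_def)
      then show ?thesis using \<eta> by (simp add: field_simps)
    qed
    moreover have "norm (wt (gnet c') (\<sigma> u) (\<sigma> z)) \<le> norm (wt (gnet c) u z) + norm (wt (gnet c') (\<sigma> u) (\<sigma> z) - wt (gnet c) u z)"
      by norm
    ultimately have "\<eta> / 2 \<le> norm (wt (gnet c) u z)" using y(2) z(2) by simp
    then show "\<exists>z\<in>verts (gnet c). y = snd (c', \<sigma>) z \<and> \<eta> / 2 \<le> norm (wt (gnet c) u z)"
      using z by (auto simp: net_ball_def)
  qed
qed

text \<open>Joint continuity in the class and in two vertices, which are transported by the
  matching. Matrix entries off the root are needed because the recursion for powers passes through
  them.\<close>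

definition local_cont :: "(nat network \<Rightarrow> nat \<Rightarrow> nat \<Rightarrow> 'b::topological_space) \<Rightarrow> bool" where
  "local_cont h \<longleftrightarrow> (\<forall>c. \<forall>u\<in>verts (gnet c). \<forall>v\<in>verts (gnet c).
     ((\<lambda>p. h (gnet (fst p)) (snd p u) (snd p v)) \<longlongrightarrow> h (gnet c) u v) (nearF c))"

lemma local_contD:
  "local_cont h \<Longrightarrow> u \<in> verts (gnet c) \<Longrightarrow> v \<in> verts (gnet c) \<Longrightarrow>
     ((\<lambda>p. h (gnet (fst p)) (snd p u) (snd p v)) \<longlongrightarrow> h (gnet c) u v) (nearF c)"
  unfolding local_cont_def by blast

lemma local_contI:
  "(\<And>c u v. u \<in> verts (gnet c) \<Longrightarrow> v \<in> verts (gnet c) \<Longrightarrow>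
     ((\<lambda>p. h (gnet (fst p)) (snd p u) (snd p v)) \<longlongrightarrow> h (gnet c) u v) (nearF c)) \<Longrightarrow> local_cont h"
  unfolding local_cont_def by blast

lemma local_cont_wt: "local_cont wt"
  by (intro local_contI nearF_wt)

lemma local_cont_unit: "local_cont (\<lambda>G u v. unit_vec v u)"
proof (rule local_contI)
  fix c u v assume uv: "u \<in> verts (gnet c)" "v \<in> verts (gnet c)"
  have "eventually (\<lambda>p. unit_vec (snd p v) (snd p u) = unit_vec v u) (nearF c)"
  proof (cases "u = v")
    case True then show ?thesis by (simp add: unit_vec_def)
  next
    case False
    show ?thesis using nearF_inj[OF uv False] by eventually_elim (use False in \<open>simp add: unit_vec_def\<close>)
  qed
  then show "((\<lambda>p. unit_vec (snd p v) (snd p u)) \<longlongrightarrow> unit_vec v u) (nearF c)"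
    by (rule tendsto_eventually)
qed

lemma local_cont_root:
  assumes "local_cont h"
  shows "continuous_on UNIV (\<lambda>c. h (gnet c) (groot c) (groot c))"
proof (rule continuous_nearI)
  fix c
  have "((\<lambda>p. h (gnet (fst p)) (snd p (groot c)) (snd p (groot c))) \<longlongrightarrow> h (gnet c) (groot c) (groot c)) (nearF c)"
    by (rule local_contD[OF assms]) auto
  then show "((\<lambda>p. h (gnet (fst p)) (groot (fst p)) (groot (fst p))) \<longlongrightarrow> h (gnet c) (groot c) (groot c)) (nearF c)"
    by (rule Lim_transform_eventually) (use nearF_root in \<open>eventually_elim, simp\<close>)
qed

section \<open>Truncated weights\<close>

lemma chi_bounds: "0 \<le> \<theta> \<Longrightarrow> 0 \<le> chi \<theta> x \<and> chi \<theta> x \<le> 1"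
  by (auto simp: chi_def field_simps)

lemma chi_eq_1: "0 \<le> \<theta> \<Longrightarrow> 2 * \<theta> \<le> x \<Longrightarrow> chi \<theta> x = 1"
  by (auto simp: chi_def)

lemma chi_eq_0: "x < \<theta> \<Longrightarrow> chi \<theta> x = 0"
  by (auto simp: chi_def)

lemma chi_0 [simp]: "0 \<le> x \<Longrightarrow> chi 0 x = 1"
  by (simp add: chi_def)

lemma chi_eq_max: "0 < \<theta> \<Longrightarrow> chi \<theta> x = max 0 (min 1 ((x - \<theta>) / \<theta>))"
  by (auto simp: chi_def field_simps max_def min_def)

lemma chi'_eq_max: "chi' \<theta> x = max 0 (min 1 (1 / \<theta>\<^sup>2 - x))"
  by (auto simp: chi'_def max_def min_def)

text \<open>The degree with edges lighter than \<epsilon> ignored and those of weight at least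
  2\<epsilon> counted in full. For \<epsilon> > 0 it is locally continuous; since
  \<open>chi 0\<close> is 1, it is the true degree at \<epsilon> = 0.\<close>

definition ldeg :: "real \<Rightarrow> 'v network \<Rightarrow> 'v \<Rightarrow> real" where
  "ldeg \<epsilon> G u = (\<Sum>\<^sub>\<infinity>v\<in>verts G. (norm (wt G u v))\<^sup>2 * chi \<epsilon> (norm (wt G u v)))"

lemma ldeg_0: "ldeg 0 G u = net_deg G u"
  by (simp add: ldeg_def net_deg_def)

text \<open>Both cut-offs of \<open>trunc_wt\<close> applied to one weight, with the degree as a
  free argument that may be the true or the discounted one.\<close>

definition tw :: "real \<Rightarrow> real \<Rightarrow> complex \<Rightarrow> complex" where
  "tw \<theta> D z = z * of_real (chi' \<theta> D) * of_real (chi \<theta> (norm (z * of_real (chi' \<theta> D))))"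

text \<open>The truncation at level \<theta> with discounted degrees; \<epsilon> = 0 gives
  \<open>trunc_wt\<close>, as \<open>trunc_net_knet\<close> shows.\<close>

definition kern :: "real \<Rightarrow> real \<Rightarrow> 'v network \<Rightarrow> 'v \<Rightarrow> 'v \<Rightarrow> complex" where
  "kern \<theta> \<epsilon> G u v = tw \<theta> (max (ldeg \<epsilon> G u) (ldeg \<epsilon> G v)) (wt G u v)"

definition knet :: "real \<Rightarrow> real \<Rightarrow> 'v network \<Rightarrow> 'v network" where
  "knet \<theta> \<epsilon> G = G\<lparr>wt := kern \<theta> \<epsilon> G\<rparr>"

lemma knet_simps [simp]: "verts (knet \<theta> \<epsilon> G) = verts G" "wt (knet \<theta> \<epsilon> G) = kern \<theta> \<epsilon> G"
  by (simp_all add: knet_def)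

lemma trunc_net_knet: "trunc_net \<theta> G = knet \<theta> 0 G"
  unfolding trunc_net_def knet_def
  by (intro arg_cong[of _ _ "\<lambda>w. G\<lparr>wt := w\<rparr>"] ext)
    (simp add: trunc_wt_def trunc_wt'_def kern_def tw_def ldeg_0)

lemma tw_scale:
  assumes "0 < \<theta>"
  obtains s where "0 \<le> s" "s \<le> 1" "tw \<theta> D z = of_real s * z"
proof
  let ?s = "chi' \<theta> D * chi \<theta> (norm (z * of_real (chi' \<theta> D)))"
  have "0 \<le> chi' \<theta> D" "chi' \<theta> D \<le> 1" by (auto simp: chi'_eq_max)
  then show "0 \<le> ?s" "?s \<le> 1" using chi_bounds[of \<theta> "norm (z * of_real (chi' \<theta> D))"] assms
    by (auto intro: mult_le_one)
  show "tw \<theta> D z = of_real ?s * z" by (simp add: tw_def)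
qed

lemma norm_tw_le: "0 < \<theta> \<Longrightarrow> norm (tw \<theta> D z) \<le> norm z"
  by (rule tw_scale[of \<theta> D z]) (auto simp: norm_mult mult_left_le_one_le)

lemma norm_tw_diff_le:
  assumes "0 < \<theta>"
  shows "norm (tw \<theta> D z - z) \<le> norm z"
proof (rule tw_scale[OF assms])
  fix s :: real assume s: "0 \<le> s" "s \<le> 1" "tw \<theta> D z = of_real s * z"
  have "tw \<theta> D z - z = of_real (s - 1) * z" unfolding s(3) by (simp add: algebra_simps)
  then show ?thesis using s(1,2) by (simp add: norm_mult mult_left_le_one_le del: of_real_diff)
qed

lemma tw_0 [simp]: "tw \<theta> D 0 = 0"
  by (simp add: tw_def)

lemma tw_nonzero:
  assumes "0 < \<theta>" "tw \<theta> D z \<noteq> 0"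
  shows "\<theta> \<le> norm z" "D < 1 / \<theta>\<^sup>2"
proof -
  have 1: "chi' \<theta> D \<noteq> 0" "chi \<theta> (norm (z * of_real (chi' \<theta> D))) \<noteq> 0" using assms(2) by (auto simp: tw_def)
  then show "D < 1 / \<theta>\<^sup>2" by (auto simp: chi'_eq_max max_def min_def split: if_splits)
  have "0 \<le> chi' \<theta> D" "chi' \<theta> D \<le> 1" by (auto simp: chi'_eq_max)
  then have "norm (z * of_real (chi' \<theta> D)) \<le> norm z" by (simp add: norm_mult mult_right_le_one_le)
  moreover have "\<theta> \<le> norm (z * of_real (chi' \<theta> D))" using 1(2) chi_eq_0 by (metis not_le)
  ultimately show "\<theta> \<le> norm z" by linarith
qed

lemma tw_cnj: "tw \<theta> D (cnj z) = cnj (tw \<theta> D z)"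
  by (simp add: tw_def norm_mult)

lemma tendsto_tw:
  assumes "0 < \<theta>" "(f \<longlongrightarrow> D) F" "(g \<longlongrightarrow> z) F"
  shows "((\<lambda>x. tw \<theta> (f x) (g x)) \<longlongrightarrow> tw \<theta> D z) F"
  unfolding tw_def chi'_eq_max chi_eq_max[OF assms(1)]
  by (intro tendsto_intros assms) (use assms(1) in auto)

text \<open>The condition 2 * \<epsilon> \<le> \<eta> puts these neighbours where \<open>chi\<close>
  \<epsilon> equals 1.\<close>

lemma sum_nbrs_le_ldeg:
  assumes G: "is_network G" and u: "u \<in> verts G" and e: "0 \<le> \<epsilon>" "2 * \<epsilon> \<le> \<eta>"
    and F: "finite F" "F \<subseteq> {v \<in> verts G. \<eta> \<le> norm (wt G u v)}"
  shows "(\<Sum>v\<in>F. (norm (wt G u v))\<^sup>2) \<le> ldeg \<epsilon> G u"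
proof -
  have le: "(norm (wt G u v))\<^sup>2 * chi \<epsilon> (norm (wt G u v)) \<le> (norm (wt G u v))\<^sup>2" for v
    using chi_bounds[OF e(1)] by (simp add: mult_left_le)
  have "(\<lambda>v. (norm (wt G u v))\<^sup>2 * chi \<epsilon> (norm (wt G u v))) summable_on verts G"
    by (rule summable_on_comparison_test[OF is_networkD(3)[OF G u]])
      (use le chi_bounds[OF e(1)] in auto)
  then have "(\<Sum>v\<in>F. (norm (wt G u v))\<^sup>2 * chi \<epsilon> (norm (wt G u v))) \<le> ldeg \<epsilon> G u"
    unfolding ldeg_def using F chi_bounds[OF e(1)] by (intro finite_sum_le_infsum) auto
  moreover have "(\<Sum>v\<in>F. (norm (wt G u v))\<^sup>2 * chi \<epsilon> (norm (wt G u v))) = (\<Sum>v\<in>F. (norm (wt G u v))\<^sup>2)"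
    using F(2) e by (intro sum.cong refl) (subst chi_eq_1, auto)
  ultimately show ?thesis by simp
qed

lemma card_nbrs_le_ldeg:
  assumes G: "is_network G" and u: "u \<in> verts G" and e: "0 \<le> \<epsilon>" "2 * \<epsilon> \<le> \<eta>" "0 < \<eta>"
  shows "finite {v \<in> verts G. \<eta> \<le> norm (wt G u v)}"
    "real (card {v \<in> verts G. \<eta> \<le> norm (wt G u v)}) * \<eta>\<^sup>2 \<le> ldeg \<epsilon> G u"
proof -
  let ?S = "{v \<in> verts G. \<eta> \<le> norm (wt G u v)}"
  have *: "real (card F) * \<eta>\<^sup>2 \<le> ldeg \<epsilon> G u" if "finite F" "F \<subseteq> ?S" for F
  proof -
    have "real (card F) * \<eta>\<^sup>2 = (\<Sum>v\<in>F. \<eta>\<^sup>2)" by simp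
    also have "\<dots> \<le> (\<Sum>v\<in>F. (norm (wt G u v))\<^sup>2)"
      using that e(3) by (intro sum_mono power_mono) auto
    also have "\<dots> \<le> ldeg \<epsilon> G u" by (rule sum_nbrs_le_ldeg[OF G u e(1,2) that])
    finally show ?thesis .
  qed
  have "card F \<le> nat \<lceil>ldeg \<epsilon> G u / \<eta>\<^sup>2\<rceil>" if "finite F" "F \<subseteq> ?S" for F
  proof -
    have "real (card F) \<le> ldeg \<epsilon> G u / \<eta>\<^sup>2" using *[OF that] e(3) by (simp add: pos_le_divide_eq)
    also have "\<dots> \<le> real (nat \<lceil>ldeg \<epsilon> G u / \<eta>\<^sup>2\<rceil>)" by (rule real_nat_ceiling_ge)
    finally show ?thesis by simp
  qed
  then show "finite ?S" using finite_if_finite_subsets_card_bdd[of ?S] by blast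
  then show "real (card ?S) * \<eta>\<^sup>2 \<le> ldeg \<epsilon> G u" by (intro *) auto
qed

lemma finite_nbrs:
  assumes "is_network G" "u \<in> verts G" "0 < \<eta>"
  shows "finite {v \<in> verts G. \<eta> \<le> norm (wt G u v)}"
  by (rule card_nbrs_le_ldeg(1)[OF assms(1,2), of 0]) (use assms(3) in auto)

lemma infsum_eq_sum:
  fixes f :: "'a \<Rightarrow> 'b::{comm_monoid_add, t2_space}"
  assumes "finite F" "F \<subseteq> A" "\<And>x. x \<in> A \<Longrightarrow> x \<notin> F \<Longrightarrow> f x = 0"
  shows "(\<Sum>\<^sub>\<infinity>x\<in>A. f x) = (\<Sum>x\<in>F. f x)"
proof -
  have "(\<Sum>\<^sub>\<infinity>x\<in>A. f x) = (\<Sum>\<^sub>\<infinity>x\<in>F. f x)"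
    by (rule infsum_cong_neutral) (use assms in auto)
  then show ?thesis using assms(1) by simp
qed

text \<open>Along a correspondence of large balls the relevant neighbours of a vertex are carried to
  the relevant neighbours of its image, because heavy edges are short.\<close>

lemma local_cont_sum:
  fixes h g :: "nat network \<Rightarrow> nat \<Rightarrow> nat \<Rightarrow> 'b::real_normed_algebra"
  assumes h: "local_cont h" and g: "local_cont g" and \<eta>: "0 < \<eta>"
    and z: "\<And>G u z. norm (wt G u z) < \<eta> \<Longrightarrow> h G u z = 0"
  shows "local_cont (\<lambda>G u v. \<Sum>\<^sub>\<infinity>z\<in>verts G. h G u z * g G z v)"
proof (rule local_contI)
  fix c u v assume u: "u \<in> verts (gnet c)" and v: "v \<in> verts (gnet c)"
  \<comment> \<open>Half of \<eta>, because a neighbour of weight \<eta> in the nearby network is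
    only known to come from one of weight at least \<eta> / 2 here.\<close>
  define F where "F = {z \<in> verts (gnet c). \<eta> / 2 \<le> norm (wt (gnet c) u z)}"
  have F: "finite F" unfolding F_def using u \<eta> by (intro finite_nbrs) auto
  have Fz: "z \<in> verts (gnet c)" if "z \<in> F" for z using that by (simp add: F_def)
  have lim: "(\<Sum>\<^sub>\<infinity>z\<in>verts (gnet c). h (gnet c) u z * g (gnet c) z v) = (\<Sum>z\<in>F. h (gnet c) u z * g (gnet c) z v)"
  proof (rule infsum_eq_sum[OF F])
    fix x assume "x \<in> verts (gnet c)" "x \<notin> F"
    then have "norm (wt (gnet c) u x) < \<eta>" using \<eta> by (simp add: F_def)
    then show "h (gnet c) u x * g (gnet c) x v = 0" using z by simp
  qed (use Fz in auto)
  have inj: "eventually (\<lambda>p. inj_on (snd p) F) (nearF c)"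
  proof -
    have "eventually (\<lambda>p. \<forall>x\<in>F. \<forall>y\<in>F. x \<noteq> y \<longrightarrow> snd p x \<noteq> snd p y) (nearF c)"
      using F Fz by (intro eventually_ball_finite ballI) (auto intro: nearF_inj)
    then show ?thesis by eventually_elim (auto simp: inj_on_def)
  qed
  have inv: "eventually (\<lambda>p. snd p ` F \<subseteq> verts (gnet (fst p))) (nearF c)"
  proof -
    have "eventually (\<lambda>p. \<forall>x\<in>F. snd p x \<in> verts (gnet (fst p))) (nearF c)"
      using F Fz by (intro eventually_ball_finite ballI) (auto intro: nearF_in)
    then show ?thesis by eventually_elim auto
  qed
  have ev: "eventually (\<lambda>p. (\<Sum>z\<in>F. h (gnet (fst p)) (snd p u) (snd p z) * g (gnet (fst p)) (snd p z) (snd p v)) =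
      (\<Sum>\<^sub>\<infinity>z\<in>verts (gnet (fst p)). h (gnet (fst p)) (snd p u) z * g (gnet (fst p)) z (snd p v))) (nearF c)"
    using inj inv nearF_neighbours[OF u \<eta>]
  proof eventually_elim
    case (elim p)
    let ?G = "gnet (fst p)"
    have "(\<Sum>\<^sub>\<infinity>z\<in>verts ?G. h ?G (snd p u) z * g ?G z (snd p v)) =
        (\<Sum>z\<in>snd p ` F. h ?G (snd p u) z * g ?G z (snd p v))"
    proof (rule infsum_eq_sum)
      fix y assume y: "y \<in> verts ?G" "y \<notin> snd p ` F"
      have "norm (wt ?G (snd p u) y) < \<eta>"
      proof (rule ccontr)
        assume "\<not> norm (wt ?G (snd p u) y) < \<eta>"
        then obtain x where "x \<in> verts (gnet c)" "y = snd p x" "\<eta> / 2 \<le> norm (wt (gnet c) u x)"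
          using elim(3) y(1) by force
        then show False using y(2) by (auto simp: F_def)
      qed
      then show "h ?G (snd p u) y * g ?G y (snd p v) = 0" using z by simp
    qed (use elim F in auto)
    then show ?case using elim(1) by (simp add: sum.reindex)
  qed
  have "((\<lambda>p. \<Sum>z\<in>F. h (gnet (fst p)) (snd p u) (snd p z) * g (gnet (fst p)) (snd p z) (snd p v))
      \<longlongrightarrow> (\<Sum>z\<in>F. h (gnet c) u z * g (gnet c) z v)) (nearF c)"
    using Fz u v by (intro tendsto_sum tendsto_mult local_contD[OF h] local_contD[OF g]) auto
  then show "((\<lambda>p. \<Sum>\<^sub>\<infinity>z\<in>verts (gnet (fst p)). h (gnet (fst p)) (snd p u) z * g (gnet (fst p)) z (snd p v))
      \<longlongrightarrow> (\<Sum>\<^sub>\<infinity>z\<in>verts (gnet c). h (gnet c) u z * g (gnet c) z v)) (nearF c)"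
    unfolding lim using ev by (rule Lim_transform_eventually)
qed

lemma local_cont_ldeg:
  assumes "0 < \<epsilon>"
  shows "local_cont (\<lambda>G u v. ldeg \<epsilon> G u)"
proof -
  have "local_cont (\<lambda>G u v. \<Sum>\<^sub>\<infinity>z\<in>verts G. ((norm (wt G u z))\<^sup>2 * chi \<epsilon> (norm (wt G u z))) * 1)"
  proof (rule local_cont_sum[where \<eta> = \<epsilon>])
    show "local_cont (\<lambda>G u z. (norm (wt G u z))\<^sup>2 * chi \<epsilon> (norm (wt G u z)))"
      unfolding chi_eq_max[OF assms]
      by (rule local_contI, intro tendsto_intros nearF_wt) (use assms in auto)
    show "local_cont (\<lambda>(G::nat network) z v. 1 :: real)" by (rule local_contI) simp
  qed (use assms in \<open>auto simp: chi_eq_0\<close>)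
  then show ?thesis by (simp add: ldeg_def)
qed

lemma local_cont_kern:
  assumes "0 < \<theta>" "0 < \<epsilon>"
  shows "local_cont (kern \<theta> \<epsilon>)"
proof (rule local_contI)
  fix c u v assume uv: "u \<in> verts (gnet c)" "v \<in> verts (gnet c)"
  show "((\<lambda>p. kern \<theta> \<epsilon> (gnet (fst p)) (snd p u) (snd p v)) \<longlongrightarrow> kern \<theta> \<epsilon> (gnet c) u v) (nearF c)"
    unfolding kern_def
    by (intro tendsto_tw assms tendsto_max nearF_wt uv)
      (rule local_contD[OF local_cont_ldeg[OF assms(2)]]; fact)+
qed

lemma kern_nonzero:
  assumes "0 < \<theta>" "kern \<theta> \<epsilon> G u v \<noteq> 0"
  shows "\<theta> \<le> norm (wt G u v)" "ldeg \<epsilon> G u < 1 / \<theta>\<^sup>2"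
  using tw_nonzero[OF assms(1), of _ "wt G u v"] assms(2) unfolding kern_def by force+

lemma kern_eq_0: "0 < \<theta> \<Longrightarrow> norm (wt G u v) < \<theta> \<Longrightarrow> kern \<theta> \<epsilon> G u v = 0"
  using kern_nonzero(1)[of \<theta> \<epsilon> G u v] by linarith

lemma norm_kern_le: "0 < \<theta> \<Longrightarrow> norm (kern \<theta> \<epsilon> G u v) \<le> norm (wt G u v)"
  unfolding kern_def by (rule norm_tw_le)

lemma is_network_knet:
  assumes "is_network G" "0 < \<theta>"
  shows "is_network (knet \<theta> \<epsilon> G)"
  unfolding is_network_def knet_simps
proof (intro conjI ballI)
  show "countable (verts G)" by (rule is_networkD[OF assms(1)])
  fix u assume u: "u \<in> verts G"
  show "(\<lambda>v. (norm (kern \<theta> \<epsilon> G u v))\<^sup>2) summable_on verts G"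
    by (rule summable_on_comparison_test[OF is_networkD(3)[OF assms(1) u]])
      (auto intro: power_mono norm_kern_le[OF assms(2)])
  fix v assume v: "v \<in> verts G"
  show "kern \<theta> \<epsilon> G u v = cnj (kern \<theta> \<epsilon> G v u)"
    unfolding kern_def tw_cnj[symmetric] by (subst is_networkD(2)[OF assms(1) u v]) (simp add: max.commute)
qed

text \<open>The (u, v) entry of the k-th power of the weight matrix. The diagonal entries are the
  moments of the spectral measures.\<close>

definition wpow :: "'v network \<Rightarrow> nat \<Rightarrow> 'v \<Rightarrow> 'v \<Rightarrow> complex" where
  "wpow G k u v = (net_op G ^^ k) (unit_vec v) u"

lemma wpow_0: "wpow G 0 u v = unit_vec v u"
  by (simp add: wpow_def)

lemma wpow_Suc: "wpow G (Suc k) u v = (\<Sum>\<^sub>\<infinity>z\<in>verts G. wt G u z * wpow G k z v)"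
  by (simp add: wpow_def net_op_def)

lemma local_cont_wpow:
  assumes "0 < \<theta>" "0 < \<epsilon>"
  shows "local_cont (\<lambda>G. wpow (knet \<theta> \<epsilon> G) k)"
proof (induction k)
  case 0
  show ?case unfolding wpow_0 using local_cont_unit .
next
  case (Suc k)
  show ?case
    unfolding wpow_Suc knet_simps
    by (rule local_cont_sum[OF local_cont_kern[OF assms] Suc assms(1) kern_eq_0[OF assms(1)]])
qed

lemma net_emb_ldeg:
  assumes "net_emb \<sigma> G H" "u \<in> verts G"
  shows "ldeg \<epsilon> H (\<sigma> u) = ldeg \<epsilon> G u"
proof -
  note e = net_embD[OF assms(1)]
  have "ldeg \<epsilon> H (\<sigma> u) = (\<Sum>\<^sub>\<infinity>z\<in>verts G. (norm (wt H (\<sigma> u) (\<sigma> z)))\<^sup>2 * chi \<epsilon> (norm (wt H (\<sigma> u) (\<sigma> z))))"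
    unfolding ldeg_def by (rule net_emb_infsum[OF assms(1)]) (use e(4)[OF assms(2)] in simp)
  also have "\<dots> = ldeg \<epsilon> G u"
    unfolding ldeg_def by (intro infsum_cong) (simp add: e(3)[OF assms(2)])
  finally show ?thesis .
qed

lemma net_emb_kern:
  assumes "net_emb \<sigma> G H" "u \<in> verts G" "v \<in> verts G"
  shows "kern \<theta> \<epsilon> H (\<sigma> u) (\<sigma> v) = kern \<theta> \<epsilon> G u v"
  unfolding kern_def using assms by (simp add: net_emb_ldeg net_embD(3)[OF assms(1)])

lemma net_emb_knet:
  assumes "net_emb \<sigma> G H"
  shows "net_emb \<sigma> (knet \<theta> \<epsilon> G) (knet \<theta> \<epsilon> H)"
  unfolding net_emb_def knet_simps
proof (intro conjI ballI)
  fix u assume u: "u \<in> verts G"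
  show "kern \<theta> \<epsilon> H (\<sigma> u) (\<sigma> v) = kern \<theta> \<epsilon> G u v" if "v \<in> verts G" for v
    by (rule net_emb_kern[OF assms u that])
  show "net_row (knet \<theta> \<epsilon> H) (\<sigma> u) \<subseteq> \<sigma> ` verts G"
    using net_embD(4)[OF assms u] by (force simp: net_row_def kern_def)
qed (use net_embD[OF assms] in auto)

lemma net_emb_wpow:
  assumes "net_emb \<sigma> G H" "u \<in> verts G" "v \<in> verts G"
  shows "wpow H k (\<sigma> u) (\<sigma> v) = wpow G k u v"
  using assms(2)
proof (induction k arbitrary: u)
  case 0
  then show ?case using inj_onD[OF net_embD(1)[OF assms(1)]] assms(3)
    by (auto simp: wpow_0 unit_vec_def)
next
  case (Suc k)
  have "wpow H (Suc k) (\<sigma> u) (\<sigma> v) = (\<Sum>\<^sub>\<infinity>z\<in>verts G. wt H (\<sigma> u) (\<sigma> z) * wpow H k (\<sigma> z) (\<sigma> v))"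
    unfolding wpow_Suc by (rule net_emb_infsum[OF assms(1)]) (use net_embD(4)[OF assms(1) Suc.prems] in simp)
  also have "\<dots> = wpow G (Suc k) u v"
    unfolding wpow_Suc by (intro infsum_cong) (simp add: Suc net_embD(3)[OF assms(1)])
  finally show ?case .
qed

text \<open>A single integer bounds both the number of neighbours and the moduli of the
  weights.\<close>

definition bdd_net :: "nat \<Rightarrow> 'v network \<Rightarrow> bool" where
  "bdd_net D G \<longleftrightarrow> (\<forall>u\<in>verts G. finite (net_row G u) \<and> card (net_row G u) \<le> D \<and>
     (\<forall>v\<in>verts G. norm (wt G u v) \<le> real D))"

lemma bdd_netD:
  assumes "bdd_net D G" "u \<in> verts G"
  shows "finite (net_row G u)" "card (net_row G u) \<le> D" "v \<in> verts G \<Longrightarrow> norm (wt G u v) \<le> real D"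
  using assms unfolding bdd_net_def by auto

lemma net_emb_row:
  assumes "net_emb \<sigma> G H" "u \<in> verts G"
  shows "net_row H (\<sigma> u) = \<sigma> ` net_row G u"
proof
  show "net_row H (\<sigma> u) \<subseteq> \<sigma> ` net_row G u"
  proof
    fix y assume y: "y \<in> net_row H (\<sigma> u)"
    then obtain z where z: "z \<in> verts G" "y = \<sigma> z"
      using net_embD(4)[OF assms] by (auto simp: net_row_def)
    then have "wt G u z \<noteq> 0" using y net_embD(3)[OF assms z(1)] by (simp add: net_row_def)
    then show "y \<in> \<sigma> ` net_row G u" using z by (auto simp: net_row_def)
  qed
qed (use net_embD(2,3)[OF assms(1)] assms(2) in \<open>auto simp: net_row_def\<close>)

lemma net_emb_bdd:
  assumes "net_emb \<sigma> G H" "bdd_net D H"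
  shows "bdd_net D G"
  unfolding bdd_net_def
proof (intro ballI conjI)
  fix u assume u: "u \<in> verts G"
  have inj: "inj_on \<sigma> (net_row G u)"
    using net_embD(1)[OF assms(1)] by (rule inj_on_subset) (auto simp: net_row_def)
  have su: "\<sigma> u \<in> verts H" by (rule net_embD(2)[OF assms(1) u])
  note row = net_emb_row[OF assms(1) u]
  have "finite (\<sigma> ` net_row G u)" using bdd_netD(1)[OF assms(2) su] unfolding row .
  then show "finite (net_row G u)" by (rule finite_imageD[OF _ inj])
  have "card (\<sigma> ` net_row G u) \<le> D" using bdd_netD(2)[OF assms(2) su] unfolding row .
  then show "card (net_row G u) \<le> D" unfolding card_image[OF inj] .
  fix v assume v: "v \<in> verts G"
  have "norm (wt H (\<sigma> u) (\<sigma> v)) \<le> real D"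
    by (rule bdd_netD(3)[OF assms(2) su net_embD(2)[OF assms(1) v]])
  then show "norm (wt G u v) \<le> real D" unfolding net_embD(3)[OF assms(1) u v] .
qed

text \<open>A vertex with a surviving edge has discounted degree below 1 / \<theta>^2. Each
  neighbour joined by weight at least \<theta> contributes \<theta>^2 to it, so there are fewer than
  1 / \<theta>^4 of them, and no such weight exceeds 1 / \<theta>.\<close>

definition tbound :: "real \<Rightarrow> nat" where
  "tbound \<theta> = nat \<lceil>1 / \<theta> ^ 4 + 1 / \<theta>\<rceil>"

lemma knet_bdd:
  assumes G: "is_network G" and \<theta>: "0 < \<theta>" and \<epsilon>: "0 \<le> \<epsilon>" "2 * \<epsilon> \<le> \<theta>"
  shows "bdd_net (tbound \<theta>) (knet \<theta> \<epsilon> G)"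
  unfolding bdd_net_def knet_simps
proof (intro ballI conjI)
  fix u assume u: "u \<in> verts G"
  have pos: "0 \<le> 1 / \<theta> ^ 4" "0 \<le> 1 / \<theta>"
    using \<theta> by auto
  have tb: "1 / \<theta> ^ 4 + 1 / \<theta> \<le> real (tbound \<theta>)" unfolding tbound_def by (rule real_nat_ceiling_ge)
  let ?S = "{v \<in> verts G. \<theta> \<le> norm (wt G u v)}"
  have sub: "net_row (knet \<theta> \<epsilon> G) u \<subseteq> ?S"
    using kern_nonzero(1)[OF \<theta>] by (auto simp: net_row_def)
  show fin: "finite (net_row (knet \<theta> \<epsilon> G) u)"
    by (rule finite_subset[OF sub finite_nbrs[OF G u \<theta>]])
  show "card (net_row (knet \<theta> \<epsilon> G) u) \<le> tbound \<theta>"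
  proof (cases "net_row (knet \<theta> \<epsilon> G) u = {}")
    case False
    then obtain v where "kern \<theta> \<epsilon> G u v \<noteq> 0" by (auto simp: net_row_def)
    then have "ldeg \<epsilon> G u < 1 / \<theta>\<^sup>2" by (rule kern_nonzero(2)[OF \<theta>])
    then have "real (card ?S) * \<theta>\<^sup>2 < 1 / \<theta>\<^sup>2"
      using card_nbrs_le_ldeg(2)[OF G u \<epsilon> \<theta>] by linarith
    then have "real (card ?S) < 1 / \<theta>\<^sup>2 / \<theta>\<^sup>2"
      using pos_less_divide_eq[of "\<theta>\<^sup>2" "real (card ?S)" "1 / \<theta>\<^sup>2"] zero_less_power[OF \<theta>, of 2] by blast
    also have "\<dots> = 1 / \<theta> ^ 4"
      using power_add[of \<theta> 2 2] by simp
    also have "\<dots> \<le> real (tbound \<theta>)" using tb pos by linarith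
    finally have "card ?S \<le> tbound \<theta>" by simp
    then show ?thesis using card_mono[OF finite_nbrs[OF G u \<theta>] sub] by linarith
  qed simp
  fix v assume v: "v \<in> verts G"
  show "norm (kern \<theta> \<epsilon> G u v) \<le> real (tbound \<theta>)"
  proof (cases "kern \<theta> \<epsilon> G u v = 0")
    case False
    note k = kern_nonzero[OF \<theta> False]
    have "(norm (wt G u v))\<^sup>2 \<le> ldeg \<epsilon> G u"
      using sum_nbrs_le_ldeg[OF G u \<epsilon>, of "{v}"] k(1) v by simp
    then have "(norm (wt G u v))\<^sup>2 \<le> (1 / \<theta>)\<^sup>2" using k(2) by (simp add: power_divide)
    then have "norm (wt G u v) \<le> 1 / \<theta>" by (rule power2_le_imp_le) (use \<theta> in simp)
    then show ?thesis using norm_kern_le[OF \<theta>, of \<epsilon> G u v] tb pos by linarith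
  qed simp
qed

section \<open>Limits of truncated quantities as the parameters tend to zero\<close>

lemma ldeg_le:
  assumes G: "is_network G" and u: "u \<in> verts G" and \<epsilon>: "0 \<le> \<epsilon>"
  shows "ldeg \<epsilon> G u \<le> net_deg G u" "0 \<le> ldeg \<epsilon> G u"
proof -
  have le: "(norm (wt G u v))\<^sup>2 * chi \<epsilon> (norm (wt G u v)) \<le> (norm (wt G u v))\<^sup>2" for v
    using chi_bounds[OF \<epsilon>] by (simp add: mult_left_le)
  have "(\<lambda>v. (norm (wt G u v))\<^sup>2 * chi \<epsilon> (norm (wt G u v))) summable_on verts G"
    by (rule summable_on_comparison_test[OF is_networkD(3)[OF G u]])
      (use le chi_bounds[OF \<epsilon>] in auto)
  then show "ldeg \<epsilon> G u \<le> net_deg G u"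
    unfolding ldeg_def net_deg_def using le by (intro infsum_mono is_networkD(3)[OF G u]) auto
  show "0 \<le> ldeg \<epsilon> G u"
    unfolding ldeg_def using chi_bounds[OF \<epsilon>] by (intro infsum_nonneg) auto
qed

text \<open>Any finite partial sum of the degree is counted in full once 2\<epsilon> is below its
  nonzero weights, and the discounted degree never exceeds the true one.\<close>

lemma tendsto_ldeg:
  assumes G: "is_network G" and u: "u \<in> verts G"
  shows "((\<lambda>\<epsilon>. ldeg \<epsilon> G u) \<longlongrightarrow> ldeg 0 G u) (at_right 0)"
proof (rule order_tendstoI)
  fix x assume "x < ldeg 0 G u"
  then have "x < (\<Sum>\<^sub>\<infinity>v\<in>verts G. (norm (wt G u v))\<^sup>2)" by (simp add: ldeg_0 net_deg_def)
  then have "eventually (\<lambda>F. x < (\<Sum>v\<in>F. (norm (wt G u v))\<^sup>2)) (finite_subsets_at_top (verts G))"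
    using order_tendstoD(1)[OF infsum_tendsto[OF is_networkD(3)[OF G u]]] by blast
  then obtain F where F: "finite F" "F \<subseteq> verts G" "x < (\<Sum>v\<in>F. (norm (wt G u v))\<^sup>2)"
    unfolding eventually_finite_subsets_at_top by blast
  \<comment> \<open>Vertices of weight zero are dropped, since 2\<epsilon> has to lie below every
    weight in the set.\<close>
  define F' where "F' = {v \<in> F. wt G u v \<noteq> 0}"
  have F': "finite F'" "F' \<subseteq> verts G" "(\<Sum>v\<in>F. (norm (wt G u v))\<^sup>2) = (\<Sum>v\<in>F'. (norm (wt G u v))\<^sup>2)"
    using F by (auto simp: F'_def intro!: sum.mono_neutral_right)
  have "eventually (\<lambda>\<epsilon>. \<forall>v\<in>F'. 2 * \<epsilon> < norm (wt G u v)) (at_right (0::real))"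
    using F'(1)
  proof (rule eventually_ball_finite, intro ballI)
    fix v assume "v \<in> F'"
    then have "0 < norm (wt G u v) / 2" by (simp add: F'_def)
    then show "eventually (\<lambda>\<epsilon>. 2 * \<epsilon> < norm (wt G u v)) (at_right 0)"
      by (rule eventually_mono[OF eventually_at_right_real]) auto
  qed
  moreover have "eventually (\<lambda>\<epsilon>. 0 < \<epsilon>) (at_right (0::real))" by (rule eventually_at_right_less)
  ultimately show "eventually (\<lambda>\<epsilon>. x < ldeg \<epsilon> G u) (at_right 0)"
  proof eventually_elim
    case (elim \<epsilon>)
    define m where "m = 2 * \<epsilon>"
    have "(\<Sum>v\<in>F'. (norm (wt G u v))\<^sup>2) \<le> ldeg \<epsilon> G u"
      by (rule sum_nbrs_le_ldeg[OF G u, of _ m]) (use elim F' in \<open>auto simp: m_def intro: less_imp_le\<close>)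
    then show ?case using F(3) F'(3) by linarith
  qed
next
  fix x assume x: "ldeg 0 G u < x"
  have "eventually (\<lambda>\<epsilon>. 0 < \<epsilon>) (at_right (0::real))" by (rule eventually_at_right_less)
  then show "eventually (\<lambda>\<epsilon>. ldeg \<epsilon> G u < x) (at_right 0)"
  proof eventually_elim
    case (elim \<epsilon>)
    then show ?case using ldeg_le(1)[OF G u, of \<epsilon>] x by (simp add: ldeg_0)
  qed
qed

lemma tendsto_kern:
  assumes G: "is_network G" and uv: "u \<in> verts G" "v \<in> verts G" and \<theta>: "0 < \<theta>"
  shows "((\<lambda>\<epsilon>. kern \<theta> \<epsilon> G u v) \<longlongrightarrow> kern \<theta> 0 G u v) (at_right 0)"
  unfolding kern_def by (intro tendsto_tw \<theta> tendsto_max tendsto_ldeg G uv tendsto_const)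

lemma tw_eq_id:
  assumes "0 < \<theta>" "D \<le> 1 / \<theta>\<^sup>2 - 1" "2 * \<theta> \<le> norm z"
  shows "tw \<theta> D z = z"
  using assms by (simp add: tw_def chi'_eq_max chi_eq_1)

text \<open>With the degree bounded by d, both cut-offs are inactive as soon as the level is small,
  so the truncated weight is eventually the weight itself.\<close>

lemma tendsto_tw_0:
  assumes "eventually (\<lambda>x. 0 < t x) F" "(t \<longlongrightarrow> 0) F" "eventually (\<lambda>x. D x \<le> d) F"
  shows "((\<lambda>x. tw (t x) (D x) z) \<longlongrightarrow> z) F"
proof (cases "z = 0")
  case False
  have a: "filterlim t (at_right 0) F"
    using assms(1,2) by (auto simp: filterlim_at elim: eventually_mono)
  have "eventually (\<lambda>\<theta>. d \<le> 1 / \<theta>\<^sup>2 - 1) (at_right (0::real))"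
  proof (rule eventually_mono[OF eventually_at_right_real])
    \<comment> \<open>Below this threshold x \<le> 1, so x^2 (|d| + 1) \<le> x (|d| + 1) \<le> 1,
      which is d \<le> 1 / x^2 - 1.\<close>
    show "0 < 1 / (\<bar>d\<bar> + 1)" by simp
    fix x :: real assume x: "x \<in> {0<..<1 / (\<bar>d\<bar> + 1)}"
    then have "x * (\<bar>d\<bar> + 1) < 1" by (simp add: pos_less_divide_eq)
    moreover have "x \<le> x * (\<bar>d\<bar> + 1)" using x by (simp add: mult_le_cancel_left1)
    ultimately have "x \<le> 1" by linarith
    have "x\<^sup>2 * (\<bar>d\<bar> + 1) \<le> 1"
      using mult_mono[OF \<open>x \<le> 1\<close> less_imp_le[OF \<open>x * (\<bar>d\<bar> + 1) < 1\<close>]] x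
      by (simp add: power2_eq_square mult.assoc)
    then have "\<bar>d\<bar> + 1 \<le> 1 / x\<^sup>2" using x by (simp add: pos_le_divide_eq mult.commute)
    then show "d \<le> 1 / x\<^sup>2 - 1" by linarith
  qed
  then have 1: "eventually (\<lambda>x. d \<le> 1 / (t x)\<^sup>2 - 1) F" using a by (rule eventually_compose_filterlim)
  have "eventually (\<lambda>x. t x < norm z / 2) F"
    using False by (intro order_tendstoD(2)[OF assms(2)]) auto
  with assms(1,3) 1 have "eventually (\<lambda>x. tw (t x) (D x) z = z) F"
    by eventually_elim (intro tw_eq_id, auto)
  then show ?thesis by (rule tendsto_eventually)
qed simp

lemma tendsto_kern_0:
  assumes G: "is_network G" and uv: "u \<in> verts G" "v \<in> verts G"
    and t: "eventually (\<lambda>x. 0 < t x) F" "(t \<longlongrightarrow> 0) F" "eventually (\<lambda>x. 0 \<le> e x) F"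
  shows "((\<lambda>x. kern (t x) (e x) G u v) \<longlongrightarrow> wt G u v) F"
  unfolding kern_def
proof (rule tendsto_tw_0[OF t(1,2)])
  show "eventually (\<lambda>x. max (ldeg (e x) G u) (ldeg (e x) G v) \<le> max (net_deg G u) (net_deg G v)) F"
    using t(3) by eventually_elim (intro max.mono ldeg_le(1) G uv)
qed

text \<open>The finite sets \<open>R u\<close> contain the nonzero entries of row \<open>u\<close>
  both in the limit and eventually along the filter, so all powers are finite sums over fixed index
  sets.\<close>

lemma tendsto_wpow:
  assumes v: "verts G = V" "eventually (\<lambda>x. verts (H x) = V) F"
    and R: "\<And>u. u \<in> V \<Longrightarrow> finite (R u)" "\<And>u. R u \<subseteq> V"
    and w: "\<And>u v. u \<in> V \<Longrightarrow> v \<in> V \<Longrightarrow> ((\<lambda>x. wt (H x) u v) \<longlongrightarrow> wt G u v) F"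
    and z: "\<And>u v. u \<in> V \<Longrightarrow> v \<in> V \<Longrightarrow> v \<notin> R u \<Longrightarrow> wt G u v = 0"
      "eventually (\<lambda>x. \<forall>u\<in>V. \<forall>v\<in>V. v \<notin> R u \<longrightarrow> wt (H x) u v = 0) F"
    and uv: "u \<in> V" "y \<in> V"
  shows "((\<lambda>x. wpow (H x) k u y) \<longlongrightarrow> wpow G k u y) F"
  using uv(1)
proof (induction k arbitrary: u)
  case 0
  show ?case by (simp add: wpow_0)
next
  case (Suc k)
  have eq: "wpow G (Suc k) u y = (\<Sum>z\<in>R u. wt G u z * wpow G k z y)"
    unfolding wpow_Suc v using R Suc.prems z(1) by (intro infsum_eq_sum) auto
  have ev: "eventually (\<lambda>x. (\<Sum>z\<in>R u. wt (H x) u z * wpow (H x) k z y) = wpow (H x) (Suc k) u y) F"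
    using v(2) z(2)
  proof eventually_elim
    case (elim x)
    show ?case unfolding wpow_Suc elim(1) using R Suc.prems elim(2) by (intro infsum_eq_sum[symmetric]) auto
  qed
  have "((\<lambda>x. \<Sum>z\<in>R u. wt (H x) u z * wpow (H x) k z y) \<longlongrightarrow> (\<Sum>z\<in>R u. wt G u z * wpow G k z y)) F"
    using R(2) Suc by (intro tendsto_sum tendsto_mult w) auto
  then show ?case unfolding eq using ev by (rule Lim_transform_eventually)
qed

lemma tendsto_wpow_knet:
  assumes G: "is_network G" and uv: "u \<in> verts G" "v \<in> verts G" and \<theta>: "0 < \<theta>"
  shows "((\<lambda>\<epsilon>. wpow (knet \<theta> \<epsilon> G) k u v) \<longlongrightarrow> wpow (knet \<theta> 0 G) k u v) (at_right 0)"
  by (rule tendsto_wpow[where V = "verts G" and R = "\<lambda>u. {v \<in> verts G. \<theta> \<le> norm (wt G u v)}"])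
    (use G uv \<theta> in \<open>auto intro!: finite_nbrs tendsto_kern kern_eq_0 always_eventually\<close>)

lemma tendsto_wpow_knet_0:
  assumes G: "is_network G" "bdd_net D G" and uv: "u \<in> verts G" "v \<in> verts G"
    and t: "eventually (\<lambda>x. 0 < t x) F" "(t \<longlongrightarrow> 0) F" "eventually (\<lambda>x. 0 \<le> e x) F"
  shows "((\<lambda>x. wpow (knet (t x) (e x) G) k u v) \<longlongrightarrow> wpow G k u v) F"
proof (rule tendsto_wpow[where V = "verts G" and R = "net_row G"])
  show "((\<lambda>x. wt (knet (t x) (e x) G) u v) \<longlongrightarrow> wt G u v) F" if "u \<in> verts G" "v \<in> verts G" for u v
    unfolding knet_simps by (rule tendsto_kern_0[OF G(1) that t])
  show "eventually (\<lambda>x. \<forall>u\<in>verts G. \<forall>v\<in>verts G. v \<notin> net_row G u \<longrightarrow> wt (knet (t x) (e x) G) u v = 0) F"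
    by (rule always_eventually) (auto simp: net_row_def kern_def)
qed (use bdd_netD(1)[OF G(2)] uv in \<open>auto simp: net_row_def\<close>)

section \<open>The Hausdorff moment problem\<close>

context
  fixes M :: "nat \<Rightarrow> nat \<Rightarrow> real"
  assumes M_nonneg: "\<And>k l. 0 \<le> M k l"
    and M_rec: "\<And>k l. M k l = M (Suc k) l + M k (Suc l)"
    and M_0: "M 0 0 = 1"
begin

text \<open>In the intended model \<open>M k l\<close> is the integral of x^k (1 - x)^l over [0, 1],
  and this is the expansion of (x + (1 - x))^n = 1.\<close>

lemma hausdorff_expand: "M k l = (\<Sum>j\<le>n. real (n choose j) * M (k + j) (l + (n - j)))"
proof (induction n arbitrary: k l)
  case (Suc n)
  let ?f = "\<lambda>j. M (k + j) (l + (Suc n - j))"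
  have 1: "(\<Sum>j\<le>n. real (n choose j) * ?f (Suc j)) = M (Suc k) l"
    using Suc[of "Suc k" l] by simp
  have 2: "(\<Sum>j\<le>n. real (n choose j) * ?f j) = M k (Suc l)"
    unfolding Suc[of k "Suc l"] by (intro sum.cong) (auto simp: Suc_diff_le)
  have "(\<Sum>j\<le>Suc n. real (Suc n choose j) * ?f j) = ?f 0 + (\<Sum>j\<le>n. real (Suc n choose Suc j) * ?f (Suc j))"
    by (subst sum.atMost_Suc_shift) simp
  also have "\<dots> = ?f 0 + (\<Sum>j\<le>n. real (n choose Suc j) * ?f (Suc j)) + (\<Sum>j\<le>n. real (n choose j) * ?f (Suc j))"
    by (simp add: sum.distrib[symmetric] algebra_simps)
  also have "?f 0 + (\<Sum>j\<le>n. real (n choose Suc j) * ?f (Suc j)) = (\<Sum>j\<le>Suc n. real (n choose j) * ?f j)"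
    by (subst sum.atMost_Suc_shift[of _ n]) simp
  also have "\<dots> = (\<Sum>j\<le>n. real (n choose j) * ?f j)" by simp
  finally show ?case unfolding 1 2 using M_rec[of k l] by simp
qed simp

text \<open>The binomial coefficient times the ratio of falling factorials is the coefficient of n -
  k over j - k. Terms with j < k vanish: the factor i = j is zero, and later ones are zero by
  natural subtraction.\<close>

lemma choose_falling_sum:
  assumes "k \<le> n"
  shows "(\<Sum>j\<le>n. real (n choose j) * (\<Prod>i<k. real (j - i) / real (n - i)) * g j) =
    (\<Sum>i\<le>n - k. real ((n - k) choose i) * g (k + i))"
  using assms
proof (induction k arbitrary: n g)
  case (Suc k)
  then obtain m where n: "n = Suc m" "k \<le> m" by (cases n) auto
  have p: "(\<Prod>i<Suc k. real (j - i) / real (n - i)) = real j / real n * (\<Prod>i<k. real (j - 1 - i) / real (m - i))" for j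
    unfolding prod.lessThan_Suc_shift n by simp
  have "(\<Sum>j\<le>n. real (n choose j) * (\<Prod>i<Suc k. real (j - i) / real (n - i)) * g j) =
      (\<Sum>j\<le>m. real (n choose Suc j) * (real (Suc j) / real n * (\<Prod>i<k. real (j - i) / real (m - i))) * g (Suc j))"
    unfolding p unfolding n(1) sum.atMost_Suc_shift[of _ m] by simp
  also have "\<dots> = (\<Sum>j\<le>m. real (m choose j) * (\<Prod>i<k. real (j - i) / real (m - i)) * g (Suc j))"
  proof (intro sum.cong refl)
    fix j
    have "real (Suc j) * real (n choose Suc j) = real n * real (m choose j)"
      unfolding n(1) by (metis Suc_times_binomial of_nat_mult)
    then have "real (n choose Suc j) * (real (Suc j) / real n) = real (m choose j)"
      unfolding n(1) by (simp add: field_simps)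
    then show "real (n choose Suc j) * (real (Suc j) / real n * (\<Prod>i<k. real (j - i) / real (m - i))) * g (Suc j)
        = real (m choose j) * (\<Prod>i<k. real (j - i) / real (m - i)) * g (Suc j)"
      unfolding mult.assoc[symmetric] by (simp only:)
  qed
  also have "\<dots> = (\<Sum>i\<le>m - k. real ((m - k) choose i) * g (Suc (k + i)))"
    using Suc.IH[OF n(2)] by simp
  finally show ?case using n by simp
qed simp

text \<open>Mass on the grid j / n as in Bernstein polynomials: in the model, the law of the
  proportion of successes in n trials with random success probability.\<close>

definition hausdorff_node :: "nat \<Rightarrow> real measure" where
  "hausdorff_node n = distr (point_measure {..n} (\<lambda>j. ennreal (real (n choose j) * M j (n - j)))) borel (\<lambda>j. real j / real n)"

lemma hausdorff_node_nonneg: "0 \<le> real (n choose j) * M j (n - j)"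
  using M_nonneg by simp

lemma hausdorff_node_sum: "(\<Sum>j\<le>n. real (n choose j) * M j (n - j)) = 1"
  using hausdorff_expand[of 0 0 n] M_0 by simp

lemma real_distribution_hausdorff_node: "real_distribution (hausdorff_node n)"
proof -
  have "prob_space (point_measure {..n} (\<lambda>j. ennreal (real (n choose j) * M j (n - j))))"
  proof
    have "(\<Sum>j\<le>n. ennreal (real (n choose j) * M j (n - j))) = ennreal (\<Sum>j\<le>n. real (n choose j) * M j (n - j))"
      by (rule sum_ennreal) (rule hausdorff_node_nonneg)
    then show "emeasure (point_measure {..n} (\<lambda>j. ennreal (real (n choose j) * M j (n - j))))
        (space (point_measure {..n} (\<lambda>j. ennreal (real (n choose j) * M j (n - j))))) = 1"
      by (simp add: space_point_measure emeasure_point_measure_finite hausdorff_node_sum)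
  qed
  then show ?thesis
    unfolding hausdorff_node_def by (intro prob_space.real_distribution_distr) simp_all
qed

lemma integral_hausdorff_node:
  fixes f :: "real \<Rightarrow> real"
  assumes "f \<in> borel_measurable borel"
  shows "(\<integral>x. f x \<partial>hausdorff_node n) = (\<Sum>j\<le>n. real (n choose j) * M j (n - j) * f (real j / real n))"
  unfolding hausdorff_node_def
  by (subst integral_distr)
    (use assms hausdorff_node_nonneg in \<open>auto simp: lebesgue_integral_point_measure_finite mult.assoc\<close>)

text \<open>Both sides are products of k factors in [0, 1], so their difference is at most the sum
  of the differences of the factors, each at most k / (n - k).\<close>

lemma falling_power_diff:
  assumes "j \<le> n" "k < n"
  shows "\<bar>(real j / real n) ^ k - (\<Prod>i<k. real (j - i) / real (n - i))\<bar> \<le> real k * (real k / real (n - k))"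
proof -
  have "norm ((\<Prod>i<k. real j / real n) - (\<Prod>i<k. real (j - i) / real (n - i)))
      \<le> (\<Sum>i<k. norm (real j / real n - real (j - i) / real (n - i)))"
  proof (rule norm_prod_diff)
    fix i assume "i \<in> {..<k}"
    then show "norm (real (j - i) / real (n - i)) \<le> 1" using assms
      by (simp add: divide_le_eq_1 of_nat_diff)
  qed (use assms in \<open>simp add: divide_le_eq_1\<close>)
  also have "\<dots> \<le> (\<Sum>i<k. real k / real (n - k))"
  proof (intro sum_mono)
    fix i assume i: "i \<in> {..<k}"
    have le: "real i / real (n - i) \<le> real k / real (n - k)"
      using i assms by (intro frac_le) auto
    have "\<bar>real j / real n - real (j - i) / real (n - i)\<bar> \<le> real i / real (n - i)"
    proof (cases "i \<le> j")
      case True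
      have e: "real j / real n - real (j - i) / real (n - i) = real i * real (n - j) / (real n * real (n - i))"
        using True i assms by (simp add: of_nat_diff field_simps)
      have "real i * real (n - j) / (real n * real (n - i)) \<le> real i * real n / (real n * real (n - i))"
        using assms by (intro divide_right_mono mult_left_mono) auto
      moreover have "real i * real n / (real n * real (n - i)) = real i / real (n - i)" using assms by simp
      moreover have "0 \<le> real i * real (n - j) / (real n * real (n - i))" by simp
      ultimately show ?thesis unfolding e by (simp only: abs_of_nonneg)
    next
      case False
      \<comment> \<open>Here j < i, so \<open>j - i\<close> is 0 and only j / n has to be
        bounded.\<close>
      then have "real j / real n \<le> real i / real (n - i)" using i assms by (intro frac_le) auto
      then show ?thesis using False by simp
    qed
    then show "norm (real j / real n - real (j - i) / real (n - i)) \<le> real k / real (n - k)"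
      using le by simp
  qed
  finally show ?thesis by simp
qed

text \<open>Expanding \<open>M k 0\<close> to level n gives the same grid weights with (j / n)^k
  replaced by a ratio of falling factorials.\<close>

lemma hausdorff_node_moment:
  "(\<lambda>n. \<integral>x. x ^ k \<partial>hausdorff_node n) \<longlonglongrightarrow> M k 0"
proof (rule LIM_zero_cancel, rule Lim_null_comparison)
  show "eventually (\<lambda>n. norm ((\<integral>x. x ^ k \<partial>hausdorff_node n) - M k 0) \<le> real k * (real k / real (n - k))) sequentially"
  proof (rule eventually_sequentiallyI[of "Suc k"])
    fix n assume n: "Suc k \<le> n"
    let ?w = "\<lambda>j. real (n choose j) * M j (n - j)"
    let ?P = "\<lambda>j. \<Prod>i<k. real (j - i) / real (n - i)"
    have "M k 0 = (\<Sum>i\<le>n - k. real ((n - k) choose i) * M (k + i) (n - (k + i)))"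
      using hausdorff_expand[of k 0 "n - k"] by (simp add: diff_diff_left)
    also have "\<dots> = (\<Sum>j\<le>n. real (n choose j) * ?P j * M j (n - j))"
      using choose_falling_sum[of k n "\<lambda>j. M j (n - j)"] n by simp
    finally have M: "M k 0 = (\<Sum>j\<le>n. ?w j * ?P j)" by (simp add: mult_ac)
    have eq: "(\<integral>x. x ^ k \<partial>hausdorff_node n) - M k 0 = (\<Sum>j\<le>n. ?w j * ((real j / real n) ^ k - ?P j))"
      unfolding M by (simp add: integral_hausdorff_node sum_subtractf right_diff_distrib)
    have "norm (\<Sum>j\<le>n. ?w j * ((real j / real n) ^ k - ?P j)) \<le> (\<Sum>j\<le>n. ?w j * (real k * (real k / real (n - k))))"
    proof (rule sum_norm_le)
      fix j assume "j \<in> {..n}"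
      then show "norm (?w j * ((real j / real n) ^ k - ?P j)) \<le> ?w j * (real k * (real k / real (n - k)))"
        unfolding real_norm_def abs_mult[of "?w j"] abs_of_nonneg[OF hausdorff_node_nonneg]
        using n falling_power_diff[of j n k] by (intro mult_left_mono hausdorff_node_nonneg) auto
    qed
    also have "\<dots> = real k * (real k / real (n - k))"
      by (simp only: sum_distrib_right[symmetric] hausdorff_node_sum mult_1)
    finally show "norm ((\<integral>x. x ^ k \<partial>hausdorff_node n) - M k 0) \<le> real k * (real k / real (n - k))"
      unfolding eq .
  qed
  have "(\<lambda>n. real k / real n) \<longlonglongrightarrow> 0" by (rule lim_const_over_n)
  then have "(\<lambda>n. real k / real (n - k)) \<longlonglongrightarrow> 0"
    by (subst LIMSEQ_offset[of _ k]) (auto intro: LIMSEQ_offset[of _ k])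
  then show "(\<lambda>n. real k * (real k / real (n - k))) \<longlonglongrightarrow> 0" by (rule tendsto_mult_right_zero)
qed

lemma AE_hausdorff_node: "AE x in hausdorff_node n. 0 \<le> x \<and> x \<le> 1"
  unfolding hausdorff_node_def
  by (subst AE_distr_iff) (auto simp: point_measure_def AE_density AE_count_space divide_le_eq_1)

text \<open>The grid measures live on [0, 1], hence are tight; a limit along a subsequence has the
  right moments.\<close>

lemma hausdorff_moment_exists:
  "\<exists>\<mu>. real_distribution \<mu> \<and> (AE x in \<mu>. 0 \<le> x \<and> x \<le> 1) \<and> (\<forall>k. (\<integral>x. x ^ k \<partial>\<mu>) = M k 0)"
proof -
  let ?N = hausdorff_node
  interpret N: real_distribution "?N n" for n by (rule real_distribution_hausdorff_node)
  have "tight ?N"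
    unfolding tight_def
  proof (intro conjI allI impI)
    fix \<epsilon> :: real assume e: "0 < \<epsilon>"
    have "measure (?N n) {-1<..2} = 1" for n
      using AE_hausdorff_node[of n] by (intro N.prob_eq_1[THEN iffD2]) (auto elim: eventually_mono)
    then have "(-1::real) < 2 \<and> (\<forall>n. 1 - \<epsilon> < measure (?N n) {-1<..2})" using e by simp
    then show "\<exists>a b. a < b \<and> (\<forall>n. 1 - \<epsilon> < measure (?N n) {a<..b})" by blast
  qed (rule N.real_distribution_axioms)
  from tight_imp_convergent_subsubsequence[OF this strict_mono_id] obtain r \<mu> where
    r: "strict_mono (r :: nat \<Rightarrow> nat)" and \<mu>: "real_distribution \<mu>" and w: "weak_conv_m (\<lambda>n. ?N (r n)) \<mu>"
    by (auto simp: o_def)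
  interpret \<mu>: real_distribution \<mu> by (rule \<mu>)
  note conv = weak_conv_imp_integral_bdd_continuous_conv[OF N.real_distribution_axioms \<mu> w]
  have ae: "AE x in \<mu>. 0 \<le> x \<and> x \<le> 1"
  proof -
    \<comment> \<open>Bounded, continuous and zero exactly on [0, 1]: its integral detects mass
      outside the interval and passes to the weak limit.\<close>
    let ?g = "\<lambda>x::real. min 1 (max 0 (- x) + max 0 (x - 1))"
    have "(\<lambda>n. \<integral>x. ?g x \<partial>?N (r n)) \<longlonglongrightarrow> (\<integral>x. ?g x \<partial>\<mu>)"
      by (rule conv[where B = 1]) (auto intro!: continuous_intros simp: abs_real_def)
    moreover have "(\<integral>x. ?g x \<partial>?N n) = 0" for n
    proof -
      have "AE x in ?N n. ?g x = 0" using AE_hausdorff_node[of n] by eventually_elim auto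
      then have "(\<integral>x. ?g x \<partial>?N n) = (\<integral>x. 0 \<partial>?N n)" by (intro integral_cong_AE) auto
      then show ?thesis by simp
    qed
    ultimately have z: "(\<integral>x. ?g x \<partial>\<mu>) = 0" by (simp add: LIMSEQ_const_iff)
    have "integrable \<mu> ?g"
      by (rule \<mu>.integrable_const_bound[where B = 1]) (auto simp: abs_real_def)
    then have "AE x in \<mu>. ?g x = 0"
      using z by (subst (asm) integral_nonneg_eq_0_iff_AE) auto
    then show ?thesis by eventually_elim (auto simp: min_def max_def split: if_splits)
  qed
  have "(\<integral>x. x ^ k \<partial>\<mu>) = M k 0" for k
  proof -
    \<comment> \<open>Powers are unbounded, so they are replaced by a bounded continuous function
      that agrees with them on [0, 1].\<close>
    let ?g = "\<lambda>x::real. (max 0 (min 1 x)) ^ k"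
    have eq: "(\<integral>x. x ^ k \<partial>\<nu>) = (\<integral>x. ?g x \<partial>\<nu>)" if "AE x in \<nu>. 0 \<le> x \<and> x \<le> 1" "sets \<nu> = sets borel" for \<nu> :: "real measure"
    proof (rule integral_cong_AE)
      show "AE x in \<nu>. x ^ k = ?g x" using that(1) by eventually_elim auto
    qed (use that(2) in \<open>simp_all cong: measurable_cong_sets\<close>)
    have "(\<lambda>n. \<integral>x. ?g x \<partial>?N (r n)) \<longlonglongrightarrow> (\<integral>x. ?g x \<partial>\<mu>)"
      by (rule conv[where B = 1]) (auto intro!: continuous_intros power_le_one)
    then have "(\<lambda>n. \<integral>x. x ^ k \<partial>?N (r n)) \<longlonglongrightarrow> (\<integral>x. x ^ k \<partial>\<mu>)"
      unfolding eq[OF AE_hausdorff_node N.events_eq_borel] eq[OF ae \<mu>.events_eq_borel] .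
    moreover have "(\<lambda>n. \<integral>x. x ^ k \<partial>?N (r n)) \<longlonglongrightarrow> M k 0"
      using LIMSEQ_subseq_LIMSEQ[OF hausdorff_node_moment r] by (simp add: o_def)
    ultimately show ?thesis by (rule LIMSEQ_unique)
  qed
  then show ?thesis using \<mu> ae by blast
qed

end

section \<open>Exponentials as limits of powers\<close>

lemma norm_power_diff_le:
  fixes w v :: "'a::real_normed_field"
  assumes "norm w \<le> b" "norm v \<le> b" "1 \<le> b"
  shows "norm (w ^ n - v ^ n) \<le> real n * b ^ n * norm (w - v)"
proof (induction n)
  case (Suc n)
  have b: "0 \<le> b" using assms(3) by linarith
  have "w ^ Suc n - v ^ Suc n = w * (w ^ n - v ^ n) + (w - v) * v ^ n" by (simp add: algebra_simps)
  also have "norm \<dots> \<le> norm w * norm (w ^ n - v ^ n) + norm (w - v) * norm v ^ n"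
    by (rule order_trans[OF norm_triangle_ineq]) (simp add: norm_mult norm_power)
  also have "\<dots> \<le> b * (real n * b ^ n * norm (w - v)) + norm (w - v) * b ^ n"
    using Suc assms b by (intro add_mono mult_mono power_mono mult_left_mono) auto
  also have "\<dots> \<le> b * (real n * b ^ n * norm (w - v)) + norm (w - v) * b ^ Suc n"
    using assms(3) by (intro add_left_mono mult_left_mono power_increasing) auto
  finally show ?case by (simp add: algebra_simps)
qed simp

text \<open>An approximation of e^{iy} that is polynomial in y, so that its mean depends on finitely
  many moments and can be written as a matrix power.\<close>

definition pexp :: "nat \<Rightarrow> real \<Rightarrow> complex" where
  "pexp N y = (1 + \<i> * of_real (y / real N)) ^ N"

lemma norm_pexp_factor: "(norm (1 + \<i> * of_real y :: complex))\<^sup>2 = 1 + y\<^sup>2"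
  by (simp add: cmod_power2)

lemma norm_pexp_factor_power_le: "0 < N \<Longrightarrow> norm (1 + \<i> * of_real (y / real N) :: complex) ^ N \<le> exp (y\<^sup>2 / real N)"
proof -
  assume N: "0 < N"
  let ?a = "norm (1 + \<i> * of_real (y / real N) :: complex)"
  have sq: "?a\<^sup>2 = 1 + (y / real N)\<^sup>2" by (rule norm_pexp_factor)
  have "1 \<le> ?a" by (rule power2_le_imp_le, unfold sq, simp_all)
  then have "?a ^ N \<le> (?a\<^sup>2) ^ N" by (intro power_mono self_le_power) auto
  also have "\<dots> \<le> (exp ((y / real N)\<^sup>2)) ^ N" unfolding sq by (intro power_mono exp_ge_add_one_self) auto
  also have "\<dots> = exp (y\<^sup>2 / real N)" using N by (simp add: exp_of_nat_mult[symmetric] power_divide power2_eq_square)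
  finally show ?thesis .
qed

lemma norm_pexp_le: "norm (pexp N y) \<le> exp (y\<^sup>2)"
proof (cases "N = 0")
  case False
  have "norm (pexp N y) \<le> exp (y\<^sup>2 / real N)" unfolding pexp_def norm_power
    using False by (intro norm_pexp_factor_power_le) auto
  also have "\<dots> \<le> exp (y\<^sup>2)" using False by (simp add: divide_le_eq mult_le_cancel_left1)
  finally show ?thesis .
qed (simp add: pexp_def)

text \<open>The bases 1 + iy/N and e^{iy/N} differ by at most y^2 / N^2, and raising to the N-th
  power costs a factor N times a bounded one.\<close>

lemma pexp_tendsto: "(\<lambda>N. pexp N y) \<longlonglongrightarrow> iexp y"
proof (rule LIM_zero_cancel, rule Lim_null_comparison)
  show "eventually (\<lambda>N. norm (pexp N y - iexp y) \<le> exp (y\<^sup>2) * y\<^sup>2 / real N) sequentially"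
  proof (rule eventually_sequentiallyI[of 1])
    fix N :: nat assume N: "1 \<le> N"
    let ?w = "1 + \<i> * of_real (y / real N) :: complex" and ?v = "iexp (y / real N)"
    have sq: "(norm ?w)\<^sup>2 = 1 + (y / real N)\<^sup>2" by (rule norm_pexp_factor)
    have w1: "1 \<le> norm ?w" by (rule power2_le_imp_le, unfold sq, simp_all)
    have v: "?v ^ N = iexp y" using N by (simp add: exp_of_nat_mult[symmetric])
    have d: "norm (?w - ?v) \<le> (y / real N)\<^sup>2"
    proof -
      have "norm (?v - (\<Sum>k\<le>1. (\<i> * of_real (y / real N)) ^ k / fact k)) \<le> \<bar>y / real N\<bar> ^ Suc 1 / fact (Suc 1)"
        by (rule iexp_approx1)
      moreover have "(\<Sum>k\<le>1. (\<i> * of_real (y / real N)) ^ k / fact k) = ?w" by simp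
      ultimately have "norm (?v - ?w) \<le> \<bar>y / real N\<bar>\<^sup>2 / 2" by (simp add: eval_nat_numeral)
      also have "\<dots> \<le> (y / real N)\<^sup>2" unfolding power2_abs using zero_le_power2[of "y / real N"] by linarith
      finally show ?thesis by (simp add: norm_minus_commute)
    qed
    have "norm (pexp N y - iexp y) = norm (?w ^ N - ?v ^ N)" unfolding v pexp_def ..
    also have "\<dots> \<le> real N * norm ?w ^ N * norm (?w - ?v)"
      using w1 by (intro norm_power_diff_le) auto
    also have "\<dots> \<le> real N * exp (y\<^sup>2) * (y / real N)\<^sup>2"
      using d norm_pexp_le[of N y] by (intro mult_mono) (auto simp: pexp_def norm_power)
    also have "\<dots> = exp (y\<^sup>2) * y\<^sup>2 / real N" using N by (simp add: power_divide power2_eq_square)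
    finally show "norm (pexp N y - iexp y) \<le> exp (y\<^sup>2) * y\<^sup>2 / real N" .
  qed
  show "(\<lambda>N. exp (y\<^sup>2) * y\<^sup>2 / real N) \<longlonglongrightarrow> 0" by (rule lim_const_over_n)
qed

text \<open>The mean of \<open>pexp\<close> N (t x) expressed through a sequence of moments; for
  large N it approximates the characteristic function at t.\<close>

definition pexp_poly :: "nat \<Rightarrow> real \<Rightarrow> (nat \<Rightarrow> complex) \<Rightarrow> complex" where
  "pexp_poly N t m = (\<Sum>k\<le>N. of_nat (N choose k) * (\<i> * of_real (t / real N)) ^ k * m k)"

lemma pexp_poly_power: "pexp_poly N t (\<lambda>k. of_real (x ^ k)) = pexp N (t * x)"
proof -
  have "pexp N (t * x) = (\<i> * of_real (t / real N) * of_real x + 1) ^ N"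
    by (simp add: pexp_def add.commute mult.assoc)
  also have "\<dots> = pexp_poly N t (\<lambda>k. of_real (x ^ k))"
    unfolding binomial_ring pexp_poly_def
    by (intro sum.cong refl) (simp only: power_mult_distrib power_one mult_1_right of_real_power mult.assoc)
  finally show ?thesis by simp
qed

text \<open>Markov's inequality for the power 2k bounds the mass beyond R > C by (C / R)^{2k}, and k
  is arbitrary.\<close>

lemma AE_le_of_moments:
  assumes "real_distribution \<nu>" "0 \<le> C"
    and "\<And>k. 0 < k \<Longrightarrow> integrable \<nu> (\<lambda>x. x ^ k)" "\<And>k. 0 < k \<Longrightarrow> (\<integral>x. x ^ (2 * k) \<partial>\<nu>) \<le> C ^ (2 * k)"
  shows "AE x in \<nu>. \<bar>x\<bar> \<le> C"
proof -
  interpret real_distribution \<nu> by fact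
  have *: "measure \<nu> {x. C + 1 / real (Suc n) \<le> \<bar>x\<bar>} = 0" for n
  proof -
    let ?R = "C + 1 / real (Suc n)"
    have R: "0 < ?R" "C < ?R" using assms(2) by (auto intro: add_nonneg_pos)
    have b: "measure \<nu> {x. ?R \<le> \<bar>x\<bar>} \<le> (C\<^sup>2 / ?R\<^sup>2) ^ k" if k: "0 < k" for k
    proof -
      have "{x. ?R \<le> \<bar>x\<bar>} = {x \<in> space \<nu>. ?R ^ (2 * k) \<le> x ^ (2 * k)}"
      proof -
        have "?R ^ (2 * k) \<le> x ^ (2 * k) \<longleftrightarrow> ?R \<le> \<bar>x\<bar>" for x
        proof -
          have "x ^ (2 * k) = \<bar>x\<bar> ^ (2 * k)" by (simp add: power_mult)
          then show ?thesis using R(1) k by (simp add: power_mono_iff)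
        qed
        then show ?thesis by simp
      qed
      then have "measure \<nu> {x. ?R \<le> \<bar>x\<bar>} \<le> (\<integral>x. x ^ (2 * k) \<partial>\<nu>) / ?R ^ (2 * k)"
        using integral_Markov_inequality_measure[where A = "{}" and u = "\<lambda>x. x ^ (2*k)" and c = "?R ^ (2 * k)" and M = \<nu>]
          assms(3)[of "2 * k"] k R(1) by (auto simp: zero_le_even_power)
      also have "\<dots> \<le> C ^ (2 * k) / ?R ^ (2 * k)"
        using assms(4)[OF k] R(1) by (intro divide_right_mono) auto
      also have "\<dots> = (C\<^sup>2 / ?R\<^sup>2) ^ k" by (simp add: power_mult power_divide)
      finally show ?thesis .
    qed
    have "C\<^sup>2 / ?R\<^sup>2 < 1" using R assms(2) by (simp add: power_strict_mono)
    then have "(\<lambda>k. (C\<^sup>2 / ?R\<^sup>2) ^ k) \<longlonglongrightarrow> 0" by (intro LIMSEQ_realpow_zero) auto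
    then have "measure \<nu> {x. ?R \<le> \<bar>x\<bar>} \<le> 0"
      by (rule LIMSEQ_le_const) (use b in \<open>auto intro!: exI[of _ 1]\<close>)
    then show ?thesis by (simp add: measure_le_0_iff)
  qed
  have "AE x in \<nu>. \<forall>n. \<not> C + 1 / real (Suc n) \<le> \<bar>x\<bar>"
    unfolding AE_all_countable
  proof
    fix n
    have "{x. C + 1 / real (Suc n) \<le> \<bar>x\<bar>} \<in> null_sets \<nu>"
      using *[of n] by (simp add: emeasure_eq_measure null_setsI)
    then show "AE x in \<nu>. \<not> C + 1 / real (Suc n) \<le> \<bar>x\<bar>" by (rule AE_I') auto
  qed
  then show ?thesis
  proof eventually_elim
    case (elim x)
    show ?case
    proof (rule ccontr)
      assume "\<not> \<bar>x\<bar> \<le> C"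
      then obtain n where "1 / real (Suc n) < \<bar>x\<bar> - C" using reals_Archimedean[of "\<bar>x\<bar> - C"]
        by (auto simp: inverse_eq_divide)
      then show False using elim[rule_format, of n] by linarith
    qed
  qed
qed

text \<open>On a bounded support \<open>pexp\<close> is bounded uniformly in N, which gives both the
  dominated convergence and the second claim.\<close>

lemma char_moment_limit:
  assumes "real_distribution \<mu>" "AE x in \<mu>. \<bar>x\<bar> \<le> C"
  shows "(\<lambda>N. pexp_poly N t (\<lambda>k. of_real (\<integral>x. x ^ k \<partial>\<mu>))) \<longlonglongrightarrow> char \<mu> t"
    "norm (pexp_poly N t (\<lambda>k. of_real (\<integral>x. x ^ k \<partial>\<mu>))) \<le> exp ((t * C)\<^sup>2)"
proof -
  interpret real_distribution \<mu> by fact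
  have int: "integrable \<mu> (\<lambda>x. x ^ k)" for k
    by (rule integrable_const_bound[where B = "\<bar>C\<bar> ^ k"])
      (use assms(2) in \<open>auto elim!: eventually_mono simp: power_abs intro!: power_mono\<close>)
  have intc: "integrable \<mu> (\<lambda>x. complex_of_real (x ^ k))" for k using int by (rule integrable_of_real)
  have eq: "pexp_poly N t (\<lambda>k. of_real (\<integral>x. x ^ k \<partial>\<mu>)) = (\<integral>x. pexp N (t * x) \<partial>\<mu>)" for N
    unfolding pexp_poly_power[symmetric] unfolding pexp_poly_def
    by (subst Bochner_Integration.integral_sum) (auto intro!: sum.cong integrable_mult_right intc simp: integral_of_real[symmetric] simp del: of_real_power)
  have bd: "AE x in \<mu>. norm (pexp N (t * x)) \<le> exp ((t * C)\<^sup>2)" for N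
    using assms(2)
  proof eventually_elim
    case (elim x)
    have "(t * x)\<^sup>2 \<le> (t * C)\<^sup>2" using elim by (simp add: power_mult_distrib mult_left_mono abs_le_square_iff[symmetric])
    then show ?case using norm_pexp_le[of N "t * x"] by (meson exp_le_cancel_iff order_trans)
  qed
  have meas: "(\<lambda>x. pexp N (t * x)) \<in> borel_measurable \<mu>" for N
    unfolding pexp_def by measurable
  show "(\<lambda>N. pexp_poly N t (\<lambda>k. of_real (\<integral>x. x ^ k \<partial>\<mu>))) \<longlonglongrightarrow> char \<mu> t"
    unfolding eq char_def
    by (rule integral_dominated_convergence[where w = "\<lambda>x. exp ((t * C)\<^sup>2)"])
      (use meas bd pexp_tendsto in \<open>simp_all del: of_real_mult\<close>)
  show "norm (pexp_poly N t (\<lambda>k. of_real (\<integral>x. x ^ k \<partial>\<mu>))) \<le> exp ((t * C)\<^sup>2)"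
    unfolding eq using bd[of N]
    by (intro order_trans[OF integral_norm_bound] integral_le_const integrable_norm integrable_const_bound[OF bd meas]) auto
qed

text \<open>The even moments force the other measure onto the same interval, and there the moments
  determine the characteristic function.\<close>

lemma moments_unique:
  assumes "real_distribution \<mu>" "real_distribution \<nu>" "AE x in \<mu>. \<bar>x\<bar> \<le> C" "0 \<le> C"
    and "\<And>k. 1 \<le> k \<Longrightarrow> integrable \<nu> (\<lambda>x. x ^ k)"
    and "\<And>k. 1 \<le> k \<Longrightarrow> (\<integral>x. x ^ k \<partial>\<nu>) = (\<integral>x. x ^ k \<partial>\<mu>)"
  shows "\<nu> = \<mu>"
proof -
  interpret \<mu>: real_distribution \<mu> by fact
  interpret \<nu>: real_distribution \<nu> by fact
  have m: "(\<integral>x. x ^ k \<partial>\<nu>) = (\<integral>x. x ^ k \<partial>\<mu>)" for k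
    using assms(6)[of k] by (cases k) (auto simp: \<mu>.prob_space \<nu>.prob_space simp del: \<mu>.space_eq_univ \<nu>.space_eq_univ)
  have "AE x in \<nu>. \<bar>x\<bar> \<le> C"
  proof (rule AE_le_of_moments[OF assms(2,4)])
    fix k :: nat assume "0 < k"
    then show "integrable \<nu> (\<lambda>x. x ^ k)" using assms(5) by simp
    have "(\<integral>x. x ^ (2 * k) \<partial>\<mu>) \<le> C ^ (2 * k)"
    proof (rule \<mu>.integral_le_const)
      have ae: "AE x in \<mu>. \<bar>x ^ (2 * k)\<bar> \<le> C ^ (2 * k)"
        using assms(3) by eventually_elim (auto simp: power_abs intro!: power_mono)
      then show "integrable \<mu> (\<lambda>x. x ^ (2 * k))" by (intro \<mu>.integrable_const_bound[where B = "C ^ (2 * k)"]) auto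
      show "AE x in \<mu>. x ^ (2 * k) \<le> C ^ (2 * k)" using ae by eventually_elim auto
    qed
    then show "(\<integral>x. x ^ (2 * k) \<partial>\<nu>) \<le> C ^ (2 * k)" unfolding m .
  qed
  then have "char \<nu> t = char \<mu> t" for t
    using char_moment_limit(1)[OF assms(1,3), of t] char_moment_limit(1)[OF assms(2), of C t]
    unfolding m by (blast intro: LIMSEQ_unique)
  then show ?thesis by (intro Levy_uniqueness assms ext)
qed

section \<open>Spectral measures of bounded networks\<close>

text \<open>A symmetric pair of commuting positive operators with sum the identity yields a completely
  monotone double sequence of moments, whence a measure by Hausdorff's theorem.\<close>

locale positive_partition =
  fixes F :: "'x set" and ip :: "'x \<Rightarrow> 'x \<Rightarrow> complex" and B S :: "'x \<Rightarrow> 'x"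
  assumes closed: "f \<in> F \<Longrightarrow> B f \<in> F" "f \<in> F \<Longrightarrow> S f \<in> F"
    and symm: "f \<in> F \<Longrightarrow> g \<in> F \<Longrightarrow> ip (B f) g = ip f (B g)" "f \<in> F \<Longrightarrow> g \<in> F \<Longrightarrow> ip (S f) g = ip f (S g)"
    and pos: "f \<in> F \<Longrightarrow> 0 \<le> Re (ip f (B f))" "f \<in> F \<Longrightarrow> 0 \<le> Re (ip f (S f))"
    and split: "f \<in> F \<Longrightarrow> g \<in> F \<Longrightarrow> ip f g = ip f (B g) + ip f (S g)"
    and comm: "f \<in> F \<Longrightarrow> B (S f) = S (B f)"
begin

lemma pow_closed: "f \<in> F \<Longrightarrow> (B ^^ k) f \<in> F" "f \<in> F \<Longrightarrow> (S ^^ k) f \<in> F"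
  by (induction k) (auto intro: closed)

lemma pow_symm: "f \<in> F \<Longrightarrow> g \<in> F \<Longrightarrow> ip ((B ^^ k) f) g = ip f ((B ^^ k) g)"
  "f \<in> F \<Longrightarrow> g \<in> F \<Longrightarrow> ip ((S ^^ k) f) g = ip f ((S ^^ k) g)"
proof (induction k arbitrary: g)
  case (Suc k)
  { case 1 then show ?case using Suc(1)[of "B g"] by (simp add: symm(1) pow_closed closed funpow_swap1[symmetric])
  next case 2 then show ?case using Suc(2)[of "S g"] by (simp add: symm(2) pow_closed closed funpow_swap1[symmetric]) }
qed simp_all

lemma pow_comm1: "f \<in> F \<Longrightarrow> S ((B ^^ k) f) = (B ^^ k) (S f)"
  by (induction k) (auto simp: comm[symmetric] pow_closed)

lemma pow_comm: "f \<in> F \<Longrightarrow> (S ^^ l) ((B ^^ k) f) = (B ^^ k) ((S ^^ l) f)"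
  by (induction l) (auto simp: pow_comm1 pow_closed)

text \<open>The double sequence \<langle>e, B^k S^l e\<rangle>, to which the Hausdorff theorem is
  applied.\<close>

definition pmom :: "'x \<Rightarrow> nat \<Rightarrow> nat \<Rightarrow> real" where
  "pmom e k l = Re (ip e ((B ^^ k) ((S ^^ l) e)))"

lemma pmom_rec:
  assumes "e \<in> F"
  shows "pmom e k l = pmom e (Suc k) l + pmom e k (Suc l)"
proof -
  have "ip e ((B ^^ k) ((S ^^ l) e)) = ip e (B ((B ^^ k) ((S ^^ l) e))) + ip e (S ((B ^^ k) ((S ^^ l) e)))"
    using assms by (intro split pow_closed)
  then show ?thesis using assms by (simp add: pmom_def pow_comm1 pow_closed)
qed

lemma split_norm_nonneg: "f \<in> F \<Longrightarrow> 0 \<le> Re (ip f f)"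
  using split[of f f] pos[of f] by simp

text \<open>A product of commuting positive operators is positive. Square roots are avoided by
  inserting B + S = 1: the form of BS at f is the form of S at Bf plus the form of B at Sf.\<close>

lemma pos_BS:
  assumes "f \<in> F"
  shows "0 \<le> Re (ip f (B (S f)))"
proof -
  have "ip f (B (S f)) = ip f (B (B (S f))) + ip f (S (B (S f)))"
    using assms by (intro split closed)
  also have "ip f (B (B (S f))) = ip (B f) (S (B f))"
    using assms by (simp add: symm closed comm)
  also have "ip f (S (B (S f))) = ip (S f) (B (S f))"
    using assms by (simp add: symm closed)
  finally show ?thesis using assms by (simp add: pos closed)
qed

text \<open>Half of each exponent moves to the left argument by symmetry, which leaves the form of
  1, B, S or BS according to the parities of k and l.\<close>

lemma pmom_nonneg:
  assumes e: "e \<in> F"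
  shows "0 \<le> pmom e k l"
proof -
  define a b where "a = k div 2" and "b = l div 2"
  define f where "f = (B ^^ a) ((S ^^ b) e)"
  have f: "f \<in> F" unfolding f_def using e by (intro pow_closed)
  have red: "ip e ((B ^^ a) ((S ^^ b) g)) = ip f g" if g: "g \<in> F" for g
  proof -
    have "ip f g = ip e ((S ^^ b) ((B ^^ a) g))"
      unfolding f_def using e g by (simp add: pow_symm pow_closed)
    then show ?thesis using g by (simp add: pow_comm)
  qed
  have k: "k = a + (a + k mod 2)" and l: "l = b + (b + l mod 2)" unfolding a_def b_def by presburger+
  have "(B ^^ k) ((S ^^ l) e) = (B ^^ a) ((B ^^ (a + k mod 2)) ((S ^^ b) ((S ^^ (b + l mod 2)) e)))"
    by (subst k, subst l) (simp only: funpow_add o_apply)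
  also have "\<dots> = (B ^^ a) ((S ^^ b) ((B ^^ (a + k mod 2)) ((S ^^ (b + l mod 2)) e)))"
    using e by (subst pow_comm) (auto intro: pow_closed)
  finally have 1: "pmom e k l = Re (ip f ((B ^^ (a + k mod 2)) ((S ^^ (b + l mod 2)) e)))"
    unfolding pmom_def using e by (simp only: red pow_closed)
  have 2: "(B ^^ (a + k mod 2)) ((S ^^ (b + l mod 2)) e) = (B ^^ (k mod 2)) ((S ^^ (l mod 2)) f)"
  proof -
    have "(B ^^ (k mod 2)) ((S ^^ (l mod 2)) f) = (B ^^ (k mod 2)) ((B ^^ a) ((S ^^ (l mod 2)) ((S ^^ b) e)))"
      unfolding f_def using e by (subst pow_comm) (auto intro: pow_closed)
    then show ?thesis by (simp only: add.commute[of a] add.commute[of b] funpow_add o_apply)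
  qed
  have "k mod 2 = 0 \<or> k mod 2 = 1" "l mod 2 = 0 \<or> l mod 2 = 1" by auto
  then show ?thesis unfolding 1 2
    using split_norm_nonneg[OF f] pos[OF f] pos_BS[OF f] by auto
qed

lemma pmom_measure:
  assumes "e \<in> F" "ip e e = 1"
  shows "\<exists>\<mu>. real_distribution \<mu> \<and> (AE x in \<mu>. 0 \<le> x \<and> x \<le> 1) \<and> (\<forall>k. (\<integral>x. x ^ k \<partial>\<mu>) = Re (ip e ((B ^^ k) e)))"
proof -
  have "pmom e 0 0 = 1" using assms(2) by (simp add: pmom_def)
  from hausdorff_moment_exists[of "pmom e", OF pmom_nonneg[OF assms(1)] pmom_rec[OF assms(1)] this]
  show ?thesis by (simp add: pmom_def)
qed

end

text \<open>Bounded networks have finite rows, so the operator preserves finitely supported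
  functions, and the moments at a vertex are computed without completing the space.\<close>

definition fsupp :: "'v set \<Rightarrow> ('v \<Rightarrow> complex) set" where
  "fsupp V = {f. finite {u. f u \<noteq> 0} \<and> {u. f u \<noteq> 0} \<subseteq> V}"

definition fip :: "('v \<Rightarrow> complex) \<Rightarrow> ('v \<Rightarrow> complex) \<Rightarrow> complex" where
  "fip f g = (\<Sum>u | f u \<noteq> 0. cnj (f u) * g u)"

lemma fip_eq_sum:
  assumes "finite A" "{u. f u \<noteq> 0} \<subseteq> A"
  shows "fip f g = (\<Sum>u\<in>A. cnj (f u) * g u)"
  unfolding fip_def by (rule sum.mono_neutral_left) (use assms in auto)

lemma fip_eq_sum':
  assumes "finite A" "{u. g u \<noteq> 0} \<subseteq> A" "finite {u. f u \<noteq> 0}"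
  shows "fip f g = (\<Sum>u\<in>A. cnj (f u) * g u)"
proof -
  have "fip f g = (\<Sum>u\<in>A \<union> {u. f u \<noteq> 0}. cnj (f u) * g u)"
    by (rule fip_eq_sum) (use assms in auto)
  also have "\<dots> = (\<Sum>u\<in>A. cnj (f u) * g u)"
    by (rule sum.mono_neutral_right) (use assms in auto)
  finally show ?thesis .
qed

lemma fip_linear: "fip f (\<lambda>u. a * g u + b * h u) = a * fip f g + b * fip f h"
  unfolding fip_def by (simp add: sum_distrib_left sum.distrib[symmetric] algebra_simps)

lemma fip_cnj:
  assumes "finite {u. f u \<noteq> 0}" "finite {u. g u \<noteq> 0}"
  shows "fip f g = cnj (fip g f)"
proof -
  let ?A = "{u. f u \<noteq> 0} \<union> {u. g u \<noteq> 0}"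
  have "fip f g = (\<Sum>u\<in>?A. cnj (f u) * g u)" "fip g f = (\<Sum>u\<in>?A. cnj (g u) * f u)"
    by (rule fip_eq_sum, use assms in auto)+
  then show ?thesis by (simp add: mult.commute)
qed

locale bounded_network =
  fixes G :: "'v network" and D :: nat
  assumes net: "is_network G" and bdd: "bdd_net D G"
begin

abbreviation "V \<equiv> verts G"

text \<open>Cut off outside the vertex set, where the weights are arbitrary, so that the operator
  stays within \<open>fsupp V\<close>.\<close>

definition T :: "('v \<Rightarrow> complex) \<Rightarrow> 'v \<Rightarrow> complex" where
  "T f u = (if u \<in> V then net_op G f u else 0)"

lemma T_eq_sum:
  assumes "finite A" "A \<subseteq> V" "{u. f u \<noteq> 0} \<subseteq> A" "u \<in> V"
  shows "T f u = (\<Sum>z\<in>A. wt G u z * f z)"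
  unfolding T_def net_op_def using assms by (auto intro!: infsum_eq_sum)

lemma wt_sym: "u \<in> V \<Longrightarrow> v \<in> V \<Longrightarrow> wt G u v = 0 \<longleftrightarrow> wt G v u = 0"
  using is_networkD(2)[OF net, of u v] by (metis complex_cnj_zero_iff)

lemma T_supp:
  assumes "f \<in> fsupp V"
  shows "{u. T f u \<noteq> 0} \<subseteq> (\<Union>z\<in>{u. f u \<noteq> 0}. net_row G z)"
proof
  fix u assume u: "u \<in> {u. T f u \<noteq> 0}"
  then have uV: "u \<in> V" by (auto simp: T_def split: if_splits)
  have "T f u = (\<Sum>z\<in>{u. f u \<noteq> 0}. wt G u z * f z)"
    using assms uV by (intro T_eq_sum) (auto simp: fsupp_def)
  then obtain z where "f z \<noteq> 0" "wt G u z \<noteq> 0" using u sum.neutral by (metis (mono_tags, lifting) mem_Collect_eq mult_eq_0_iff)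
  moreover have "z \<in> V" using \<open>f z \<noteq> 0\<close> assms by (auto simp: fsupp_def)
  ultimately show "u \<in> (\<Union>z\<in>{u. f u \<noteq> 0}. net_row G z)"
    using wt_sym[OF uV] uV by (auto simp: net_row_def)
qed

lemma T_closed:
  assumes "f \<in> fsupp V"
  shows "T f \<in> fsupp V"
proof -
  have "finite (\<Union>z\<in>{u. f u \<noteq> 0}. net_row G z)"
    using assms bdd_netD(1)[OF bdd] by (auto simp: fsupp_def)
  moreover have "{u. T f u \<noteq> 0} \<subseteq> V" by (auto simp: T_def split: if_splits)
  ultimately show ?thesis using T_supp[OF assms] by (auto simp: fsupp_def dest: finite_subset)
qed

lemma fsuppD: "f \<in> fsupp V \<Longrightarrow> finite {u. f u \<noteq> 0}" "f \<in> fsupp V \<Longrightarrow> {u. f u \<noteq> 0} \<subseteq> V"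
  by (auto simp: fsupp_def)

lemma T_symm:
  assumes f: "f \<in> fsupp V" and g: "g \<in> fsupp V"
  shows "fip (T f) g = fip f (T g)"
proof -
  define A where "A = {u. f u \<noteq> 0} \<union> {u. g u \<noteq> 0}"
  have A: "finite A" "A \<subseteq> V" "{u. f u \<noteq> 0} \<subseteq> A" "{u. g u \<noteq> 0} \<subseteq> A"
    using fsuppD[OF f] fsuppD[OF g] by (auto simp: A_def)
  have "fip (T f) g = (\<Sum>u\<in>A. cnj (T f u) * g u)"
    by (rule fip_eq_sum'[OF A(1,4) fsuppD(1)[OF T_closed[OF f]]])
  also have "\<dots> = (\<Sum>u\<in>A. \<Sum>z\<in>A. cnj (f z) * (wt G z u * g u))"
  proof (intro sum.cong refl)
    fix u assume u: "u \<in> A"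
    have "cnj (T f u) * g u = (\<Sum>z\<in>A. cnj (wt G u z) * cnj (f z) * g u)"
      using u A by (subst T_eq_sum[OF A(1,2,3)]) (auto simp: sum_distrib_right)
    also have "\<dots> = (\<Sum>z\<in>A. cnj (f z) * (wt G z u * g u))"
      using u A by (intro sum.cong refl) (subst is_networkD(2)[OF net, of _ u], auto)
    finally show "cnj (T f u) * g u = (\<Sum>z\<in>A. cnj (f z) * (wt G z u * g u))" .
  qed
  also have "\<dots> = (\<Sum>z\<in>A. \<Sum>u\<in>A. cnj (f z) * (wt G z u * g u))" by (rule sum.swap)
  also have "\<dots> = (\<Sum>z\<in>A. cnj (f z) * T g z)"
    using A by (intro sum.cong refl) (subst T_eq_sum[OF A(1,2,4)], auto simp: sum_distrib_left)
  also have "\<dots> = fip f (T g)" by (rule fip_eq_sum[OF A(1,3), symmetric])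
  finally show ?thesis .
qed

text \<open>The row sums are at most D * D; the added 1 makes the constant positive, as it occurs as
  a divisor in \<open>P\<close> and \<open>Q\<close>.\<close>

definition C :: real where "C = (real D)\<^sup>2 + 1"

lemma C_pos: "0 < C"
  by (simp add: C_def add_nonneg_pos)

lemma row_sum_le:
  assumes "u \<in> V" "finite A" "A \<subseteq> V"
  shows "(\<Sum>z\<in>A. norm (wt G u z)) \<le> C"
proof -
  have "(\<Sum>z\<in>A. norm (wt G u z)) = (\<Sum>z\<in>A \<inter> net_row G u. norm (wt G u z))"
    using assms by (intro sum.mono_neutral_right) (auto simp: net_row_def)
  also have "\<dots> \<le> real (card (A \<inter> net_row G u)) * real D"
    using assms bdd_netD(3)[OF bdd assms(1)] by (intro sum_bounded_above) auto
  also have "\<dots> \<le> real D * real D"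
  proof (intro mult_right_mono of_nat_mono)
    show "card (A \<inter> net_row G u) \<le> D"
      using bdd_netD(1,2)[OF bdd assms(1)] card_mono[of "net_row G u" "A \<inter> net_row G u"] by simp
  qed simp
  also have "\<dots> \<le> C" by (simp add: C_def power2_eq_square)
  finally show ?thesis .
qed

text \<open>The Schur test: each product |f u| |f z| is at most half the sum of the squares, and
  rows and columns have the same absolute sums.\<close>

lemma T_bound:
  assumes f: "f \<in> fsupp V"
  shows "\<bar>Re (fip f (T f))\<bar> \<le> C * Re (fip f f)"
proof -
  define A where "A = {u. f u \<noteq> 0}"
  have A: "finite A" "A \<subseteq> V" "{u. f u \<noteq> 0} \<subseteq> A"
    using fsuppD[OF f] by (auto simp: A_def)
  let ?w = "\<lambda>u z. norm (wt G u z)"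
  have sw: "?w u z = ?w z u" if "u \<in> A" "z \<in> A" for u z
  proof -
    have "wt G u z = cnj (wt G z u)" using that A by (intro is_networkD(2)[OF net]) auto
    then show ?thesis by simp
  qed
  have "fip f (T f) = (\<Sum>u\<in>A. cnj (f u) * T f u)" by (rule fip_eq_sum[OF A(1,3)])
  also have "\<dots> = (\<Sum>u\<in>A. cnj (f u) * (\<Sum>z\<in>A. wt G u z * f z))"
    using A by (intro sum.cong refl) (subst T_eq_sum[OF A], auto)
  finally have e: "fip f (T f) = (\<Sum>u\<in>A. cnj (f u) * (\<Sum>z\<in>A. wt G u z * f z))" .
  have "\<bar>Re (fip f (T f))\<bar> \<le> norm (fip f (T f))" by (rule abs_Re_le_cmod)
  also have "\<dots> \<le> (\<Sum>u\<in>A. \<Sum>z\<in>A. ?w u z * ((norm (f u))\<^sup>2 / 2 + (norm (f z))\<^sup>2 / 2))"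
    unfolding e
  proof (intro sum_norm_le)
    fix u assume "u \<in> A"
    have "norm (cnj (f u) * (\<Sum>z\<in>A. wt G u z * f z)) \<le> norm (f u) * (\<Sum>z\<in>A. ?w u z * norm (f z))"
      unfolding norm_mult complex_mod_cnj by (intro mult_left_mono sum_norm_le) (auto simp: norm_mult)
    also have "\<dots> = (\<Sum>z\<in>A. ?w u z * (norm (f u) * norm (f z)))"
      by (simp add: sum_distrib_left mult_ac)
    also have "\<dots> \<le> (\<Sum>z\<in>A. ?w u z * ((norm (f u))\<^sup>2 / 2 + (norm (f z))\<^sup>2 / 2))"
    proof (intro sum_mono mult_left_mono)
      fix z
      have "0 \<le> (norm (f u) - norm (f z))\<^sup>2" by simp
      then show "norm (f u) * norm (f z) \<le> (norm (f u))\<^sup>2 / 2 + (norm (f z))\<^sup>2 / 2"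
        by (simp add: power2_diff)
    qed simp
    finally show "norm (cnj (f u) * (\<Sum>z\<in>A. wt G u z * f z)) \<le> (\<Sum>z\<in>A. ?w u z * ((norm (f u))\<^sup>2 / 2 + (norm (f z))\<^sup>2 / 2))" .
  qed
  also have "\<dots> = (\<Sum>u\<in>A. \<Sum>z\<in>A. ?w u z * ((norm (f u))\<^sup>2 / 2)) + (\<Sum>u\<in>A. \<Sum>z\<in>A. ?w u z * ((norm (f z))\<^sup>2 / 2))"
    by (simp add: sum.distrib distrib_left)
  also have "(\<Sum>u\<in>A. \<Sum>z\<in>A. ?w u z * ((norm (f z))\<^sup>2 / 2)) = (\<Sum>z\<in>A. \<Sum>u\<in>A. ?w u z * ((norm (f z))\<^sup>2 / 2))"
    by (rule sum.swap)
  also have "\<dots> = (\<Sum>u\<in>A. \<Sum>z\<in>A. ?w u z * ((norm (f u))\<^sup>2 / 2))"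
    by (intro sum.cong refl) (simp add: sw)
  also have "(\<Sum>u\<in>A. \<Sum>z\<in>A. ?w u z * ((norm (f u))\<^sup>2 / 2)) + (\<Sum>u\<in>A. \<Sum>z\<in>A. ?w u z * ((norm (f u))\<^sup>2 / 2))
     = (\<Sum>u\<in>A. (\<Sum>z\<in>A. ?w u z) * (norm (f u))\<^sup>2)"
    by (simp add: sum.distrib[symmetric] sum_distrib_right)
  also have "\<dots> \<le> (\<Sum>u\<in>A. C * (norm (f u))\<^sup>2)"
    using A by (intro sum_mono mult_right_mono row_sum_le) auto
  also have "\<dots> = C * Re (fip f f)"
    by (simp add: fip_eq_sum[OF A(1,3)] sum_distrib_left complex_norm_square[symmetric] mult.commute[of "cnj _"] flip: of_real_power)
  finally show ?thesis .
qed

text \<open>The operators (1 + T / C) / 2 and (1 - T / C) / 2: they commute, sum to the identity,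
  and are positive by \<open>T_bound\<close>.\<close>

definition P :: "('v \<Rightarrow> complex) \<Rightarrow> 'v \<Rightarrow> complex" where
  "P f u = (1 / 2) * f u + of_real (1 / (2 * C)) * T f u"

definition Q :: "('v \<Rightarrow> complex) \<Rightarrow> 'v \<Rightarrow> complex" where
  "Q f u = (1 / 2) * f u + of_real (- 1 / (2 * C)) * T f u"

lemma lin_closed:
  assumes "f \<in> fsupp V" "g \<in> fsupp V"
  shows "(\<lambda>u. a * f u + b * g u) \<in> fsupp V"
proof -
  have "{u. a * f u + b * g u \<noteq> 0} \<subseteq> {u. f u \<noteq> 0} \<union> {u. g u \<noteq> 0}" by auto
  then show ?thesis using fsuppD[OF assms(1)] fsuppD[OF assms(2)]
    unfolding fsupp_def by (auto dest: finite_subset)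
qed

lemma T_linear:
  assumes f: "f \<in> fsupp V" and g: "g \<in> fsupp V"
  shows "T (\<lambda>u. a * f u + b * g u) = (\<lambda>u. a * T f u + b * T g u)"
proof
  fix u
  define A where "A = {u. f u \<noteq> 0} \<union> {u. g u \<noteq> 0}"
  have A: "finite A" "A \<subseteq> V" "{u. f u \<noteq> 0} \<subseteq> A" "{u. g u \<noteq> 0} \<subseteq> A" "{u. a * f u + b * g u \<noteq> 0} \<subseteq> A"
    using fsuppD[OF f] fsuppD[OF g] by (auto simp: A_def)
  show "T (\<lambda>u. a * f u + b * g u) u = a * T f u + b * T g u"
  proof (cases "u \<in> V")
    case True
    then show ?thesis
      unfolding T_eq_sum[OF A(1,2,3) True] T_eq_sum[OF A(1,2,4) True] T_eq_sum[OF A(1,2,5) True]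
      by (simp add: sum_distrib_left sum.distrib[symmetric] algebra_simps)
  qed (simp add: T_def)
qed

lemma PQ_closed: "f \<in> fsupp V \<Longrightarrow> P f \<in> fsupp V" "f \<in> fsupp V \<Longrightarrow> Q f \<in> fsupp V"
  unfolding P_def[abs_def] Q_def[abs_def] by (intro lin_closed T_closed; assumption)+

lemma fip_linear_left:
  assumes "f \<in> fsupp V" "g \<in> fsupp V" "h \<in> fsupp V"
  shows "fip (\<lambda>u. of_real a * f u + of_real b * g u) h = of_real a * fip f h + of_real b * fip g h"
proof -
  have "fip (\<lambda>u. of_real a * f u + of_real b * g u) h = cnj (fip h (\<lambda>u. of_real a * f u + of_real b * g u))"
    by (intro fip_cnj fsuppD(1) lin_closed assms)
  also have "\<dots> = of_real a * cnj (fip h f) + of_real b * cnj (fip h g)" by (simp add: fip_linear)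
  also have "\<dots> = of_real a * fip f h + of_real b * fip g h"
    using fip_cnj[OF fsuppD(1)[OF assms(1)] fsuppD(1)[OF assms(3)]]
      fip_cnj[OF fsuppD(1)[OF assms(2)] fsuppD(1)[OF assms(3)]] by simp
  finally show ?thesis .
qed

sublocale positive_partition "fsupp V" fip P Q
proof
  fix f g :: "'v \<Rightarrow> complex" assume f: "f \<in> fsupp V"
  show "P f \<in> fsupp V" "Q f \<in> fsupp V" using PQ_closed f by auto
  have half: "(1 / 2 :: complex) = of_real (1 / 2)" by simp
  have fP: "fip h (P g) = (1 / 2) * fip h g + of_real (1 / (2 * C)) * fip h (T g)" for h g
    unfolding P_def[abs_def] by (rule fip_linear)
  have fQ: "fip h (Q g) = (1 / 2) * fip h g + of_real (- 1 / (2 * C)) * fip h (T g)" for h g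
    unfolding Q_def[abs_def] by (rule fip_linear)
  have b: "\<bar>Re (fip f (T f))\<bar> / C \<le> Re (fip f f)"
    using T_bound[OF f] C_pos by (simp add: divide_le_eq mult.commute)
  have "- \<bar>Re (fip f (T f))\<bar> / C \<le> Re (fip f (T f)) / C" "Re (fip f (T f)) / C \<le> \<bar>Re (fip f (T f))\<bar> / C"
    using C_pos by (intro divide_right_mono; simp)+
  then show "0 \<le> Re (fip f (P f))" "0 \<le> Re (fip f (Q f))"
    unfolding fP fQ using b by (simp_all add: field_simps)
  show "P (Q f) = Q (P f)"
    unfolding P_def Q_def T_linear[OF f T_closed[OF f]] by (simp add: algebra_simps)
  assume g: "g \<in> fsupp V"
  show "fip (P f) g = fip f (P g)"
    unfolding fP unfolding P_def[abs_def] half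
    by (subst fip_linear_left[OF f T_closed[OF f] g]) (simp add: T_symm[OF f g])
  show "fip (Q f) g = fip f (Q g)"
    unfolding fQ unfolding Q_def[abs_def] half
    by (subst fip_linear_left[OF f T_closed[OF f] g]) (simp add: T_symm[OF f g])
  show "fip f g = fip f (P g) + fip f (Q g)"
    unfolding fP fQ by simp
qed

lemma T_pow_closed: "f \<in> fsupp V \<Longrightarrow> (T ^^ k) f \<in> fsupp V"
  by (induction k) (auto intro: T_closed)

lemma unit_vec_fsupp: "v \<in> V \<Longrightarrow> unit_vec v \<in> fsupp V"
  by (auto simp: fsupp_def unit_vec_def)

lemma fip_unit_vec: "fip (unit_vec v) g = g v"
proof -
  have "{u. unit_vec v u \<noteq> 0} = {v}" by (auto simp: unit_vec_def)
  then show ?thesis unfolding fip_def by (simp add: unit_vec_def)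
qed

lemma T_pow_wpow:
  assumes "u \<in> V"
  shows "(T ^^ k) (unit_vec v) u = wpow G k u v"
  using assms
proof (induction k arbitrary: u)
  case 0 then show ?case by (simp add: wpow_0)
next
  case (Suc k)
  then show ?case by (simp add: T_def net_op_def wpow_Suc cong: infsum_cong)
qed

lemma T_pow_symm: "f \<in> fsupp V \<Longrightarrow> g \<in> fsupp V \<Longrightarrow> fip ((T ^^ k) f) g = fip f ((T ^^ k) g)"
proof (induction k arbitrary: g)
  case (Suc k)
  then have "fip ((T ^^ Suc k) f) g = fip ((T ^^ k) f) (T g)" by (simp add: T_symm T_pow_closed)
  also have "\<dots> = fip f ((T ^^ k) (T g))" using Suc T_closed by simp
  finally show ?case by (simp add: funpow_swap1)
qed simp

text \<open>The measure of \<open>P\<close> on [0, 1] is carried to [-C, C] by y \<mapsto> 2 C y -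
  C, because T = 2 C P - C.\<close>

lemma spectral_exists:
  assumes v: "v \<in> V"
  shows "\<exists>\<mu>. real_distribution \<mu> \<and> (AE x in \<mu>. \<bar>x\<bar> \<le> C) \<and> (\<forall>k. of_real (\<integral>x. x ^ k \<partial>\<mu>) = wpow G k v v)"
proof -
  let ?e = "unit_vec v"
  have e: "?e \<in> fsupp V" by (rule unit_vec_fsupp[OF v])
  have "fip ?e ?e = 1" by (simp add: fip_unit_vec) (simp add: unit_vec_def)
  from pmom_measure[OF e this] obtain \<mu> where \<mu>: "real_distribution \<mu>" "AE y in \<mu>. 0 \<le> y \<and> y \<le> 1"
    and m: "\<And>k. (\<integral>y. y ^ k \<partial>\<mu>) = Re (fip ?e ((P ^^ k) ?e))" by blast
  interpret \<mu>: real_distribution \<mu> by (rule \<mu>)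
  let ?x = "\<lambda>y. 2 * C * y - C"
  have bx: "AE y in \<mu>. \<bar>?x y\<bar> \<le> C"
    using \<mu>(2)
  proof eventually_elim
    case (elim y)
    then have "0 \<le> C * y" "C * y \<le> C * 1" using C_pos by (auto intro!: mult_left_mono)
    then show ?case by simp
  qed
  have int: "integrable \<mu> (\<lambda>y. ?x y ^ k * y ^ j)" for k j
  proof (rule \<mu>.integrable_const_bound[where B = "C ^ k"])
    show "AE y in \<mu>. norm (?x y ^ k * y ^ j) \<le> C ^ k"
      using bx \<mu>(2)
    proof eventually_elim
      case (elim y)
      have "\<bar>?x y\<bar> ^ k * \<bar>y\<bar> ^ j \<le> C ^ k * 1"
        using elim C_pos by (intro mult_mono power_mono power_le_one) auto
      then show ?case by (simp only: real_norm_def abs_mult power_abs mult_1_right)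
    qed
  qed simp
  \<comment> \<open>Mixed moments make the induction on k work: one factor 2 C y - C is traded for
    one more y, that is, T for P.\<close>
  have mom: "(\<integral>y. ?x y ^ k * y ^ j \<partial>\<mu>) = Re (fip ((T ^^ k) ?e) ((P ^^ j) ?e))" for k j
  proof (induction k arbitrary: j)
    case 0 then show ?case using m by simp
  next
    case (Suc k)
    let ?g = "(P ^^ j) ?e"
    have g: "?g \<in> fsupp V" by (rule pow_closed(1)[OF e])
    have Tg: "T ?g = (\<lambda>u. of_real (2 * C) * P ?g u + of_real (- C) * ?g u)"
      using C_pos by (auto simp: P_def field_simps)
    have "fip ((T ^^ Suc k) ?e) ?g = fip ((T ^^ k) ?e) (T ?g)"
      by (simp add: T_symm T_pow_closed e g)
    also have "\<dots> = of_real (2 * C) * fip ((T ^^ k) ?e) (P ?g) + of_real (- C) * fip ((T ^^ k) ?e) ?g"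
      unfolding Tg by (rule fip_linear)
    finally have 1: "Re (fip ((T ^^ Suc k) ?e) ?g) = 2 * C * Re (fip ((T ^^ k) ?e) ((P ^^ Suc j) ?e)) - C * Re (fip ((T ^^ k) ?e) ?g)"
      by simp
    have "(\<integral>y. ?x y ^ Suc k * y ^ j \<partial>\<mu>) = (\<integral>y. 2 * C * (?x y ^ k * y ^ Suc j) - C * (?x y ^ k * y ^ j) \<partial>\<mu>)"
      by (intro Bochner_Integration.integral_cong refl) (simp add: algebra_simps)
    also have "\<dots> = 2 * C * (\<integral>y. ?x y ^ k * y ^ Suc j \<partial>\<mu>) - C * (\<integral>y. ?x y ^ k * y ^ j \<partial>\<mu>)"
      by (subst Bochner_Integration.integral_diff) (intro integrable_mult_right int, intro integrable_mult_right int, simp only: integral_mult_right_zero)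
    finally show ?case unfolding 1 Suc.IH .
  qed
  let ?\<nu> = "distr \<mu> borel ?x"
  have \<nu>: "real_distribution ?\<nu>" by (rule \<mu>.real_distribution_distr) simp
  have ae: "AE x in ?\<nu>. \<bar>x\<bar> \<le> C" using bx by (subst AE_distr_iff) auto
  have "of_real (\<integral>x. x ^ k \<partial>?\<nu>) = wpow G k v v" for k
  proof -
    have "(\<integral>x. x ^ k \<partial>?\<nu>) = (\<integral>y. ?x y ^ k \<partial>\<mu>)" by (rule integral_distr) auto
    also have "\<dots> = Re (fip ((T ^^ k) ?e) ?e)" using mom[of k 0] by simp
    finally have 1: "(\<integral>x. x ^ k \<partial>?\<nu>) = Re (fip ((T ^^ k) ?e) ?e)" .
    have 2: "fip ((T ^^ k) ?e) ?e = fip ?e ((T ^^ k) ?e)" by (rule T_pow_symm[OF e e])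
    have 3: "fip ((T ^^ k) ?e) ?e = cnj (fip ?e ((T ^^ k) ?e))" by (intro fip_cnj fsuppD(1) T_pow_closed e)
    have "Im (fip ((T ^^ k) ?e) ?e) = 0" using 2 3 by (simp add: complex_eq_iff)
    then have "of_real (\<integral>x. x ^ k \<partial>?\<nu>) = fip ((T ^^ k) ?e) ?e" unfolding 1 by (simp add: complex_eq_iff)
    also have "\<dots> = wpow G k v v" unfolding 2 fip_unit_vec by (rule T_pow_wpow[OF v])
    finally show ?thesis .
  qed
  then show ?thesis using \<nu> ae by blast
qed

end

definition sbound :: "nat \<Rightarrow> real" where "sbound D = (real D)\<^sup>2 + 1"

lemma sbound_pos: "0 < sbound D"
  by (simp add: sbound_def add_nonneg_pos)

lemma l2_inner_unit_vec:
  assumes "v \<in> verts G"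
  shows "l2_inner G (unit_vec v) f = f v"
proof -
  have "l2_inner G (unit_vec v) f = (\<Sum>u\<in>{v}. cnj (unit_vec v u) * f u)"
    unfolding l2_inner_def by (rule infsum_eq_sum) (use assms in \<open>auto simp: unit_vec_def\<close>)
  then show ?thesis by (simp add: unit_vec_def)
qed

lemma integrable_power_of_AE_le:
  assumes "real_distribution \<mu>" "AE x in \<mu>. \<bar>x\<bar> \<le> C"
  shows "integrable \<mu> (\<lambda>x. x ^ k)"
proof -
  interpret real_distribution \<mu> by fact
  show ?thesis
    by (rule integrable_const_bound[where B = "\<bar>C\<bar> ^ k"])
      (use assms(2) in \<open>auto elim!: eventually_mono simp: power_abs intro!: power_mono\<close>)
qed

text \<open>Resolves the definite description: bounded support of one candidate makes the moment
  problem determinate.\<close>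

lemma spectral_measure_eqI:
  assumes v: "v \<in> verts G" and \<mu>: "real_distribution \<mu>" "AE x in \<mu>. \<bar>x\<bar> \<le> C" "0 \<le> C"
    and m: "\<And>k. of_real (\<integral>x. x ^ k \<partial>\<mu>) = wpow G k v v"
  shows "spectral_measure G v = \<mu>"
  unfolding spectral_measure_def
proof (rule the_equality)
  note int = integrable_power_of_AE_le[OF \<mu>(1,2)]
  show "real_distribution \<mu> \<and> (\<forall>k\<ge>1. integrable \<mu> (\<lambda>x. x ^ k) \<and>
      complex_of_real (\<integral>x. x ^ k \<partial>\<mu>) = l2_inner G (unit_vec v) ((net_op G ^^ k) (unit_vec v)))"
    using \<mu>(1) int m by (simp add: l2_inner_unit_vec[OF v] wpow_def)
  fix \<nu> assume \<nu>: "real_distribution \<nu> \<and> (\<forall>k\<ge>1. integrable \<nu> (\<lambda>x. x ^ k) \<and>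
      complex_of_real (\<integral>x. x ^ k \<partial>\<nu>) = l2_inner G (unit_vec v) ((net_op G ^^ k) (unit_vec v)))"
  then have "complex_of_real (\<integral>x. x ^ k \<partial>\<nu>) = of_real (\<integral>x. x ^ k \<partial>\<mu>)" if "1 \<le> k" for k
    using that m[of k] by (simp add: l2_inner_unit_vec[OF v] wpow_def)
  then show "\<nu> = \<mu>" using \<nu> by (intro moments_unique[OF \<mu>(1) _ \<mu>(2,3)]) (auto simp: of_real_eq_iff)
qed

lemma spectral_measure_props:
  assumes "is_network G" "bdd_net D G" and v: "v \<in> verts G"
  shows "real_distribution (spectral_measure G v)"
    and "AE x in spectral_measure G v. \<bar>x\<bar> \<le> sbound D"
    and "of_real (\<integral>x. x ^ k \<partial>spectral_measure G v) = wpow G k v v"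
proof -
  interpret bounded_network G D by unfold_locales fact+
  obtain \<mu> where \<mu>: "real_distribution \<mu>" "AE x in \<mu>. \<bar>x\<bar> \<le> C" "\<And>k. of_real (\<integral>x. x ^ k \<partial>\<mu>) = wpow G k v v"
    using spectral_exists[OF v] by blast
  have eq: "spectral_measure G v = \<mu>"
    by (rule spectral_measure_eqI[OF v \<mu>(1,2) less_imp_le[OF C_pos] \<mu>(3)])
  show "real_distribution (spectral_measure G v)" unfolding eq by (rule \<mu>(1))
  show "AE x in spectral_measure G v. \<bar>x\<bar> \<le> sbound D" unfolding eq using \<mu>(2) by (simp only: sbound_def C_def)
  show "of_real (\<integral>x. x ^ k \<partial>spectral_measure G v) = wpow G k v v" unfolding eq by (rule \<mu>(3))
qed

section \<open>Bounded networks form a Borel set\<close>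

definition bdd_class :: "nat \<Rightarrow> gstar set" where
  "bdd_class D = {c. bdd_net D (gnet c)}"

text \<open>A violation is witnessed by finitely many vertices and open conditions (D + 1 nonzero
  weights in a row, or a weight of modulus above D), so it persists in nearby networks.\<close>

lemma closed_bdd_class: "closed (bdd_class D)"
  unfolding closed_def
proof (rule open_nearI)
  fix c assume "c \<in> - bdd_class D"
  then obtain u where u: "u \<in> verts (gnet c)"
    and "\<not> (finite (net_row (gnet c) u) \<and> card (net_row (gnet c) u) \<le> D \<and> (\<forall>v\<in>verts (gnet c). norm (wt (gnet c) u v) \<le> real D))"
    by (auto simp: bdd_class_def bdd_net_def)
  then consider (row) "infinite (net_row (gnet c) u) \<or> Suc D \<le> card (net_row (gnet c) u)"
    | (wt) v where "v \<in> verts (gnet c)" "real D < norm (wt (gnet c) u v)"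
    by (meson not_le not_less_eq_eq)
  then show "eventually (\<lambda>p. fst p \<in> - bdd_class D) (nearF c)"
  proof cases
    case row
    then obtain F where F: "F \<subseteq> net_row (gnet c) u" "finite F" "card F = Suc D"
    proof (cases "finite (net_row (gnet c) u)")
      case True
      then have "Suc D \<le> card (net_row (gnet c) u)" using row by simp
      then show thesis by (rule obtain_subset_with_card_n) (rule that)
    next
      case False
      then show thesis using infinite_arbitrarily_large[OF False, of "Suc D"] that by auto
    qed
    have Fv: "z \<in> verts (gnet c)" "wt (gnet c) u z \<noteq> 0" if "z \<in> F" for z
      using F(1) that by (auto simp: net_row_def)
    have "eventually (\<lambda>p. \<forall>x\<in>F. \<forall>y\<in>F. x \<noteq> y \<longrightarrow> snd p x \<noteq> snd p y) (nearF c)"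
      using F(2) Fv by (intro eventually_ball_finite ballI) (auto intro: nearF_inj)
    moreover have "eventually (\<lambda>p. \<forall>x\<in>F. snd p x \<in> verts (gnet (fst p))) (nearF c)"
      using F(2) Fv by (intro eventually_ball_finite ballI) (auto intro: nearF_in)
    moreover have "eventually (\<lambda>p. \<forall>x\<in>F. wt (gnet (fst p)) (snd p u) (snd p x) \<noteq> 0) (nearF c)"
      using F(2)
    proof (rule eventually_ball_finite, intro ballI)
      fix x assume "x \<in> F"
      from tendsto_imp_eventually_ne[OF nearF_wt[OF u Fv(1)[OF this]] Fv(2)[OF this]]
      show "eventually (\<lambda>p. wt (gnet (fst p)) (snd p u) (snd p x) \<noteq> 0) (nearF c)" .
    qed
    ultimately show ?thesis using nearF_in[OF u]
    proof eventually_elim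
      case (elim p)
      have "snd p ` F \<subseteq> net_row (gnet (fst p)) (snd p u)" using elim by (auto simp: net_row_def)
      moreover have "card (snd p ` F) = Suc D" using elim(1) F(3) by (subst card_image) (auto simp: inj_on_def)
      ultimately have "\<not> (finite (net_row (gnet (fst p)) (snd p u)) \<and> card (net_row (gnet (fst p)) (snd p u)) \<le> D)"
        using card_mono[of "net_row (gnet (fst p)) (snd p u)" "snd p ` F"] by auto
      then show ?case using elim(4) by (auto simp: bdd_class_def bdd_net_def)
    qed
  next
    case wt
    have "eventually (\<lambda>p. real D < norm (wt (gnet (fst p)) (snd p u) (snd p v))) (nearF c)"
      by (rule order_tendstoD(1)[OF tendsto_norm[OF nearF_wt[OF u wt(1)]] wt(2)])
    then show ?thesis using nearF_in[OF u] nearF_in[OF wt(1)]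
    proof eventually_elim
      case (elim p)
      have "\<not> norm (wt (gnet (fst p)) (snd p u) (snd p v)) \<le> real D" using elim(1) by simp
      then have "\<not> bdd_net D (gnet (fst p))" using bdd_netD(3)[OF _ elim(2) elim(3)] by auto
      then show ?case by (simp add: bdd_class_def)
    qed
  qed
qed

definition trunc_class :: "real \<Rightarrow> gstar \<Rightarrow> gstar" where
  "trunc_class \<theta> c = rooted_class (trunc_net \<theta> (gnet c)) (groot c)"

lemma trunc_class_emb:
  assumes "0 < \<theta>"
  shows "\<exists>\<sigma>. net_emb \<sigma> (gnet (trunc_class \<theta> c)) (knet \<theta> 0 (gnet c)) \<and> \<sigma> (groot (trunc_class \<theta> c)) = groot c"
  unfolding trunc_class_def trunc_net_knet
  by (rule gnet_rooted_class) (use assms in \<open>auto intro: is_network_knet\<close>)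

lemma trunc_class_bdd:
  assumes "0 < \<theta>"
  shows "trunc_class \<theta> c \<in> bdd_class (tbound \<theta>)"
proof -
  obtain \<sigma> where "net_emb \<sigma> (gnet (trunc_class \<theta> c)) (knet \<theta> 0 (gnet c))"
    using trunc_class_emb[OF assms] by blast
  then show ?thesis
    unfolding bdd_class_def using net_emb_bdd knet_bdd[of "gnet c" \<theta> 0] assms by auto
qed

section \<open>Finite templates of rooted networks\<close>

text \<open>A template prescribes, up to an error, rational approximations of the weights between finitely
  many labelled vertices, and requires that the first few of them have little further weight. On
  bounded networks the templates generate the local topology, and they are countable in number.\<close>

type_synonym template = "nat \<times> (rat \<times> rat) list list \<times> nat"

definition ratc :: "rat \<times> rat \<Rightarrow> complex" where
  "ratc p = Complex (of_rat (fst p)) (of_rat (snd p))"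

definition labelling :: "template \<Rightarrow> 'v network \<Rightarrow> 'v \<Rightarrow> 'v list \<Rightarrow> bool" where
  "labelling t G r xs \<longleftrightarrow> length xs = length (fst (snd t)) \<and> xs \<noteq> [] \<and> xs ! 0 = r \<and> distinct xs \<and> set xs \<subseteq> verts G"

text \<open>The second clause joins every label after the first to an earlier one, which keeps the
  labels in the component of the root. The number \<open>a\<close> is slack: 0 is the real
  condition, while positive slack turns strict inequalities into ones that survive limits.\<close>

definition fits :: "template \<Rightarrow> real \<Rightarrow> 'v network \<Rightarrow> 'v list \<Rightarrow> bool" where
  "fits t a G xs \<longleftrightarrow>
     (\<forall>i\<in>{..<length xs}. \<forall>j\<in>{..<length xs}. norm (wt G (xs ! i) (xs ! j) - ratc (fst (snd t) ! i ! j)) + a < 1 / real (Suc (snd (snd t)))) \<and>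
     (\<forall>i\<in>{0<..<length xs}. a < (\<Sum>j<i. norm (wt G (xs ! j) (xs ! i)))) \<and>
     (\<forall>i\<in>{..<min (fst t) (length xs)}. net_deg G (xs ! i) - (\<Sum>j<length xs. (norm (wt G (xs ! i) (xs ! j)))\<^sup>2) + a < 1 / real (Suc (snd (snd t))))"

definition matches :: "template \<Rightarrow> 'v network \<Rightarrow> 'v \<Rightarrow> bool" where
  "matches t G r \<longleftrightarrow> (\<exists>xs. labelling t G r xs \<and> fits t 0 G xs)"

lemma net_emb_net_deg: "net_emb \<sigma> G H \<Longrightarrow> u \<in> verts G \<Longrightarrow> net_deg H (\<sigma> u) = net_deg G u"
  using net_emb_ldeg[of \<sigma> G H u 0] by (simp add: ldeg_0)

lemma fits_map:
  assumes "net_emb \<sigma> G H" "set xs \<subseteq> verts G"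
  shows "fits t a H (map \<sigma> xs) \<longleftrightarrow> fits t a G xs"
proof -
  have v: "xs ! i \<in> verts G" if "i < length xs" for i using assms(2) that by auto
  have w: "wt H (map \<sigma> xs ! i) (map \<sigma> xs ! j) = wt G (xs ! i) (xs ! j)" if "i < length xs" "j < length xs" for i j
    using net_embD(3)[OF assms(1) v[OF that(1)] v[OF that(2)]] that by simp
  have d: "net_deg H (map \<sigma> xs ! i) = net_deg G (xs ! i)" if "i < length xs" for i
    using net_emb_net_deg[OF assms(1) v[OF that]] that by simp
  show ?thesis unfolding fits_def length_map
    by (intro conj_cong ball_cong refl) (simp_all add: w d del: nth_map)
qed

lemma matches_emb:
  assumes e: "net_emb \<sigma> G H" and r: "r \<in> verts G"
  shows "matches t H (\<sigma> r) \<longleftrightarrow> matches t G r"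
proof
  assume "matches t G r"
  then obtain xs where xs: "labelling t G r xs" "fits t 0 G xs" by (auto simp: matches_def)
  have "inj_on \<sigma> (set xs)" "\<sigma> ` set xs \<subseteq> verts H" "map \<sigma> xs ! 0 = \<sigma> (xs ! 0)"
    using xs(1) inj_on_subset[OF net_embD(1)[OF e], of "set xs"] net_embD(2)[OF e]
    by (auto simp: labelling_def intro!: nth_map)
  then have "labelling t H (\<sigma> r) (map \<sigma> xs)"
    using xs(1) by (simp add: labelling_def distinct_map)
  moreover have "fits t 0 H (map \<sigma> xs)"
    using xs fits_map[OF e, of xs] by (auto simp: labelling_def)
  ultimately show "matches t H (\<sigma> r)" by (auto simp: matches_def)
next
  assume "matches t H (\<sigma> r)"
  then obtain ys where ys: "labelling t H (\<sigma> r) ys" "fits t 0 H ys" by (auto simp: matches_def)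
  \<comment> \<open>By strong induction: each label has a nonzero weight to an earlier one, and no
    edge leaves the image of the embedding.\<close>
  have im: "ys ! i \<in> \<sigma> ` verts G" if "i < length ys" for i
    using that
  proof (induction i rule: less_induct)
    case (less i)
    show ?case
    proof (cases "i = 0")
      case True then show ?thesis using ys(1) r by (auto simp: labelling_def)
    next
      case False
      then have "0 < (\<Sum>j<i. norm (wt H (ys ! j) (ys ! i)))" using ys(2) less.prems by (auto simp: fits_def)
      then obtain j where j: "j < i" "wt H (ys ! j) (ys ! i) \<noteq> 0"
        by (metis (no_types, lifting) lessThan_iff less_irrefl norm_zero sum.neutral)
      obtain z where z: "z \<in> verts G" "ys ! j = \<sigma> z" using less.IH[OF j(1)] j(1) less.prems by auto
      have "ys ! i \<in> verts H" using ys(1) less.prems by (auto simp: labelling_def)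
      then show ?thesis using net_embD(4)[OF e z(1)] j(2) z(2) by auto
    qed
  qed
  define xs where "xs = map (inv_into (verts G) \<sigma>) ys"
  have sub: "set ys \<subseteq> \<sigma> ` verts G" using im by (auto simp: in_set_conv_nth)
  then have m: "map \<sigma> xs = ys" unfolding xs_def map_map by (intro map_idI) (auto intro: f_inv_into_f)
  have xv: "set xs \<subseteq> verts G" unfolding xs_def using sub by (auto intro: inv_into_into)
  have "xs \<noteq> []" using ys(1) m by (auto simp: labelling_def)
  moreover have "xs ! 0 = r"
  proof -
    have "map \<sigma> xs ! 0 = \<sigma> (xs ! 0)" using \<open>xs \<noteq> []\<close> by (intro nth_map) auto
    then have "\<sigma> (xs ! 0) = \<sigma> r" using ys(1) m by (simp add: labelling_def)
    moreover have "xs ! 0 \<in> verts G" using xv \<open>xs \<noteq> []\<close> by auto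
    ultimately show ?thesis using net_embD(1)[OF e] r by (auto dest: inj_onD)
  qed
  moreover have "distinct xs" using ys(1) m by (auto simp: labelling_def distinct_map)
  moreover have "length xs = length ys" using m by auto
  ultimately have "labelling t G r xs" using ys(1) xv by (simp add: labelling_def)
  moreover have "fits t 0 G xs" using fits_map[OF e xv] m ys(2) by simp
  ultimately show "matches t G r" by (auto simp: matches_def)
qed

lemma local_cont_deg_knet:
  assumes "0 < \<theta>" "0 < \<epsilon>"
  shows "local_cont (\<lambda>G u v. net_deg (knet \<theta> \<epsilon> G) u)"
proof -
  have "local_cont (\<lambda>G u v. \<Sum>\<^sub>\<infinity>z\<in>verts G. (norm (kern \<theta> \<epsilon> G u z))\<^sup>2 * 1)"
  proof (rule local_cont_sum[OF _ _ assms(1)])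
    show "local_cont (\<lambda>G u z. (norm (kern \<theta> \<epsilon> G u z))\<^sup>2)"
      by (rule local_contI, intro tendsto_intros local_contD[OF local_cont_kern[OF assms]])
    show "local_cont (\<lambda>(G::nat network) z v. 1 :: real)" by (rule local_contI) simp
  qed (use kern_eq_0[OF assms(1)] in auto)
  then show ?thesis by (simp add: net_deg_def)
qed

lemma tendsto_deg_knet:
  assumes G: "is_network G" and u: "u \<in> verts G" and \<theta>: "0 < \<theta>"
  shows "((\<lambda>\<epsilon>. net_deg (knet \<theta> \<epsilon> G) u) \<longlongrightarrow> net_deg (knet \<theta> 0 G) u) (at_right 0)"
proof -
  let ?R = "{v \<in> verts G. \<theta> \<le> norm (wt G u v)}"
  have eq: "net_deg (knet \<theta> \<epsilon> G) u = (\<Sum>z\<in>?R. (norm (kern \<theta> \<epsilon> G u z))\<^sup>2)" for \<epsilon>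
    unfolding net_deg_def knet_simps
    using finite_nbrs[OF G u \<theta>] by (intro infsum_eq_sum) (auto intro!: kern_eq_0[OF \<theta>])
  show ?thesis unfolding eq
    by (intro tendsto_sum tendsto_power tendsto_norm tendsto_kern G u \<theta>) auto
qed

text \<open>A sequence tending to 0 that satisfies the side condition 2 * \<epsilon> \<le> \<theta>
  of \<open>knet_bdd\<close> from the start.\<close>

definition eps :: "real \<Rightarrow> nat \<Rightarrow> real" where "eps \<theta> k = \<theta> / (2 * real (Suc k))"

lemma eps_pos: "0 < \<theta> \<Longrightarrow> 0 < eps \<theta> k" and eps_le: "0 < \<theta> \<Longrightarrow> 2 * eps \<theta> k \<le> \<theta>"
  by (auto simp: eps_def field_simps)

lemma eps_lim:
  assumes "0 < \<theta>"
  shows "filterlim (eps \<theta>) (at_right 0) sequentially"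
proof -
  have "(\<lambda>k. \<theta> / 2 * inverse (real (Suc k))) \<longlonglongrightarrow> \<theta> / 2 * 0"
    by (intro tendsto_mult tendsto_const LIMSEQ_inverse_real_of_nat)
  then have "eps \<theta> \<longlonglongrightarrow> 0" unfolding eps_def[abs_def] by (simp add: field_simps)
  then show ?thesis by (simp add: filterlim_at eps_pos[OF assms] less_imp_neq[OF eps_pos[OF assms], symmetric])
qed

text \<open>For fixed positive \<epsilon> these are finitely many strict inequalities between
  locally continuous quantities, and the labels can be transported by the matching.\<close>

lemma open_fitting:
  assumes "0 < \<theta>"
  shows "open {c. \<exists>xs. labelling t (gnet c) (groot c) xs \<and> (\<forall>k\<in>{N..M::nat}. fits t a (knet \<theta> (eps \<theta> k) (gnet c)) xs)}" (is "open ?A")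
proof (rule open_nearI)
  fix c assume "c \<in> ?A"
  then obtain xs where l: "labelling t (gnet c) (groot c) xs" and
    f: "\<And>k. k \<in> {N..M} \<Longrightarrow> fits t a (knet \<theta> (eps \<theta> k) (gnet c)) xs" by blast
  have v: "xs ! i \<in> verts (gnet c)" if "i < length xs" for i using l that by (auto simp: labelling_def)
  have vs: "x \<in> verts (gnet c)" if "x \<in> set xs" for x using l that by (auto simp: labelling_def)
  have lc: "((\<lambda>p. kern \<theta> (eps \<theta> k) (gnet (fst p)) (snd p (xs ! i)) (snd p (xs ! j))) \<longlongrightarrow>
      kern \<theta> (eps \<theta> k) (gnet c) (xs ! i) (xs ! j)) (nearF c)" if "i < length xs" "j < length xs" for i j k
    by (rule local_contD[OF local_cont_kern[OF assms eps_pos[OF assms]] v[OF that(1)] v[OF that(2)]])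
  have ld: "((\<lambda>p. net_deg (knet \<theta> (eps \<theta> k) (gnet (fst p))) (snd p (xs ! i))) \<longlongrightarrow>
      net_deg (knet \<theta> (eps \<theta> k) (gnet c)) (xs ! i)) (nearF c)" if "i < length xs" for i k
    by (rule local_contD[OF local_cont_deg_knet[OF assms eps_pos[OF assms]] v[OF that] groot_in])
  have ev1: "eventually (\<lambda>p. \<forall>x\<in>set xs. \<forall>y\<in>set xs. x \<noteq> y \<longrightarrow> snd p x \<noteq> snd p y) (nearF c)"
    using vs by (intro eventually_ball_finite ballI) (auto intro: nearF_inj)
  have ev2: "eventually (\<lambda>p. \<forall>x\<in>set xs. snd p x \<in> verts (gnet (fst p))) (nearF c)"
    using vs by (intro eventually_ball_finite ballI) (auto intro: nearF_in)
  have ev3: "eventually (\<lambda>p. \<forall>k\<in>{N..M}. fits t a (knet \<theta> (eps \<theta> k) (gnet (fst p))) (map (snd p) xs)) (nearF c)"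
  proof (intro eventually_ball_finite ballI)
    fix k assume "k \<in> {N..M}"
    note fk = f[OF this, unfolded fits_def knet_simps]
    let ?q = "\<lambda>i j. ratc (fst (snd t) ! i ! j)" and ?s = "1 / real (Suc (snd (snd t)))"
    let ?e = "eps \<theta> k"
    have a: "eventually (\<lambda>p. \<forall>i\<in>{..<length xs}. \<forall>j\<in>{..<length xs}.
        norm (kern \<theta> ?e (gnet (fst p)) (snd p (xs ! i)) (snd p (xs ! j)) - ?q i j) + a < ?s) (nearF c)"
      by (intro eventually_ball_finite ballI order_tendstoD(2)[OF tendsto_add[OF tendsto_norm[OF tendsto_diff[OF lc tendsto_const]] tendsto_const]])
        (use fk in auto)
    have b: "eventually (\<lambda>p. \<forall>i\<in>{0<..<length xs}.
        a < (\<Sum>j<i. norm (kern \<theta> ?e (gnet (fst p)) (snd p (xs ! j)) (snd p (xs ! i))))) (nearF c)"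
      by (intro eventually_ball_finite ballI order_tendstoD(1)[OF tendsto_sum[OF tendsto_norm[OF lc]]])
        (use fk in auto)
    have d: "eventually (\<lambda>p. \<forall>i\<in>{..<min (fst t) (length xs)}. net_deg (knet \<theta> ?e (gnet (fst p))) (snd p (xs ! i))
        - (\<Sum>j<length xs. (norm (kern \<theta> ?e (gnet (fst p)) (snd p (xs ! i)) (snd p (xs ! j))))\<^sup>2) + a < ?s) (nearF c)"
      by (intro eventually_ball_finite ballI
          order_tendstoD(2)[OF tendsto_add[OF tendsto_diff[OF ld tendsto_sum[OF tendsto_power[OF tendsto_norm[OF lc]]]] tendsto_const]])
        (use fk in auto)
    show "eventually (\<lambda>p. fits t a (knet \<theta> ?e (gnet (fst p))) (map (snd p) xs)) (nearF c)"
      using a b d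
    proof eventually_elim
      case (elim p)
      show ?case unfolding fits_def knet_simps length_map
      proof (intro conjI ballI)
        fix i j assume "i \<in> {..<length xs}" "j \<in> {..<length xs}"
        then show "norm (kern \<theta> ?e (gnet (fst p)) (map (snd p) xs ! i) (map (snd p) xs ! j) - ?q i j) + a < ?s"
          using elim(1) by simp
      next
        fix i assume i: "i \<in> {0<..<length xs}"
        have "(\<Sum>j<i. norm (kern \<theta> ?e (gnet (fst p)) (map (snd p) xs ! j) (map (snd p) xs ! i)))
          = (\<Sum>j<i. norm (kern \<theta> ?e (gnet (fst p)) (snd p (xs ! j)) (snd p (xs ! i))))"
          using i by (intro sum.cong) auto
        then show "a < (\<Sum>j<i. norm (kern \<theta> ?e (gnet (fst p)) (map (snd p) xs ! j) (map (snd p) xs ! i)))"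
          using elim(2) i by simp
      next
        fix i assume i: "i \<in> {..<min (fst t) (length xs)}"
        have "(\<Sum>j<length xs. (norm (kern \<theta> ?e (gnet (fst p)) (map (snd p) xs ! i) (map (snd p) xs ! j)))\<^sup>2)
          = (\<Sum>j<length xs. (norm (kern \<theta> ?e (gnet (fst p)) (snd p (xs ! i)) (snd p (xs ! j))))\<^sup>2)"
          using i by (intro sum.cong) auto
        then show "net_deg (knet \<theta> ?e (gnet (fst p))) (map (snd p) xs ! i)
            - (\<Sum>j<length xs. (norm (kern \<theta> ?e (gnet (fst p)) (map (snd p) xs ! i) (map (snd p) xs ! j)))\<^sup>2) + a < ?s"
          using elim(3) i by simp
      qed
    qed
  qed simp
  show "eventually (\<lambda>p. fst p \<in> ?A) (nearF c)"
    using ev1 ev2 ev3 nearF_root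
  proof eventually_elim
    case (elim p)
    have "map (snd p) xs ! 0 = snd p (xs ! 0)" using l by (intro nth_map) (auto simp: labelling_def)
    then have "labelling t (gnet (fst p)) (groot (fst p)) (map (snd p) xs)"
      using l elim(1,2,4) by (auto simp: labelling_def distinct_map inj_on_def)
    then show ?case using elim(3) by blast
  qed
qed

text \<open>A strict inequality holds in the limit exactly when it eventually holds with some fixed
  slack. One index N serves for the slack and for the threshold, which keeps the quantifiers
  countable.\<close>

lemma fits_limit:
  assumes G: "is_network G" and xs: "set xs \<subseteq> verts G" and \<theta>: "0 < \<theta>"
  shows "fits t 0 (knet \<theta> 0 G) xs \<longleftrightarrow> (\<exists>N. \<forall>k\<ge>N. fits t (1 / real (Suc N)) (knet \<theta> (eps \<theta> k) G) xs)"
proof -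
  have v: "xs ! i \<in> verts G" if "i < length xs" for i using xs that by auto
  let ?q = "\<lambda>i j. ratc (fst (snd t) ! i ! j)" and ?s = "1 / real (Suc (snd (snd t)))"
  let ?P = "sequentially \<times>\<^sub>F sequentially"
  let ?k = "\<lambda>\<epsilon> i j. kern \<theta> \<epsilon> G (xs ! i) (xs ! j)"
  have lk: "(\<lambda>k. ?k (eps \<theta> k) i j) \<longlonglongrightarrow> ?k 0 i j" if "i < length xs" "j < length xs" for i j
    by (rule filterlim_compose[OF tendsto_kern[OF G v[OF that(1)] v[OF that(2)] \<theta>] eps_lim[OF \<theta>]])
  have ld: "(\<lambda>k. net_deg (knet \<theta> (eps \<theta> k) G) (xs ! i)) \<longlonglongrightarrow> net_deg (knet \<theta> 0 G) (xs ! i)" if "i < length xs" for i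
    by (rule filterlim_compose[OF tendsto_deg_knet[OF G v[OF that] \<theta>] eps_lim[OF \<theta>]])
  have la: "(\<lambda>N. 1 / real (Suc N)) \<longlonglongrightarrow> 0" using LIMSEQ_inverse_real_of_nat by (simp add: inverse_eq_divide)
  note lk' = filterlim_compose[OF lk filterlim_snd]
  note ld' = filterlim_compose[OF ld filterlim_snd]
  note la' = filterlim_compose[OF la filterlim_fst]
  show ?thesis
  proof
    assume "fits t 0 (knet \<theta> 0 G) xs"
    note f = this[unfolded fits_def knet_simps]
    have a: "eventually (\<lambda>p. \<forall>i\<in>{..<length xs}. \<forall>j\<in>{..<length xs}. norm (?k (eps \<theta> (snd p)) i j - ?q i j) + 1 / real (Suc (fst p)) < ?s) ?P"
      by (intro eventually_ball_finite ballI order_tendstoD(2)[OF tendsto_add[OF tendsto_norm[OF tendsto_diff[OF lk' tendsto_const]] la']])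
        (use f in auto)
    have b: "eventually (\<lambda>p. \<forall>i\<in>{0<..<length xs}. 0 < (\<Sum>j<i. norm (?k (eps \<theta> (snd p)) j i)) - 1 / real (Suc (fst p))) ?P"
      by (intro eventually_ball_finite ballI order_tendstoD(1)[OF tendsto_diff[OF tendsto_sum[OF tendsto_norm[OF lk']] la']])
        (use f in auto)
    have d: "eventually (\<lambda>p. \<forall>i\<in>{..<min (fst t) (length xs)}. net_deg (knet \<theta> (eps \<theta> (snd p)) G) (xs ! i)
        - (\<Sum>j<length xs. (norm (?k (eps \<theta> (snd p)) i j))\<^sup>2) + 1 / real (Suc (fst p)) < ?s) ?P"
      by (intro eventually_ball_finite ballI
          order_tendstoD(2)[OF tendsto_add[OF tendsto_diff[OF ld' tendsto_sum[OF tendsto_power[OF tendsto_norm[OF lk']]]] la']])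
        (use f in auto)
    have "eventually (\<lambda>p. fits t (1 / real (Suc (fst p))) (knet \<theta> (eps \<theta> (snd p)) G) xs) ?P"
      using a b d by eventually_elim (simp add: fits_def)
    then obtain N where "\<forall>m\<ge>N. \<forall>n\<ge>N. fits t (1 / real (Suc m)) (knet \<theta> (eps \<theta> n) G) xs"
      unfolding eventually_prod_sequentially by auto
    then show "\<exists>N. \<forall>k\<ge>N. fits t (1 / real (Suc N)) (knet \<theta> (eps \<theta> k) G) xs" by blast
  next
    assume "\<exists>N. \<forall>k\<ge>N. fits t (1 / real (Suc N)) (knet \<theta> (eps \<theta> k) G) xs"
    then obtain N where N: "\<And>k. N \<le> k \<Longrightarrow> fits t (1 / real (Suc N)) (knet \<theta> (eps \<theta> k) G) xs" by blast
    note f = N[unfolded fits_def knet_simps]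
    let ?a = "1 / real (Suc N)"
    have a: "0 < ?a" by simp
    show "fits t 0 (knet \<theta> 0 G) xs"
      unfolding fits_def knet_simps
    proof (intro conjI ballI)
      fix i j assume ij: "i \<in> {..<length xs}" "j \<in> {..<length xs}"
      have "norm (?k 0 i j - ?q i j) + ?a \<le> ?s"
      proof (rule LIMSEQ_le_const2[OF tendsto_add[OF tendsto_norm[OF tendsto_diff[OF lk tendsto_const]] tendsto_const]])
        show "\<exists>N. \<forall>k\<ge>N. norm (?k (eps \<theta> k) i j - ?q i j) + ?a \<le> ?s"
          using f(1) ij by (intro exI[of _ N] allI impI less_imp_le) blast
      qed (use ij in auto)
      then show "norm (?k 0 i j - ?q i j) + 0 < ?s" using a by linarith
    next
      fix i assume i: "i \<in> {0<..<length xs}"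
      have "?a \<le> (\<Sum>j<i. norm (?k 0 j i))"
      proof (rule LIMSEQ_le_const[OF tendsto_sum[OF tendsto_norm[OF lk]]])
        show "\<exists>N. \<forall>k\<ge>N. ?a \<le> (\<Sum>j<i. norm (?k (eps \<theta> k) j i))"
          using f(1) i by (intro exI[of _ N] allI impI less_imp_le) blast
      qed (use i in auto)
      then show "0 < (\<Sum>j<i. norm (?k 0 j i))" using a by linarith
    next
      fix i assume i: "i \<in> {..<min (fst t) (length xs)}"
      have "net_deg (knet \<theta> 0 G) (xs ! i) - (\<Sum>j<length xs. (norm (?k 0 i j))\<^sup>2) + ?a \<le> ?s"
      proof (rule LIMSEQ_le_const2[OF tendsto_add[OF tendsto_diff[OF ld tendsto_sum[OF tendsto_power[OF tendsto_norm[OF lk]]]] tendsto_const]])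
        show "\<exists>N. \<forall>k\<ge>N. net_deg (knet \<theta> (eps \<theta> k) G) (xs ! i) - (\<Sum>j<length xs. (norm (?k (eps \<theta> k) i j))\<^sup>2) + ?a \<le> ?s"
          using f(1) i by (intro exI[of _ N] allI impI less_imp_le) blast
      qed (use i in auto)
      then show "net_deg (knet \<theta> 0 G) (xs ! i) - (\<Sum>j<length xs. (norm (?k 0 i j))\<^sup>2) + 0 < ?s" using a by linarith
    qed
  qed
qed

primrec heavy_reach :: "real \<Rightarrow> 'v network \<Rightarrow> 'v \<Rightarrow> nat \<Rightarrow> 'v set" where
  "heavy_reach \<theta> G r 0 = {r}"
| "heavy_reach \<theta> G r (Suc k) = heavy_reach \<theta> G r k \<union> (\<Union>u\<in>heavy_reach \<theta> G r k. {v \<in> verts G. \<theta> \<le> norm (wt G u v)})"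

lemma heavy_reach_mono: "k \<le> l \<Longrightarrow> heavy_reach \<theta> G r k \<subseteq> heavy_reach \<theta> G r l"
  by (induction rule: dec_induct) auto

lemma finite_heavy_reach:
  assumes "is_network G" "r \<in> verts G" "0 < \<theta>"
  shows "finite (heavy_reach \<theta> G r k) \<and> heavy_reach \<theta> G r k \<subseteq> verts G"
  using assms by (induction k) (auto intro!: finite_nbrs)

text \<open>The i-th label is reached from the root by at most i edges of weight at least \<theta>.
  Finiteness later permits exchanging the choice of labels with a quantifier over k.\<close>

lemma finite_fitting:
  assumes "0 < \<theta>" "0 \<le> a" "is_network G" "r \<in> verts G"
  shows "finite {xs. labelling t G r xs \<and> fits t a (knet \<theta> \<epsilon> G) xs}"
proof (rule finite_subset)
  let ?n = "length (fst (snd t))"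
  show "finite {xs. set xs \<subseteq> heavy_reach \<theta> G r ?n \<and> length xs = ?n}"
    using finite_heavy_reach[OF assms(3,4,1)] by (intro finite_lists_length_eq) auto
  show "{xs. labelling t G r xs \<and> fits t a (knet \<theta> \<epsilon> G) xs} \<subseteq> {xs. set xs \<subseteq> heavy_reach \<theta> G r ?n \<and> length xs = ?n}"
  proof safe
    fix xs assume xs: "labelling t G r xs" "fits t a (knet \<theta> \<epsilon> G) xs"
    show len: "length xs = ?n" using xs(1) by (simp add: labelling_def)
    have in_reach: "xs ! i \<in> heavy_reach \<theta> G r i" if "i < length xs" for i
      using that
    proof (induction i rule: less_induct)
      case (less i)
      show ?case
      proof (cases "i = 0")
        case True then show ?thesis using xs(1) by (auto simp: labelling_def)
      next
        case False
        then have "a < (\<Sum>j<i. norm (kern \<theta> \<epsilon> G (xs ! j) (xs ! i)))" using xs(2) less.prems by (auto simp: fits_def)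
        then obtain j where j: "j < i" "kern \<theta> \<epsilon> G (xs ! j) (xs ! i) \<noteq> 0"
          using assms(2) by (metis (no_types, lifting) lessThan_iff not_le norm_zero sum.neutral)
        have "\<theta> \<le> norm (wt G (xs ! j) (xs ! i))" by (rule kern_nonzero(1)[OF assms(1) j(2)])
        moreover have "xs ! j \<in> heavy_reach \<theta> G r j" using less j(1) by auto
        then have "xs ! j \<in> heavy_reach \<theta> G r (i - 1)" by (rule subsetD[OF heavy_reach_mono, rotated]) (use j(1) in simp)
        moreover have "xs ! i \<in> verts G" using xs(1) less.prems by (auto simp: labelling_def)
        ultimately have "xs ! i \<in> heavy_reach \<theta> G r (Suc (i - 1))" by auto
        then show ?thesis using False by simp
      qed
    qed
    fix x assume "x \<in> set xs"
    then obtain i where "i < length xs" "x = xs ! i" by (auto simp: in_set_conv_nth)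
    then show "x \<in> heavy_reach \<theta> G r ?n" using subsetD[OF heavy_reach_mono in_reach, of i ?n] len by simp
  qed
qed

text \<open>At \<epsilon> = 0 matching is not an open condition, but it is a countable union of
  countable intersections of open ones.\<close>

lemma matches_trunc_borel:
  assumes \<theta>: "0 < \<theta>"
  shows "{c. matches t (knet \<theta> 0 (gnet c)) (groot c)} \<in> sets borel"
proof -
  let ?A = "\<lambda>N M. {c. \<exists>xs. labelling t (gnet c) (groot c) xs \<and> (\<forall>k\<in>{N..M::nat}. fits t (1 / real (Suc N)) (knet \<theta> (eps \<theta> k) (gnet c)) xs)}"
  have "{c. matches t (knet \<theta> 0 (gnet c)) (groot c)} = (\<Union>N. \<Inter>M\<in>{N..}. ?A N M)" (is "?L = ?R")
  proof (intro set_eqI)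
    fix c
    let ?G = "gnet c"
    have "c \<in> ?L \<longleftrightarrow> (\<exists>xs. labelling t ?G (groot c) xs \<and> fits t 0 (knet \<theta> 0 ?G) xs)"
      by (simp add: matches_def labelling_def)
    also have "\<dots> \<longleftrightarrow> (\<exists>N xs. labelling t ?G (groot c) xs \<and> (\<forall>k\<ge>N. fits t (1 / real (Suc N)) (knet \<theta> (eps \<theta> k) ?G) xs))"
      using fits_limit[OF is_network_gnet _ \<theta>] by (metis labelling_def)
    also have "\<dots> \<longleftrightarrow> (\<exists>N. \<forall>M\<ge>N. c \<in> ?A N M)"
    proof (intro iff_exI iffI)
      fix N assume h: "\<forall>M\<ge>N. c \<in> ?A N M"
      let ?X = "{xs. labelling t ?G (groot c) xs \<and> fits t (1 / real (Suc N)) (knet \<theta> (eps \<theta> N) ?G) xs}"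
      have fin: "finite ?X" using \<theta> by (intro finite_fitting) auto
      show "\<exists>xs. labelling t ?G (groot c) xs \<and> (\<forall>k\<ge>N. fits t (1 / real (Suc N)) (knet \<theta> (eps \<theta> k) ?G) xs)"
      \<comment> \<open>A compactness argument: if each of the finitely many candidates failed at
        some k, none would survive up to the largest of these k.\<close>
      proof (rule ccontr)
        assume "\<not> ?thesis"
        then have "\<forall>xs\<in>?X. \<exists>k\<ge>N. \<not> fits t (1 / real (Suc N)) (knet \<theta> (eps \<theta> k) ?G) xs" by blast
        then obtain K where K: "\<And>xs. xs \<in> ?X \<Longrightarrow> N \<le> K xs \<and> \<not> fits t (1 / real (Suc N)) (knet \<theta> (eps \<theta> (K xs)) ?G) xs"
          by metis
        define M where "M = Max (insert N (K ` ?X))"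
        have M: "N \<le> M" "\<And>xs. xs \<in> ?X \<Longrightarrow> K xs \<le> M" unfolding M_def using fin by auto
        obtain xs where xs: "labelling t ?G (groot c) xs" "\<And>k. k \<in> {N..M} \<Longrightarrow> fits t (1 / real (Suc N)) (knet \<theta> (eps \<theta> k) ?G) xs"
          using h M(1) by blast
        have "xs \<in> ?X" using xs(1) xs(2)[of N] M(1) by simp
        then show False using K[of xs] M(2)[of xs] xs(2)[of "K xs"] by simp
      qed
    qed (use atLeastAtMost_iff in blast)
    finally show "c \<in> ?L \<longleftrightarrow> c \<in> ?R" by (simp only: UN_iff INT_iff Ball_def Bex_def atLeast_iff UNIV_I simp_thms)
  qed
  also have "\<dots> \<in> sets borel"
    by (intro sets.countable_UN' sets.countable_INT' image_subsetI borel_open open_fitting \<theta>) auto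
  finally show ?thesis .
qed

section \<open>Reachable vertices and short paths in bounded networks\<close>

primrec reach :: "'v network \<Rightarrow> 'v \<Rightarrow> nat \<Rightarrow> 'v set" where
  "reach G r 0 = {r}"
| "reach G r (Suc k) = reach G r k \<union> (\<Union>u\<in>reach G r k. net_row G u)"

lemma reach_mono: "k \<le> l \<Longrightarrow> reach G r k \<subseteq> reach G r l"
  by (induction rule: dec_induct) auto

lemma finite_reach:
  assumes "bdd_net D G" "r \<in> verts G"
  shows "finite (reach G r k) \<and> reach G r k \<subseteq> verts G"
proof (induction k)
  case (Suc k)
  then show ?case using bdd_netD(1)[OF assms(1)] by (auto simp: net_row_def)
qed (use assms in auto)

text \<open>An enumeration in which every vertex has an earlier neighbour, as the second clause of
  \<open>fits\<close> demands.\<close>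

definition ordered_list :: "'v network \<Rightarrow> 'v \<Rightarrow> 'v list \<Rightarrow> bool" where
  "ordered_list G r xs \<longleftrightarrow> xs \<noteq> [] \<and> xs ! 0 = r \<and> distinct xs \<and>
     (\<forall>i. 0 < i \<longrightarrow> i < length xs \<longrightarrow> (\<exists>j<i. wt G (xs ! j) (xs ! i) \<noteq> 0))"

lemma ordered_list_extend:
  assumes "bdd_net D G" "r \<in> verts G" "ordered_list G r xs" "set xs = reach G r k"
  shows "\<exists>ys. ordered_list G r (xs @ ys) \<and> set (xs @ ys) = reach G r (Suc k)"
proof -
  have "finite (reach G r (Suc k) - reach G r k)" using finite_reach[OF assms(1,2), of "Suc k"] by auto
  then obtain ys where ys: "set ys = reach G r (Suc k) - reach G r k" "distinct ys"
    using finite_distinct_list by blast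
  have "\<exists>j<i. wt G ((xs @ ys) ! j) ((xs @ ys) ! i) \<noteq> 0" if i: "0 < i" "i < length (xs @ ys)" for i
  proof (cases "i < length xs")
    case True
    then obtain j where "j < i" "wt G (xs ! j) (xs ! i) \<noteq> 0" using assms(3) i(1) by (auto simp: ordered_list_def)
    moreover from this have "j < length xs" using True by simp
    ultimately show ?thesis using True by (intro exI[of _ j]) (simp add: nth_append)
  next
    case False
    then have "(xs @ ys) ! i \<in> set ys" using i(2) by (simp add: nth_append)
    then obtain u where u: "u \<in> reach G r k" "wt G u ((xs @ ys) ! i) \<noteq> 0"
      unfolding ys(1) by (auto simp: net_row_def)
    then obtain j where "j < length xs" "xs ! j = u" using assms(4) by (metis in_set_conv_nth)
    then show ?thesis using u(2) False by (intro exI[of _ j]) (auto simp: nth_append)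
  qed
  moreover have "(xs @ ys) ! 0 = r" using assms(3) by (simp add: ordered_list_def nth_append)
  ultimately have "ordered_list G r (xs @ ys)"
    using assms(3,4) ys by (auto simp: ordered_list_def)
  moreover have "set (xs @ ys) = reach G r (Suc k)" using assms(4) ys(1) reach_mono[of k "Suc k" G r] by auto
  ultimately show ?thesis by blast
qed

lemma ordered_list_exists:
  assumes "bdd_net D G" "r \<in> verts G"
  shows "\<exists>xs. ordered_list G r xs \<and> set xs = reach G r k"
proof (induction k)
  case 0
  then show ?case by (intro exI[of _ "[r]"]) (simp add: ordered_list_def)
next
  case (Suc k)
  then obtain xs where xs: "ordered_list G r xs" "set xs = reach G r k" by blast
  show ?case using ordered_list_extend[OF assms xs] by blast
qed

text \<open>Weights are at most D, so every edge adds at least 1 / D^2 to the squared length. Short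
  paths thus have few edges.\<close>

lemma path_len_edges:
  assumes "bdd_net D G" "net_path G p"
  shows "real (length p - 1) \<le> (path_len G p)\<^sup>2 * (real D)\<^sup>2"
proof -
  have e: "1 \<le> inverse ((norm (wt G (p ! i) (p ! Suc i)))\<^sup>2) * (real D)\<^sup>2" if i: "i < length p - 1" for i
  proof -
    have v: "p ! i \<in> verts G" "p ! Suc i \<in> verts G" "wt G (p ! i) (p ! Suc i) \<noteq> 0"
      using assms(2) i by (auto simp: net_path_def subset_iff)
    have "(norm (wt G (p ! i) (p ! Suc i)))\<^sup>2 \<le> (real D)\<^sup>2"
      using bdd_netD(3)[OF assms(1) v(1,2)] by (intro power_mono) auto
    then show ?thesis using v(3) by (simp add: field_simps)
  qed
  have "real (length p - 1) = (\<Sum>i<length p - 1. 1)" by simp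
  also have "\<dots> \<le> (\<Sum>i<length p - 1. inverse ((norm (wt G (p ! i) (p ! Suc i)))\<^sup>2) * (real D)\<^sup>2)"
    using e by (intro sum_mono) auto
  also have "\<dots> = (path_len G p)\<^sup>2 * (real D)\<^sup>2" by (simp add: path_len_sq sum_distrib_right)
  finally show ?thesis .
qed

lemma path_edge_ge:
  assumes "net_path G p" "path_len G p \<le> L" "Suc i < length p" "0 < L"
  shows "1 / L \<le> norm (wt G (p ! i) (p ! Suc i))"
proof -
  let ?w = "norm (wt G (p ! i) (p ! Suc i))"
  have w: "0 < ?w" using assms(1,3) by (simp add: net_path_def)
  have "inverse (?w\<^sup>2) \<le> (path_len G p)\<^sup>2"
    unfolding path_len_sq
    by (rule member_le_sum[where f = "\<lambda>i. inverse ((norm (wt G (p ! i) (p ! Suc i)))\<^sup>2)"]) (use assms(3) in auto)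
  also have "\<dots> \<le> L\<^sup>2" using assms(2) by (intro power_mono) auto
  finally have "(1 / L)\<^sup>2 \<le> ?w\<^sup>2" using w assms(4) by (simp add: field_simps)
  then show ?thesis by (rule power2_le_imp_le) simp
qed

text \<open>Edges on a path of length at most L weigh at least 1 / L, so an error \<kappa> shrinks
  each of them by a factor of at least 1 - \<kappa> L, and the length grows at most by the
  reciprocal.\<close>

lemma path_transfer:
  assumes p: "net_path G (map x \<pi>)" "path_len G (map x \<pi>) \<le> L" "0 < L"
    and y: "y ` set \<pi> \<subseteq> verts H"
    and close: "\<And>i j. i \<in> set \<pi> \<Longrightarrow> j \<in> set \<pi> \<Longrightarrow> norm (wt G (x i) (x j) - wt H (y i) (y j)) \<le> \<kappa>"
    and \<kappa>: "0 \<le> \<kappa>" "\<kappa> * L < 1"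
  shows "net_path H (map y \<pi>)" "path_len H (map y \<pi>) \<le> path_len G (map x \<pi>) / (1 - \<kappa> * L)"
proof -
  let ?w = "\<lambda>i. norm (wt G (x (\<pi> ! i)) (x (\<pi> ! Suc i)))" and ?v = "\<lambda>i. norm (wt H (y (\<pi> ! i)) (y (\<pi> ! Suc i)))"
  have e: "0 < ?w i \<and> ?w i * (1 - \<kappa> * L) \<le> ?v i" if i: "Suc i < length \<pi>" for i
  proof -
    have "1 / L \<le> norm (wt G (map x \<pi> ! i) (map x \<pi> ! Suc i))"
      by (rule path_edge_ge[OF p(1,2)]) (use i p(3) in auto)
    then have w: "1 / L \<le> ?w i" using i by simp
    have pos: "0 < 1 / L" using p(3) by simp
    have "norm (wt G (x (\<pi> ! i)) (x (\<pi> ! Suc i)) - wt H (y (\<pi> ! i)) (y (\<pi> ! Suc i))) \<le> \<kappa>"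
      using i by (intro close) auto
    then have "?w i - \<kappa> \<le> ?v i" using norm_triangle_ineq2[of "wt G (x (\<pi> ! i)) (x (\<pi> ! Suc i))" "wt H (y (\<pi> ! i)) (y (\<pi> ! Suc i))"] by linarith
    moreover have "\<kappa> * 1 \<le> \<kappa> * (L * ?w i)"
      using w p(3) \<kappa>(1) by (intro mult_left_mono) (auto simp: field_simps)
    ultimately show ?thesis using w pos by (auto simp: algebra_simps)
  qed
  have c: "0 < 1 - \<kappa> * L" using \<kappa>(2) by simp
  have vpos: "0 < ?v i" if "Suc i < length \<pi>" for i
  proof -
    have "0 < ?w i * (1 - \<kappa> * L)" using e[OF that] c by simp
    then show ?thesis using e[OF that] by linarith
  qed
  show "net_path H (map y \<pi>)"
    using p(1) y vpos by (auto simp: net_path_def)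
  have "(path_len H (map y \<pi>))\<^sup>2 = (\<Sum>i<length \<pi> - 1. inverse ((?v i)\<^sup>2))"
    unfolding path_len_sq by (intro sum.cong) auto
  also have "\<dots> \<le> (\<Sum>i<length \<pi> - 1. inverse ((?w i)\<^sup>2) / (1 - \<kappa> * L)\<^sup>2)"
  proof (intro sum_mono)
    fix i assume "i \<in> {..<length \<pi> - 1}"
    then have i: "Suc i < length \<pi>" by auto
    have "0 < ?w i * (1 - \<kappa> * L)" using e[OF i] c by simp
    then have "inverse ((?v i)\<^sup>2) \<le> inverse ((?w i * (1 - \<kappa> * L))\<^sup>2)"
      using e[OF i] by (intro le_imp_inverse_le power_mono) auto
    then show "inverse ((?v i)\<^sup>2) \<le> inverse ((?w i)\<^sup>2) / (1 - \<kappa> * L)\<^sup>2"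
      by (simp add: power_mult_distrib divide_inverse)
  qed
  also have "\<dots> = (path_len G (map x \<pi>) / (1 - \<kappa> * L))\<^sup>2"
    unfolding power_divide path_len_sq sum_divide_distrib by (intro sum.cong) auto
  finally show "path_len H (map y \<pi>) \<le> path_len G (map x \<pi>) / (1 - \<kappa> * L)"
    by (rule power2_le_imp_le) (use c in simp)
qed

text \<open>A short path from the root cannot leave the labels: a leaving edge has weight at least 1
  / L and would contribute 1 / L^2 \<ge> \<kappa> to the degree outside the labels. Labels
  \<open>zs\<close> extend one step beyond \<open>xs\<close>, so the outer condition is available at
  every vertex before the last.\<close>

lemma confined_path:
  assumes H: "is_network H"
    and zs: "distinct zs" "length zs = length ys" "length xs \<le> length zs" "take (length xs) zs = xs" "zs \<noteq> []"
    and reach: "set xs = reach G r K" "set zs = reach G r (Suc K)" "zs ! 0 = r"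
    and r: "ys ! 0 = r'" and ys: "set ys \<subseteq> verts H" "distinct ys" and zv: "set zs \<subseteq> verts G"
    and close: "\<And>i j. i < length zs \<Longrightarrow> j < length zs \<Longrightarrow> norm (wt G (zs ! i) (zs ! j) - wt H (ys ! i) (ys ! j)) < \<kappa>"
    and outer: "\<And>i. i < length xs \<Longrightarrow> net_deg H (ys ! i) - (\<Sum>j<length zs. (norm (wt H (ys ! i) (ys ! j)))\<^sup>2) < \<kappa>"
    and L: "0 < L" "\<kappa> * L < 1" "\<kappa> \<le> 1 / L\<^sup>2"
    and p: "net_path H p" "hd p = r'" "path_len H p \<le> L" "length p \<le> Suc K"
  shows "\<exists>\<pi>. p = map ((!) ys) \<pi> \<and> set \<pi> \<subseteq> {..<length zs} \<and> \<pi> \<noteq> [] \<and> hd \<pi> = 0 \<and>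
     net_path G (map ((!) zs) \<pi>) \<and> zs ! last \<pi> \<in> reach G r (length p - 1)"
  using p
proof (induction p rule: rev_induct)
  case Nil
  then show ?case by (simp add: net_path_def)
next
  case (snoc w p)
  show ?case
  proof (cases "p = []")
    case True
    then have "w = r'" using snoc.prems by simp
    moreover have "zs ! 0 \<in> verts G" using zv zs(5) by auto
    ultimately show ?thesis using True r zs(5) reach(3) by (intro exI[of _ "[0]"]) auto
  next
    case False
    have q: "net_path H p" "w \<in> verts H" "wt H (last p) w \<noteq> 0"
      using snoc.prems(1) net_path_snoc[OF False] by auto
    have pl: "path_len H p \<le> L" using path_len_snoc_mono[OF False, of H w] snoc.prems(3) by linarith
    have hp: "hd p = r'" using snoc.prems(2) False by simp
    have lenp: "length p \<le> Suc K" using snoc.prems(4) by simp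
    from snoc.IH[OF q(1) hp pl lenp] obtain \<pi> where \<pi>: "p = map ((!) ys) \<pi>" "set \<pi> \<subseteq> {..<length zs}" "\<pi> \<noteq> []" "hd \<pi> = 0"
      "net_path G (map ((!) zs) \<pi>)" "zs ! last \<pi> \<in> reach G r (length p - 1)"
      by blast
    let ?i = "last \<pi>"
    have i: "?i < length zs" using \<pi>(2,3) by (meson last_in_set lessThan_iff subsetD)
    have lp: "last p = ys ! ?i" using \<pi>(1,3) by (simp add: last_map)
    have "length p - 1 \<le> K" using snoc.prems(4) by simp
    then have "zs ! ?i \<in> set xs" unfolding reach(1) by (rule subsetD[OF reach_mono \<pi>(6)])
    then obtain i' where i': "i' < length xs" "xs ! i' = zs ! ?i" by (metis in_set_conv_nth)
    have "zs ! i' = zs ! ?i" using i' zs(4) by (metis nth_take)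
    then have "i' = ?i" using zs(1) i i'(1) zs(3) by (simp add: nth_eq_iff_index_eq)
    then have ix: "?i < length xs" using i'(1) by simp
    have wL: "1 / L \<le> norm (wt H (ys ! ?i) w)"
    proof -
      have "1 / L \<le> norm (wt H ((p @ [w]) ! (length p - 1)) ((p @ [w]) ! Suc (length p - 1)))"
        by (rule path_edge_ge[OF snoc.prems(1,3)]) (use False L(1) in auto)
      then show ?thesis using False lp by (simp add: nth_append last_conv_nth)
    qed
    have "w \<in> set ys"
    proof (rule ccontr)
      assume w: "w \<notin> set ys"
      have yi: "ys ! ?i \<in> verts H" using ys(1) i zs(2) by auto
      let ?f = "\<lambda>v. (norm (wt H (ys ! ?i) v))\<^sup>2"
      have "(\<Sum>v\<in>insert w (set ys). ?f v) \<le> net_deg H (ys ! ?i)"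
        unfolding net_deg_def using ys(1) q(2)
        by (intro finite_sum_le_infsum is_networkD(3)[OF H yi]) auto
      moreover have "(\<Sum>v\<in>set ys. ?f v) = (\<Sum>j<length zs. ?f (ys ! j))"
        using ys(2) zs(2) by (simp add: sum_list_distinct_conv_sum_set[symmetric] sum_list_sum_nth atLeast0LessThan)
      ultimately have "?f w < \<kappa>" using outer[OF ix] w by simp
      moreover have "(1 / L)\<^sup>2 \<le> ?f w" using wL L(1) by (intro power_mono) auto
      ultimately show False using L(3) by (simp add: power_divide)
    qed
    then obtain j where j: "j < length zs" "w = ys ! j" using zs(2) by (metis in_set_conv_nth)
    have "norm (wt G (zs ! ?i) (zs ! j) - wt H (ys ! ?i) (ys ! j)) < \<kappa>" by (rule close[OF i j(1)])
    moreover have "\<kappa> < 1 / L" using L(1,2) by (simp add: field_simps)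
    ultimately have g: "wt G (zs ! ?i) (zs ! j) \<noteq> 0" using wL j(2) by auto
    have zj: "zs ! j \<in> verts G" using zv j(1) by auto
    have "zs ! j \<in> reach G r (Suc (length p - 1))" using \<pi>(6) g zj by (auto simp: net_row_def)
    moreover have "net_path G (map ((!) zs) (\<pi> @ [j]))"
    proof -
      have "net_path G (map ((!) zs) \<pi> @ [zs ! j])"
        using net_path_snoc[of "map ((!) zs) \<pi>" G "zs ! j"] \<pi>(3,5) zj g by (simp add: last_map)
      then show ?thesis by simp
    qed
    ultimately show ?thesis
      using \<pi> j False by (intro exI[of _ "\<pi> @ [j]"]) auto
  qed
qed

text \<open>Radii with a margin around them free of the given distances; balls of such a radius are
  stable under small changes of the lengths.\<close>

lemma ex_generic:
  assumes "finite (E :: real set)"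
  shows "\<exists>t \<delta>. t0 < t \<and> t < t0 + 1/2 \<and> 0 < \<delta> \<and> \<delta> \<le> 1/4 \<and> (\<forall>d\<in>E. d < t - \<delta> \<or> t + \<delta> < d)"
proof -
  have "infinite {t0<..<t0 + 1/2}" by (rule infinite_Ioo) simp
  then obtain t where t: "t \<in> {t0<..<t0 + 1/2}" "t \<notin> E" using assms by (metis finite_subset subsetI)
  define \<delta> where "\<delta> = Min (insert (1/4) ((\<lambda>d. \<bar>d - t\<bar> / 2) ` E))"
  have \<delta>: "\<delta> \<le> 1/4" "\<And>d. d \<in> E \<Longrightarrow> \<delta> \<le> \<bar>d - t\<bar> / 2"
    unfolding \<delta>_def by (rule Min_le; use assms in simp)+
  have pos: "0 < \<delta>" unfolding \<delta>_def using assms t(2) by auto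
  have "d < t - \<delta> \<or> t + \<delta> < d" if "d \<in> E" for d
    using \<delta>(2)[OF that] pos by (cases "d < t") (auto simp: abs_if)
  then show ?thesis using t \<delta>(1) pos by auto
qed

lemma ratc_dense:
  assumes "0 < e"
  shows "\<exists>q. norm (z - ratc q) < e"
proof -
  have e: "0 < e / 2" using assms by simp
  have "\<exists>a. \<bar>x - of_rat a\<bar> < e / 2" for x :: real
  proof -
    obtain y where "y \<in> \<rat>" "x - e / 2 < y" "y < x + e / 2"
      using Rats_dense_in_real[of "x - e/2" "x + e/2"] e by auto
    moreover obtain a where "y = of_rat a" using \<open>y \<in> \<rat>\<close> by (rule Rats_cases)
    ultimately have "\<bar>x - of_rat a\<bar> < e / 2" unfolding abs_less_iff by linarith
    then show ?thesis by blast
  qed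
  then obtain a b where "\<bar>Re z - of_rat a\<bar> < e / 2" "\<bar>Im z - of_rat b\<bar> < e / 2" by blast
  then have "norm (z - ratc (a, b)) < e"
    using cmod_le[of "z - ratc (a, b)"] by (simp add: ratc_def)
  then show ?thesis by blast
qed

text \<open>The template records all vertices within K + 1 steps of the root and demands little
  further weight at those within K steps. On bounded networks this determines the ball of a generic
  radius s slightly above t0, so a match yields a correspondence of balls.\<close>

lemma template_basis:
  assumes c: "c \<in> bdd_class D" and t0: "1 \<le> t0"
  shows "\<exists>t. matches t (gnet c) (groot c) \<and>
    (\<forall>c'\<in>bdd_class D. matches t (gnet c') (groot c') \<longrightarrow> (\<exists>s>t0. \<exists>\<sigma>. near s c c' \<sigma>))"
proof -
  let ?G = "gnet c" and ?r = "groot c"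
  have bG: "bdd_net D ?G" using c by (simp add: bdd_class_def)
  \<comment> \<open>Room for s + \<delta>, which is below t0 + 3 / 4.\<close>
  define L where "L = t0 + 1"
  \<comment> \<open>The bound of \<open>path_len_edges\<close> on the number of edges of a path of
    length at most L.\<close>
  define K where "K = nat \<lceil>L\<^sup>2 * (real D)\<^sup>2\<rceil>"
  obtain xs where xs: "ordered_list ?G ?r xs" "set xs = reach ?G ?r K"
    using ordered_list_exists[OF bG groot_in] by blast
  obtain ws where ws: "ordered_list ?G ?r (xs @ ws)" "set (xs @ ws) = reach ?G ?r (Suc K)"
    using ordered_list_extend[OF bG groot_in xs] by blast
  define zs where "zs = xs @ ws"
  define n where "n = length zs"
  have z: "zs \<noteq> []" "zs ! 0 = ?r" "distinct zs" "set zs \<subseteq> verts ?G" "set zs = reach ?G ?r (Suc K)"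
    and zc: "\<And>i. 0 < i \<Longrightarrow> i < n \<Longrightarrow> \<exists>j<i. wt ?G (zs ! j) (zs ! i) \<noteq> 0"
    using ws finite_reach[OF bG groot_in, of "Suc K"] by (auto simp: ordered_list_def zs_def n_def)
  have zx: "length xs \<le> length zs" "take (length xs) zs = xs" by (auto simp: zs_def)
  define d where "d i = enn2real (net_dist ?G ?r (zs ! i))" for i
  have d: "net_dist ?G ?r (zs ! i) = ennreal (d i)" if "i < n" for i
  proof -
    have "net_dist ?G ?r (zs ! i) < \<infinity>" using z(4) that by (intro gnet_connected) (auto simp: n_def)
    then show ?thesis by (simp add: d_def less_top)
  qed
  obtain s \<delta> where s: "t0 < s" "s < t0 + 1/2" and \<delta>: "0 < \<delta>" "\<delta> \<le> 1/4"
    and gen: "\<And>i. i < n \<Longrightarrow> d i < s - \<delta> \<or> s + \<delta> < d i"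
    using ex_generic[of "d ` {..<n}" t0] by auto
  have L: "0 < L" "s + \<delta> < L" "1 \<le> L" using s \<delta> t0 by (auto simp: L_def)
  have "(\<lambda>l. 2 / real (Suc l)) \<longlonglongrightarrow> 0"
    using tendsto_mult[OF tendsto_const[of 2] LIMSEQ_inverse_real_of_nat] by (simp add: divide_inverse)
  \<comment> \<open>The first bound keeps the stretch of lengths within \<delta> / 2, the second
    confines short paths to the labels, and the third gives \<kappa> L < 1 and \<kappa> \<le> 1 / s.
    The numerator 2 stands for two errors 1 / (l + 1), one for each network against the
    template.\<close>
  moreover have "0 < min (\<delta> / (2 * L * (L + \<delta>))) (min (1 / L\<^sup>2) (1 / (2 * L)))"
    using L \<delta> by simp
  ultimately have "eventually (\<lambda>l. 2 / real (Suc l) < min (\<delta> / (2 * L * (L + \<delta>))) (min (1 / L\<^sup>2) (1 / (2 * L)))) sequentially"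
    by (rule order_tendstoD(2))
  then obtain l where l: "2 / real (Suc l) < min (\<delta> / (2 * L * (L + \<delta>))) (min (1 / L\<^sup>2) (1 / (2 * L)))"
    by (auto simp: eventually_sequentially)
  define \<kappa> where "\<kappa> = 2 / real (Suc l)"
  have \<kappa>: "0 < \<kappa>" "\<kappa> < \<delta> / (2 * L * (L + \<delta>))" "\<kappa> < 1 / L\<^sup>2" "\<kappa> < 1 / (2 * L)"
    using l by (auto simp: \<kappa>_def)
  have \<kappa>L: "\<kappa> * L < 1" using \<kappa>(4) L by (simp add: field_simps)
  have "1 / L \<le> 1" "1 / (2 * L) \<le> 1 / L" using L by (auto simp: field_simps)
  have \<kappa>s: "\<kappa> \<le> 1 / s"
  proof -
    have "1 / (2 * L) \<le> 1 / s" using L s t0 \<delta> by (intro frac_le) auto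
    then show ?thesis using \<kappa>(4) by linarith
  qed
  have stretch: "x / (1 - \<kappa> * L) \<le> x + \<delta> / 2" if x: "0 \<le> x" "x \<le> L" for x
  proof -
    have "\<kappa> * (2 * L * (L + \<delta>)) < \<delta>" using \<kappa>(2) L \<delta> by (simp add: pos_less_divide_eq)
    then have "2 * (\<kappa> * L) * (L + \<delta>) < \<delta>" by (simp add: mult_ac)
    moreover have "2 * (\<kappa> * L) * (x + \<delta>/2) \<le> 2 * (\<kappa> * L) * (L + \<delta>)"
      using x \<kappa>(1) L \<delta> by (intro mult_left_mono) auto
    ultimately have "x \<le> (x + \<delta> / 2) * (1 - \<kappa> * L)" by (simp add: algebra_simps)
    then show ?thesis using \<kappa>L by (simp add: pos_divide_le_eq)
  qed
  have "\<exists>q. norm (wt ?G (zs ! i) (zs ! j) - ratc q) < 1 / real (Suc l)" for i j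
    by (rule ratc_dense) simp
  then obtain q where q: "\<And>i j. norm (wt ?G (zs ! i) (zs ! j) - ratc (q i j)) < 1 / real (Suc l)" by metis
  define qs where "qs = map (\<lambda>i. map (q i) [0..<n]) [0..<n]"
  define t :: template where "t = (length xs, qs, l)"
  have tq: "fst (snd t) ! i ! j = q i j" if "i < n" "j < n" for i j using that by (simp add: t_def qs_def)
  have tl: "length (fst (snd t)) = n" by (simp add: t_def qs_def)
  have lab: "labelling t ?G ?r zs" using z by (simp add: labelling_def tl n_def)
  have outerG: "net_deg ?G (zs ! i) = (\<Sum>j<n. (norm (wt ?G (zs ! i) (zs ! j)))\<^sup>2)" if i: "i < length xs" for i
  proof -
    have "zs ! i \<in> reach ?G ?r K" using i xs(2) by (metis nth_append nth_mem zs_def)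
    then have sub: "net_row ?G (zs ! i) \<subseteq> set zs" unfolding z(5) by auto
    have "net_deg ?G (zs ! i) = (\<Sum>v\<in>set zs. (norm (wt ?G (zs ! i) v))\<^sup>2)"
      unfolding net_deg_def using z(4) sub by (intro infsum_eq_sum) (auto simp: net_row_def)
    then show ?thesis using z(3)
      by (simp add: sum_list_distinct_conv_sum_set[symmetric] sum_list_sum_nth atLeast0LessThan n_def)
  qed
  have fit: "fits t 0 ?G zs"
    unfolding fits_def
  proof (intro conjI ballI)
    fix i j assume "i \<in> {..<length zs}" "j \<in> {..<length zs}"
    then show "norm (wt ?G (zs ! i) (zs ! j) - ratc (fst (snd t) ! i ! j)) + 0 < 1 / real (Suc (snd (snd t)))"
      using q[of i j] tq[of i j] by (simp add: n_def t_def)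
  next
    fix i assume "i \<in> {0<..<length zs}"
    then obtain j where "j < i" "wt ?G (zs ! j) (zs ! i) \<noteq> 0" using zc[of i] by (auto simp: n_def)
    then show "0 < (\<Sum>j<i. norm (wt ?G (zs ! j) (zs ! i)))"
      by (intro sum_pos2[of _ j]) auto
  next
    fix i assume "i \<in> {..<min (fst t) (length zs)}"
    then have "i < length xs" by (simp add: t_def)
    from outerG[OF this] show "net_deg ?G (zs ! i) - (\<Sum>j<length zs. (norm (wt ?G (zs ! i) (zs ! j)))\<^sup>2) + 0 < 1 / real (Suc (snd (snd t)))"
      by (simp add: n_def)
  qed
  have "\<exists>\<sigma>. near s c c' \<sigma>" if c': "c' \<in> bdd_class D" and m: "matches t (gnet c') (groot c')" for c'
  proof -
    let ?H = "gnet c'" and ?r' = "groot c'"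
    have bH: "bdd_net D ?H" using c' by (simp add: bdd_class_def)
    obtain ys where ys: "labelling t ?H ?r' ys" "fits t 0 ?H ys" using m by (auto simp: matches_def)
    have y: "length ys = n" "ys ! 0 = ?r'" "distinct ys" "set ys \<subseteq> verts ?H"
      using ys(1) by (auto simp: labelling_def tl)
    have close: "norm (wt ?G (zs ! i) (zs ! j) - wt ?H (ys ! i) (ys ! j)) < \<kappa>" if "i < n" "j < n" for i j
    proof -
      have "norm (wt ?H (ys ! i) (ys ! j) - ratc (fst (snd t) ! i ! j)) + 0 < 1 / real (Suc (snd (snd t)))"
        using ys(2) that y(1) unfolding fits_def by blast
      then have "norm (wt ?H (ys ! i) (ys ! j) - ratc (q i j)) < 1 / real (Suc l)"
        unfolding tq[OF that] by (simp add: t_def)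
      then have "norm (wt ?G (zs ! i) (zs ! j) - wt ?H (ys ! i) (ys ! j)) < 1 / real (Suc l) + 1 / real (Suc l)"
        using q[of i j] by (intro norm_diff_triangle_less[of _ "ratc (q i j)"]) (simp_all add: norm_minus_commute)
      then show ?thesis by (simp add: \<kappa>_def)
    qed
    have outer: "net_deg ?H (ys ! i) - (\<Sum>j<length zs. (norm (wt ?H (ys ! i) (ys ! j)))\<^sup>2) < \<kappa>" if "i < length xs" for i
    proof -
      have "net_deg ?H (ys ! i) - (\<Sum>j<length ys. (norm (wt ?H (ys ! i) (ys ! j)))\<^sup>2) + 0 < 1 / real (Suc l)"
        using ys(2) that y(1) zx(1) by (auto simp: fits_def t_def n_def)
      moreover have "1 / real (Suc l) \<le> \<kappa>" by (simp add: \<kappa>_def divide_right_mono)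
      ultimately show ?thesis using y(1) by (simp add: n_def)
    qed
    have outer': "net_deg ?G (zs ! i) - (\<Sum>j<length zs. (norm (wt ?G (zs ! i) (zs ! j)))\<^sup>2) < \<kappa>" if "i < length xs" for i
      using outerG[OF that] \<kappa>(1) by (simp add: n_def)
    have short: "length p \<le> Suc K" if "bdd_net D N" "net_path N p" "path_len N p \<le> L" for N :: "nat network" and p
    proof -
      have "real (length p - 1) \<le> L\<^sup>2 * (real D)\<^sup>2"
        using path_len_edges[OF that(1,2)] mult_right_mono[OF power_mono[OF that(3), of 2], of "(real D)\<^sup>2"] by simp
      also have "\<dots> \<le> real K" unfolding K_def by (rule real_nat_ceiling_ge)
      finally show ?thesis by simp
    qed
    have \<kappa>2: "\<kappa> \<le> 1 / L\<^sup>2" using \<kappa>(3) by simp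
    have confH: "\<exists>\<pi>. p = map ((!) ys) \<pi> \<and> set \<pi> \<subseteq> {..<n} \<and> \<pi> \<noteq> [] \<and> hd \<pi> = 0 \<and> net_path ?G (map ((!) zs) \<pi>)"
      if p: "net_path ?H p" "hd p = ?r'" "path_len ?H p \<le> L" for p
      using confined_path[OF is_network_gnet z(3) _ zx z(1) xs(2) z(5,2) y(2,4,3) z(4) close outer L(1) \<kappa>L \<kappa>2 p short[OF bH p(1,3)]]
        y(1) by (auto simp: n_def)
    have confG: "\<exists>\<pi>. p = map ((!) zs) \<pi> \<and> set \<pi> \<subseteq> {..<n} \<and> \<pi> \<noteq> [] \<and> hd \<pi> = 0"
      if p: "net_path ?G p" "hd p = ?r" "path_len ?G p \<le> L" for p
      using confined_path[OF is_network_gnet z(3) refl zx z(1) xs(2) z(5,2) z(2,4,3) z(4) _ outer' L(1) \<kappa>L \<kappa>2 p short[OF bG p(1,3)]]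
        \<kappa>(1) by (auto simp: n_def)
    have inG: "\<exists>i<n. v = zs ! i" if v: "net_dist ?G ?r v < ennreal L" for v
    proof -
      obtain p where p: "net_path ?G p" "hd p = ?r" "last p = v" "ennreal (path_len ?G p) < ennreal L"
        using net_dist_lessE[OF v] .
      then have "path_len ?G p \<le> L" using L(1) by (simp add: ennreal_less_iff)
      from confG[OF p(1,2) this] obtain \<pi> where \<pi>: "p = map ((!) zs) \<pi>" "set \<pi> \<subseteq> {..<n}" "\<pi> \<noteq> []" by blast
      then show ?thesis using p(3) by (intro exI[of _ "last \<pi>"]) (auto simp: last_map dest: last_in_set)
    qed
    have HG: "\<exists>i<n. v = ys ! i \<and> d i < s" if v: "net_dist ?H ?r' v \<le> ennreal s" for v
    proof -
      have "net_dist ?H ?r' v < ennreal (s + \<delta> / 2)"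
        using v \<delta>(1) s t0 by (intro le_less_trans[OF v]) (simp add: ennreal_less_iff)
      then obtain p where p: "net_path ?H p" "hd p = ?r'" "last p = v" "ennreal (path_len ?H p) < ennreal (s + \<delta> / 2)"
        by (rule net_dist_lessE)
      then have pl: "path_len ?H p < s + \<delta> / 2" by (simp add: ennreal_less_iff)
      then have pL: "path_len ?H p \<le> L" using L \<delta> by linarith
      from confH[OF p(1,2) this] obtain \<pi> where \<pi>: "p = map ((!) ys) \<pi>" "set \<pi> \<subseteq> {..<n}" "\<pi> \<noteq> []" "hd \<pi> = 0"
        "net_path ?G (map ((!) zs) \<pi>)" by blast
      have le: "path_len ?G (map ((!) zs) \<pi>) \<le> path_len ?H (map ((!) ys) \<pi>) / (1 - \<kappa> * L)"
      proof (rule path_transfer(2)[where H = ?G and G = ?H])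
        show "norm (wt ?H (ys ! i) (ys ! j) - wt ?G (zs ! i) (zs ! j)) \<le> \<kappa>" if "i \<in> set \<pi>" "j \<in> set \<pi>" for i j
        proof -
          have "i < n" "j < n" using that \<pi>(2) by auto
          from close[OF this] show ?thesis by (simp add: norm_minus_commute)
        qed
        show "(!) zs ` set \<pi> \<subseteq> verts ?G"
        proof safe
          fix i assume "i \<in> set \<pi>"
          then have "i < length zs" using \<pi>(2) by (auto simp: n_def)
          then show "zs ! i \<in> verts ?G" using z(4) nth_mem by blast
        qed
      qed (use p(1) \<pi>(1) pL L \<kappa>(1) \<kappa>L in auto)
      also have "\<dots> \<le> path_len ?H p + \<delta> / 2" unfolding \<pi>(1)[symmetric] by (rule stretch) (use pL in auto)
      also have "\<dots> < s + \<delta>" using pl by simp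
      finally have "path_len ?G (map ((!) zs) \<pi>) < s + \<delta>" .
      moreover have "net_dist ?G ?r (zs ! last \<pi>) \<le> ennreal (path_len ?G (map ((!) zs) \<pi>))"
        using net_dist_le[OF \<pi>(5)] \<pi>(3,4) z(2) by (simp add: hd_map last_map)
      moreover have i: "last \<pi> < n" using \<pi>(2,3) by (meson last_in_set lessThan_iff subsetD)
      ultimately have "d (last \<pi>) < s + \<delta>" unfolding d[OF i]
        by (metis (no_types, lifting) ennreal_le_iff le_less_trans path_len_nonneg)
      \<comment> \<open>The margin around s upgrades a distance below s + \<delta> to one below
        s.\<close>
      then have "d (last \<pi>) < s" using gen[OF i] \<delta>(1) by linarith
      then show ?thesis using i p(3) \<pi>(1,3) by (intro exI[of _ "last \<pi>"]) (auto simp: last_map)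
    qed
    have GH: "net_dist ?H ?r' (ys ! i) \<le> ennreal s" if i: "i < n" "d i \<le> s" for i
    proof -
      have "d i < s - \<delta>" using gen[OF i(1)] i(2) \<delta>(1) by linarith
      then have "net_dist ?G ?r (zs ! i) < ennreal (s - \<delta>)" unfolding d[OF i(1)] by (simp add: ennreal_less_iff d_def)
      then obtain p where p: "net_path ?G p" "hd p = ?r" "last p = zs ! i" "ennreal (path_len ?G p) < ennreal (s - \<delta>)"
        by (rule net_dist_lessE)
      then have pl: "path_len ?G p < s - \<delta>" by (simp add: ennreal_less_iff)
      then have pL: "path_len ?G p \<le> L" using L \<delta> by linarith
      from confG[OF p(1,2) this] obtain \<pi> where \<pi>: "p = map ((!) zs) \<pi>" "set \<pi> \<subseteq> {..<n}" "\<pi> \<noteq> []" "hd \<pi> = 0" by blast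
      have li: "last \<pi> < n" using \<pi>(2,3) by (meson last_in_set lessThan_iff subsetD)
      have "zs ! last \<pi> = zs ! i" using p(3) \<pi>(1,3) by (simp add: last_map)
      then have la: "last \<pi> = i" using z(3) li i(1) by (simp add: nth_eq_iff_index_eq n_def)
      have cl: "norm (wt ?G (zs ! i) (zs ! j) - wt ?H (ys ! i) (ys ! j)) \<le> \<kappa>" if "i \<in> set \<pi>" "j \<in> set \<pi>" for i j
      proof -
        have "i < n" "j < n" using that \<pi>(2) by auto
        from close[OF this] show ?thesis by simp
      qed
      have yv: "(!) ys ` set \<pi> \<subseteq> verts ?H"
      proof safe
        fix i assume "i \<in> set \<pi>"
        then have "i < length ys" using \<pi>(2) y(1) by auto
        then show "ys ! i \<in> verts ?H" using y(4) nth_mem by blast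
      qed
      note tr = path_transfer[OF p(1)[unfolded \<pi>(1)] pL[unfolded \<pi>(1)] L(1) yv cl less_imp_le[OF \<kappa>(1)] \<kappa>L]
      have "path_len ?G (map ((!) zs) \<pi>) / (1 - \<kappa> * L) \<le> path_len ?G p + \<delta> / 2"
        unfolding \<pi>(1)[symmetric] by (rule stretch) (use pL in auto)
      then have "path_len ?H (map ((!) ys) \<pi>) \<le> s" using tr(2) pl \<delta>(1) by linarith
      then have "ennreal (path_len ?H (map ((!) ys) \<pi>)) \<le> ennreal s" by (rule ennreal_leI)
      moreover have "net_dist ?H ?r' (ys ! i) \<le> ennreal (path_len ?H (map ((!) ys) \<pi>))"
        using net_dist_le[OF tr(1)] \<pi>(3,4) la y(2) by (simp add: hd_map last_map)
      ultimately show ?thesis by (rule order_trans[rotated])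
    qed
    define I where "I = {i. i < n \<and> d i \<le> s}"
    have ballG: "net_ball ?G ?r s = (!) zs ` I"
    proof (intro set_eqI iffI)
      fix v assume "v \<in> net_ball ?G ?r s"
      then have v: "net_dist ?G ?r v \<le> ennreal s" by (simp add: net_ball_def)
      also have "ennreal s < ennreal L" using L \<delta> s t0 by (simp add: ennreal_less_iff)
      finally obtain i where i: "i < n" "v = zs ! i" using inG by blast
      then have "d i \<le> s" using v d[OF i(1)] s t0 by (simp add: ennreal_le_iff)
      then show "v \<in> (!) zs ` I" using i by (auto simp: I_def)
    next
      fix v assume "v \<in> (!) zs ` I"
      then show "v \<in> net_ball ?G ?r s" using d z(4) by (auto simp: I_def net_ball_def n_def ennreal_leI)
    qed
    have ballH: "net_ball ?H ?r' s = (!) ys ` I"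
    proof (intro set_eqI iffI)
      fix v assume "v \<in> net_ball ?H ?r' s"
      then show "v \<in> (!) ys ` I" using HG[of v] by (auto simp: I_def net_ball_def)
    next
      fix v assume "v \<in> (!) ys ` I"
      then show "v \<in> net_ball ?H ?r' s" using GH y(1,4) by (auto simp: I_def net_ball_def)
    qed
    define \<sigma> where "\<sigma> v = ys ! (inv_into {..<n} ((!) zs) v)" for v
    have injz: "inj_on ((!) zs) {..<n}" using z(3) by (auto simp: inj_on_def nth_eq_iff_index_eq n_def)
    have \<sigma>: "\<sigma> (zs ! i) = ys ! i" if "i < n" for i
      unfolding \<sigma>_def using inv_into_f_f[OF injz, of i] that by simp
    have n0: "0 < n" using z(1) by (simp add: n_def)
    have "bij_betw \<sigma> (net_ball ?G ?r s) (net_ball ?H ?r' s)"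
      unfolding bij_betw_def ballG ballH
    proof
      show "inj_on \<sigma> ((!) zs ` I)"
        using y(1,3) by (auto simp: inj_on_def I_def \<sigma> nth_eq_iff_index_eq)
      show "\<sigma> ` (!) zs ` I = (!) ys ` I" unfolding image_image by (intro image_cong) (auto simp: I_def \<sigma>)
    qed
    moreover have "\<sigma> ?r = ?r'" using \<sigma>[OF n0] z(2) y(2) by simp
    moreover have "norm (wt ?H (\<sigma> u) (\<sigma> v) - wt ?G u v) \<le> 1 / s"
      if inb: "u \<in> net_ball ?G ?r s" "v \<in> net_ball ?G ?r s" for u v
    proof -
      obtain i j where "i \<in> I" "j \<in> I" and uv: "u = zs ! i" "v = zs ! j"
        using inb unfolding ballG by (elim imageE)
      then have ij: "i < n" "j < n" "u = zs ! i" "v = zs ! j" by (simp_all add: I_def)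
      show ?thesis using close[OF ij(1,2)] \<kappa>s ij by (simp add: \<sigma> norm_minus_commute)
    qed
    ultimately have "near s c c' \<sigma>" unfolding near_def using s t0 by auto
    then show ?thesis by blast
  qed
  then show ?thesis using lab fit s(1) unfolding matches_def by blast
qed

text \<open>Truncations are bounded, so the preimage of an open set is the union, over the countably
  many templates that force bounded classes into it, of the Borel sets of
  \<open>matches_trunc_borel\<close>.\<close>

lemma measurable_trunc_class:
  assumes "0 < \<theta>"
  shows "trunc_class \<theta> \<in> borel_measurable borel"
proof (rule borel_measurableI)
  fix U :: "gstar set" assume U: "open U"
  let ?D = "tbound \<theta>"
  let ?T = "{t. \<forall>c'\<in>bdd_class ?D. matches t (gnet c') (groot c') \<longrightarrow> c' \<in> U}"
  have m: "matches t (gnet (trunc_class \<theta> c)) (groot (trunc_class \<theta> c)) \<longleftrightarrow> matches t (knet \<theta> 0 (gnet c)) (groot c)" for t c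
  proof -
    obtain \<sigma> where "net_emb \<sigma> (gnet (trunc_class \<theta> c)) (knet \<theta> 0 (gnet c))" "\<sigma> (groot (trunc_class \<theta> c)) = groot c"
      using trunc_class_emb[OF assms] by blast
    then show ?thesis using matches_emb[of \<sigma> "gnet (trunc_class \<theta> c)" "knet \<theta> 0 (gnet c)" "groot (trunc_class \<theta> c)" t] by simp
  qed
  have "trunc_class \<theta> -` U = (\<Union>t\<in>?T. {c. matches t (knet \<theta> 0 (gnet c)) (groot c)})"
  proof (intro set_eqI iffI)
    fix c assume "c \<in> trunc_class \<theta> -` U"
    then have cU: "trunc_class \<theta> c \<in> U" by simp
    then obtain e where e: "0 < e" "\<And>c'. d_loc (trunc_class \<theta> c) c' < e \<Longrightarrow> c' \<in> U"
      using U unfolding open_gstar_def by blast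
    define t0 where "t0 = max 1 (1 / e)"
    have "1 \<le> t0" by (simp add: t0_def)
    from template_basis[OF trunc_class_bdd[OF assms] this]
    obtain t where t: "matches t (gnet (trunc_class \<theta> c)) (groot (trunc_class \<theta> c))"
      "\<And>c'. c' \<in> bdd_class ?D \<Longrightarrow> matches t (gnet c') (groot c') \<Longrightarrow> \<exists>s>t0. \<exists>\<sigma>. near s (trunc_class \<theta> c) c' \<sigma>"
      by blast
    have "t \<in> ?T"
    proof (intro CollectI ballI impI)
      fix c' assume "c' \<in> bdd_class ?D" "matches t (gnet c') (groot c')"
      then obtain s \<sigma> where s: "t0 < s" "near s (trunc_class \<theta> c) c' \<sigma>" using t(2) by blast
      have "1 / e < 1 + s" "0 < s" using s(1) by (auto simp: t0_def)
      then have "1 / (1 + s) < e" using e(1) by (simp add: field_simps)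
      then show "c' \<in> U" using near_d_loc_le[OF s(2)] by (intro e(2)) linarith
    qed
    then show "c \<in> (\<Union>t\<in>?T. {c. matches t (knet \<theta> 0 (gnet c)) (groot c)})" using t(1) m by blast
  next
    fix c assume "c \<in> (\<Union>t\<in>?T. {c. matches t (knet \<theta> 0 (gnet c)) (groot c)})"
    then obtain t where "t \<in> ?T" "matches t (gnet (trunc_class \<theta> c)) (groot (trunc_class \<theta> c))" using m by blast
    then show "c \<in> trunc_class \<theta> -` U" using trunc_class_bdd[OF assms] by simp
  qed
  also have "\<dots> \<in> sets borel"
    by (intro sets.countable_UN'' matches_trunc_borel assms) auto
  finally show "trunc_class \<theta> -` U \<inter> space borel \<in> sets borel" by simp
qed

section \<open>The mean spectral measure of a truncated law\<close>

text \<open>Made a total kernel by a point mass at 0 outside the bounded class.\<close>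

definition spec_kernel :: "nat \<Rightarrow> gstar \<Rightarrow> real measure" where
  "spec_kernel D c = (if c \<in> bdd_class D then spectral_measure (gnet c) (groot c) else return borel 0)"

lemma spec_kernel_props:
  shows "real_distribution (spec_kernel D c)" "AE x in spec_kernel D c. \<bar>x\<bar> \<le> sbound D"
    "(\<integral>x. x ^ k \<partial>spec_kernel D c) = (if c \<in> bdd_class D then Re (wpow (gnet c) k (groot c) (groot c)) else 0 ^ k)"
proof (atomize (full), cases "c \<in> bdd_class D")
  case True
  then have eq: "spec_kernel D c = spectral_measure (gnet c) (groot c)" by (simp add: spec_kernel_def)
  have b: "bdd_net D (gnet c)" using True by (simp add: bdd_class_def)
  note p = spectral_measure_props[OF is_network_gnet b groot_in]
  have "(\<integral>x. x ^ k \<partial>spectral_measure (gnet c) (groot c)) = Re (wpow (gnet c) k (groot c) (groot c))"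
    unfolding p(3)[symmetric] by simp
  then show "real_distribution (spec_kernel D c) \<and> (AE x in spec_kernel D c. \<bar>x\<bar> \<le> sbound D) \<and>
    (\<integral>x. x ^ k \<partial>spec_kernel D c) = (if c \<in> bdd_class D then Re (wpow (gnet c) k (groot c) (groot c)) else 0 ^ k)"
    unfolding eq using p(1,2) True by simp
next
  case False
  then have eq: "spec_kernel D c = return borel 0" by (simp add: spec_kernel_def)
  have 1: "real_distribution (return borel (0::real))"
    by (simp add: real_distribution_def real_distribution_axioms_def prob_space_return)
  have 2: "AE x in return borel 0. \<bar>x\<bar> \<le> sbound D"
    using sbound_pos[of D] by (subst AE_return) auto
  have 3: "(\<integral>x. x ^ k \<partial>return borel 0) = (0::real) ^ k" by (subst integral_return) auto
  show "real_distribution (spec_kernel D c) \<and> (AE x in spec_kernel D c. \<bar>x\<bar> \<le> sbound D) \<and>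
    (\<integral>x. x ^ k \<partial>spec_kernel D c) = (if c \<in> bdd_class D then Re (wpow (gnet c) k (groot c) (groot c)) else 0 ^ k)"
    unfolding eq using 1 2 3 False by (intro conjI) simp_all
qed

lemma bdd_class_borel [measurable]: "bdd_class D \<in> sets borel"
  by (rule borel_closed[OF closed_bdd_class])

lemma borel_wpow_knet:
  assumes "0 < \<theta>" "0 < \<epsilon>"
  shows "(\<lambda>c. wpow (knet \<theta> \<epsilon> (gnet c)) k (groot c) (groot c)) \<in> borel_measurable borel"
  by (intro borel_measurable_continuous_onI local_cont_root local_cont_wpow assms)

text \<open>On bounded networks the truncation disappears as both of its parameters tend to 0, so
  the moments are limits of continuous functions of the class.\<close>

lemma measurable_spec_kernel_moment: "(\<lambda>c. \<integral>x. x ^ k \<partial>spec_kernel D c) \<in> borel_measurable borel"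
proof -
  let ?t = "\<lambda>j. 1 / real (Suc j)"
  have lim: "(\<lambda>j. if c \<in> bdd_class D then Re (wpow (knet (?t j) (?t j) (gnet c)) k (groot c) (groot c)) else 0 ^ k)
      \<longlonglongrightarrow> (\<integral>x. x ^ k \<partial>spec_kernel D c)" for c
  proof (cases "c \<in> bdd_class D")
    case True
    have "(\<lambda>j. Re (wpow (knet (?t j) (?t j) (gnet c)) k (groot c) (groot c))) \<longlonglongrightarrow> Re (wpow (gnet c) k (groot c) (groot c))"
    proof (intro tendsto_Re tendsto_wpow_knet_0)
      show "bdd_net D (gnet c)" using True by (simp add: bdd_class_def)
      show "?t \<longlonglongrightarrow> 0" using LIMSEQ_inverse_real_of_nat by (simp add: inverse_eq_divide)
    qed auto
    then show ?thesis using True by (simp add: spec_kernel_props(3))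
  qed (simp add: spec_kernel_props(3))
  have [measurable]: "(\<lambda>c. wpow (knet (?t j) (?t j) (gnet c)) k (groot c) (groot c)) \<in> borel_measurable borel" for j
    by (rule borel_wpow_knet) auto
  show ?thesis
    by (rule borel_measurable_LIMSEQ_real[OF lim]) measurable
qed

text \<open>All these measures live on one compact interval, where polynomials approximate
  uniformly; their integrals reduce to moments.\<close>

lemma measurable_spec_kernel_integral:
  fixes f :: "real \<Rightarrow> real"
  assumes f: "continuous_on UNIV f"
  shows "(\<lambda>c. \<integral>x. f x \<partial>spec_kernel D c) \<in> borel_measurable borel"
proof -
  let ?C = "sbound D"
  have "\<exists>g. real_polynomial_function g \<and> (\<forall>x\<in>{-?C..?C}. \<bar>f x - g x\<bar> < 1 / real (Suc n))" for n
  proof -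
    obtain g where "real_polynomial_function g" "\<And>x. x \<in> {-?C..?C} \<Longrightarrow> \<bar>f x - g x\<bar> < 1 / real (Suc n)"
      using Stone_Weierstrass_real_polynomial_function[of "{-?C..?C}" f "1 / real (Suc n)"]
        continuous_on_subset[OF f] by auto
    then show ?thesis by blast
  qed
  then obtain g where g: "\<And>n. real_polynomial_function (g n)" "\<And>n x. x \<in> {-?C..?C} \<Longrightarrow> \<bar>f x - g n x\<bar> < 1 / real (Suc n)"
    by metis
  have int: "integrable (spec_kernel D c) h" if h: "continuous_on UNIV h" for h :: "real \<Rightarrow> real" and c
  proof -
    interpret real_distribution "spec_kernel D c" by (rule spec_kernel_props)
    have "compact (h ` {-?C..?C})" using continuous_on_subset[OF h] by (intro compact_continuous_image) auto
    then obtain B where B: "\<And>x. x \<in> {-?C..?C} \<Longrightarrow> norm (h x) \<le> B"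
      using compact_imp_bounded bounded_iff by (metis imageI)
    show ?thesis
    proof (rule integrable_const_bound[where B = B])
      show "AE x in spec_kernel D c. norm (h x) \<le> B"
        using spec_kernel_props(2)[of D c] by eventually_elim (rule B, simp add: abs_le_iff)
      show "h \<in> borel_measurable (spec_kernel D c)" using borel_measurable_continuous_onI[OF h] by simp
    qed
  qed
  have gc: "continuous_on UNIV (g n)" for n using g(1) continuous_on_polymonial_function real_polynomial_function_eq by blast
  have lim: "(\<lambda>n. \<integral>x. g n x \<partial>spec_kernel D c) \<longlonglongrightarrow> (\<integral>x. f x \<partial>spec_kernel D c)" for c
  proof (rule LIM_zero_cancel, rule Lim_null_comparison)
    interpret real_distribution "spec_kernel D c" by (rule spec_kernel_props)
    show "(\<lambda>n. 1 / real (Suc n)) \<longlonglongrightarrow> 0" using LIMSEQ_inverse_real_of_nat by (simp add: inverse_eq_divide)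
    show "eventually (\<lambda>n. norm ((\<integral>x. g n x \<partial>spec_kernel D c) - (\<integral>x. f x \<partial>spec_kernel D c)) \<le> 1 / real (Suc n)) sequentially"
    proof (rule always_eventually, rule allI)
      fix n
      have eq: "(\<integral>x. g n x \<partial>spec_kernel D c) - (\<integral>x. f x \<partial>spec_kernel D c) = (\<integral>x. g n x - f x \<partial>spec_kernel D c)"
        by (rule Bochner_Integration.integral_diff[symmetric]) (intro int gc f)+
      have "norm (\<integral>x. g n x - f x \<partial>spec_kernel D c) \<le> (\<integral>x. norm (g n x - f x) \<partial>spec_kernel D c)"
        by (rule integral_norm_bound)
      also have "\<dots> \<le> 1 / real (Suc n)"
      proof (rule integral_le_const)
        show "integrable (spec_kernel D c) (\<lambda>x. norm (g n x - f x))"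
          by (intro integrable_norm Bochner_Integration.integrable_diff int gc f)
        show "AE x in spec_kernel D c. norm (g n x - f x) \<le> 1 / real (Suc n)"
          using spec_kernel_props(2)[of D c]
        proof eventually_elim
          case (elim x)
          then have "\<bar>f x - g n x\<bar> < 1 / real (Suc n)" by (intro g(2)) auto
          then show ?case by (simp add: abs_minus_commute)
        qed
      qed
      finally show "norm ((\<integral>x. g n x \<partial>spec_kernel D c) - (\<integral>x. f x \<partial>spec_kernel D c)) \<le> 1 / real (Suc n)"
        unfolding eq .
    qed
  qed
  show ?thesis
  proof (rule borel_measurable_LIMSEQ_real[OF lim])
    fix n
    obtain a m where am: "g n = (\<lambda>x. \<Sum>i\<le>m. a i * x ^ i)"
      using g(1)[of n] unfolding real_polynomial_function_iff_sum by blast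
    have "(\<integral>x. g n x \<partial>spec_kernel D c) = (\<Sum>i\<le>m. a i * (\<integral>x. x ^ i \<partial>spec_kernel D c))" for c
      unfolding am using int[of "\<lambda>x. x ^ i" c for i]
      by (subst Bochner_Integration.integral_sum) (auto intro!: continuous_intros int)
    then show "(\<lambda>c. \<integral>x. g n x \<partial>spec_kernel D c) \<in> borel_measurable borel"
      using measurable_spec_kernel_moment by simp
  qed
qed

lemma measurable_spec_kernel: "spec_kernel D \<in> measurable borel (subprob_algebra borel)"
proof (rule measurable_subprob_algebra_generated)
  show "sets borel = sigma_sets (UNIV :: real set) (range (\<lambda>a. {..a}))"
    unfolding borel_eq_atMost by simp
  show "Int_stable (range (\<lambda>a::real. {..a}))"
  proof (rule Int_stableI)
    fix a b assume "a \<in> range (\<lambda>a::real. {..a})" "b \<in> range (\<lambda>a::real. {..a})"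
    then obtain x y where "a = {..x}" "b = {..y}" by blast
    then have "a \<inter> b = {..min x y}" by auto
    then show "a \<inter> b \<in> range (\<lambda>a::real. {..a})" by blast
  qed
  fix c :: gstar
  interpret real_distribution "spec_kernel D c" by (rule spec_kernel_props)
  show "subprob_space (spec_kernel D c)" by (rule prob_space_imp_subprob_space[OF prob_space_axioms])
  show "sets (spec_kernel D c) = sets borel" by simp
next
  have "emeasure (spec_kernel D c) UNIV = 1" for c
  proof -
    interpret real_distribution "spec_kernel D c" by (rule spec_kernel_props)
    show ?thesis using emeasure_space_1 by simp
  qed
  then show "(\<lambda>c. emeasure (spec_kernel D c) UNIV) \<in> borel_measurable borel" by simp
next
  fix A assume "A \<in> range (\<lambda>a::real. {..a})"
  then obtain a where A: "A = {..a}" by blast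
  \<comment> \<open>Continuous ramps decreasing to the indicator of the half-line; half-lines form a
    generator stable under intersection.\<close>
  let ?f = "\<lambda>n x. max 0 (min 1 (1 - real n * (x - a)))"
  have lim: "(\<lambda>n. \<integral>x. ?f n x \<partial>spec_kernel D c) \<longlonglongrightarrow> measure (spec_kernel D c) {..a}" for c
  proof -
    interpret real_distribution "spec_kernel D c" by (rule spec_kernel_props)
    have pt: "(\<lambda>n. ?f n x) \<longlonglongrightarrow> indicator {..a} x" for x
    proof (cases "x \<le> a")
      case True
      then have "?f n x = 1" for n using mult_nonneg_nonpos[of "real n" "x - a"] by (simp add: min_def max_def)
      then show ?thesis using True by simp
    next
      case False
      obtain N :: nat where N: "1 / (x - a) \<le> real N" using real_arch_simple by blast
      have "?f n x = 0" if "N \<le> n" for n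
      proof -
        have "1 / (x - a) \<le> real n" using N that by linarith
        then have "1 \<le> real n * (x - a)" using False by (simp add: pos_divide_le_eq)
        then show ?thesis by simp
      qed
      then have "eventually (\<lambda>n. ?f n x = 0) sequentially" by (auto simp: eventually_sequentially)
      then show ?thesis using False by (simp add: tendsto_eventually)
    qed
    have "(\<lambda>n. \<integral>x. ?f n x \<partial>spec_kernel D c) \<longlonglongrightarrow> (\<integral>x. indicator {..a} x \<partial>spec_kernel D c)"
      by (rule integral_dominated_convergence[where w = "\<lambda>x. 1"]) (use pt in auto)
    then show ?thesis by simp
  qed
  have "(\<lambda>c. measure (spec_kernel D c) {..a}) \<in> borel_measurable borel"
    by (rule borel_measurable_LIMSEQ_real[OF lim], rule measurable_spec_kernel_integral) (auto intro!: continuous_intros)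
  moreover have "emeasure (spec_kernel D c) {..a} = ennreal (measure (spec_kernel D c) {..a})" for c
  proof -
    interpret real_distribution "spec_kernel D c" by (rule spec_kernel_props)
    show ?thesis by (rule emeasure_eq_measure)
  qed
  ultimately show "(\<lambda>c. emeasure (spec_kernel D c) A) \<in> borel_measurable borel" unfolding A by simp
qed auto

definition tspec :: "real \<Rightarrow> gstar \<Rightarrow> real measure" where
  "tspec \<theta> c = spectral_measure (gnet (trunc_class \<theta> c)) (groot (trunc_class \<theta> c))"

lemma tspec_kernel: "0 < \<theta> \<Longrightarrow> tspec \<theta> c = spec_kernel (tbound \<theta>) (trunc_class \<theta> c)"
  using trunc_class_bdd[of \<theta> c] by (simp add: tspec_def spec_kernel_def)

lemma wpow_trunc_class:
  assumes "0 < \<theta>"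
  shows "wpow (gnet (trunc_class \<theta> c)) k (groot (trunc_class \<theta> c)) (groot (trunc_class \<theta> c)) =
    wpow (knet \<theta> 0 (gnet c)) k (groot c) (groot c)"
proof -
  obtain \<sigma> where s: "net_emb \<sigma> (gnet (trunc_class \<theta> c)) (knet \<theta> 0 (gnet c))" "\<sigma> (groot (trunc_class \<theta> c)) = groot c"
    using trunc_class_emb[OF assms] by blast
  show ?thesis using net_emb_wpow[OF s(1) groot_in groot_in, of k] s(2) by simp
qed

lemma tspec_props:
  assumes "0 < \<theta>"
  shows "real_distribution (tspec \<theta> c)" "AE x in tspec \<theta> c. \<bar>x\<bar> \<le> sbound (tbound \<theta>)"
    "of_real (\<integral>x. x ^ k \<partial>tspec \<theta> c) = wpow (knet \<theta> 0 (gnet c)) k (groot c) (groot c)"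
    "tspec \<theta> \<in> measurable borel (subprob_algebra borel)"
proof -
  show "real_distribution (tspec \<theta> c)" "AE x in tspec \<theta> c. \<bar>x\<bar> \<le> sbound (tbound \<theta>)"
    unfolding tspec_kernel[OF assms] by (rule spec_kernel_props)+
  have b: "bdd_net (tbound \<theta>) (gnet (trunc_class \<theta> c))"
    using trunc_class_bdd[OF assms] by (simp add: bdd_class_def)
  show "of_real (\<integral>x. x ^ k \<partial>tspec \<theta> c) = wpow (knet \<theta> 0 (gnet c)) k (groot c) (groot c)"
    unfolding tspec_def wpow_trunc_class[OF assms, symmetric]
    by (rule spectral_measure_props(3)[OF is_network_gnet b groot_in])
  have "tspec \<theta> = spec_kernel (tbound \<theta>) \<circ> trunc_class \<theta>" using tspec_kernel[OF assms] by auto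
  then show "tspec \<theta> \<in> measurable borel (subprob_algebra borel)"
    using measurable_comp[OF measurable_trunc_class[OF assms] measurable_spec_kernel] by simp
qed

definition tmean :: "real \<Rightarrow> gstar measure \<Rightarrow> real measure" where
  "tmean \<theta> \<rho> = mean_spectral (trunc_law \<theta> \<rho>)"

text \<open>Identifies the set function in \<open>mean_spectral\<close> with a monadic bind, which
  shows that it is a measure and provides its integrals.\<close>

lemma tmean_bind:
  assumes \<theta>: "0 < \<theta>" and \<rho>: "prob_space \<rho>" "sets \<rho> = sets borel"
  shows "tmean \<theta> \<rho> = \<rho> \<bind> tspec \<theta>"
proof -
  interpret prob_space \<rho> by fact
  let ?D = "tbound \<theta>"
  have m [measurable]: "trunc_class \<theta> \<in> measurable \<rho> borel"
    using measurable_trunc_class[OF \<theta>] measurable_cong_sets[OF \<rho>(2) refl] by blast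
  have tl: "trunc_law \<theta> \<rho> = distr \<rho> borel (trunc_class \<theta>)"
    unfolding trunc_law_def trunc_class_def[abs_def] ..
  have ts: "tspec \<theta> \<in> measurable \<rho> (subprob_algebra borel)"
    using tspec_props(4)[OF \<theta>] measurable_cong_sets[OF \<rho>(2) refl] by blast
  have ae: "AE c in distr \<rho> borel (trunc_class \<theta>). c \<in> bdd_class ?D"
    by (subst AE_distr_iff[OF m]) (auto simp: trunc_class_bdd[OF \<theta>])
  have em: "(\<integral>\<^sup>+c. emeasure (spectral_measure (gnet c) (groot c)) A \<partial>trunc_law \<theta> \<rho>) = emeasure (\<rho> \<bind> tspec \<theta>) A"
    if A: "A \<in> sets borel" for A
  proof -
    have "(\<integral>\<^sup>+c. emeasure (spectral_measure (gnet c) (groot c)) A \<partial>trunc_law \<theta> \<rho>) =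
        (\<integral>\<^sup>+c. emeasure (spec_kernel ?D c) A \<partial>distr \<rho> borel (trunc_class \<theta>))"
      unfolding tl
    proof (rule nn_integral_cong_AE)
      show "AE c in distr \<rho> borel (trunc_class \<theta>). emeasure (spectral_measure (gnet c) (groot c)) A = emeasure (spec_kernel ?D c) A"
        using ae by eventually_elim (simp add: spec_kernel_def)
    qed
    also have "\<dots> = (\<integral>\<^sup>+c. emeasure (spec_kernel ?D (trunc_class \<theta> c)) A \<partial>\<rho>)"
      by (rule nn_integral_distr[OF m]) (use measurable_emeasure_kernel[OF measurable_spec_kernel A] in simp)
    also have "\<dots> = (\<integral>\<^sup>+c. emeasure (tspec \<theta> c) A \<partial>\<rho>)" unfolding tspec_kernel[OF \<theta>] ..
    also have "\<dots> = emeasure (\<rho> \<bind> tspec \<theta>) A"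
      by (rule emeasure_bind[OF not_empty ts A, symmetric])
    finally show ?thesis .
  qed
  have sets: "sets (\<rho> \<bind> tspec \<theta>) = sets borel"
    using real_distribution.events_eq_borel[OF tspec_props(1)[OF \<theta>]] not_empty by (intro sets_bind) auto
  have "tmean \<theta> \<rho> = measure_of UNIV (sets borel) (emeasure (\<rho> \<bind> tspec \<theta>))"
    unfolding tmean_def mean_spectral_def
    by (rule measure_of_eq) (auto simp: em sets.sigma_sets_eq[of borel, unfolded space_borel])
  also have "\<dots> = \<rho> \<bind> tspec \<theta>"
    using measure_of_of_measure[of "\<rho> \<bind> tspec \<theta>"] sets sets_eq_imp_space_eq[OF sets] by simp
  finally show ?thesis .
qed

context
  fixes \<theta> :: real and \<rho> :: "gstar measure"
  assumes \<theta>: "0 < \<theta>" and \<rho>: "prob_space \<rho>" "sets \<rho> = sets borel"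
begin

interpretation prob_space \<rho> by (rule \<rho>(1))

lemma measurable_tspec: "tspec \<theta> \<in> measurable \<rho> (subprob_algebra borel)"
  using tspec_props(4)[OF \<theta>] measurable_cong_sets[OF \<rho>(2) refl] by blast

lemma real_distribution_tmean: "real_distribution (tmean \<theta> \<rho>)"
proof -
  have "prob_space (\<rho> \<bind> tspec \<theta>)"
  proof (rule prob_space_bind[OF _ measurable_tspec])
    show "AE x in \<rho>. prob_space (tspec \<theta> x)"
      using tspec_props(1)[OF \<theta>] by (simp add: real_distribution_def)
  qed
  moreover have "sets (\<rho> \<bind> tspec \<theta>) = sets borel"
    using real_distribution.events_eq_borel[OF tspec_props(1)[OF \<theta>]] not_empty by (intro sets_bind) auto
  ultimately show ?thesis
    unfolding tmean_bind[OF \<theta> \<rho>] real_distribution_def real_distribution_axioms_def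
    by (simp add: sets_eq_imp_space_eq)
qed

lemma nn_integral_tmean:
  assumes "f \<in> borel_measurable borel"
  shows "(\<integral>\<^sup>+x. f x \<partial>tmean \<theta> \<rho>) = (\<integral>\<^sup>+c. \<integral>\<^sup>+x. f x \<partial>tspec \<theta> c \<partial>\<rho>)"
  unfolding tmean_bind[OF \<theta> \<rho>] by (rule nn_integral_bind[OF assms measurable_tspec])

lemma measurable_integral_tspec:
  fixes f :: "real \<Rightarrow> 'b::{banach, second_countable_topology}"
  assumes "f \<in> borel_measurable borel"
  shows "(\<lambda>c. \<integral>x. f x \<partial>tspec \<theta> c) \<in> borel_measurable \<rho>"
  by (rule measurable_compose[OF measurable_tspec integral_measurable_subprob_algebra[OF assms]])

lemma integral_tmean:
  fixes f :: "real \<Rightarrow> real"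
  assumes f: "f \<in> borel_measurable borel" and B: "\<And>x. \<bar>f x\<bar> \<le> B"
  shows "(\<integral>x. f x \<partial>tmean \<theta> \<rho>) = (\<integral>c. \<integral>x. f x \<partial>tspec \<theta> c \<partial>\<rho>)"
  unfolding tmean_bind[OF \<theta> \<rho>]
proof (rule integral_bind[OF f _ measurable_tspec finite_measure_axioms])
  show "AE c in \<rho>. emeasure (tspec \<theta> c) (space (tspec \<theta> c)) \<le> ennreal 1"
    using tspec_props(1)[OF \<theta>] by (simp add: real_distribution_def prob_space.emeasure_space_1)
qed (rule B)

lemma char_tmean: "char (tmean \<theta> \<rho>) t = (\<integral>c. char (tspec \<theta> c) t \<partial>\<rho>)"
proof -
  have re: "Re (char (tspec \<theta> c) t) = (\<integral>x. cos (t * x) \<partial>tspec \<theta> c)" and im: "Im (char (tspec \<theta> c) t) = (\<integral>x. sin (t * x) \<partial>tspec \<theta> c)"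
    and le: "norm (char (tspec \<theta> c) t) \<le> 1" for c
  proof -
    interpret ts: real_distribution "tspec \<theta> c" by (rule tspec_props(1)[OF \<theta>])
    have i: "integrable (tspec \<theta> c) (\<lambda>x. iexp (t * x))" by (rule ts.integrable_iexp) auto
    show "Re (char (tspec \<theta> c) t) = (\<integral>x. cos (t * x) \<partial>tspec \<theta> c)"
      unfolding char_def by (subst integral_Re[OF i, symmetric]) (simp add: Re_exp)
    show "Im (char (tspec \<theta> c) t) = (\<integral>x. sin (t * x) \<partial>tspec \<theta> c)"
      unfolding char_def by (subst integral_Im[OF i, symmetric]) (simp add: Im_exp)
    show "norm (char (tspec \<theta> c) t) \<le> 1" by (rule ts.cmod_char_le_1)
  qed
  interpret tm: real_distribution "tmean \<theta> \<rho>" by (rule real_distribution_tmean)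
  have i: "integrable (tmean \<theta> \<rho>) (\<lambda>x. iexp (t * x))" by (rule tm.integrable_iexp) auto
  have "(\<lambda>c. char (tspec \<theta> c) t) \<in> borel_measurable \<rho>"
    unfolding char_def by (rule measurable_integral_tspec) measurable
  then have ic: "integrable \<rho> (\<lambda>c. char (tspec \<theta> c) t)"
    by (intro integrable_const_bound[where B = 1]) (use le in auto)
  have "Re (char (tmean \<theta> \<rho>) t) = (\<integral>x. cos (t * x) \<partial>tmean \<theta> \<rho>)"
    unfolding char_def by (subst integral_Re[OF i, symmetric]) (simp add: Re_exp)
  also have "\<dots> = Re (\<integral>c. char (tspec \<theta> c) t \<partial>\<rho>)"
    unfolding integral_Re[OF ic, symmetric] re by (rule integral_tmean[where B = 1]) auto
  finally have 1: "Re (char (tmean \<theta> \<rho>) t) = Re (\<integral>c. char (tspec \<theta> c) t \<partial>\<rho>)" .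
  have "Im (char (tmean \<theta> \<rho>) t) = (\<integral>x. sin (t * x) \<partial>tmean \<theta> \<rho>)"
    unfolding char_def by (subst integral_Im[OF i, symmetric]) (simp add: Im_exp)
  also have "\<dots> = Im (\<integral>c. char (tspec \<theta> c) t \<partial>\<rho>)"
    unfolding integral_Im[OF ic, symmetric] im by (rule integral_tmean[where B = 1]) auto
  finally show ?thesis using 1 by (simp add: complex_eq_iff)
qed

end

section \<open>A trace inequality for finite networks\<close>

text \<open>The entries of (1 + s A)^N through the binomial theorem, where A is the weight
  matrix.\<close>

definition xpow :: "'v network \<Rightarrow> complex \<Rightarrow> nat \<Rightarrow> 'v \<Rightarrow> 'v \<Rightarrow> complex" where
  "xpow G s N u v = (\<Sum>k\<le>N. of_nat (N choose k) * s ^ k * wpow G k u v)"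

lemma pexp_poly_xpow: "pexp_poly N t (\<lambda>k. wpow G k v v) = xpow G (\<i> * of_real (t / real N)) N v v"
  by (simp add: pexp_poly_def xpow_def)

lemma xpow_0: "xpow G s 0 u v = unit_vec v u"
  by (simp add: xpow_def wpow_0)

lemma xpow_Suc:
  assumes "finite (verts G)"
  shows "xpow G s (Suc N) u v = xpow G s N u v + s * (\<Sum>z\<in>verts G. wt G u z * xpow G s N z v)"
proof -
  let ?w = "\<lambda>k. s ^ k * wpow G k u v"
  have "xpow G s (Suc N) u v = ?w 0 + (\<Sum>k\<le>N. of_nat (Suc N choose Suc k) * ?w (Suc k))"
    unfolding xpow_def by (subst sum.atMost_Suc_shift) (simp add: mult.assoc)
  also have "\<dots> = (?w 0 + (\<Sum>k\<le>N. of_nat (N choose Suc k) * ?w (Suc k))) + (\<Sum>k\<le>N. of_nat (N choose k) * ?w (Suc k))"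
    by (simp add: sum.distrib[symmetric] algebra_simps)
  also have "?w 0 + (\<Sum>k\<le>N. of_nat (N choose Suc k) * ?w (Suc k)) = (\<Sum>k\<le>Suc N. of_nat (N choose k) * ?w k)"
    by (subst sum.atMost_Suc_shift[of _ N]) simp
  also have "\<dots> = xpow G s N u v" by (simp add: xpow_def mult.assoc)
  also have "(\<Sum>k\<le>N. of_nat (N choose k) * ?w (Suc k)) = s * (\<Sum>z\<in>verts G. wt G u z * xpow G s N z v)"
  proof -
    have "(\<Sum>z\<in>verts G. wt G u z * xpow G s N z v) = (\<Sum>k\<le>N. \<Sum>z\<in>verts G. wt G u z * (of_nat (N choose k) * s ^ k * wpow G k z v))"
      unfolding xpow_def sum_distrib_left by (rule sum.swap)
    also have "\<dots> = (\<Sum>k\<le>N. of_nat (N choose k) * s ^ k * wpow G (Suc k) u v)"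
      using assms by (intro sum.cong refl) (simp add: wpow_Suc sum_distrib_left mult_ac)
    finally show ?thesis by (simp add: sum_distrib_left mult_ac)
  qed
  finally show ?thesis .
qed

context
  fixes V :: "'v set"
  assumes fin: "finite V"
begin

definition mmul :: "('v \<Rightarrow> 'v \<Rightarrow> complex) \<Rightarrow> ('v \<Rightarrow> 'v \<Rightarrow> complex) \<Rightarrow> 'v \<Rightarrow> 'v \<Rightarrow> complex" where
  "mmul M K u v = (\<Sum>z\<in>V. M u z * K z v)"

definition mtr :: "('v \<Rightarrow> 'v \<Rightarrow> complex) \<Rightarrow> complex" where
  "mtr M = (\<Sum>u\<in>V. M u u)"

lemma mmul_assoc: "mmul (mmul M K) L u v = mmul M (mmul K L) u v"
proof -
  have "mmul (mmul M K) L u v = (\<Sum>z\<in>V. \<Sum>y\<in>V. M u y * K y z * L z v)"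
    by (simp add: mmul_def sum_distrib_right)
  also have "\<dots> = (\<Sum>y\<in>V. \<Sum>z\<in>V. M u y * K y z * L z v)" by (rule sum.swap)
  finally show ?thesis by (simp add: mmul_def sum_distrib_left mult.assoc)
qed

lemma mtr_cyclic: "mtr (mmul M K) = mtr (mmul K M)"
proof -
  have "mtr (mmul M K) = (\<Sum>u\<in>V. \<Sum>z\<in>V. M u z * K z u)" by (simp add: mtr_def mmul_def)
  also have "\<dots> = (\<Sum>z\<in>V. \<Sum>u\<in>V. M u z * K z u)" by (rule sum.swap)
  finally show ?thesis by (simp add: mtr_def mmul_def mult.commute)
qed

definition vnorm2 :: "('v \<Rightarrow> complex) \<Rightarrow> real" where
  "vnorm2 f = (\<Sum>u\<in>V. (norm (f u))\<^sup>2)"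

context
  fixes G :: "'v network" and C :: real
  assumes vG: "verts G = V"
    and herm: "\<And>u v. u \<in> V \<Longrightarrow> v \<in> V \<Longrightarrow> wt G u v = cnj (wt G v u)"
    and rows: "\<And>u. u \<in> V \<Longrightarrow> (\<Sum>v\<in>V. norm (wt G u v)) \<le> C"
    and C: "0 \<le> C"
begin

definition xmat :: "complex \<Rightarrow> 'v \<Rightarrow> 'v \<Rightarrow> complex" where
  "xmat s u v = unit_vec v u + s * wt G u v"

lemma mmul_xmat:
  assumes "u \<in> V"
  shows "mmul (xmat s) M u v = M u v + s * (\<Sum>z\<in>V. wt G u z * M z v)"
proof -
  have "(\<Sum>z\<in>V. unit_vec z u * M z v) = (\<Sum>z\<in>V. if z = u then M u v else 0)"
    by (intro sum.cong) (auto simp: unit_vec_def)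
  also have "\<dots> = M u v" using assms fin by simp
  finally show ?thesis
    by (simp add: mmul_def xmat_def distrib_right sum.distrib sum_distrib_left mult.assoc)
qed

lemma xpow_Suc_left: "u \<in> V \<Longrightarrow> xpow G s (Suc N) u v = mmul (xmat s) (xpow G s N) u v"
  using fin vG by (simp add: mmul_xmat xpow_Suc)

lemma xpow_Suc_right: "u \<in> V \<Longrightarrow> v \<in> V \<Longrightarrow> xpow G s (Suc N) u v = mmul (xpow G s N) (xmat s) u v"
proof (induction N arbitrary: u)
  case 0
  have "mmul (xpow G s 0) (xmat s) u v = (\<Sum>z\<in>V. if z = u then xmat s u v else 0)"
    unfolding mmul_def by (intro sum.cong) (auto simp: xpow_0 unit_vec_def)
  also have "\<dots> = xmat s u v" using 0 fin by simp
  moreover have "xpow G s (Suc 0) u v = xmat s u v"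
  proof -
    have "(\<Sum>z\<in>V. wt G u z * unit_vec v z) = (\<Sum>z\<in>V. if z = v then wt G u v else 0)"
      by (intro sum.cong) (auto simp: unit_vec_def)
    also have "\<dots> = wt G u v" using 0 fin by simp
    finally show ?thesis using fin vG by (simp add: xpow_Suc xpow_0 xmat_def)
  qed
  ultimately show ?case by simp
next
  case (Suc N)
  have "xpow G s (Suc (Suc N)) u v = mmul (xmat s) (xpow G s (Suc N)) u v" by (rule xpow_Suc_left[OF Suc.prems(1)])
  also have "\<dots> = mmul (xmat s) (mmul (xpow G s N) (xmat s)) u v"
    unfolding mmul_def[of "xmat s" "xpow G s (Suc N)"] mmul_def[of "xmat s" "mmul (xpow G s N) (xmat s)"]
    using Suc by (intro sum.cong) auto
  also have "\<dots> = mmul (mmul (xmat s) (xpow G s N)) (xmat s) u v" by (rule mmul_assoc[symmetric])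
  also have "\<dots> = mmul (xpow G s (Suc N)) (xmat s) u v"
    unfolding mmul_def[of "mmul (xmat s) (xpow G s N)"] mmul_def[of "xpow G s (Suc N)"]
    using Suc.prems by (intro sum.cong) (simp_all add: xpow_Suc_left)
  finally show ?case .
qed

text \<open>The Schur test again, by Cauchy-Schwarz with the weights split into square
  roots.\<close>

lemma vnorm2_apply_le: "vnorm2 (\<lambda>u. \<Sum>z\<in>V. wt G u z * f z) \<le> C\<^sup>2 * vnorm2 f"
proof -
  let ?a = "\<lambda>u z. norm (wt G u z)"
  have sym: "?a u z = ?a z u" if "u \<in> V" "z \<in> V" for u z
    using arg_cong[OF herm[OF that], of norm] by simp
  have "vnorm2 (\<lambda>u. \<Sum>z\<in>V. wt G u z * f z) \<le> (\<Sum>u\<in>V. C * (\<Sum>z\<in>V. ?a u z * (norm (f z))\<^sup>2))"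
    unfolding vnorm2_def
  proof (intro sum_mono)
    fix u assume u: "u \<in> V"
    have "norm (\<Sum>z\<in>V. wt G u z * f z) \<le> (\<Sum>z\<in>V. sqrt (?a u z) * (sqrt (?a u z) * norm (f z)))"
      by (rule sum_norm_le) (simp add: norm_mult mult.assoc[symmetric])
    then have "(norm (\<Sum>z\<in>V. wt G u z * f z))\<^sup>2 \<le> (\<Sum>z\<in>V. sqrt (?a u z) * (sqrt (?a u z) * norm (f z)))\<^sup>2"
      by (rule power_mono) simp
    also have "\<dots> \<le> (\<Sum>z\<in>V. (sqrt (?a u z))\<^sup>2) * (\<Sum>z\<in>V. (sqrt (?a u z) * norm (f z))\<^sup>2)"
      by (rule Cauchy_Schwarz_ineq_sum)
    also have "\<dots> = (\<Sum>z\<in>V. ?a u z) * (\<Sum>z\<in>V. ?a u z * (norm (f z))\<^sup>2)"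
      by (simp add: power_mult_distrib)
    also have "\<dots> \<le> C * (\<Sum>z\<in>V. ?a u z * (norm (f z))\<^sup>2)"
      using rows[OF u] by (intro mult_right_mono sum_nonneg) auto
    finally show "(norm (\<Sum>z\<in>V. wt G u z * f z))\<^sup>2 \<le> C * (\<Sum>z\<in>V. ?a u z * (norm (f z))\<^sup>2)" .
  qed
  also have "\<dots> = C * (\<Sum>z\<in>V. (\<Sum>u\<in>V. ?a u z) * (norm (f z))\<^sup>2)"
    unfolding sum_distrib_left[symmetric] sum_distrib_right by (subst sum.swap) (rule refl)
  also have "\<dots> = C * (\<Sum>z\<in>V. (\<Sum>u\<in>V. ?a z u) * (norm (f z))\<^sup>2)"
    using sym by (intro arg_cong[of _ _ "\<lambda>x. C * x"] sum.cong refl arg_cong2[of _ _ _ _ "(*)"]) auto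
  also have "\<dots> \<le> C * (\<Sum>z\<in>V. C * (norm (f z))\<^sup>2)"
    using rows C by (intro mult_left_mono sum_mono mult_right_mono) auto
  also have "\<dots> = C\<^sup>2 * vnorm2 f" by (simp add: vnorm2_def sum_distrib_left power2_eq_square mult.assoc)
  finally show ?thesis .
qed

text \<open>The cross terms cancel because the quadratic form of a Hermitian matrix is real.\<close>

lemma vnorm2_xmat_le:
  "vnorm2 (\<lambda>u. f u + \<i> * of_real \<tau> * (\<Sum>z\<in>V. wt G u z * f z)) \<le> (1 + \<tau>\<^sup>2 * C\<^sup>2) * vnorm2 f"
proof -
  let ?A = "\<lambda>u. \<Sum>z\<in>V. wt G u z * f z"
  have sq: "(norm (x + \<i> * of_real \<tau> * y))\<^sup>2 = (norm x)\<^sup>2 + \<tau>\<^sup>2 * (norm y)\<^sup>2 - 2 * \<tau> * Im (cnj x * y)" for x y :: complex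
    by (simp only: cmod_power2) (simp add: power2_eq_square algebra_simps)
  have im: "(\<Sum>u\<in>V. Im (cnj (f u) * ?A u)) = 0"
  proof -
    let ?q = "\<Sum>u\<in>V. cnj (f u) * ?A u"
    have "cnj ?q = (\<Sum>u\<in>V. \<Sum>z\<in>V. f u * (cnj (wt G u z) * cnj (f z)))"
      by (simp add: sum_distrib_left)
    also have "\<dots> = (\<Sum>u\<in>V. \<Sum>z\<in>V. cnj (f z) * (wt G z u * f u))"
    proof (intro sum.cong refl)
      fix u z assume "u \<in> V" "z \<in> V"
      then have "wt G z u = cnj (wt G u z)" by (intro herm)
      then show "f u * (cnj (wt G u z) * cnj (f z)) = cnj (f z) * (wt G z u * f u)" by simp
    qed
    also have "\<dots> = (\<Sum>z\<in>V. \<Sum>u\<in>V. cnj (f z) * (wt G z u * f u))" by (rule sum.swap)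
    also have "\<dots> = ?q" by (simp add: sum_distrib_left)
    finally have "Im ?q = 0" by (metis Reals_cnj_iff complex_is_Real_iff)
    then show ?thesis by simp
  qed
  have "vnorm2 (\<lambda>u. f u + \<i> * of_real \<tau> * ?A u) = vnorm2 f + \<tau>\<^sup>2 * vnorm2 ?A - 2 * \<tau> * (\<Sum>u\<in>V. Im (cnj (f u) * ?A u))"
    unfolding vnorm2_def sq by (simp only: sum.distrib sum_subtractf sum_distrib_left[symmetric])
  also have "\<dots> = vnorm2 f + \<tau>\<^sup>2 * vnorm2 ?A" unfolding im by simp
  also have "\<dots> \<le> vnorm2 f + \<tau>\<^sup>2 * (C\<^sup>2 * vnorm2 f)"
    using vnorm2_apply_le[of f] by (intro add_left_mono mult_left_mono) auto
  finally show ?thesis by (simp add: algebra_simps)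
qed

text \<open>Applied to each column: one factor 1 + i\<tau>A increases the squared norm only by the
  second-order amount \<tau>^2 C^2, so N factors with \<tau> = t / N stay near 1.\<close>

lemma vnorm2_xpow_le:
  "vnorm2 (\<lambda>u. mmul (xpow G (\<i> * of_real \<tau>) j) M u v) \<le> (1 + \<tau>\<^sup>2 * C\<^sup>2) ^ j * vnorm2 (\<lambda>u. M u v)"
proof (induction j)
  case 0
  have "mmul (xpow G (\<i> * of_real \<tau>) 0) M u v = M u v" if "u \<in> V" for u
  proof -
    have "mmul (xpow G (\<i> * of_real \<tau>) 0) M u v = (\<Sum>z\<in>V. if z = u then M u v else 0)"
      unfolding mmul_def by (intro sum.cong) (auto simp: xpow_0 unit_vec_def)
    then show ?thesis using that fin by simp
  qed
  then show ?case by (simp add: vnorm2_def)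
next
  case (Suc j)
  let ?s = "\<i> * of_real \<tau> :: complex"
  let ?f = "\<lambda>u. mmul (xpow G ?s j) M u v"
  have eq: "mmul (xpow G ?s (Suc j)) M u v = ?f u + ?s * (\<Sum>z\<in>V. wt G u z * ?f z)" if u: "u \<in> V" for u
  proof -
    have "mmul (xpow G ?s (Suc j)) M u v = mmul (mmul (xmat ?s) (xpow G ?s j)) M u v"
      unfolding mmul_def[of _ M] using xpow_Suc_left[OF u] by simp
    also have "\<dots> = mmul (xmat ?s) (mmul (xpow G ?s j) M) u v" by (rule mmul_assoc)
    finally show ?thesis by (simp add: mmul_xmat[OF u])
  qed
  have "vnorm2 (\<lambda>u. mmul (xpow G ?s (Suc j)) M u v) = vnorm2 (\<lambda>u. ?f u + ?s * (\<Sum>z\<in>V. wt G u z * ?f z))"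
    unfolding vnorm2_def by (intro sum.cong refl) (simp add: eq)
  also have "\<dots> \<le> (1 + \<tau>\<^sup>2 * C\<^sup>2) * vnorm2 ?f" by (rule vnorm2_xmat_le)
  also have "\<dots> \<le> (1 + \<tau>\<^sup>2 * C\<^sup>2) * ((1 + \<tau>\<^sup>2 * C\<^sup>2) ^ j * vnorm2 (\<lambda>u. M u v))"
    using Suc.IH by (intro mult_left_mono) auto
  finally show ?case by (simp add: mult.assoc)
qed

end

lemma mmul_cong: "(\<And>z. z \<in> V \<Longrightarrow> M u z = M' u z) \<Longrightarrow> (\<And>z. z \<in> V \<Longrightarrow> K z v = K' z v) \<Longrightarrow> mmul M K u v = mmul M' K' u v"
  unfolding mmul_def by (intro sum.cong) auto

text \<open>Telescope over the products X^j Y^{N - j}. Each step is the trace of s (A - B) times a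
  product P, which Cauchy-Schwarz bounds by the rows of A - B and the columns of P. As the columns
  have norm close to 1, the constant C drops out when N grows.\<close>

lemma trace_xpow_diff:
  fixes A B :: "'v network" and C t :: real
  assumes vA: "verts A = V" and vB: "verts B = V"
    and hA: "\<And>u v. u \<in> V \<Longrightarrow> v \<in> V \<Longrightarrow> wt A u v = cnj (wt A v u)"
    and hB: "\<And>u v. u \<in> V \<Longrightarrow> v \<in> V \<Longrightarrow> wt B u v = cnj (wt B v u)"
    and rA: "\<And>u. u \<in> V \<Longrightarrow> (\<Sum>v\<in>V. norm (wt A u v)) \<le> C"
    and rB: "\<And>u. u \<in> V \<Longrightarrow> (\<Sum>v\<in>V. norm (wt B u v)) \<le> C"
    and C: "0 \<le> C" and N: "0 < N"
  shows "norm ((\<Sum>v\<in>V. pexp_poly N t (\<lambda>k. wpow A k v v)) - (\<Sum>v\<in>V. pexp_poly N t (\<lambda>k. wpow B k v v)))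
    \<le> \<bar>t\<bar> * exp ((t * C)\<^sup>2 / real N) * (\<Sum>u\<in>V. sqrt (\<Sum>z\<in>V. (norm (wt A u z - wt B u z))\<^sup>2))"
proof -
  define \<tau> where "\<tau> = t / real N"
  define s where "s = \<i> * complex_of_real \<tau>"
  define q where "q = 1 + \<tau>\<^sup>2 * C\<^sup>2"
  let ?X = "xpow A s" and ?Y = "xpow B s"
  let ?\<Delta> = "\<lambda>u. sqrt (\<Sum>z\<in>V. (norm (wt A u z - wt B u z))\<^sup>2)"
  define a where "a j = mtr (mmul (?X j) (?Y (N - j)))" for j
  have q1: "1 \<le> q" by (simp add: q_def)
  have step: "norm (a (Suc j) - a j) \<le> \<bar>\<tau>\<bar> * q ^ N * (\<Sum>u\<in>V. ?\<Delta> u)" if j: "j < N" for j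
  proof -
    define m where "m = N - Suc j"
    have m: "N - j = Suc m" "N - Suc j = m" "j + m < N" using j by (auto simp: m_def)
    let ?P = "mmul (?X j) (?Y m)"
    have 1: "a (Suc j) = mtr (mmul (xmat A s) ?P)"
    proof -
      have "mmul (?X (Suc j)) (?Y m) u u = mmul (xmat A s) ?P u u" if u: "u \<in> V" for u
      proof -
        have "mmul (?X (Suc j)) (?Y m) u u = mmul (mmul (xmat A s) (?X j)) (?Y m) u u"
          by (intro mmul_cong refl xpow_Suc_left[OF vA hA rA C u])
        then show ?thesis by (simp add: mmul_assoc)
      qed
      then show ?thesis unfolding a_def m(2) mtr_def by simp
    qed
    \<comment> \<open>The spare factor is split off on the right and moved to the left by cyclicity
      of the trace, so that consecutive terms differ only in this first factor.\<close>
    have 2: "a j = mtr (mmul (xmat B s) ?P)"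
    proof -
      have "mmul (?X j) (?Y (Suc m)) u u = mmul ?P (xmat B s) u u" if u: "u \<in> V" for u
      proof -
        have "mmul (?X j) (?Y (Suc m)) u u = mmul (?X j) (mmul (?Y m) (xmat B s)) u u"
          using u by (intro mmul_cong refl xpow_Suc_right[OF vB hB rB C])
        then show ?thesis by (simp add: mmul_assoc)
      qed
      then have "a j = mtr (mmul ?P (xmat B s))" unfolding a_def m(1) mtr_def by simp
      then show ?thesis unfolding mtr_cyclic[of ?P] .
    qed
    have "a (Suc j) - a j = (\<Sum>u\<in>V. s * (\<Sum>z\<in>V. (wt A u z - wt B u z) * ?P z u))"
      unfolding 1 2 mtr_def
      by (subst sum_subtractf[symmetric], intro sum.cong refl)
        (simp add: mmul_xmat[OF vA hA rA C] mmul_xmat[OF vB hB rB C] left_diff_distrib sum_subtractf right_diff_distrib)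
    then have "norm (a (Suc j) - a j) \<le> (\<Sum>u\<in>V. \<bar>\<tau>\<bar> * (?\<Delta> u * q ^ N))"
    proof (simp only:, intro sum_norm_le)
      fix u assume u: "u \<in> V"
      have v1: "vnorm2 (\<lambda>z. ?P z u) \<le> q ^ j * vnorm2 (\<lambda>z. ?Y m z u)"
        unfolding s_def q_def by (rule vnorm2_xpow_le[OF vA hA rA C])
      have v2: "vnorm2 (\<lambda>z. ?Y m z u) \<le> q ^ m"
      proof -
        have "vnorm2 (\<lambda>z. mmul (?Y m) (\<lambda>z v. unit_vec v z) z u) \<le> q ^ m * vnorm2 (\<lambda>z. unit_vec u z)"
          unfolding s_def q_def by (rule vnorm2_xpow_le[OF vB hB rB C])
        moreover have "mmul (?Y m) (\<lambda>z v. unit_vec v z) z u = ?Y m z u" for z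
        proof -
          have "mmul (?Y m) (\<lambda>z v. unit_vec v z) z u = (\<Sum>y\<in>V. if y = u then ?Y m z u else 0)"
            unfolding mmul_def by (intro sum.cong) (auto simp: unit_vec_def)
          then show ?thesis using u fin by simp
        qed
        moreover have "vnorm2 (\<lambda>z. unit_vec u z) = 1"
        proof -
          have "vnorm2 (\<lambda>z. unit_vec u z) = (\<Sum>z\<in>V. if z = u then 1 else 0)"
            unfolding vnorm2_def by (intro sum.cong) (auto simp: unit_vec_def)
          then show ?thesis using u fin by simp
        qed
        ultimately show ?thesis by simp
      qed
      have "vnorm2 (\<lambda>z. ?P z u) \<le> q ^ j * q ^ m"
        by (rule order_trans[OF v1 mult_left_mono[OF v2]]) (use q1 in simp)
      also have "\<dots> = q ^ (j + m)" by (simp add: power_add)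
      also have "\<dots> \<le> q ^ N" using q1 m(3) by (intro power_increasing) auto
      \<comment> \<open>A crude bound that makes the square root equal to q^N; it is harmless since
        q^N \<le> exp ((t C)^2 / N).\<close>
      also have "\<dots> \<le> (q ^ N)\<^sup>2" using q1 by (intro self_le_power) auto
      finally have v: "sqrt (vnorm2 (\<lambda>z. ?P z u)) \<le> q ^ N"
        using q1 by (intro real_le_lsqrt) (auto simp: vnorm2_def sum_nonneg)
      have "norm (\<Sum>z\<in>V. (wt A u z - wt B u z) * ?P z u) \<le> (\<Sum>z\<in>V. \<bar>norm (wt A u z - wt B u z)\<bar> * \<bar>norm (?P z u)\<bar>)"
        by (rule sum_norm_le) (simp add: norm_mult)
      also have "\<dots> \<le> ?\<Delta> u * sqrt (vnorm2 (\<lambda>z. ?P z u))"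
        using L2_set_mult_ineq[of "\<lambda>z. norm (wt A u z - wt B u z)" "\<lambda>z. norm (?P z u)" V]
        by (simp add: L2_set_def vnorm2_def)
      also have "\<dots> \<le> ?\<Delta> u * q ^ N" using v by (intro mult_left_mono) (auto simp: sum_nonneg)
      finally show "norm (s * (\<Sum>z\<in>V. (wt A u z - wt B u z) * ?P z u)) \<le> \<bar>\<tau>\<bar> * (?\<Delta> u * q ^ N)"
        unfolding norm_mult[of s] by (intro mult_mono) (auto simp: s_def norm_mult)
    qed
    then show ?thesis by (simp add: sum_distrib_left sum_distrib_right mult_ac)
  qed
  have "a N - a 0 = (\<Sum>j<N. a (Suc j) - a j)" by (rule sum_lessThan_telescope[symmetric])
  then have "norm (a N - a 0) \<le> (\<Sum>j<N. \<bar>\<tau>\<bar> * q ^ N * (\<Sum>u\<in>V. ?\<Delta> u))"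
    using step by (simp only:) (intro sum_norm_le, auto)
  also have "\<dots> = \<bar>t\<bar> * q ^ N * (\<Sum>u\<in>V. ?\<Delta> u)" using N by (simp add: \<tau>_def)
  also have "\<dots> \<le> \<bar>t\<bar> * exp ((t * C)\<^sup>2 / real N) * (\<Sum>u\<in>V. ?\<Delta> u)"
  proof (intro mult_right_mono mult_left_mono sum_nonneg)
    have "q ^ N \<le> exp (\<tau>\<^sup>2 * C\<^sup>2) ^ N" unfolding q_def by (intro power_mono exp_ge_add_one_self) auto
    also have "\<dots> = exp ((t * C)\<^sup>2 / real N)"
      using N by (simp add: exp_of_nat_mult[symmetric] \<tau>_def power_divide power_mult_distrib power2_eq_square)
    finally show "q ^ N \<le> exp ((t * C)\<^sup>2 / real N)" .
  qed (auto simp: sum_nonneg)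
  finally have fin_le: "norm (a N - a 0) \<le> \<bar>t\<bar> * exp ((t * C)\<^sup>2 / real N) * (\<Sum>u\<in>V. ?\<Delta> u)" .
  have "a N = (\<Sum>v\<in>V. pexp_poly N t (\<lambda>k. wpow A k v v))"
  proof -
    have "mmul (?X N) (?Y 0) v v = ?X N v v" if "v \<in> V" for v
    proof -
      have "mmul (?X N) (?Y 0) v v = (\<Sum>y\<in>V. if y = v then ?X N v v else 0)"
        unfolding mmul_def by (intro sum.cong) (auto simp: xpow_0 unit_vec_def)
      then show ?thesis using that fin by simp
    qed
    then show ?thesis unfolding a_def mtr_def pexp_poly_xpow s_def \<tau>_def by simp
  qed
  moreover have "a 0 = (\<Sum>v\<in>V. pexp_poly N t (\<lambda>k. wpow B k v v))"
  proof -
    have "mmul (?X 0) (?Y N) v v = ?Y N v v" if "v \<in> V" for v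
    proof -
      have "mmul (?X 0) (?Y N) v v = (\<Sum>y\<in>V. if y = v then ?Y N v v else 0)"
        unfolding mmul_def by (intro sum.cong) (auto simp: xpow_0 unit_vec_def)
      then show ?thesis using that fin by simp
    qed
    then show ?thesis unfolding a_def mtr_def pexp_poly_xpow s_def \<tau>_def by simp
  qed
  ultimately show ?thesis using fin_le by simp
qed

end

section \<open>Continuity in the truncation level of sofic laws\<close>

lemma bdd_net_row_sum:
  assumes "bdd_net D G" "u \<in> verts G" "finite (verts G)"
  shows "(\<Sum>v\<in>verts G. norm (wt G u v)) \<le> (real D)\<^sup>2"
proof -
  have "(\<Sum>v\<in>verts G. norm (wt G u v)) = (\<Sum>v\<in>net_row G u. norm (wt G u v))"
    using assms(3) by (intro sum.mono_neutral_right) (auto simp: net_row_def)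
  also have "\<dots> \<le> real (card (net_row G u)) * real D"
    using bdd_netD(3)[OF assms(1,2)] by (intro sum_bounded_above) (auto simp: net_row_def)
  also have "\<dots> \<le> real D * real D"
    using bdd_netD(2)[OF assms(1,2)] by (intro mult_right_mono) auto
  finally show ?thesis by (simp add: power2_eq_square)
qed

lemma bdd_net_deg:
  assumes "bdd_net D G" "u \<in> verts G"
  shows "net_deg G u \<le> (real D) ^ 3"
proof -
  have "net_deg G u = (\<Sum>v\<in>net_row G u. (norm (wt G u v))\<^sup>2)"
    unfolding net_deg_def using bdd_netD(1)[OF assms] by (intro infsum_eq_sum) (auto simp: net_row_def)
  also have "\<dots> \<le> real (card (net_row G u)) * (real D)\<^sup>2"
    using bdd_netD(3)[OF assms] by (intro sum_bounded_above power_mono) (auto simp: net_row_def)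
  also have "\<dots> \<le> real D * (real D)\<^sup>2"
    using bdd_netD(2)[OF assms] by (intro mult_right_mono) auto
  finally show ?thesis by (simp add: power3_eq_cube power2_eq_square mult.assoc)
qed

text \<open>The N-th approximation of the characteristic function of the spectral measure at
  \<open>v\<close>, as a polynomial in local quantities.\<close>

definition pchar :: "real \<Rightarrow> real \<Rightarrow> nat \<Rightarrow> real \<Rightarrow> nat network \<Rightarrow> nat \<Rightarrow> complex" where
  "pchar \<theta> \<epsilon> N t G v = pexp_poly N t (\<lambda>k. wpow (knet \<theta> \<epsilon> G) k v v)"

text \<open>The Euclidean norm of a row of the difference of two truncations.\<close>

definition rowdiff :: "real \<Rightarrow> real \<Rightarrow> real \<Rightarrow> nat network \<Rightarrow> nat \<Rightarrow> real" where
  "rowdiff \<theta> \<theta>' \<epsilon> G v = sqrt (\<Sum>\<^sub>\<infinity>z\<in>verts G. (norm (kern \<theta> \<epsilon> G v z - kern \<theta>' \<epsilon> G v z))\<^sup>2)"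

lemma pchar_bound:
  assumes "is_network G" "v \<in> verts G" "0 < \<theta>" "0 \<le> \<epsilon>" "2 * \<epsilon> \<le> \<theta>"
  shows "norm (pchar \<theta> \<epsilon> N t G v) \<le> exp ((t * sbound (tbound \<theta>))\<^sup>2)"
proof -
  have "v \<in> verts (knet \<theta> \<epsilon> G)" using assms(2) by simp
  note p = spectral_measure_props[OF is_network_knet[OF assms(1,3)] knet_bdd[OF assms(1,3,4,5)] this]
  show ?thesis unfolding pchar_def p(3)[symmetric] by (rule char_moment_limit(2)[OF p(1,2)])
qed

lemma continuous_pchar:
  assumes "0 < \<theta>" "0 < \<epsilon>"
  shows "continuous_on UNIV (\<lambda>c. pchar \<theta> \<epsilon> N t (gnet c) (groot c))"
  unfolding pchar_def pexp_poly_def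
  by (intro continuous_intros local_cont_root local_cont_wpow assms)

lemma continuous_rowdiff:
  assumes "0 < \<theta>" "0 < \<theta>'" "0 < \<epsilon>"
  shows "continuous_on UNIV (\<lambda>c. rowdiff \<theta> \<theta>' \<epsilon> (gnet c) (groot c))"
proof -
  have "local_cont (\<lambda>G u v. \<Sum>\<^sub>\<infinity>z\<in>verts G. (norm (kern \<theta> \<epsilon> G u z - kern \<theta>' \<epsilon> G u z))\<^sup>2 * 1)"
  proof (rule local_cont_sum[where \<eta> = "min \<theta> \<theta>'"])
    show "local_cont (\<lambda>G u z. (norm (kern \<theta> \<epsilon> G u z - kern \<theta>' \<epsilon> G u z))\<^sup>2)"
      by (rule local_contI, intro tendsto_intros local_contD[OF local_cont_kern] assms)
    show "local_cont (\<lambda>(G::nat network) z v. 1 :: real)" by (rule local_contI) simp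
    show "(norm (kern \<theta> \<epsilon> G u z - kern \<theta>' \<epsilon> G u z))\<^sup>2 = 0" if "norm (wt G u z) < min \<theta> \<theta>'" for G u z
      using kern_eq_0[OF assms(1), of G u z \<epsilon>] kern_eq_0[OF assms(2), of G u z \<epsilon>] that by simp
  qed (use assms in auto)
  from local_cont_root[OF this] show ?thesis
    unfolding rowdiff_def by (intro continuous_on_real_sqrt) simp
qed

lemma rowdiff_finite_sum:
  assumes "is_network G" "v \<in> verts G" "0 < \<theta>" "0 < \<theta>'"
  shows "rowdiff \<theta> \<theta>' \<epsilon> G v = sqrt (\<Sum>z\<in>{z \<in> verts G. min \<theta> \<theta>' \<le> norm (wt G v z)}. (norm (kern \<theta> \<epsilon> G v z - kern \<theta>' \<epsilon> G v z))\<^sup>2)"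
  unfolding rowdiff_def
proof (intro arg_cong[of _ _ sqrt] infsum_eq_sum)
  show "finite {z \<in> verts G. min \<theta> \<theta>' \<le> norm (wt G v z)}" using assms by (intro finite_nbrs) auto
  fix z assume "z \<in> verts G" "z \<notin> {z \<in> verts G. min \<theta> \<theta>' \<le> norm (wt G v z)}"
  then have "norm (wt G v z) < \<theta>" "norm (wt G v z) < \<theta>'" by auto
  then show "(norm (kern \<theta> \<epsilon> G v z - kern \<theta>' \<epsilon> G v z))\<^sup>2 = 0" by (simp add: kern_eq_0 assms(3,4))
qed auto

lemma rowdiff_nonneg: "0 \<le> rowdiff \<theta> \<theta>' \<epsilon> G v"
  by (simp add: rowdiff_def infsum_nonneg)

lemma rowdiff_bound:
  assumes "is_network G" "v \<in> verts G" "0 < \<theta>" "0 < \<theta>'" "0 \<le> \<epsilon>" "2 * \<epsilon> \<le> \<theta>" "2 * \<epsilon> \<le> \<theta>'"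
  shows "rowdiff \<theta> \<theta>' \<epsilon> G v \<le> sqrt (2 * real (tbound \<theta>) ^ 3 + 2 * real (tbound \<theta>') ^ 3)"
proof -
  let ?R = "{z \<in> verts G. min \<theta> \<theta>' \<le> norm (wt G v z)}"
  have le: "(\<Sum>z\<in>?R. (norm (kern s \<epsilon> G v z))\<^sup>2) \<le> real (tbound s) ^ 3" if s: "0 < s" "2 * \<epsilon> \<le> s" "min \<theta> \<theta>' \<le> s" for s
  proof -
    have "net_deg (knet s \<epsilon> G) v = (\<Sum>z\<in>?R. (norm (kern s \<epsilon> G v z))\<^sup>2)"
      unfolding net_deg_def knet_simps
    proof (rule infsum_eq_sum)
      show "finite ?R" using assms by (intro finite_nbrs) auto
      fix z assume "z \<in> verts G" "z \<notin> ?R"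
      then have "norm (wt G v z) < s" using s(3) by auto
      then show "(norm (kern s \<epsilon> G v z))\<^sup>2 = 0" by (simp add: kern_eq_0[OF s(1)])
    qed auto
    then show ?thesis
      using bdd_net_deg[OF knet_bdd[OF assms(1) s(1) assms(5) s(2)], of v] assms(2) by simp
  qed
  have "(\<Sum>z\<in>?R. (norm (kern \<theta> \<epsilon> G v z - kern \<theta>' \<epsilon> G v z))\<^sup>2) \<le>
      (\<Sum>z\<in>?R. 2 * (norm (kern \<theta> \<epsilon> G v z))\<^sup>2 + 2 * (norm (kern \<theta>' \<epsilon> G v z))\<^sup>2)"
  proof (intro sum_mono)
    fix z
    have "(norm (kern \<theta> \<epsilon> G v z - kern \<theta>' \<epsilon> G v z))\<^sup>2 \<le> (norm (kern \<theta> \<epsilon> G v z) + norm (kern \<theta>' \<epsilon> G v z))\<^sup>2"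
      by (intro power_mono norm_triangle_ineq4) auto
    also have "\<dots> \<le> 2 * (norm (kern \<theta> \<epsilon> G v z))\<^sup>2 + 2 * (norm (kern \<theta>' \<epsilon> G v z))\<^sup>2"
      using zero_le_power2[of "norm (kern \<theta> \<epsilon> G v z) - norm (kern \<theta>' \<epsilon> G v z)"]
      by (simp add: power2_sum power2_diff)
    finally show "(norm (kern \<theta> \<epsilon> G v z - kern \<theta>' \<epsilon> G v z))\<^sup>2 \<le> 2 * (norm (kern \<theta> \<epsilon> G v z))\<^sup>2 + 2 * (norm (kern \<theta>' \<epsilon> G v z))\<^sup>2" .
  qed
  also have "\<dots> \<le> 2 * real (tbound \<theta>) ^ 3 + 2 * real (tbound \<theta>') ^ 3"
    unfolding sum.distrib sum_distrib_left[symmetric]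
    using le[of \<theta>] le[of \<theta>'] assms by (intro add_mono mult_left_mono) auto
  finally show ?thesis
    unfolding rowdiff_finite_sum[OF assms(1-4)] by (rule real_sqrt_le_mono)
qed

lemma is_network_matrix: "H \<in> admissible Sa Sb n \<Longrightarrow> is_network (matrix_network n H)"
proof -
  assume "H \<in> admissible Sa Sb n"
  then have h: "\<forall>i\<in>{1..n}. \<forall>j\<in>{1..n}. H i j = cnj (H j i)" unfolding admissible_def by blast
  show "is_network (matrix_network n H)"
    unfolding is_network_def
  proof (intro conjI)
    show "\<forall>u\<in>verts (matrix_network n H). \<forall>v\<in>verts (matrix_network n H).
        wt (matrix_network n H) u v = cnj (wt (matrix_network n H) v u)"
      unfolding matrix_network_def network.simps by (rule h)
  qed (simp_all add: matrix_network_def)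
qed

lemma verts_matrix_network [simp]: "verts (matrix_network n H) = {1..n}"
  and wt_matrix_network [simp]: "wt (matrix_network n H) = H"
  by (simp_all add: matrix_network_def)

lemma integral_unif_law:
  fixes f :: "gstar \<Rightarrow> real"
  assumes "continuous_on UNIV f" "0 < n"
  shows "(\<integral>c. f c \<partial>unif_law (matrix_network n H)) = (\<Sum>v=1..n. f (rooted_class (matrix_network n H) v)) / real n"
proof -
  have "(\<integral>c. f c \<partial>unif_law (matrix_network n H)) =
      (\<integral>v. f (rooted_class (matrix_network n H) v) \<partial>uniform_count_measure {1..n})"
    unfolding unif_law_def verts_matrix_network
  proof (rule integral_distr)
    show "f \<in> borel_measurable borel" by (rule borel_measurable_continuous_onI[OF assms(1)])
    show "rooted_class (matrix_network n H) \<in> measurable (uniform_count_measure {1..n}) borel"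
      by (auto simp: measurable_def sets_uniform_count_measure space_uniform_count_measure)
  qed
  then show ?thesis by (simp add: integral_uniform_count_measure)
qed

lemma sofic_average_tendsto:
  fixes f :: "gstar \<Rightarrow> real"
  assumes w: "weak_lim (\<lambda>n. unif_law (matrix_network n (H n))) \<rho> sequentially"
    and f: "continuous_on UNIV f" "\<And>c. \<bar>f c\<bar> \<le> B"
  shows "(\<lambda>n. (\<Sum>v=1..n. f (rooted_class (matrix_network n (H n)) v)) / real n) \<longlonglongrightarrow> (\<integral>c. f c \<partial>\<rho>)"
proof -
  have "bounded (range f)" using f(2) by (auto simp: bounded_iff)
  then have "(\<lambda>n. \<integral>c. f c \<partial>unif_law (matrix_network n (H n))) \<longlonglongrightarrow> (\<integral>c. f c \<partial>\<rho>)"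
    using w f(1) unfolding weak_lim_def by blast
  moreover have "eventually (\<lambda>n. (\<integral>c. f c \<partial>unif_law (matrix_network n (H n))) =
      (\<Sum>v=1..n. f (rooted_class (matrix_network n (H n)) v)) / real n) sequentially"
    using eventually_gt_at_top[of 0] by eventually_elim (rule integral_unif_law[OF f(1)])
  ultimately show ?thesis by (rule Lim_transform_eventually)
qed

lemma rooted_class_pchar:
  assumes "is_network G" "v \<in> verts G"
  shows "pchar \<theta> \<epsilon> N t (gnet (rooted_class G v)) (groot (rooted_class G v)) = pchar \<theta> \<epsilon> N t G v"
    "rowdiff \<theta> \<theta>' \<epsilon> (gnet (rooted_class G v)) (groot (rooted_class G v)) = rowdiff \<theta> \<theta>' \<epsilon> G v"
proof -
  obtain \<sigma> where s: "net_emb \<sigma> (gnet (rooted_class G v)) G" "\<sigma> (groot (rooted_class G v)) = v"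
    using gnet_rooted_class[OF assms] by blast
  let ?G = "gnet (rooted_class G v)" and ?r = "groot (rooted_class G v)"
  have "?r \<in> verts (knet \<theta> \<epsilon> ?G)" by simp
  from net_emb_wpow[OF net_emb_knet[OF s(1)] this this]
  show "pchar \<theta> \<epsilon> N t ?G ?r = pchar \<theta> \<epsilon> N t G v" unfolding pchar_def s(2) by simp
  have "(\<Sum>\<^sub>\<infinity>z\<in>verts G. (norm (kern \<theta> \<epsilon> G v z - kern \<theta>' \<epsilon> G v z))\<^sup>2) =
      (\<Sum>\<^sub>\<infinity>z\<in>verts ?G. (norm (kern \<theta> \<epsilon> G v (\<sigma> z) - kern \<theta>' \<epsilon> G v (\<sigma> z)))\<^sup>2)"
  proof (rule net_emb_infsum[OF s(1)])
    fix y assume y: "y \<in> verts G" "y \<notin> \<sigma> ` verts ?G"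
    have "wt G v y = 0" using net_embD(4)[OF s(1) groot_in y] s(2) by simp
    then show "(norm (kern \<theta> \<epsilon> G v y - kern \<theta>' \<epsilon> G v y))\<^sup>2 = 0" by (simp add: kern_def)
  qed
  also have "\<dots> = (\<Sum>\<^sub>\<infinity>z\<in>verts ?G. (norm (kern \<theta> \<epsilon> ?G ?r z - kern \<theta>' \<epsilon> ?G ?r z))\<^sup>2)"
  proof (intro infsum_cong)
    fix z assume z: "z \<in> verts ?G"
    show "(norm (kern \<theta> \<epsilon> G v (\<sigma> z) - kern \<theta>' \<epsilon> G v (\<sigma> z)))\<^sup>2 = (norm (kern \<theta> \<epsilon> ?G ?r z - kern \<theta>' \<epsilon> ?G ?r z))\<^sup>2"
      using net_emb_kern[OF s(1) groot_in z, of \<theta> \<epsilon>] net_emb_kern[OF s(1) groot_in z, of \<theta>' \<epsilon>] s(2) by simp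
  qed
  finally show "rowdiff \<theta> \<theta>' \<epsilon> ?G ?r = rowdiff \<theta> \<theta>' \<epsilon> G v" unfolding rowdiff_def by simp
qed

lemma integral_complex_tendsto:
  fixes f :: "'a \<Rightarrow> complex"
  assumes "integrable \<rho> f" "(\<lambda>n. Re (a n)) \<longlonglongrightarrow> (\<integral>c. Re (f c) \<partial>\<rho>)" "(\<lambda>n. Im (a n)) \<longlonglongrightarrow> (\<integral>c. Im (f c) \<partial>\<rho>)"
  shows "a \<longlonglongrightarrow> (\<integral>c. f c \<partial>\<rho>)"
  using assms unfolding tendsto_complex_iff by simp

text \<open>The consequence of soficity used for convergence: it replaces the trace inequality,
  which has no direct meaning on infinite networks.\<close>

definition tr_lipschitz :: "gstar measure \<Rightarrow> bool" where
  "tr_lipschitz \<rho> \<longleftrightarrow> (\<forall>\<theta> \<theta>' t. 0 < \<theta> \<longrightarrow> 0 < \<theta>' \<longrightarrow>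
     norm (char (tmean \<theta> \<rho>) t - char (tmean \<theta>' \<rho>) t) \<le> \<bar>t\<bar> * (\<integral>c. rowdiff \<theta> \<theta>' 0 (gnet c) (groot c) \<partial>\<rho>))"

lemma measurable_rowdiff:
  assumes "0 < \<theta>" "0 < \<theta>'"
  shows "(\<lambda>c. rowdiff \<theta> \<theta>' 0 (gnet c) (groot c)) \<in> borel_measurable borel"
    and "(\<lambda>k. rowdiff \<theta> \<theta>' (eps (min \<theta> \<theta>') k) (gnet c) (groot c)) \<longlonglongrightarrow> rowdiff \<theta> \<theta>' 0 (gnet c) (groot c)"
proof -
  have m: "0 < min \<theta> \<theta>'" using assms by simp
  show lim: "(\<lambda>k. rowdiff \<theta> \<theta>' (eps (min \<theta> \<theta>') k) (gnet c) (groot c)) \<longlonglongrightarrow> rowdiff \<theta> \<theta>' 0 (gnet c) (groot c)" for c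
    unfolding rowdiff_finite_sum[OF is_network_gnet groot_in assms]
  proof (intro tendsto_real_sqrt tendsto_sum tendsto_power tendsto_norm tendsto_diff)
    fix z assume "z \<in> {z \<in> verts (gnet c). min \<theta> \<theta>' \<le> norm (wt (gnet c) (groot c) z)}"
    then have z: "z \<in> verts (gnet c)" by simp
    show "(\<lambda>k. kern \<theta> (eps (min \<theta> \<theta>') k) (gnet c) (groot c) z) \<longlonglongrightarrow> kern \<theta> 0 (gnet c) (groot c) z"
      by (rule filterlim_compose[OF tendsto_kern[OF is_network_gnet groot_in z assms(1)] eps_lim[OF m]])
    show "(\<lambda>k. kern \<theta>' (eps (min \<theta> \<theta>') k) (gnet c) (groot c) z) \<longlonglongrightarrow> kern \<theta>' 0 (gnet c) (groot c) z"
      by (rule filterlim_compose[OF tendsto_kern[OF is_network_gnet groot_in z assms(2)] eps_lim[OF m]])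
  qed
  show "(\<lambda>c. rowdiff \<theta> \<theta>' 0 (gnet c) (groot c)) \<in> borel_measurable borel"
    by (rule borel_measurable_LIMSEQ_real[OF lim])
      (intro borel_measurable_continuous_onI continuous_rowdiff assms eps_pos[OF m])
qed

lemma pchar_tendsto:
  assumes "0 < \<theta>" "0 < m"
  shows "(\<lambda>k. pchar \<theta> (eps m k) N t (gnet c) (groot c)) \<longlonglongrightarrow> pchar \<theta> 0 N t (gnet c) (groot c)"
  unfolding pchar_def pexp_poly_def
  by (intro tendsto_sum tendsto_mult tendsto_const filterlim_compose[OF tendsto_wpow_knet eps_lim] is_network_gnet groot_in assms)

text \<open>The inequality for finite matrices is passed through three limits, whose order matters:
  the size n for fixed \<epsilon> > 0 and N, where all functionals are bounded and continuous; then
  \<epsilon>; then N, which turns approximations into characteristic functions and the exponential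
  factor into 1.\<close>

lemma sofic_tr_lipschitz:
  assumes "\<rho> \<in> sofic Sa Sb"
  shows "tr_lipschitz \<rho>"
  unfolding tr_lipschitz_def
proof (intro allI impI)
  fix \<theta> \<theta>' t :: real assume \<theta>: "0 < \<theta>" "0 < \<theta>'"
  have \<rho>: "prob_space \<rho>" "sets \<rho> = sets borel" using assms by (auto simp: sofic_def)
  obtain H where H: "\<And>n. H n \<in> admissible Sa Sb n" and
    w: "weak_lim (\<lambda>n. unif_law (matrix_network n (H n))) \<rho> sequentially"
    using assms by (auto simp: sofic_def)
  interpret prob_space \<rho> by (rule \<rho>)
  have bm: "f \<in> borel_measurable \<rho>" if "f \<in> borel_measurable borel" for f :: "gstar \<Rightarrow> 'b::topological_space"
    using that measurable_cong_sets[OF \<rho>(2) refl] by blast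
  define C where "C = max ((real (tbound \<theta>))\<^sup>2) ((real (tbound \<theta>'))\<^sup>2)"
  define m where "m = min \<theta> \<theta>'"
  have m: "0 < m" using \<theta> by (simp add: m_def)
  let ?B = "\<lambda>s. exp ((t * sbound (tbound s))\<^sup>2)"
  let ?RB = "sqrt (2 * real (tbound \<theta>) ^ 3 + 2 * real (tbound \<theta>') ^ 3)"
  let ?F = "\<lambda>s \<epsilon> N c. pchar s \<epsilon> N t (gnet c) (groot c)" and ?R = "\<lambda>\<epsilon> c. rowdiff \<theta> \<theta>' \<epsilon> (gnet c) (groot c)"
  have cF: "continuous_on UNIV (?F s \<epsilon> N)" if "0 < s" "0 < \<epsilon>" for s \<epsilon> N by (rule continuous_pchar[OF that])
  have bF: "norm (?F s \<epsilon> N c) \<le> ?B s" if "0 < s" "0 \<le> \<epsilon>" "2 * \<epsilon> \<le> s" for s \<epsilon> N c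
    by (rule pchar_bound[OF is_network_gnet groot_in that])
  have bR: "\<bar>?R \<epsilon> c\<bar> \<le> ?RB" if "0 \<le> \<epsilon>" "2 * \<epsilon> \<le> m" for \<epsilon> c
    using rowdiff_bound[OF is_network_gnet groot_in \<theta>, of \<epsilon> c] rowdiff_nonneg[of \<theta> \<theta>' \<epsilon> "gnet c" "groot c"] that
    by (simp add: m_def)
  have mF: "?F s \<epsilon> N \<in> borel_measurable \<rho>" if "0 < s" "0 < \<epsilon>" for s \<epsilon> N
    by (rule bm[OF borel_measurable_continuous_onI[OF cF[OF that]]])
  have iF: "integrable \<rho> (?F s \<epsilon> N)" if "0 < s" "0 < \<epsilon>" "2 * \<epsilon> \<le> s" for s \<epsilon> N
    by (rule integrable_const_bound[where B = "?B s"]) (use bF[of s \<epsilon>] mF that in auto)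
  \<comment> \<open>The limit in the matrix size.\<close>
  have 1: "norm ((\<integral>c. ?F \<theta> \<epsilon> N c \<partial>\<rho>) - (\<integral>c. ?F \<theta>' \<epsilon> N c \<partial>\<rho>)) \<le> \<bar>t\<bar> * exp ((t * C)\<^sup>2 / real N) * (\<integral>c. ?R \<epsilon> c \<partial>\<rho>)"
    if \<epsilon>: "0 < \<epsilon>" "2 * \<epsilon> \<le> m" and N: "0 < N" for \<epsilon> N
  proof -
    have \<epsilon>': "2 * \<epsilon> \<le> \<theta>" "2 * \<epsilon> \<le> \<theta>'" using \<epsilon>(2) by (auto simp: m_def)
    let ?G = "\<lambda>n. matrix_network n (H n)"
    define a where "a s n = (\<Sum>v=1..n. ?F s \<epsilon> N (rooted_class (?G n) v)) / of_nat n" for s n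
    have lim: "a s \<longlonglongrightarrow> (\<integral>c. ?F s \<epsilon> N c \<partial>\<rho>)" if s: "0 < s" "2 * \<epsilon> \<le> s" for s
    proof (rule integral_complex_tendsto[OF iF[OF s(1) \<epsilon>(1) s(2)]])
      have "Re (a s n) = (\<Sum>v=1..n. Re (?F s \<epsilon> N (rooted_class (?G n) v))) / real n" for n
        unfolding a_def by (simp add: Re_divide_of_nat)
      then show "(\<lambda>n. Re (a s n)) \<longlonglongrightarrow> (\<integral>c. Re (?F s \<epsilon> N c) \<partial>\<rho>)"
        using sofic_average_tendsto[OF w continuous_on_Re[OF cF[OF s(1) \<epsilon>(1)]]
          order_trans[OF abs_Re_le_cmod bF[OF s(1) less_imp_le[OF \<epsilon>(1)] s(2)]]] by simp
      have "Im (a s n) = (\<Sum>v=1..n. Im (?F s \<epsilon> N (rooted_class (?G n) v))) / real n" for n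
        unfolding a_def by (simp add: Im_divide_of_nat)
      then show "(\<lambda>n. Im (a s n)) \<longlonglongrightarrow> (\<integral>c. Im (?F s \<epsilon> N c) \<partial>\<rho>)"
        using sofic_average_tendsto[OF w continuous_on_Im[OF cF[OF s(1) \<epsilon>(1)]]
          order_trans[OF abs_Im_le_cmod bF[OF s(1) less_imp_le[OF \<epsilon>(1)] s(2)]]] by simp
    qed
    have limR: "(\<lambda>n. (\<Sum>v=1..n. ?R \<epsilon> (rooted_class (?G n) v)) / real n) \<longlonglongrightarrow> (\<integral>c. ?R \<epsilon> c \<partial>\<rho>)"
      by (rule sofic_average_tendsto[OF w continuous_rowdiff[OF \<theta> \<epsilon>(1)]]) (rule bR[OF less_imp_le[OF \<epsilon>(1)] \<epsilon>(2)])
    have ineq: "norm (a \<theta> n - a \<theta>' n) \<le> \<bar>t\<bar> * exp ((t * C)\<^sup>2 / real N) * ((\<Sum>v=1..n. ?R \<epsilon> (rooted_class (?G n) v)) / real n)" for n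
    proof -
      have net: "is_network (?G n)" by (rule is_network_matrix[OF H])
      have e: "?F s \<epsilon> N (rooted_class (?G n) v) = pexp_poly N t (\<lambda>k. wpow (knet s \<epsilon> (?G n)) k v v)" if "v \<in> {1..n}" for s v
        using rooted_class_pchar(1)[OF net, of v] that by (simp add: pchar_def)
      have r: "?R \<epsilon> (rooted_class (?G n) v) = sqrt (\<Sum>z=1..n. (norm (wt (knet \<theta> \<epsilon> (?G n)) v z - wt (knet \<theta>' \<epsilon> (?G n)) v z))\<^sup>2)" if "v \<in> {1..n}" for v
        using rooted_class_pchar(2)[OF net, of v] that by (simp add: rowdiff_def)
      have hk: "wt (knet s \<epsilon> (?G n)) u v = cnj (wt (knet s \<epsilon> (?G n)) v u)" if "0 < s" "u \<in> {1..n}" "v \<in> {1..n}" for s u v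
        by (rule is_networkD(2)[OF is_network_knet[OF net that(1)]]) (use that in auto)
      have rk: "(\<Sum>v=1..n. norm (wt (knet s \<epsilon> (?G n)) u v)) \<le> C" if s: "0 < s" "2 * \<epsilon> \<le> s" "(real (tbound s))\<^sup>2 \<le> C" and u: "u \<in> {1..n}" for s u
        using bdd_net_row_sum[OF knet_bdd[OF net s(1) less_imp_le[OF \<epsilon>(1)] s(2)], of u] s(3) u by simp
      have "norm ((\<Sum>v=1..n. pexp_poly N t (\<lambda>k. wpow (knet \<theta> \<epsilon> (?G n)) k v v)) - (\<Sum>v=1..n. pexp_poly N t (\<lambda>k. wpow (knet \<theta>' \<epsilon> (?G n)) k v v)))
        \<le> \<bar>t\<bar> * exp ((t * C)\<^sup>2 / real N) * (\<Sum>v=1..n. sqrt (\<Sum>z=1..n. (norm (wt (knet \<theta> \<epsilon> (?G n)) v z - wt (knet \<theta>' \<epsilon> (?G n)) v z))\<^sup>2))"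
        by (rule trace_xpow_diff[OF _ _ _ hk[OF \<theta>(1)] hk[OF \<theta>(2)] rk[OF \<theta>(1) \<epsilon>'(1)] rk[OF \<theta>(2) \<epsilon>'(2)] _ N]) (auto simp: C_def le_max_iff_disj)
      then have le: "norm ((\<Sum>v=1..n. ?F \<theta> \<epsilon> N (rooted_class (?G n) v)) - (\<Sum>v=1..n. ?F \<theta>' \<epsilon> N (rooted_class (?G n) v)))
        \<le> \<bar>t\<bar> * exp ((t * C)\<^sup>2 / real N) * (\<Sum>v=1..n. ?R \<epsilon> (rooted_class (?G n) v))"
        by (simp only: e r cong: sum.cong)
      have "norm (a \<theta> n - a \<theta>' n) = norm ((\<Sum>v=1..n. ?F \<theta> \<epsilon> N (rooted_class (?G n) v)) - (\<Sum>v=1..n. ?F \<theta>' \<epsilon> N (rooted_class (?G n) v))) / real n"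
        unfolding a_def diff_divide_distrib[symmetric] by (simp add: norm_divide)
      also have "\<dots> \<le> (\<bar>t\<bar> * exp ((t * C)\<^sup>2 / real N) * (\<Sum>v=1..n. ?R \<epsilon> (rooted_class (?G n) v))) / real n"
        by (rule divide_right_mono[OF le]) simp
      finally show ?thesis by simp
    qed
    show ?thesis
      by (rule LIMSEQ_le[OF tendsto_norm[OF tendsto_diff[OF lim[OF \<theta>(1) \<epsilon>'(1)] lim[OF \<theta>(2) \<epsilon>'(2)]]] tendsto_mult[OF tendsto_const limR]])
        (use ineq in auto)
  qed
  let ?e = "eps m"
  have e: "0 < ?e k" "2 * ?e k \<le> m" "2 * ?e k \<le> \<theta>" "2 * ?e k \<le> \<theta>'" for k
    using eps_pos[OF m] eps_le[OF m, of k] by (auto simp: m_def)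
  \<comment> \<open>The limit \<epsilon> \<rightarrow> 0, dominated because the bounds depend only
    on the truncation levels.\<close>
  have 2: "norm ((\<integral>c. ?F \<theta> 0 N c \<partial>\<rho>) - (\<integral>c. ?F \<theta>' 0 N c \<partial>\<rho>)) \<le> \<bar>t\<bar> * exp ((t * C)\<^sup>2 / real N) * (\<integral>c. ?R 0 c \<partial>\<rho>)"
    if N: "0 < N" for N
  proof -
    have l: "(\<lambda>k. \<integral>c. ?F s (?e k) N c \<partial>\<rho>) \<longlonglongrightarrow> (\<integral>c. ?F s 0 N c \<partial>\<rho>)" if s: "0 < s" "\<And>k. 2 * ?e k \<le> s" for s
    proof (rule integral_dominated_convergence[where w = "\<lambda>_. ?B s"])
      show mk: "?F s (?e k) N \<in> borel_measurable \<rho>" for k by (rule mF[OF s(1) e(1)])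
      show "?F s 0 N \<in> borel_measurable \<rho>"
        by (rule borel_measurable_LIMSEQ_metric[OF mk]) (rule pchar_tendsto[OF s(1) m])
      show "AE c in \<rho>. (\<lambda>k. ?F s (?e k) N c) \<longlonglongrightarrow> ?F s 0 N c" using pchar_tendsto[OF s(1) m] by simp
      show "AE c in \<rho>. norm (?F s (?e k) N c) \<le> ?B s" for k using bF[OF s(1) less_imp_le[OF e(1)] s(2)] by simp
    qed simp
    have lR: "(\<lambda>k. \<integral>c. ?R (?e k) c \<partial>\<rho>) \<longlonglongrightarrow> (\<integral>c. ?R 0 c \<partial>\<rho>)"
    proof (rule integral_dominated_convergence[where w = "\<lambda>_. ?RB"])
      show "?R (?e k) \<in> borel_measurable \<rho>" for k
        by (rule bm[OF borel_measurable_continuous_onI[OF continuous_rowdiff[OF \<theta> e(1)]]])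
      show "?R 0 \<in> borel_measurable \<rho>" by (rule bm[OF measurable_rowdiff(1)[OF \<theta>]])
      show "AE c in \<rho>. (\<lambda>k. ?R (?e k) c) \<longlonglongrightarrow> ?R 0 c" using measurable_rowdiff(2)[OF \<theta>] by (simp add: m_def)
      show "AE c in \<rho>. norm (?R (?e k) c) \<le> ?RB" for k using bR[OF less_imp_le[OF e(1)] e(2)] by simp
    qed simp
    show ?thesis
      by (rule LIMSEQ_le[OF tendsto_norm[OF tendsto_diff[OF l[OF \<theta>(1) e(3)] l[OF \<theta>(2) e(4)]]] tendsto_mult[OF tendsto_const lR]])
        (use 1[OF e(1,2) N] in auto)
  qed
  \<comment> \<open>The limit in N, with the bound of \<open>pchar_bound\<close>, which is uniform
    in N.\<close>
  have l: "(\<lambda>N. \<integral>c. ?F s 0 N c \<partial>\<rho>) \<longlonglongrightarrow> char (tmean s \<rho>) t" if s: "0 < s" for s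
    unfolding char_tmean[OF s \<rho>]
  proof (rule integral_dominated_convergence[where w = "\<lambda>_. ?B s"])
    note ts = tspec_props[OF s]
    have eq: "?F s 0 N c = pexp_poly N t (\<lambda>k. of_real (\<integral>x. x ^ k \<partial>tspec s c))" for N c
      unfolding pchar_def ts(3) ..
    show pt: "AE c in \<rho>. (\<lambda>N. ?F s 0 N c) \<longlonglongrightarrow> char (tspec s c) t"
      unfolding eq using char_moment_limit(1)[OF ts(1,2)] by simp
    show mk: "?F s 0 N \<in> borel_measurable \<rho>" for N
      by (rule borel_measurable_LIMSEQ_metric[OF mF[OF s eps_pos[OF s]]]) (rule pchar_tendsto[OF s s])
    show "(\<lambda>c. char (tspec s c) t) \<in> borel_measurable \<rho>"
      unfolding char_def by (rule measurable_integral_tspec[OF s \<rho>]) measurable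
    show "AE c in \<rho>. norm (?F s 0 N c) \<le> ?B s" for N using bF[OF s order_refl] s by simp
  qed simp
  have "(\<lambda>N. (t * C)\<^sup>2 / real N) \<longlonglongrightarrow> 0" by (rule lim_const_over_n)
  then have ex: "(\<lambda>N. exp ((t * C)\<^sup>2 / real N)) \<longlonglongrightarrow> exp 0" by (rule tendsto_exp)
  have "norm (char (tmean \<theta> \<rho>) t - char (tmean \<theta>' \<rho>) t) \<le> \<bar>t\<bar> * exp 0 * (\<integral>c. ?R 0 c \<partial>\<rho>)"
    by (rule LIMSEQ_le[OF tendsto_norm[OF tendsto_diff[OF l[OF \<theta>(1)] l[OF \<theta>(2)]]] tendsto_mult[OF tendsto_mult[OF tendsto_const ex] tendsto_const]])
      (use 2 in \<open>auto intro!: exI[of _ 1]\<close>)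
  then show "norm (char (tmean \<theta> \<rho>) t - char (tmean \<theta>' \<rho>) t) \<le> \<bar>t\<bar> * (\<integral>c. ?R 0 c \<partial>\<rho>)" by simp
qed

section \<open>Moments of the weights at the root\<close>

lemma summable_on_ennreal: "(f :: 'a \<Rightarrow> ennreal) summable_on A"
  by (rule nonneg_summable_on_complete) simp

lemma sum_le_infsum_ennreal:
  fixes f :: "'a \<Rightarrow> ennreal"
  assumes "finite F" "F \<subseteq> A"
  shows "sum f F \<le> infsum f A"
  using assms by (subst nonneg_infsum_complete) (auto intro: SUP_upper)

text \<open>The inclusion of \<ell>^\<alpha> in \<ell>^2. If x is the sum of the powers, every
  modulus is at most x^{1/\<alpha>}, so a square is at most the \<alpha>-th power times x^{(2 -
  \<alpha>)/\<alpha>}.\<close>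

lemma net_deg_powr_le:
  assumes G: "is_network G" and v: "v \<in> verts G" and \<alpha>: "0 < \<alpha>" "\<alpha> \<le> 2"
  shows "ennreal (net_deg G v powr (\<alpha> / 2)) \<le> (\<Sum>\<^sub>\<infinity>z\<in>verts G. ennreal (norm (wt G v z) powr \<alpha>))" (is "_ \<le> ?X")
proof (cases "?X = top")
  case False
  then obtain x where x: "?X = ennreal x" "0 \<le> x" by (cases ?X) auto
  let ?a = "\<lambda>z. norm (wt G v z)"
  have F: "(\<Sum>z\<in>F. ?a z powr \<alpha>) \<le> x" if "finite F" "F \<subseteq> verts G" for F
  proof -
    have "ennreal (\<Sum>z\<in>F. ?a z powr \<alpha>) = (\<Sum>z\<in>F. ennreal (?a z powr \<alpha>))" by (simp add: sum_ennreal)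
    also have "\<dots> \<le> ennreal x"
      unfolding x(1)[symmetric] using that by (rule sum_le_infsum_ennreal)
    finally show ?thesis using x(2) by (simp add: ennreal_le_iff)
  qed
  have each: "?a z \<le> x powr (1 / \<alpha>)" if "z \<in> verts G" for z
  proof -
    have "?a z powr \<alpha> \<le> x" using F[of "{z}"] that by simp
    then have "(?a z powr \<alpha>) powr (1 / \<alpha>) \<le> x powr (1 / \<alpha>)" using \<alpha> by (intro powr_mono2) auto
    then show ?thesis using \<alpha> by (simp add: powr_powr)
  qed
  have "(\<Sum>z\<in>F. (?a z)\<^sup>2) \<le> x powr (2 / \<alpha>)" if FF: "finite F" "F \<subseteq> verts G" for F
  proof -
    have "(\<Sum>z\<in>F. (?a z)\<^sup>2) \<le> (\<Sum>z\<in>F. ?a z powr \<alpha> * x powr ((2 - \<alpha>) / \<alpha>))"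
    proof (intro sum_mono)
      fix z assume "z \<in> F"
      then have z: "z \<in> verts G" using FF by auto
      have "(?a z)\<^sup>2 = ?a z powr \<alpha> * ?a z powr (2 - \<alpha>)"
        by (cases "?a z = 0") (simp_all add: powr_add[symmetric] powr_realpow)
      also have "\<dots> \<le> ?a z powr \<alpha> * (x powr (1 / \<alpha>)) powr (2 - \<alpha>)"
        using each[OF z] \<alpha> by (intro mult_left_mono powr_mono2) auto
      finally show "(?a z)\<^sup>2 \<le> ?a z powr \<alpha> * x powr ((2 - \<alpha>) / \<alpha>)" by (simp add: powr_powr)
    qed
    also have "\<dots> \<le> x * x powr ((2 - \<alpha>) / \<alpha>)"
      unfolding sum_distrib_right[symmetric] by (intro mult_right_mono F FF) auto
    also have "\<dots> = x powr (2 / \<alpha>)"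
    proof (cases "x = 0")
      case False
      have "x * x powr ((2 - \<alpha>) / \<alpha>) = x powr (1 + (2 - \<alpha>) / \<alpha>)" using x(2) False by (simp add: powr_add)
      also have "1 + (2 - \<alpha>) / \<alpha> = 2 / \<alpha>" using \<alpha> by (simp add: field_simps)
      finally show ?thesis .
    qed simp
    finally show ?thesis .
  qed
  then have "net_deg G v \<le> x powr (2 / \<alpha>)"
    unfolding net_deg_def by (intro infsum_le_finite_sums is_networkD(3)[OF G v])
  moreover have "0 \<le> net_deg G v" by (simp add: net_deg_def infsum_nonneg)
  ultimately have "net_deg G v powr (\<alpha> / 2) \<le> (x powr (2 / \<alpha>)) powr (\<alpha> / 2)"
    using \<alpha> by (intro powr_mono2) auto
  also have "\<dots> = x" using \<alpha> x(2) by (cases "x = 0") (auto simp: powr_powr)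
  finally show ?thesis unfolding x(1) by (rule ennreal_leI)
qed simp

text \<open>Infinite sums of weights are only lower semicontinuous: finite partial sums are
  transported by the matching, while light distant edges may escape. The flag \<open>E\<close>
  excludes the root itself.\<close>

lemma borel_weight_sum:
  assumes "0 < \<alpha>"
  shows "(\<lambda>c. \<Sum>\<^sub>\<infinity>v\<in>verts (gnet c) - (if E then {groot c} else {}). ennreal (norm (wt (gnet c) (groot c) v) powr \<alpha>)) \<in> borel_measurable borel"
    (is "?g \<in> _")
proof (rule borel_measurableI_greater)
  fix r :: ennreal
  have "open {c. r < ?g c}"
  proof (rule open_nearI)
    fix c assume "c \<in> {c. r < ?g c}"
    then have "r < (SUP F\<in>{F. finite F \<and> F \<subseteq> verts (gnet c) - (if E then {groot c} else {})}. \<Sum>v\<in>F. ennreal (norm (wt (gnet c) (groot c) v) powr \<alpha>))"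
      by (simp add: nonneg_infsum_complete)
    then obtain F where F: "finite F" "F \<subseteq> verts (gnet c) - (if E then {groot c} else {})"
      "r < (\<Sum>v\<in>F. ennreal (norm (wt (gnet c) (groot c) v) powr \<alpha>))"
      unfolding less_SUP_iff by blast
    have Fv: "v \<in> verts (gnet c)" "E \<Longrightarrow> v \<noteq> groot c" if "v \<in> F" for v using F(2) that by (auto split: if_splits)
    have e1: "eventually (\<lambda>p. \<forall>x\<in>F. \<forall>y\<in>F. x \<noteq> y \<longrightarrow> snd p x \<noteq> snd p y) (nearF c)"
      using F(1) Fv by (intro eventually_ball_finite ballI) (auto intro: nearF_inj)
    have e2: "eventually (\<lambda>p. \<forall>x\<in>F. snd p x \<in> verts (gnet (fst p))) (nearF c)"
      using F(1) Fv by (intro eventually_ball_finite ballI) (auto intro: nearF_in)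
    have e3: "eventually (\<lambda>p. \<forall>x\<in>F. E \<longrightarrow> snd p x \<noteq> snd p (groot c)) (nearF c)"
      using F(1)
    proof (rule eventually_ball_finite, intro ballI)
      fix x assume x: "x \<in> F"
      show "eventually (\<lambda>p. E \<longrightarrow> snd p x \<noteq> snd p (groot c)) (nearF c)"
      proof (cases E)
        case True
        then show ?thesis using nearF_inj[OF Fv(1)[OF x] groot_in Fv(2)[OF x True]] by simp
      qed simp
    qed
    have "((\<lambda>p. \<Sum>v\<in>F. ennreal (norm (wt (gnet (fst p)) (snd p (groot c)) (snd p v)) powr \<alpha>)) \<longlongrightarrow>
        (\<Sum>v\<in>F. ennreal (norm (wt (gnet c) (groot c) v) powr \<alpha>))) (nearF c)"
      using Fv assms by (intro tendsto_sum tendsto_ennrealI tendsto_powr' tendsto_norm nearF_wt) auto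
    then have e4: "eventually (\<lambda>p. r < (\<Sum>v\<in>F. ennreal (norm (wt (gnet (fst p)) (snd p (groot c)) (snd p v)) powr \<alpha>))) (nearF c)"
      using F(3) by (rule order_tendstoD(1))
    show "eventually (\<lambda>p. fst p \<in> {c. r < ?g c}) (nearF c)"
      using e1 e2 e3 e4 nearF_root
    proof eventually_elim
      case (elim p)
      have "(\<Sum>v\<in>F. ennreal (norm (wt (gnet (fst p)) (snd p (groot c)) (snd p v)) powr \<alpha>)) =
          (\<Sum>v\<in>snd p ` F. ennreal (norm (wt (gnet (fst p)) (groot (fst p)) v) powr \<alpha>))"
        using elim(1,5) by (subst sum.reindex) (auto simp: inj_on_def)
      also have "\<dots> \<le> ?g (fst p)"
        using F(1) elim(2,3,5) by (intro sum_le_infsum_ennreal) (auto split: if_splits)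
      finally show ?case using elim(4) by simp
    qed
  qed
  then show "{c \<in> space borel. r < ?g c} \<in> sets borel" by simp
qed

lemma borel_xi: "0 < \<alpha> \<Longrightarrow> xi \<alpha> \<in> borel_measurable borel"
  using borel_weight_sum[of \<alpha> False] by (simp add: xi_def[abs_def])

lemma borel_root_wt: "(\<lambda>c. wt (gnet c) (groot c) (groot c)) \<in> borel_measurable borel"
  by (intro borel_measurable_continuous_onI local_cont_root local_cont_wt)

lemma xi_split:
  "xi \<alpha> c = ennreal (norm (wt (gnet c) (groot c) (groot c)) powr \<alpha>) +
     (\<Sum>\<^sub>\<infinity>v\<in>verts (gnet c) - {groot c}. ennreal (norm (wt (gnet c) (groot c) v) powr \<alpha>))"
proof -
  have "verts (gnet c) = {groot c} \<union> (verts (gnet c) - {groot c})" by auto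
  then have "xi \<alpha> c = (\<Sum>\<^sub>\<infinity>v\<in>{groot c} \<union> (verts (gnet c) - {groot c}). ennreal (norm (wt (gnet c) (groot c) v) powr \<alpha>))"
    by (simp add: xi_def)
  also have "\<dots> = (\<Sum>\<^sub>\<infinity>v\<in>{groot c}. ennreal (norm (wt (gnet c) (groot c) v) powr \<alpha>)) +
     (\<Sum>\<^sub>\<infinity>v\<in>verts (gnet c) - {groot c}. ennreal (norm (wt (gnet c) (groot c) v) powr \<alpha>))"
    by (intro infsum_Un_disjoint summable_on_ennreal) auto
  finally show ?thesis by simp
qed

section \<open>Truncation errors\<close>

text \<open>Dominated convergence for sums: outside a finite set both tails are between 0 and the
  small tail of \<open>g\<close>.\<close>

lemma tendsto_infsum_dominated:
  fixes f :: "nat \<Rightarrow> 'a \<Rightarrow> real"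
  assumes g: "g summable_on A" and f: "\<And>n z. z \<in> A \<Longrightarrow> 0 \<le> f n z" "\<And>n z. z \<in> A \<Longrightarrow> f n z \<le> g z"
    and lim: "\<And>z. z \<in> A \<Longrightarrow> (\<lambda>n. f n z) \<longlonglongrightarrow> h z"
  shows "(\<lambda>n. \<Sum>\<^sub>\<infinity>z\<in>A. f n z) \<longlonglongrightarrow> (\<Sum>\<^sub>\<infinity>z\<in>A. h z)"
proof (rule tendstoI)
  fix e :: real assume e: "0 < e"
  have h: "0 \<le> h z" "h z \<le> g z" if "z \<in> A" for z
    using LIMSEQ_le_const[OF lim[OF that]] LIMSEQ_le_const2[OF lim[OF that]] f that by blast+
  have fs: "f n summable_on B" if "B \<subseteq> A" for n B
    using summable_on_subset_banach[OF g that] by (rule summable_on_comparison_test) (use f that in auto)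
  have hs: "h summable_on B" if "B \<subseteq> A" for B
    using summable_on_subset_banach[OF g that] by (rule summable_on_comparison_test) (use h that in auto)
  have "eventually (\<lambda>F. dist (sum g F) (infsum g A) < e / 4) (finite_subsets_at_top A)"
    by (rule tendstoD[OF infsum_tendsto[OF g]]) (use e in simp)
  then obtain F where F: "finite F" "F \<subseteq> A" "dist (sum g F) (infsum g A) < e / 4"
    unfolding eventually_finite_subsets_at_top by blast
  have split: "infsum u A = sum u F + infsum u (A - F)" if "u summable_on A" "u summable_on (A - F)" for u :: "'a \<Rightarrow> real"
  proof -
    have "infsum u (F \<union> (A - F)) = infsum u F + infsum u (A - F)"
      using F(1) that by (intro infsum_Un_disjoint) auto
    moreover have "F \<union> (A - F) = A" using F(2) by auto
    ultimately show ?thesis using F(1) by simp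
  qed
  have gs: "g summable_on (A - F)" by (rule summable_on_subset_banach[OF g]) auto
  have tail: "infsum g (A - F) < e / 4" using F(3) split[OF g gs] by (simp add: dist_real_def)
  have tf: "0 \<le> infsum (f n) (A - F)" "infsum (f n) (A - F) \<le> infsum g (A - F)" for n
    using f by (auto intro!: infsum_nonneg infsum_mono fs gs)
  have th: "0 \<le> infsum h (A - F)" "infsum h (A - F) \<le> infsum g (A - F)"
    using h by (auto intro!: infsum_nonneg infsum_mono hs gs)
  have "(\<lambda>n. sum (f n) F) \<longlonglongrightarrow> sum h F" using F(2) by (intro tendsto_sum lim) auto
  then have "eventually (\<lambda>n. dist (sum (f n) F) (sum h F) < e / 4) sequentially" using e by (intro tendstoD) auto
  then show "eventually (\<lambda>n. dist (\<Sum>\<^sub>\<infinity>z\<in>A. f n z) (\<Sum>\<^sub>\<infinity>z\<in>A. h z) < e) sequentially"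
  proof eventually_elim
    case (elim n)
    moreover have "infsum (f n) A = sum (f n) F + infsum (f n) (A - F)" by (rule split[OF fs fs]) auto
    moreover have "infsum h A = sum h F + infsum h (A - F)" by (rule split[OF hs hs]) auto
    ultimately show ?case
      using tf[of n] th tail unfolding dist_real_def by linarith
  qed
qed

text \<open>The Euclidean norm of the part of a row that the truncation removes.\<close>

definition rowtail :: "real \<Rightarrow> nat network \<Rightarrow> nat \<Rightarrow> real" where
  "rowtail \<theta> G v = sqrt (\<Sum>\<^sub>\<infinity>z\<in>verts G. (norm (kern \<theta> 0 G v z - wt G v z))\<^sup>2)"

lemma kern_diff_le:
  assumes "0 < \<theta>"
  shows "norm (kern \<theta> \<epsilon> G u v - wt G u v) \<le> norm (wt G u v)"
  unfolding kern_def by (rule norm_tw_diff_le[OF assms])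

lemma kern_kern_diff_le:
  assumes "0 < \<theta>" "0 < \<theta>'"
  shows "norm (kern \<theta> \<epsilon> G u v - kern \<theta>' \<epsilon> G u v) \<le> norm (wt G u v)"
proof -
  let ?D = "max (ldeg \<epsilon> G u) (ldeg \<epsilon> G v)" and ?z = "wt G u v"
  obtain s where s: "0 \<le> s" "s \<le> 1" "tw \<theta> ?D ?z = of_real s * ?z" by (rule tw_scale[OF assms(1)])
  obtain s' where s': "0 \<le> s'" "s' \<le> 1" "tw \<theta>' ?D ?z = of_real s' * ?z" by (rule tw_scale[OF assms(2)])
  have "kern \<theta> \<epsilon> G u v - kern \<theta>' \<epsilon> G u v = of_real (s - s') * ?z"
    unfolding kern_def s(3) s'(3) by (simp add: algebra_simps)
  also have "norm \<dots> \<le> norm ?z" unfolding norm_mult norm_of_real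
    using s(1,2) s'(1,2) by (intro mult_left_le_one_le) auto
  finally show ?thesis .
qed

context
  fixes G :: "nat network" and v :: nat
  assumes G: "is_network G" and v: "v \<in> verts G"
begin

lemma rowtail_summable: "0 < \<theta> \<Longrightarrow> (\<lambda>z. (norm (kern \<theta> 0 G v z - wt G v z))\<^sup>2) summable_on verts G"
  by (rule summable_on_comparison_test[OF is_networkD(3)[OF G v]]) (auto intro!: power_mono kern_diff_le)

lemma rowtail_le: "0 < \<theta> \<Longrightarrow> rowtail \<theta> G v \<le> sqrt (net_deg G v)"
  unfolding rowtail_def net_deg_def
  by (intro real_sqrt_le_mono infsum_mono rowtail_summable is_networkD(3)[OF G v] power_mono kern_diff_le) auto

lemma rowtail_nonneg: "0 \<le> rowtail \<theta> G v"
  by (simp add: rowtail_def infsum_nonneg)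

text \<open>From (x + y)^2 \<le> 2 x^2 + 2 y^2; the factor 2 rounds up the square root of 2.\<close>

lemma rowdiff_le_rowtail:
  assumes "0 < \<theta>" "0 < \<theta>'"
  shows "rowdiff \<theta> \<theta>' 0 G v \<le> 2 * (rowtail \<theta> G v + rowtail \<theta>' G v)"
proof -
  let ?f = "\<lambda>z. (norm (kern \<theta> 0 G v z - wt G v z))\<^sup>2" and ?f' = "\<lambda>z. (norm (kern \<theta>' 0 G v z - wt G v z))\<^sup>2"
  note s = rowtail_summable[OF assms(1)] rowtail_summable[OF assms(2)]
  have "(\<Sum>\<^sub>\<infinity>z\<in>verts G. (norm (kern \<theta> 0 G v z - kern \<theta>' 0 G v z))\<^sup>2) \<le> (\<Sum>\<^sub>\<infinity>z\<in>verts G. 2 * ?f z + 2 * ?f' z)"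
  proof (rule infsum_mono)
    show "(\<lambda>z. (norm (kern \<theta> 0 G v z - kern \<theta>' 0 G v z))\<^sup>2) summable_on verts G"
      by (rule summable_on_comparison_test[OF is_networkD(3)[OF G v]])
        (auto intro!: power_mono kern_kern_diff_le assms)
    show "(\<lambda>z. 2 * ?f z + 2 * ?f' z) summable_on verts G" by (intro summable_on_add summable_on_cmult_right s)
    fix z
    have "norm (kern \<theta> 0 G v z - kern \<theta>' 0 G v z) \<le> norm (kern \<theta> 0 G v z - wt G v z) + norm (kern \<theta>' 0 G v z - wt G v z)"
      using norm_triangle_ineq4[of "kern \<theta> 0 G v z - wt G v z" "kern \<theta>' 0 G v z - wt G v z"] by simp
    then have "(norm (kern \<theta> 0 G v z - kern \<theta>' 0 G v z))\<^sup>2 \<le> (norm (kern \<theta> 0 G v z - wt G v z) + norm (kern \<theta>' 0 G v z - wt G v z))\<^sup>2"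
      by (rule power_mono) simp
    also have "\<dots> \<le> 2 * ?f z + 2 * ?f' z"
      using zero_le_power2[of "norm (kern \<theta> 0 G v z - wt G v z) - norm (kern \<theta>' 0 G v z - wt G v z)"]
      by (simp add: power2_sum power2_diff)
    finally show "(norm (kern \<theta> 0 G v z - kern \<theta>' 0 G v z))\<^sup>2 \<le> 2 * ?f z + 2 * ?f' z" .
  qed
  also have "\<dots> = 2 * infsum ?f (verts G) + 2 * infsum ?f' (verts G)"
    using s by (simp add: infsum_add summable_on_cmult_right infsum_cmult_right)
  finally have "rowdiff \<theta> \<theta>' 0 G v \<le> sqrt (2 * infsum ?f (verts G) + 2 * infsum ?f' (verts G))"
    unfolding rowdiff_def by (rule real_sqrt_le_mono)
  also have "\<dots> \<le> sqrt (2 * infsum ?f (verts G)) + sqrt (2 * infsum ?f' (verts G))"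
    by (rule sqrt_add_le_add_sqrt) (auto intro!: infsum_nonneg)
  also have "\<dots> = sqrt 2 * rowtail \<theta> G v + sqrt 2 * rowtail \<theta>' G v" by (simp add: rowtail_def real_sqrt_mult)
  also have "\<dots> \<le> 2 * rowtail \<theta> G v + 2 * rowtail \<theta>' G v"
    by (intro add_mono mult_right_mono rowtail_nonneg) (auto intro!: real_le_lsqrt)
  finally show ?thesis by simp
qed

text \<open>Exhibits the tail as a limit of functions already known to be Borel, see
  \<open>borel_rowtail\<close>.\<close>

lemma rowdiff_tendsto_rowtail:
  assumes "0 < \<theta>" "\<And>n. 0 < t n" "t \<longlonglongrightarrow> 0"
  shows "(\<lambda>n. rowdiff \<theta> (t n) 0 G v) \<longlonglongrightarrow> rowtail \<theta> G v"
  unfolding rowdiff_def rowtail_def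
proof (intro tendsto_real_sqrt tendsto_infsum_dominated[OF is_networkD(3)[OF G v]])
  fix n z
  show "(norm (kern \<theta> 0 G v z - kern (t n) 0 G v z))\<^sup>2 \<le> (norm (wt G v z))\<^sup>2"
    by (intro power_mono kern_kern_diff_le assms) auto
next
  fix z assume "z \<in> verts G"
  then show "(\<lambda>n. (norm (kern \<theta> 0 G v z - kern (t n) 0 G v z))\<^sup>2) \<longlonglongrightarrow> (norm (kern \<theta> 0 G v z - wt G v z))\<^sup>2"
    using assms by (intro tendsto_intros tendsto_kern_0 G v) auto
qed auto

lemma rowtail_tendsto_0:
  assumes "\<And>n. 0 < t n" "t \<longlonglongrightarrow> 0"
  shows "(\<lambda>n. rowtail (t n) G v) \<longlonglongrightarrow> 0"
proof -
  have "(\<lambda>n. \<Sum>\<^sub>\<infinity>z\<in>verts G. (norm (kern (t n) 0 G v z - wt G v z))\<^sup>2) \<longlonglongrightarrow> (\<Sum>\<^sub>\<infinity>z\<in>verts G. (norm (wt G v z - wt G v z))\<^sup>2)"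
  proof (intro tendsto_infsum_dominated[OF is_networkD(3)[OF G v]])
    fix z assume "z \<in> verts G"
    then show "(\<lambda>n. (norm (kern (t n) 0 G v z - wt G v z))\<^sup>2) \<longlonglongrightarrow> (norm (wt G v z - wt G v z))\<^sup>2"
      using assms by (intro tendsto_intros tendsto_kern_0 G v) auto
  qed (auto intro!: power_mono kern_diff_le assms)
  from tendsto_real_sqrt[OF this] show ?thesis by (simp add: rowtail_def)
qed

end

lemma borel_rowtail:
  assumes "0 < \<theta>"
  shows "(\<lambda>c. rowtail \<theta> (gnet c) (groot c)) \<in> borel_measurable borel"
proof (rule borel_measurable_LIMSEQ_real)
  show "(\<lambda>n. rowdiff \<theta> (1 / real (Suc n)) 0 (gnet c) (groot c)) \<longlonglongrightarrow> rowtail \<theta> (gnet c) (groot c)" for c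
    using LIMSEQ_inverse_real_of_nat by (intro rowdiff_tendsto_rowtail assms) (auto simp: inverse_eq_divide)
  show "(\<lambda>c. rowdiff \<theta> (1 / real (Suc n)) 0 (gnet c) (groot c)) \<in> borel_measurable borel" for n
    by (rule measurable_rowdiff(1)[OF assms]) simp
qed

section \<open>Absolute moments of spectral measures\<close>

lemma wpow_1:
  assumes "z \<in> verts G" "v \<in> verts G"
  shows "wpow G 1 z v = wt G z v"
proof -
  have "wpow G (Suc 0) z v = (\<Sum>\<^sub>\<infinity>y\<in>verts G. wt G z y * unit_vec v y)"
    unfolding wpow_Suc wpow_0 ..
  also have "\<dots> = (\<Sum>y\<in>{v}. wt G z y * unit_vec v y)"
    by (rule infsum_eq_sum) (use assms(2) in \<open>auto simp: unit_vec_def\<close>)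
  also have "\<dots> = wt G z v" by (simp add: unit_vec_def)
  finally show ?thesis by simp
qed

lemma wpow_2:
  assumes G: "is_network G" and v: "v \<in> verts G"
  shows "wpow G 2 v v = of_real (net_deg G v)"
proof -
  have 1: "wpow G (Suc 0) z v = wt G z v" if "z \<in> verts G" for z
    using wpow_1[OF that v] by simp
  have "wpow G 2 v v = (\<Sum>\<^sub>\<infinity>z\<in>verts G. of_real ((norm (wt G v z))\<^sup>2))"
    unfolding numeral_2_eq_2 wpow_Suc[of G "Suc 0"]
  proof (rule infsum_cong)
    fix z assume z: "z \<in> verts G"
    have "wt G z v = cnj (wt G v z)" by (rule is_networkD(2)[OF G z v])
    then show "wt G v z * wpow G (Suc 0) z v = of_real ((norm (wt G v z)) ^ Suc (Suc 0))"
      unfolding 1[OF z] by (simp add: complex_norm_square[symmetric] power2_eq_square flip: numeral_2_eq_2)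
  qed
  also have "\<dots> = of_real (net_deg G v)"
    unfolding net_deg_def by (rule infsumI[OF has_sum_bounded_linear[OF bounded_linear_of_real has_sum_infsum[OF is_networkD(3)[OF G v]]]])
  finally show ?thesis .
qed

text \<open>Concavity of the power \<alpha> / 2, through the tangent at the second moment. The
  second moment is a divisor, hence the separate case where it vanishes.\<close>

lemma powr_moment_le:
  assumes \<mu>: "real_distribution \<mu>" "AE x in \<mu>. \<bar>x\<bar> \<le> C" and \<alpha>: "0 < \<alpha>" "\<alpha> < 2"
  shows "(\<integral>\<^sup>+x. ennreal (\<bar>x\<bar> powr \<alpha>) \<partial>\<mu>) \<le> ennreal ((\<integral>x. x ^ 2 \<partial>\<mu>) powr (\<alpha> / 2))"
proof -
  interpret real_distribution \<mu> by fact
  have i2: "integrable \<mu> (\<lambda>x. x ^ 2)" by (rule integrable_power_of_AE_le[OF \<mu>])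
  define M where "M = (\<integral>x. x ^ 2 \<partial>\<mu>)"
  have M0: "0 \<le> M" unfolding M_def by simp
  show ?thesis
  proof (cases "M = 0")
    case True
    then have "AE x in \<mu>. x ^ 2 = 0" unfolding M_def using i2 by (subst (asm) integral_nonneg_eq_0_iff_AE) auto
    then have "(\<integral>\<^sup>+x. ennreal (\<bar>x\<bar> powr \<alpha>) \<partial>\<mu>) = (\<integral>\<^sup>+x. 0 \<partial>\<mu>)"
      by (intro nn_integral_cong_AE) (auto elim: eventually_mono)
    then show ?thesis by simp
  next
    case False
    then have M: "0 < M" using M0 by simp
    let ?p = "\<alpha> / 2"
    \<comment> \<open>Young's inequality for u = x^2 / M and 1 reads u^p \<le> p u + 1 - p, the
      tangent line at u = 1.\<close>
    have tangent: "\<bar>x\<bar> powr \<alpha> \<le> M powr ?p * (?p * (x\<^sup>2 / M) + (1 - ?p))" for x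
    proof (cases "x = 0")
      case True
      then show ?thesis using \<alpha> by simp
    next
      case False
      have "(x\<^sup>2 / M) powr ?p * 1 powr (1 - ?p) \<le> ?p * (x\<^sup>2 / M) + (1 - ?p) * 1"
        using \<alpha> M False by (intro Youngs_inequality_0) auto
      then have le: "(x\<^sup>2 / M) powr ?p \<le> ?p * (x\<^sup>2 / M) + (1 - ?p)" by simp
      have "\<bar>x\<bar> powr \<alpha> = (x\<^sup>2) powr ?p"
      proof -
        have "x\<^sup>2 = \<bar>x\<bar> powr 2" using False by (simp add: powr_numeral)
        then show ?thesis unfolding \<open>x\<^sup>2 = \<bar>x\<bar> powr 2\<close> powr_powr by simp
      qed
      also have "\<dots> = M powr ?p * (x\<^sup>2 / M) powr ?p"
        using M by (subst powr_mult[symmetric]) auto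
      also have "\<dots> \<le> M powr ?p * (?p * (x\<^sup>2 / M) + (1 - ?p))" by (rule mult_left_mono[OF le]) simp
      finally show ?thesis .
    qed
    have int: "integrable \<mu> (\<lambda>x. M powr ?p * (?p * (x\<^sup>2 / M) + (1 - ?p)))" using i2 by simp
    have "(\<integral>\<^sup>+x. ennreal (\<bar>x\<bar> powr \<alpha>) \<partial>\<mu>) \<le> (\<integral>\<^sup>+x. ennreal (M powr ?p * (?p * (x\<^sup>2 / M) + (1 - ?p))) \<partial>\<mu>)"
      by (intro nn_integral_mono ennreal_leI tangent)
    also have "\<dots> = ennreal (\<integral>x. M powr ?p * (?p * (x\<^sup>2 / M) + (1 - ?p)) \<partial>\<mu>)"
      using \<alpha> M by (intro nn_integral_eq_integral int) auto
    also have "(\<integral>x. M powr ?p * (?p * (x\<^sup>2 / M) + (1 - ?p)) \<partial>\<mu>) = M powr ?p"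
    proof -
      have "(\<integral>x. M powr ?p * (?p * (x\<^sup>2 / M) + (1 - ?p)) \<partial>\<mu>) = M powr ?p * (?p * ((\<integral>x. x\<^sup>2 \<partial>\<mu>) / M) + (1 - ?p))"
        using i2 prob_space by simp
      then show ?thesis using M by (simp add: M_def[symmetric])
    qed
    finally show ?thesis by (simp add: M_def)
  qed
qed

text \<open>The second moment of the spectral measure at the root is the truncated degree, and its
  power \<alpha> / 2 is at most the sum of the \<alpha>-th powers. The bound does not depend on
  \<theta>.\<close>

lemma tspec_powr_moment:
  assumes \<theta>: "0 < \<theta>" and \<alpha>: "0 < \<alpha>" "\<alpha> < 2"
  shows "(\<integral>\<^sup>+x. ennreal (\<bar>x\<bar> powr \<alpha>) \<partial>tspec \<theta> c) \<le> xi \<alpha> c"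
proof -
  note p = tspec_props[OF \<theta>]
  let ?K = "knet \<theta> 0 (gnet c)"
  have K: "is_network ?K" "groot c \<in> verts ?K" using \<theta> by (auto intro: is_network_knet)
  have "of_real (\<integral>x. x ^ 2 \<partial>tspec \<theta> c) = complex_of_real (net_deg ?K (groot c))"
    unfolding p(3) by (rule wpow_2[OF K])
  then have m: "(\<integral>x. x ^ 2 \<partial>tspec \<theta> c) = net_deg ?K (groot c)" by (simp only: of_real_eq_iff)
  have "net_deg ?K (groot c) \<le> net_deg (gnet c) (groot c)"
    unfolding net_deg_def knet_simps
    using is_networkD(3)[OF K] is_networkD(3)[OF is_network_gnet groot_in, of c]
    by (intro infsum_mono power_mono norm_kern_le \<theta>) auto
  moreover have "0 \<le> net_deg ?K (groot c)" by (simp add: net_deg_def infsum_nonneg)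
  ultimately have le: "net_deg ?K (groot c) powr (\<alpha> / 2) \<le> net_deg (gnet c) (groot c) powr (\<alpha> / 2)"
    using \<alpha> by (intro powr_mono2) auto
  have "(\<integral>\<^sup>+x. ennreal (\<bar>x\<bar> powr \<alpha>) \<partial>tspec \<theta> c) \<le> ennreal (net_deg ?K (groot c) powr (\<alpha> / 2))"
    using powr_moment_le[OF p(1,2)[of c] \<alpha>] unfolding m .
  also have "\<dots> \<le> ennreal (net_deg (gnet c) (groot c) powr (\<alpha> / 2))" by (rule ennreal_leI[OF le])
  also have "\<dots> \<le> xi \<alpha> c" unfolding xi_def using \<alpha> by (intro net_deg_powr_le) auto
  finally show ?thesis .
qed

section \<open>Spectral measures of networks with finite moments\<close>

text \<open>Limits as \<theta> decreases to 0 are tested on sequences, where dominated convergence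
  applies.\<close>

lemma at_right_seqI:
  assumes "\<And>X. (\<And>n. 0 < X n) \<Longrightarrow> X \<longlonglongrightarrow> 0 \<Longrightarrow> (\<lambda>n. f (X n)) \<longlonglongrightarrow> l"
  shows "(f \<longlongrightarrow> l) (at_right (0::real))"
  unfolding tendsto_at_iff_sequentially comp_def using assms by auto

text \<open>Resolves the definite description: cosines and sines are bounded continuous test
  functions, so two weak limits have the same characteristic function.\<close>

lemma net_spectral_eqI:
  assumes \<rho>: "prob_space \<rho>" "sets \<rho> = sets borel" and \<beta>: "0 < \<beta>" "\<beta> < 2" "(\<integral>\<^sup>+c. xi \<beta> c \<partial>\<rho>) < \<infinity>"
    and \<mu>: "real_distribution \<mu>" "weak_lim (\<lambda>\<theta>. tmean \<theta> \<rho>) \<mu> (at_right 0)"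
  shows "net_spectral \<rho> = \<mu>"
proof -
  have uniq: "\<mu>' = \<mu>" if r': "real_distribution \<mu>'" and w': "weak_lim (\<lambda>\<theta>. tmean \<theta> \<rho>) \<mu>' (at_right 0)" for \<mu>'
  proof (rule Levy_uniqueness[OF r' \<mu>(1)], rule ext)
    fix t
    have eq: "(\<integral>x. f x \<partial>\<mu>') = (\<integral>x. f x \<partial>\<mu>)" if "continuous_on UNIV f" "bounded (range f)" for f :: "real \<Rightarrow> real"
    proof (rule tendsto_unique[OF trivial_limit_at_right_real[of 0]])
      show "((\<lambda>\<theta>. integral\<^sup>L (tmean \<theta> \<rho>) f) \<longlongrightarrow> integral\<^sup>L \<mu>' f) (at_right 0)"
        by (rule w'[unfolded weak_lim_def, rule_format, OF conjI[OF that]])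
      show "((\<lambda>\<theta>. integral\<^sup>L (tmean \<theta> \<rho>) f) \<longlongrightarrow> integral\<^sup>L \<mu> f) (at_right 0)"
        by (rule \<mu>(2)[unfolded weak_lim_def, rule_format, OF conjI[OF that]])
    qed
    have c: "char M t = of_real (\<integral>x. cos (t * x) \<partial>M) + \<i> * of_real (\<integral>x. sin (t * x) \<partial>M)" if "real_distribution M" for M
    proof -
      interpret real_distribution M by fact
      have i: "integrable M (\<lambda>x. iexp (t * x))" by (rule integrable_iexp) auto
      have "Re (char M t) = (\<integral>x. cos (t * x) \<partial>M)"
        unfolding char_def by (subst integral_Re[OF i, symmetric]) (simp add: Re_exp)
      moreover have "Im (char M t) = (\<integral>x. sin (t * x) \<partial>M)"
        unfolding char_def by (subst integral_Im[OF i, symmetric]) (simp add: Im_exp)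
      ultimately show ?thesis by (simp add: complex_eq_iff)
    qed
    have "(\<integral>x. cos (t * x) \<partial>\<mu>') = (\<integral>x. cos (t * x) \<partial>\<mu>)"
      by (rule eq) (auto intro!: continuous_intros boundedI[of _ 1])
    moreover have "(\<integral>x. sin (t * x) \<partial>\<mu>') = (\<integral>x. sin (t * x) \<partial>\<mu>)"
      by (rule eq) (auto intro!: continuous_intros boundedI[of _ 1])
    ultimately show "char \<mu>' t = char \<mu> t" unfolding c[OF \<mu>(1)] c[OF r'] by simp
  qed
  have "\<exists>\<beta>. 0 < \<beta> \<and> \<beta> < 2 \<and> (\<integral>\<^sup>+c. xi \<beta> c \<partial>\<rho>) < \<infinity>" using \<beta> by blast
  then have "net_spectral \<rho> = (THE \<mu>. real_distribution \<mu> \<and> weak_lim (\<lambda>\<theta>. tmean \<theta> \<rho>) \<mu> (at_right 0))"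
    unfolding net_spectral_def tmean_def by (rule if_P)
  also have "\<dots> = \<mu>" 
  proof (rule the_equality)
    show "real_distribution \<mu> \<and> weak_lim (\<lambda>\<theta>. tmean \<theta> \<rho>) \<mu> (at_right 0)" using \<mu> by (rule conjI)
  qed (elim conjE, rule uniq)
  finally show ?thesis .
qed

text \<open>A bounded continuous substitute for the identity, used to carry means through weak
  limits.\<close>

definition clip :: "real \<Rightarrow> real \<Rightarrow> real" where "clip R x = max (- R) (min R x)"

lemma clip_le: "0 \<le> R \<Longrightarrow> \<bar>clip R x\<bar> \<le> R"
  by (auto simp: clip_def)

lemma borel_clip [measurable]: "clip R \<in> borel_measurable borel"
  unfolding clip_def[abs_def] by simp

text \<open>Clipping acts only where |x| > R, and there |x| is at most R^{1 - \<alpha>}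
  |x|^\<alpha>.\<close>

lemma clip_diff_le:
  assumes R: "0 < R" and \<alpha>: "1 \<le> \<alpha>"
  shows "\<bar>clip R x - x\<bar> \<le> R powr (1 - \<alpha>) * (\<bar>x\<bar> powr \<alpha>)"
proof (cases "\<bar>x\<bar> \<le> R")
  case False
  then have x: "R \<le> \<bar>x\<bar>" "0 < \<bar>x\<bar>" using R by auto
  have "\<bar>clip R x - x\<bar> \<le> \<bar>x\<bar>" using False R unfolding clip_def by (auto simp: max_def min_def)
  also have "\<dots> = \<bar>x\<bar> powr (1 - \<alpha>) * \<bar>x\<bar> powr \<alpha>" using x(2) by (simp add: powr_add[symmetric])
  also have "\<dots> \<le> R powr (1 - \<alpha>) * \<bar>x\<bar> powr \<alpha>"
    using x R \<alpha> by (intro mult_right_mono powr_mono2') auto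
  finally show ?thesis .
qed (auto simp: clip_def)

lemma clip_mean:
  assumes \<mu>: "real_distribution \<mu>" "abs_moment \<alpha> \<mu> \<le> ennreal B" and \<alpha>: "1 \<le> \<alpha>" and B: "0 \<le> B" and R: "0 < R"
  shows "integrable \<mu> (\<lambda>x. x)" "\<bar>(\<integral>x. clip R x \<partial>\<mu>) - (\<integral>x. x \<partial>\<mu>)\<bar> \<le> R powr (1 - \<alpha>) * B"
proof -
  interpret real_distribution \<mu> by fact
  let ?p = "\<lambda>x::real. \<bar>x\<bar> powr \<alpha>"
  have p: "integrable \<mu> ?p"
  proof (rule integrableI_bounded)
    have "(\<integral>\<^sup>+x. ennreal (norm (?p x)) \<partial>\<mu>) \<le> ennreal B" using \<mu>(2) by (simp add: abs_moment_def)
    then show "(\<integral>\<^sup>+x. ennreal (norm (?p x)) \<partial>\<mu>) < \<infinity>" by (rule order_le_less_trans) simp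
  qed simp
  have pB: "(\<integral>x. ?p x \<partial>\<mu>) \<le> B"
  proof -
    have "ennreal (\<integral>x. ?p x \<partial>\<mu>) = (\<integral>\<^sup>+x. ennreal (?p x) \<partial>\<mu>)"
      by (rule nn_integral_eq_integral[symmetric, OF p]) simp
    then have "ennreal (\<integral>x. ?p x \<partial>\<mu>) \<le> ennreal B" using \<mu>(2) unfolding abs_moment_def by simp
    then show ?thesis using B by (simp add: ennreal_le_iff)
  qed
  have c: "integrable \<mu> (clip R)" using R clip_le[of R] by (intro integrable_const_bound[where B = R]) auto
  have d: "integrable \<mu> (\<lambda>x. clip R x - x)"
    by (rule Bochner_Integration.integrable_bound[OF integrable_mult_right[OF p, of "R powr (1 - \<alpha>)"]])
      (use clip_diff_le[OF R \<alpha>] in auto)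
  have "integrable \<mu> (\<lambda>x. clip R x - (clip R x - x))" by (rule Bochner_Integration.integrable_diff[OF c d])
  then show i: "integrable \<mu> (\<lambda>x. x)" by simp
  have "(\<integral>x. clip R x \<partial>\<mu>) - (\<integral>x. x \<partial>\<mu>) = (\<integral>x. clip R x - x \<partial>\<mu>)"
    by (rule Bochner_Integration.integral_diff[symmetric, OF c i])
  then have "\<bar>(\<integral>x. clip R x \<partial>\<mu>) - (\<integral>x. x \<partial>\<mu>)\<bar> \<le> (\<integral>x. \<bar>clip R x - x\<bar> \<partial>\<mu>)" by simp
  also have "\<dots> \<le> (\<integral>x. R powr (1 - \<alpha>) * ?p x \<partial>\<mu>)"
    by (intro integral_mono integrable_abs d integrable_mult_right p clip_diff_le[OF R \<alpha>])
  also have "\<dots> \<le> R powr (1 - \<alpha>) * B" using pB by (simp add: mult_left_mono)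
  finally show "\<bar>(\<integral>x. clip R x \<partial>\<mu>) - (\<integral>x. x \<partial>\<mu>)\<bar> \<le> R powr (1 - \<alpha>) * B" .
qed

lemma integral_norm_le:
  fixes f :: "'a \<Rightarrow> 'b::{banach, second_countable_topology}"
  assumes "integrable M f" "integrable M g" "AE x in M. norm (f x) \<le> g x"
  shows "norm (\<integral>x. f x \<partial>M) \<le> (\<integral>x. g x \<partial>M)"
  by (rule order_trans[OF integral_norm_bound integral_mono_AE[OF integrable_norm[OF assms(1)] assms(2,3)]])

context
  fixes \<rho> :: "gstar measure" and \<alpha> :: real
  assumes \<rho>: "prob_space \<rho>" "sets \<rho> = sets borel" and lip: "tr_lipschitz \<rho>"
    and \<alpha>: "1 < \<alpha>" "\<alpha> < 2" and fin: "(\<integral>\<^sup>+c. xi \<alpha> c \<partial>\<rho>) < \<infinity>"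
begin

interpretation prob_space \<rho> by (rule \<rho>(1))

lemma borel_\<rho>: "f \<in> borel_measurable borel \<Longrightarrow> f \<in> borel_measurable \<rho>"
  using measurable_cong_sets[OF \<rho>(2) refl] by blast

lemma AE_xi_finite: "AE c in \<rho>. xi \<alpha> c \<noteq> \<infinity>"
  using fin \<alpha> by (intro nn_integral_PInf_AE borel_\<rho> borel_xi) auto

lemma integrable_xi: "integrable \<rho> (\<lambda>c. 1 + enn2real (xi \<alpha> c))"
proof -
  have "integrable \<rho> (\<lambda>c. enn2real (xi \<alpha> c))"
  proof (rule integrableI_bounded)
    show "(\<lambda>c. enn2real (xi \<alpha> c)) \<in> borel_measurable \<rho>"
      using \<alpha> by (intro borel_measurable_enn2real borel_\<rho> borel_xi) auto
    have "(\<integral>\<^sup>+c. ennreal (norm (enn2real (xi \<alpha> c))) \<partial>\<rho>) \<le> (\<integral>\<^sup>+c. xi \<alpha> c \<partial>\<rho>)"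
      by (intro nn_integral_mono) (simp add: ennreal_enn2real_if)
    then show "(\<integral>\<^sup>+c. ennreal (norm (enn2real (xi \<alpha> c))) \<partial>\<rho>) < \<infinity>" using fin by (rule order_le_less_trans)
  qed
  then show ?thesis by simp
qed

text \<open>Since \<alpha> \<ge> 1, the square root of a number above 1 is at most its power
  \<alpha> / 2; the summand 1 covers smaller degrees. This provides the integrable majorant for all
  truncation errors.\<close>

lemma AE_deg_le: "AE c in \<rho>. sqrt (net_deg (gnet c) (groot c)) \<le> 1 + enn2real (xi \<alpha> c)"
  using AE_xi_finite
proof eventually_elim
  case (elim c)
  define d where "d = net_deg (gnet c) (groot c)"
  have d0: "0 \<le> d" by (simp add: d_def net_deg_def infsum_nonneg)
  obtain x where x: "xi \<alpha> c = ennreal x" "0 \<le> x" using elim by (cases "xi \<alpha> c") auto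
  have "ennreal (d powr (\<alpha> / 2)) \<le> ennreal x"
    unfolding x(1)[symmetric] xi_def d_def using \<alpha> by (intro net_deg_powr_le) auto
  then have le: "d powr (\<alpha> / 2) \<le> x" using x(2) by (simp add: ennreal_le_iff)
  have "sqrt d \<le> 1 + x"
  proof (cases "d \<le> 1")
    case True
    then have "sqrt d \<le> 1" by simp
    then show ?thesis using x(2) by linarith
  next
    case False
    have "sqrt d = d powr (1 / 2)" using d0 by (rule powr_half_sqrt[symmetric])
    also have "\<dots> \<le> d powr (\<alpha> / 2)" using False \<alpha> by (intro powr_mono) auto
    finally show ?thesis using le by simp
  qed
  then show ?case using x by (simp add: d_def)
qed

lemma
  shows integrable_rowtail: "0 < \<theta> \<Longrightarrow> integrable \<rho> (\<lambda>c. rowtail \<theta> (gnet c) (groot c))"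
    and mean_rowtail_tendsto: "(\<And>n. 0 < X n) \<Longrightarrow> X \<longlonglongrightarrow> 0 \<Longrightarrow> (\<lambda>n. \<integral>c. rowtail (X n) (gnet c) (groot c) \<partial>\<rho>) \<longlonglongrightarrow> 0"
proof -
  have le: "AE c in \<rho>. norm (rowtail \<theta> (gnet c) (groot c)) \<le> 1 + enn2real (xi \<alpha> c)" if "0 < \<theta>" for \<theta>
    using AE_deg_le
  proof eventually_elim
    case (elim c)
    then show ?case
      using rowtail_le[OF is_network_gnet groot_in that, of c] rowtail_nonneg[OF is_network_gnet groot_in, of \<theta> c] by simp
  qed
  show "integrable \<rho> (\<lambda>c. rowtail \<theta> (gnet c) (groot c))" if "0 < \<theta>"
    by (rule Bochner_Integration.integrable_bound[OF integrable_xi borel_\<rho>[OF borel_rowtail[OF that]]])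
      (use le[OF that] in \<open>eventually_elim, simp\<close>)
  assume X: "\<And>n. 0 < X n" "X \<longlonglongrightarrow> 0"
  have "(\<lambda>n. \<integral>c. rowtail (X n) (gnet c) (groot c) \<partial>\<rho>) \<longlonglongrightarrow> (\<integral>c. 0 \<partial>\<rho>)"
  proof (rule integral_dominated_convergence[where w = "\<lambda>c. 1 + enn2real (xi \<alpha> c)"])
    show "AE c in \<rho>. (\<lambda>n. rowtail (X n) (gnet c) (groot c)) \<longlonglongrightarrow> 0"
      by (intro AE_I2 rowtail_tendsto_0 is_network_gnet groot_in X)
  qed (intro borel_measurable_const integrable_xi borel_\<rho> borel_rowtail X le)+
  then show "(\<lambda>n. \<integral>c. rowtail (X n) (gnet c) (groot c) \<partial>\<rho>) \<longlonglongrightarrow> 0" by simp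
qed

lemma char_tmean_diff_le:
  assumes "0 < \<theta>" "0 < \<theta>'"
  shows "norm (char (tmean \<theta> \<rho>) t - char (tmean \<theta>' \<rho>) t) \<le>
    \<bar>t\<bar> * (2 * ((\<integral>c. rowtail \<theta> (gnet c) (groot c) \<partial>\<rho>) + (\<integral>c. rowtail \<theta>' (gnet c) (groot c) \<partial>\<rho>)))"
proof -
  note i = integrable_rowtail[OF assms(1)] integrable_rowtail[OF assms(2)]
  have i2: "integrable \<rho> (\<lambda>c. 2 * (rowtail \<theta> (gnet c) (groot c) + rowtail \<theta>' (gnet c) (groot c)))" using i by simp
  have le: "rowdiff \<theta> \<theta>' 0 (gnet c) (groot c) \<le> 2 * (rowtail \<theta> (gnet c) (groot c) + rowtail \<theta>' (gnet c) (groot c))" for c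
    by (rule rowdiff_le_rowtail[OF is_network_gnet groot_in assms])
  have "integrable \<rho> (\<lambda>c. rowdiff \<theta> \<theta>' 0 (gnet c) (groot c))"
  proof (rule Bochner_Integration.integrable_bound[OF i2 borel_\<rho>[OF measurable_rowdiff(1)[OF assms]]], intro AE_I2)
    fix c show "norm (rowdiff \<theta> \<theta>' 0 (gnet c) (groot c)) \<le> norm (2 * (rowtail \<theta> (gnet c) (groot c) + rowtail \<theta>' (gnet c) (groot c)))"
      using le[of c] rowdiff_nonneg[of \<theta> \<theta>' 0 "gnet c" "groot c"] by simp
  qed
  then have "(\<integral>c. rowdiff \<theta> \<theta>' 0 (gnet c) (groot c) \<partial>\<rho>) \<le> (\<integral>c. 2 * (rowtail \<theta> (gnet c) (groot c) + rowtail \<theta>' (gnet c) (groot c)) \<partial>\<rho>)"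
    by (intro integral_mono i2 le)
  also have "\<dots> = 2 * ((\<integral>c. rowtail \<theta> (gnet c) (groot c) \<partial>\<rho>) + (\<integral>c. rowtail \<theta>' (gnet c) (groot c) \<partial>\<rho>))"
    using i by simp
  finally have "\<bar>t\<bar> * (\<integral>c. rowdiff \<theta> \<theta>' 0 (gnet c) (groot c) \<partial>\<rho>) \<le>
      \<bar>t\<bar> * (2 * ((\<integral>c. rowtail \<theta> (gnet c) (groot c) \<partial>\<rho>) + (\<integral>c. rowtail \<theta>' (gnet c) (groot c) \<partial>\<rho>)))"
    by (rule mult_left_mono) simp
  with lip[unfolded tr_lipschitz_def, rule_format, OF assms, of t] show ?thesis by (rule order_trans)
qed

lemma tmean_abs_moment:
  assumes "0 < \<theta>"
  shows "abs_moment \<alpha> (tmean \<theta> \<rho>) \<le> (\<integral>\<^sup>+c. xi \<alpha> c \<partial>\<rho>)"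
  unfolding abs_moment_def
  using \<alpha> by (subst nn_integral_tmean[OF assms \<rho>]) (auto intro!: nn_integral_mono tspec_powr_moment assms)

lemma tight_tmean:
  assumes X: "\<And>n. 0 < X n"
  shows "tight (\<lambda>n. tmean (X n) \<rho>)"
  unfolding tight_def
proof (intro conjI allI impI)
  fix n show "real_distribution (tmean (X n) \<rho>)" by (rule real_distribution_tmean[OF X \<rho>])
next
  fix e :: real assume e: "0 < e"
  obtain m where m: "(\<integral>\<^sup>+c. xi \<alpha> c \<partial>\<rho>) = ennreal m" "0 \<le> m" using fin by (cases "\<integral>\<^sup>+c. xi \<alpha> c \<partial>\<rho>") auto
  \<comment> \<open>Chosen so that m / K < e; also K \<ge> 1, so that |x| \<ge> K implies
    |x|^\<alpha> \<ge> |x| \<ge> K.\<close>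
  define K where "K = m / e + 1"
  have K: "1 \<le> K" "1 / K * m < e" using m(2) e by (auto simp: K_def field_simps)
  show "\<exists>a b. a < b \<and> (\<forall>n. 1 - e < measure (tmean (X n) \<rho>) {a<..b})"
  proof (rule exI[of _ "- K"], rule exI[of _ K], intro conjI allI)
    show "- K < K" using K by simp
    fix n
    interpret t: real_distribution "tmean (X n) \<rho>" by (rule real_distribution_tmean[OF X \<rho>])
    let ?u = "\<lambda>x. ennreal (\<bar>x\<bar> powr \<alpha>)"
    have "emeasure (tmean (X n) \<rho>) (UNIV - {-K<..K}) \<le> emeasure (tmean (X n) \<rho>) {x\<in>UNIV. 1 \<le> ennreal (1 / K) * ?u x}"
    proof (rule emeasure_mono)
      show "UNIV - {-K<..K} \<subseteq> {x\<in>UNIV. 1 \<le> ennreal (1 / K) * ?u x}"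
      proof
        fix x assume "x \<in> UNIV - {-K<..K}"
        then have x: "K \<le> \<bar>x\<bar>" by auto
        have "K \<le> \<bar>x\<bar> powr 1" using x K by simp
        also have "\<dots> \<le> \<bar>x\<bar> powr \<alpha>" using x K \<alpha> by (intro powr_mono) auto
        finally have "1 \<le> 1 / K * (\<bar>x\<bar> powr \<alpha>)" using K by (simp add: field_simps)
        then show "x \<in> {x\<in>UNIV. 1 \<le> ennreal (1 / K) * ?u x}"
          using K by (simp add: ennreal_mult[symmetric] del: times_divide_eq_left)
      qed
    qed simp
    also have "\<dots> \<le> ennreal (1 / K) * (\<integral>\<^sup>+x. ?u x * indicator UNIV x \<partial>tmean (X n) \<rho>)"
      by (rule nn_integral_Markov_inequality) auto
    also have "\<dots> \<le> ennreal (1 / K) * ennreal m"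
      using tmean_abs_moment[OF X[of n]] unfolding m(1) abs_moment_def by (intro mult_left_mono) auto
    also have "\<dots> = ennreal (1 / K * m)" using m(2) K by (intro ennreal_mult[symmetric]) auto
    finally have "measure (tmean (X n) \<rho>) (UNIV - {-K<..K}) \<le> 1 / K * m"
      using m(2) K by (simp add: t.emeasure_eq_measure ennreal_le_iff)
    moreover have "measure (tmean (X n) \<rho>) (UNIV - {-K<..K}) = 1 - measure (tmean (X n) \<rho>) {-K<..K}"
      using t.prob_compl[of "{-K<..K}"] by simp
    ultimately show "1 - e < measure (tmean (X n) \<rho>) {-K<..K}" using K by linarith
  qed
qed

text \<open>Tightness gives a limit along a subsequence. Letting the second level run along it makes
  its error vanish, so the limit is compared with every truncation, not only with those of the
  subsequence.\<close>

lemma ex_limit: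
  "\<exists>\<mu>. real_distribution \<mu> \<and> (\<forall>\<theta> t. 0 < \<theta> \<longrightarrow>
     norm (char (tmean \<theta> \<rho>) t - char \<mu> t) \<le> \<bar>t\<bar> * (2 * (\<integral>c. rowtail \<theta> (gnet c) (groot c) \<partial>\<rho>)))"
proof -
  define X where "X n = 1 / real (Suc n)" for n
  have X: "0 < X n" for n by (simp add: X_def)
  have X0: "X \<longlonglongrightarrow> 0" using LIMSEQ_inverse_real_of_nat by (simp add: X_def[abs_def] inverse_eq_divide)
  have "tight (\<lambda>n. tmean (X n) \<rho>)" by (rule tight_tmean) (rule X)
  from tight_imp_convergent_subsubsequence[OF this strict_mono_id]
  obtain r \<mu> where r: "strict_mono (r :: nat \<Rightarrow> nat)" "real_distribution \<mu>"
    "weak_conv_m ((\<lambda>n. tmean (X n) \<rho>) \<circ> id \<circ> r) \<mu>"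
    by (elim exE conjE) (rule that)
  have "norm (char (tmean \<theta> \<rho>) t - char \<mu> t) \<le> \<bar>t\<bar> * (2 * ((\<integral>c. rowtail \<theta> (gnet c) (groot c) \<partial>\<rho>) + 0))"
    if \<theta>: "0 < \<theta>" for \<theta> t
  proof (rule LIMSEQ_le)
    have "(\<lambda>n. char (((\<lambda>n. tmean (X n) \<rho>) \<circ> id \<circ> r) n) t) \<longlonglongrightarrow> char \<mu> t"
      by (rule levy_continuity1[OF _ r(2,3)]) (simp add: real_distribution_tmean[OF X \<rho>])
    then have "(\<lambda>n. char (tmean (X (r n)) \<rho>) t) \<longlonglongrightarrow> char \<mu> t" by (simp only: comp_def id_apply)
    then show "(\<lambda>n. norm (char (tmean \<theta> \<rho>) t - char (tmean (X (r n)) \<rho>) t)) \<longlonglongrightarrow> norm (char (tmean \<theta> \<rho>) t - char \<mu> t)"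
      by (intro tendsto_norm tendsto_diff tendsto_const)
    have "(X \<circ> r) \<longlonglongrightarrow> 0" by (rule LIMSEQ_subseq_LIMSEQ[OF X0 r(1)])
    then have "(\<lambda>n. \<integral>c. rowtail (X (r n)) (gnet c) (groot c) \<partial>\<rho>) \<longlonglongrightarrow> 0"
      by (intro mean_rowtail_tendsto X) (simp add: comp_def)
    then show "(\<lambda>n. \<bar>t\<bar> * (2 * ((\<integral>c. rowtail \<theta> (gnet c) (groot c) \<partial>\<rho>) + (\<integral>c. rowtail (X (r n)) (gnet c) (groot c) \<partial>\<rho>))))
        \<longlonglongrightarrow> \<bar>t\<bar> * (2 * ((\<integral>c. rowtail \<theta> (gnet c) (groot c) \<partial>\<rho>) + 0))"
      by (intro tendsto_mult tendsto_add tendsto_const)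
    show "\<exists>N. \<forall>n\<ge>N. norm (char (tmean \<theta> \<rho>) t - char (tmean (X (r n)) \<rho>) t) \<le>
        \<bar>t\<bar> * (2 * ((\<integral>c. rowtail \<theta> (gnet c) (groot c) \<partial>\<rho>) + (\<integral>c. rowtail (X (r n)) (gnet c) (groot c) \<partial>\<rho>)))"
      using char_tmean_diff_le[OF \<theta> X] by blast
  qed
  then show ?thesis using r(2) unfolding add_0_right by blast
qed

text \<open>The bound of \<open>ex_limit\<close> gives convergence of the characteristic functions
  along every null sequence, hence weak convergence of the whole family.\<close>

lemma
  shows net_spectral_distribution: "real_distribution (net_spectral \<rho>)"
    and net_spectral_weak_lim: "weak_lim (\<lambda>\<theta>. tmean \<theta> \<rho>) (net_spectral \<rho>) (at_right 0)"
proof -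
  obtain \<mu> where \<mu>: "real_distribution \<mu>"
    and le: "\<And>\<theta> t. 0 < \<theta> \<Longrightarrow> norm (char (tmean \<theta> \<rho>) t - char \<mu> t) \<le> \<bar>t\<bar> * (2 * (\<integral>c. rowtail \<theta> (gnet c) (groot c) \<partial>\<rho>))"
    using ex_limit by blast
  have w: "weak_lim (\<lambda>\<theta>. tmean \<theta> \<rho>) \<mu> (at_right 0)"
    unfolding weak_lim_def
  proof (intro allI impI, elim conjE, rule at_right_seqI)
    fix f :: "real \<Rightarrow> real" and X :: "nat \<Rightarrow> real"
    assume f: "continuous_on UNIV f" "bounded (range f)" and X: "\<And>n. 0 < X n" "X \<longlonglongrightarrow> 0"
    have "(\<lambda>n. char (tmean (X n) \<rho>) t) \<longlonglongrightarrow> char \<mu> t" for t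
    proof (rule Lim_null[THEN iffD2], rule Lim_null_comparison)
      show "eventually (\<lambda>n. norm (char (tmean (X n) \<rho>) t - char \<mu> t) \<le> \<bar>t\<bar> * (2 * (\<integral>c. rowtail (X n) (gnet c) (groot c) \<partial>\<rho>))) sequentially"
        using le[OF X(1)] by simp
      show "(\<lambda>n. \<bar>t\<bar> * (2 * (\<integral>c. rowtail (X n) (gnet c) (groot c) \<partial>\<rho>))) \<longlonglongrightarrow> 0"
        using tendsto_mult_left[OF tendsto_mult_left[OF mean_rowtail_tendsto[OF X], of 2], of "\<bar>t\<bar>"] by simp
    qed
    then have wc: "weak_conv_m (\<lambda>n. tmean (X n) \<rho>) \<mu>"
      by (intro levy_continuity real_distribution_tmean X \<rho> \<mu>)
    obtain B where "\<And>x. norm (f x) \<le> B" using f(2) by (auto simp: bounded_iff)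
    then show "(\<lambda>n. integral\<^sup>L (tmean (X n) \<rho>) f) \<longlonglongrightarrow> integral\<^sup>L \<mu> f"
      using f(1) by (intro weak_conv_imp_integral_bdd_continuous_conv[OF real_distribution_tmean[OF X(1) \<rho>] \<mu> wc])
        (auto simp: continuous_on_eq_continuous_at)
  qed
  have "net_spectral \<rho> = \<mu>"
    using \<alpha> by (intro net_spectral_eqI[OF \<rho> _ _ fin \<mu> w]) auto
  with \<mu> w show "real_distribution (net_spectral \<rho>)" "weak_lim (\<lambda>\<theta>. tmean \<theta> \<rho>) (net_spectral \<rho>) (at_right 0)"
    by auto
qed

text \<open>Weak limits are tested with the bounded functions min(|x|^\<alpha>, n); monotone
  convergence in n then restores the moment.\<close>

lemma net_spectral_abs_moment: "abs_moment \<alpha> (net_spectral \<rho>) \<le> (\<integral>\<^sup>+c. xi \<alpha> c \<partial>\<rho>)"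
proof -
  obtain m where m: "(\<integral>\<^sup>+c. xi \<alpha> c \<partial>\<rho>) = ennreal m" "0 \<le> m" using fin by (cases "\<integral>\<^sup>+c. xi \<alpha> c \<partial>\<rho>") auto
  let ?\<mu> = "net_spectral \<rho>"
  interpret mu: real_distribution ?\<mu> by (rule net_spectral_distribution)
  let ?g = "\<lambda>n x. min (\<bar>x\<bar> powr \<alpha>) (real n)"
  have le: "(\<integral>\<^sup>+x. ennreal (?g n x) \<partial>?\<mu>) \<le> ennreal m" for n
  proof -
    have int: "integrable M (?g n)" if "real_distribution M" for M
    proof -
      interpret M: real_distribution M by fact
      show ?thesis by (rule M.integrable_const_bound[where B = "real n"]) auto
    qed
    have lim: "((\<lambda>\<theta>. \<integral>x. ?g n x \<partial>tmean \<theta> \<rho>) \<longlongrightarrow> (\<integral>x. ?g n x \<partial>?\<mu>)) (at_right 0)"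
    proof (rule net_spectral_weak_lim[unfolded weak_lim_def, rule_format], intro conjI)
      show "continuous_on UNIV (?g n)" using \<alpha> by (intro continuous_intros continuous_on_powr') auto
      show "bounded (range (?g n))" by (rule boundedI[of _ "real n"]) auto
    qed
    have "(\<integral>x. ?g n x \<partial>?\<mu>) \<le> m"
    proof (rule tendsto_upperbound[OF lim])
      show "eventually (\<lambda>\<theta>. (\<integral>x. ?g n x \<partial>tmean \<theta> \<rho>) \<le> m) (at_right 0)"
        unfolding eventually_at_filter
      proof (intro always_eventually allI impI)
        fix \<theta> :: real assume "\<theta> \<in> {0<..}"
        then have \<theta>: "0 < \<theta>" by simp
        have "ennreal (\<integral>x. ?g n x \<partial>tmean \<theta> \<rho>) = (\<integral>\<^sup>+x. ennreal (?g n x) \<partial>tmean \<theta> \<rho>)"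
          by (rule nn_integral_eq_integral[symmetric, OF int[OF real_distribution_tmean[OF \<theta> \<rho>]]]) simp
        also have "\<dots> \<le> abs_moment \<alpha> (tmean \<theta> \<rho>)" unfolding abs_moment_def by (intro nn_integral_mono ennreal_leI) simp
        also have "\<dots> \<le> ennreal m" using tmean_abs_moment[OF \<theta>] unfolding m(1) .
        finally show "(\<integral>x. ?g n x \<partial>tmean \<theta> \<rho>) \<le> m" using m(2) by (simp add: ennreal_le_iff)
      qed
    qed (rule trivial_limit_at_right_real)
    moreover have "(\<integral>\<^sup>+x. ennreal (?g n x) \<partial>?\<mu>) = ennreal (\<integral>x. ?g n x \<partial>?\<mu>)"
      by (rule nn_integral_eq_integral[OF int[OF net_spectral_distribution]]) simp
    ultimately show ?thesis by (simp add: ennreal_leI)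
  qed
  have "abs_moment \<alpha> ?\<mu> = (\<integral>\<^sup>+x. (SUP n. ennreal (?g n x)) \<partial>?\<mu>)"
    unfolding abs_moment_def
  proof (rule nn_integral_cong)
    fix x :: real
    obtain k :: nat where k: "\<bar>x\<bar> powr \<alpha> \<le> real k" using real_arch_simple by blast
    show "ennreal (\<bar>x\<bar> powr \<alpha>) = (SUP n. ennreal (?g n x))"
    proof (rule antisym)
      show "ennreal (\<bar>x\<bar> powr \<alpha>) \<le> (SUP n. ennreal (?g n x))" using k by (intro SUP_upper2[of k]) auto
      show "(SUP n. ennreal (?g n x)) \<le> ennreal (\<bar>x\<bar> powr \<alpha>)" by (intro SUP_least ennreal_leI) simp
    qed
  qed
  also have "\<dots> = (SUP n. \<integral>\<^sup>+x. ennreal (?g n x) \<partial>?\<mu>)"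
    by (rule nn_integral_monotone_convergence_SUP) (auto simp: incseq_def le_fun_def intro!: ennreal_leI)
  also have "\<dots> \<le> ennreal m" by (intro SUP_least le)
  finally show ?thesis unfolding m(1) .
qed

text \<open>The mean of each truncated spectral measure is the truncated loop weight. The identity
  is unbounded, so it is clipped at R; the error is at most R^{1 - \<alpha>} times the mean of
  \<open>xi\<close>, uniformly in \<theta>, and vanishes as R grows because \<alpha> > 1.\<close>

lemma net_spectral_mean:
  shows "integrable (net_spectral \<rho>) (\<lambda>x. x)"
    and "integrable \<rho> (\<lambda>c. Re (wt (gnet c) (groot c) (groot c)))"
    and "(\<integral>x. x \<partial>net_spectral \<rho>) = (\<integral>c. Re (wt (gnet c) (groot c) (groot c)) \<partial>\<rho>)"
proof -
  obtain m where m: "(\<integral>\<^sup>+c. xi \<alpha> c \<partial>\<rho>) = ennreal m" "0 \<le> m" using fin by (cases "\<integral>\<^sup>+c. xi \<alpha> c \<partial>\<rho>") auto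
  let ?\<mu> = "net_spectral \<rho>"
  let ?w = "\<lambda>c. Re (wt (gnet c) (groot c) (groot c))" and ?k = "\<lambda>\<theta> c. Re (kern \<theta> 0 (gnet c) (groot c) (groot c))"
  have am: "abs_moment \<alpha> ?\<mu> \<le> ennreal m" using net_spectral_abs_moment unfolding m(1) .
  have a1: "1 \<le> \<alpha>" using \<alpha> by simp
  show "integrable ?\<mu> (\<lambda>x. x)" by (rule clip_mean(1)[OF net_spectral_distribution am a1 m(2) zero_less_one])
  have wle: "AE c in \<rho>. norm (wt (gnet c) (groot c) (groot c)) \<le> 1 + enn2real (xi \<alpha> c)"
    using AE_deg_le
  proof eventually_elim
    case (elim c)
    have "(\<Sum>z\<in>{groot c}. (norm (wt (gnet c) (groot c) z))\<^sup>2) \<le> net_deg (gnet c) (groot c)"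
      unfolding net_deg_def by (rule finite_sum_le_infsum[OF is_networkD(3)[OF is_network_gnet groot_in]]) auto
    then have "norm (wt (gnet c) (groot c) (groot c)) \<le> sqrt (net_deg (gnet c) (groot c))" by (intro real_le_rsqrt) simp
    then show ?case using elim by simp
  qed
  have mw: "?w \<in> borel_measurable \<rho>" 
    by (intro borel_\<rho> borel_measurable_continuous_onI continuous_on_Re local_cont_root local_cont_wt)
  show "integrable \<rho> ?w"
    by (rule Bochner_Integration.integrable_bound[OF integrable_xi mw])
      (use wle in \<open>eventually_elim, auto intro: order_trans[OF abs_Re_le_cmod]\<close>)
  have tk: "(\<integral>x. x \<partial>tspec \<theta> c) = ?k \<theta> c" if "0 < \<theta>" for \<theta> c
  proof -
    have "complex_of_real (\<integral>x. x ^ 1 \<partial>tspec \<theta> c) = wt (knet \<theta> 0 (gnet c)) (groot c) (groot c)"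
      unfolding tspec_props(3)[OF that] by (rule wpow_1) simp_all
    then have "complex_of_real (\<integral>x. x \<partial>tspec \<theta> c) = kern \<theta> 0 (gnet c) (groot c) (groot c)" by (simp add: knet_simps)
    then show ?thesis by (metis Re_complex_of_real)
  qed
  have mk: "?k \<theta> \<in> borel_measurable \<rho>" if "0 < \<theta>" for \<theta>
  proof -
    have "(\<lambda>c. \<integral>x. x \<partial>tspec \<theta> c) \<in> borel_measurable \<rho>" by (rule measurable_integral_tspec[OF that \<rho>]) simp
    then show ?thesis unfolding tk[OF that] .
  qed
  have kle: "AE c in \<rho>. norm (?k \<theta> c) \<le> 1 + enn2real (xi \<alpha> c)" if "0 < \<theta>" for \<theta>
    using wle
  proof eventually_elim
    case (elim c)
    have "norm (?k \<theta> c) \<le> norm (kern \<theta> 0 (gnet c) (groot c) (groot c))" by (simp add: abs_Re_le_cmod)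
    also have "\<dots> \<le> norm (wt (gnet c) (groot c) (groot c))" by (rule norm_kern_le[OF that])
    finally show ?case using elim by simp
  qed
  have ik: "integrable \<rho> (?k \<theta>)" if "0 < \<theta>" for \<theta>
    by (rule Bochner_Integration.integrable_bound[OF integrable_xi mk[OF that]])
      (use kle[OF that] in \<open>eventually_elim, simp\<close>)
  have lk: "((\<lambda>\<theta>. \<integral>c. ?k \<theta> c \<partial>\<rho>) \<longlongrightarrow> (\<integral>c. ?w c \<partial>\<rho>)) (at_right 0)"
  proof (rule at_right_seqI)
    fix X :: "nat \<Rightarrow> real" assume X: "\<And>n. 0 < X n" "X \<longlonglongrightarrow> 0"
    show "(\<lambda>n. \<integral>c. ?k (X n) c \<partial>\<rho>) \<longlonglongrightarrow> (\<integral>c. ?w c \<partial>\<rho>)"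
    proof (rule integral_dominated_convergence[where w = "\<lambda>c. 1 + enn2real (xi \<alpha> c)"])
      show "AE c in \<rho>. (\<lambda>n. ?k (X n) c) \<longlonglongrightarrow> ?w c"
        using X by (intro AE_I2 tendsto_Re tendsto_kern_0 is_network_gnet groot_in) auto
    qed (intro integrable_xi mw mk kle X)+
  qed
  \<comment> \<open>The clipping error occurs twice, before the limit in \<theta> and for the limit
    measure, hence the factor 2.\<close>
  have main: "\<bar>(\<integral>x. x \<partial>?\<mu>) - (\<integral>c. ?w c \<partial>\<rho>)\<bar> \<le> 2 * m * R powr (1 - \<alpha>)" if R: "0 < R" for R
  proof -
    let ?s = "R powr (1 - \<alpha>)"
    have pre: "\<bar>(\<integral>x. clip R x \<partial>tmean \<theta> \<rho>) - (\<integral>c. ?k \<theta> c \<partial>\<rho>)\<bar> \<le> ?s * m" if \<theta>: "0 < \<theta>" for \<theta>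
    proof -
      have ic: "integrable \<rho> (\<lambda>c. \<integral>x. clip R x \<partial>tspec \<theta> c)"
      proof (rule integrable_const_bound[where B = R])
        show "(\<lambda>c. \<integral>x. clip R x \<partial>tspec \<theta> c) \<in> borel_measurable \<rho>" by (rule measurable_integral_tspec[OF \<theta> \<rho>]) simp
        have "norm (\<integral>x. clip R x \<partial>tspec \<theta> c) \<le> R" for c
        proof -
          interpret ts: real_distribution "tspec \<theta> c" by (rule tspec_props(1)[OF \<theta>])
          have "norm (\<integral>x. clip R x \<partial>tspec \<theta> c) \<le> (\<integral>x. R \<partial>tspec \<theta> c)"
          proof (rule integral_norm_le)
            show "integrable (tspec \<theta> c) (clip R)" by (rule ts.integrable_const_bound[where B = R]) (use clip_le R in auto)
          qed (use clip_le R in auto)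
          then show ?thesis using ts.prob_space by simp
        qed
        then show "AE c in \<rho>. norm (\<integral>x. clip R x \<partial>tspec \<theta> c) \<le> R" by simp
      qed
      have xr: "integrable \<rho> (\<lambda>c. enn2real (xi \<alpha> c))"
        using Bochner_Integration.integrable_diff[OF integrable_xi integrable_const[of 1]] by simp
      have xm: "(\<integral>c. enn2real (xi \<alpha> c) \<partial>\<rho>) = m"
      proof -
        have "ennreal (\<integral>c. enn2real (xi \<alpha> c) \<partial>\<rho>) = (\<integral>\<^sup>+c. ennreal (enn2real (xi \<alpha> c)) \<partial>\<rho>)"
          by (rule nn_integral_eq_integral[symmetric, OF xr]) simp
        also have "\<dots> = ennreal m" unfolding m(1)[symmetric]
          by (rule nn_integral_cong_AE) (use AE_xi_finite in \<open>eventually_elim, simp add: ennreal_enn2real_if\<close>)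
        finally show ?thesis using m(2) by (simp add: integral_nonneg_AE)
      qed
      have "(\<integral>x. clip R x \<partial>tmean \<theta> \<rho>) = (\<integral>c. \<integral>x. clip R x \<partial>tspec \<theta> c \<partial>\<rho>)"
        by (rule integral_tmean[OF \<theta> \<rho>, where B = R]) (use clip_le R in auto)
      then have "(\<integral>x. clip R x \<partial>tmean \<theta> \<rho>) - (\<integral>c. ?k \<theta> c \<partial>\<rho>) = (\<integral>c. (\<integral>x. clip R x \<partial>tspec \<theta> c) - ?k \<theta> c \<partial>\<rho>)"
        using ic ik[OF \<theta>] by simp
      then have "\<bar>(\<integral>x. clip R x \<partial>tmean \<theta> \<rho>) - (\<integral>c. ?k \<theta> c \<partial>\<rho>)\<bar> = norm (\<integral>c. (\<integral>x. clip R x \<partial>tspec \<theta> c) - ?k \<theta> c \<partial>\<rho>)"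
        by simp
      also have "\<dots> \<le> (\<integral>c. ?s * enn2real (xi \<alpha> c) \<partial>\<rho>)"
      proof (rule integral_norm_le)
        show "integrable \<rho> (\<lambda>c. (\<integral>x. clip R x \<partial>tspec \<theta> c) - ?k \<theta> c)" using ic ik[OF \<theta>] by simp
        show "integrable \<rho> (\<lambda>c. ?s * enn2real (xi \<alpha> c))" using xr by simp
        show "AE c in \<rho>. norm ((\<integral>x. clip R x \<partial>tspec \<theta> c) - ?k \<theta> c) \<le> ?s * enn2real (xi \<alpha> c)"
          using AE_xi_finite
        proof eventually_elim
          case (elim c)
          then have "abs_moment \<alpha> (tspec \<theta> c) \<le> ennreal (enn2real (xi \<alpha> c))"
            using tspec_powr_moment[of \<theta> \<alpha> c] \<theta> \<alpha> by (simp add: abs_moment_def ennreal_enn2real_if)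
          from clip_mean(2)[OF tspec_props(1)[OF \<theta>] this a1 _ R] show ?case unfolding tk[OF \<theta>] by simp
        qed
      qed
      also have "\<dots> = ?s * m" by (simp add: xm)
      finally show ?thesis .
    qed
    have lc: "((\<lambda>\<theta>. \<integral>x. clip R x \<partial>tmean \<theta> \<rho>) \<longlongrightarrow> (\<integral>x. clip R x \<partial>?\<mu>)) (at_right 0)"
    proof (rule net_spectral_weak_lim[unfolded weak_lim_def, rule_format], intro conjI)
      show "continuous_on UNIV (clip R)" unfolding clip_def[abs_def] by (intro continuous_intros)
      show "bounded (range (clip R))" by (rule boundedI[of _ R]) (use clip_le R in auto)
    qed
    have "\<bar>(\<integral>x. clip R x \<partial>?\<mu>) - (\<integral>c. ?w c \<partial>\<rho>)\<bar> \<le> ?s * m"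
    proof (rule tendsto_upperbound[OF tendsto_rabs[OF tendsto_diff[OF lc lk]]])
      show "eventually (\<lambda>\<theta>. \<bar>(\<integral>x. clip R x \<partial>tmean \<theta> \<rho>) - (\<integral>c. ?k \<theta> c \<partial>\<rho>)\<bar> \<le> ?s * m) (at_right 0)"
        unfolding eventually_at_filter by (intro always_eventually allI impI pre) simp
    qed (rule trivial_limit_at_right_real)
    moreover have "\<bar>(\<integral>x. clip R x \<partial>?\<mu>) - (\<integral>x. x \<partial>?\<mu>)\<bar> \<le> ?s * m"
      by (rule clip_mean(2)[OF net_spectral_distribution am a1 m(2) R])
    ultimately show ?thesis by (simp add: field_simps)
  qed
  have "((\<lambda>R. 2 * m * R powr (1 - \<alpha>)) \<longlongrightarrow> 2 * m * 0) at_top"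
    using \<alpha> by (intro tendsto_mult tendsto_const tendsto_neg_powr filterlim_ident) auto
  then have "((\<lambda>R. 2 * m * R powr (1 - \<alpha>)) \<longlongrightarrow> 0) at_top" by simp
  then have "\<bar>(\<integral>x. x \<partial>?\<mu>) - (\<integral>c. ?w c \<partial>\<rho>)\<bar> \<le> 0"
    by (rule tendsto_lowerbound) (auto intro: eventually_mono[OF eventually_gt_at_top[of 0]] main)
  then show "(\<integral>x. x \<partial>?\<mu>) = (\<integral>c. ?w c \<partial>\<rho>)" by simp
qed

end

section \<open>The lower bounds\<close>

lemma gnet_matrix_diag:
  assumes "H \<in> admissible Sa Sb n" "v \<in> {1..n}"
  shows "wt (gnet (rooted_class (matrix_network n H) v)) (groot (rooted_class (matrix_network n H) v)) (groot (rooted_class (matrix_network n H) v)) = H v v"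
proof -
  have "v \<in> verts (matrix_network n H)" using assms(2) by simp
  from gnet_rooted_class[OF is_network_matrix[OF assms(1)] this] obtain \<sigma> where
    s: "net_emb \<sigma> (gnet (rooted_class (matrix_network n H) v)) (matrix_network n H)"
      "\<sigma> (groot (rooted_class (matrix_network n H) v)) = v" by blast
  show ?thesis using net_embD(3)[OF s(1) groot_in groot_in] unfolding s(2) wt_matrix_network by (rule sym)
qed

text \<open>The loops of the approximating matrices are nonnegative, and being a nonnegative real is
  a closed condition on a continuous function of the class.\<close>

lemma sofic_root_nonneg:
  assumes "\<rho> \<in> sofic Sa {1}"
  shows "AE c in \<rho>. wt (gnet c) (groot c) (groot c) = of_real (norm (wt (gnet c) (groot c) (groot c)))"
proof -
  from assms obtain H where \<rho>: "prob_space \<rho>" "sets \<rho> = sets borel" and H: "\<And>n. H n \<in> admissible Sa {1} n"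
    and w: "weak_lim (\<lambda>n. unif_law (matrix_network n (H n))) \<rho> sequentially"
    unfolding sofic_def by blast
  interpret prob_space \<rho> by (rule \<rho>(1))
  \<comment> \<open>Bounded, continuous, and zero exactly when the loop weight is a nonnegative
    real.\<close>
  define f where "f c = min 1 (norm (wt (gnet c) (groot c) (groot c) - of_real (norm (wt (gnet c) (groot c) (groot c)))))" for c
  have cf: "continuous_on UNIV f"
    unfolding f_def[abs_def]
    by (intro continuous_on_min continuous_on_const continuous_on_norm continuous_on_diff continuous_on_of_real local_cont_root local_cont_wt)
  have f0: "0 \<le> f c" "\<bar>f c\<bar> \<le> 1" for c by (auto simp: f_def)
  have "f (rooted_class (matrix_network n (H n)) v) = 0" if v: "v \<in> {1..n}" for n v
  proof -
    have "H n v v = 0 \<or> H n v v / of_real (norm (H n v v)) = 1"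
      using H[of n] v unfolding admissible_def by blast
    then have "H n v v = of_real (norm (H n v v))" by (auto simp: field_simps split: if_splits)
    then show ?thesis unfolding f_def gnet_matrix_diag[OF H v] by simp
  qed
  then have z: "(\<Sum>v=1..n. f (rooted_class (matrix_network n (H n)) v)) / real n = 0" for n by simp
  have "(\<integral>c. f c \<partial>\<rho>) = 0"
    using sofic_average_tendsto[OF w cf f0(2)] unfolding z LIMSEQ_const_iff by simp
  moreover have "f \<in> borel_measurable \<rho>"
    using borel_measurable_continuous_onI[OF cf] measurable_cong_sets[OF \<rho>(2) refl] by blast
  then have "integrable \<rho> f" using f0(2) by (intro integrable_const_bound[where B = 1]) auto
  ultimately have "AE c in \<rho>. f c = 0" using f0(1) integral_nonneg_eq_0_iff_AE[of \<rho> f] by auto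
  then show ?thesis by eventually_elim (auto simp: f_def min_def split: if_splits)
qed

lemma nn_integral_xi:
  assumes "sets \<rho> = sets borel" "0 < \<alpha>"
  shows "(\<integral>\<^sup>+c. xi \<alpha> c \<partial>\<rho>) = (\<integral>\<^sup>+c. ennreal (norm (wt (gnet c) (groot c) (groot c)) powr \<alpha>) \<partial>\<rho>) +
    (\<integral>\<^sup>+c. (\<Sum>\<^sub>\<infinity>v\<in>verts (gnet c) - {groot c}. ennreal (norm (wt (gnet c) (groot c) v) powr \<alpha>)) \<partial>\<rho>)"
proof -
  have m: "f \<in> borel_measurable \<rho>" if "f \<in> borel_measurable borel" for f :: "gstar \<Rightarrow> ennreal"
    using that measurable_cong_sets[OF assms(1) refl] by blast
  have 1: "(\<lambda>c. ennreal (norm (wt (gnet c) (groot c) (groot c)) powr \<alpha>)) \<in> borel_measurable borel"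
    using borel_root_wt by measurable
  have 2: "(\<lambda>c. \<Sum>\<^sub>\<infinity>v\<in>verts (gnet c) - {groot c}. ennreal (norm (wt (gnet c) (groot c) v) powr \<alpha>)) \<in> borel_measurable borel"
    using borel_weight_sum[OF assms(2), of True] by simp
  show ?thesis unfolding xi_split by (rule nn_integral_add[OF m[OF 1] m[OF 2]])
qed

context
  fixes \<rho> :: "gstar measure" and \<alpha> b :: real and a :: ennreal and Sa :: "complex set"
  assumes sofic: "\<rho> \<in> sofic Sa {1}" and \<alpha>: "1 < \<alpha>" "\<alpha> < 2" and ab: "0 < a" "0 < b"
    and I: "rate_I \<alpha> a b \<rho> < \<infinity>"
begin

text \<open>Both coefficients of the rate are positive, so finiteness of the rate bounds the loop
  part and the edge part of \<open>xi\<close> separately.\<close>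

lemma rate_I_finite:
  shows "prob_space \<rho>" "sets \<rho> = sets borel" "tr_lipschitz \<rho>" "(\<integral>\<^sup>+c. xi \<alpha> c \<partial>\<rho>) < \<infinity>"
proof -
  show \<rho>: "prob_space \<rho>" "sets \<rho> = sets borel" using sofic unfolding sofic_def by blast+
  show "tr_lipschitz \<rho>" by (rule sofic_tr_lipschitz[OF sofic])
  let ?A = "\<integral>\<^sup>+c. ennreal (norm (wt (gnet c) (groot c) (groot c)) powr \<alpha>) \<partial>\<rho>"
  let ?B = "\<integral>\<^sup>+c. (\<Sum>\<^sub>\<infinity>v\<in>verts (gnet c) - {groot c}. ennreal (norm (wt (gnet c) (groot c) v) powr \<alpha>)) \<partial>\<rho>"
  have "ennreal b * ?A < top" "a / 2 * ?B < top" using I unfolding rate_I_def by simp_all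
  moreover have "a / 2 \<noteq> 0" using ab(1) by (simp add: ennreal_divide_eq_0_iff)
  ultimately have "?A < top" "?B < top" using ab(2) by (auto simp: ennreal_mult_less_top)
  then show "(\<integral>\<^sup>+c. xi \<alpha> c \<partial>\<rho>) < \<infinity>" unfolding nn_integral_xi[OF \<rho>(2) order.strict_trans[OF zero_less_one \<alpha>(1)]] by simp
qed

lemma net_spectral_mean_nonneg: "integrable (net_spectral \<rho>) (\<lambda>x. x)" "0 \<le> (\<integral>x. x \<partial>net_spectral \<rho>)"
proof -
  note m = net_spectral_mean[OF rate_I_finite(1-3) \<alpha> rate_I_finite(4)]
  show "integrable (net_spectral \<rho>) (\<lambda>x. x)" by (rule m(1))
  have "AE c in \<rho>. 0 \<le> Re (wt (gnet c) (groot c) (groot c))"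
    using sofic_root_nonneg[OF sofic] by eventually_elim (metis Re_complex_of_real norm_ge_zero)
  then show "0 \<le> (\<integral>x. x \<partial>net_spectral \<rho>)" unfolding m(3) by (rule integral_nonneg_AE)
qed

lemma centered_rate_ge:
  assumes "(\<integral>x. x \<partial>net_spectral \<rho>) = 0"
  shows "a / 2 * abs_moment \<alpha> (net_spectral \<rho>) \<le> rate_I \<alpha> a b \<rho>"
proof -
  note m = net_spectral_mean[OF rate_I_finite(1-3) \<alpha> rate_I_finite(4)]
  have r: "AE c in \<rho>. wt (gnet c) (groot c) (groot c) = of_real (norm (wt (gnet c) (groot c) (groot c)))"
    by (rule sofic_root_nonneg[OF sofic])
  have "AE c in \<rho>. 0 \<le> Re (wt (gnet c) (groot c) (groot c))"
    using r by eventually_elim (metis Re_complex_of_real norm_ge_zero)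
  then have "AE c in \<rho>. Re (wt (gnet c) (groot c) (groot c)) = 0"
    using assms integral_nonneg_eq_0_iff_AE[OF m(2)] unfolding m(3) by blast
  with r have z: "AE c in \<rho>. ennreal (norm (wt (gnet c) (groot c) (groot c)) powr \<alpha>) = 0"
  proof eventually_elim
    case (elim c)
    then have "wt (gnet c) (groot c) (groot c) = 0" by (metis Re_complex_of_real of_real_0)
    then show ?case by simp
  qed
  have "(\<integral>\<^sup>+c. ennreal (norm (wt (gnet c) (groot c) (groot c)) powr \<alpha>) \<partial>\<rho>) = (\<integral>\<^sup>+c. 0 \<partial>\<rho>)"
    by (rule nn_integral_cong_AE[OF z])
  then have z: "(\<integral>\<^sup>+c. ennreal (norm (wt (gnet c) (groot c) (groot c)) powr \<alpha>) \<partial>\<rho>) = 0" by simp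
  have "a / 2 * abs_moment \<alpha> (net_spectral \<rho>) \<le> a / 2 * (\<integral>\<^sup>+c. xi \<alpha> c \<partial>\<rho>)"
    by (intro mult_left_mono net_spectral_abs_moment[OF rate_I_finite(1-3) \<alpha> rate_I_finite(4)]) simp
  also have "\<dots> = rate_I \<alpha> a b \<rho>"
    unfolding rate_I_def nn_integral_xi[OF rate_I_finite(2) order.strict_trans[OF zero_less_one \<alpha>(1)]] z by simp
  finally show ?thesis .
qed

end

lemma ext_mean_integrable:
  assumes "integrable \<mu> (\<lambda>x. x)"
  shows "ext_mean \<mu> = ereal (\<integral>x. x \<partial>\<mu>)"
proof -
  have p: "integrable \<mu> (\<lambda>x. max 0 x)" "integrable \<mu> (\<lambda>x. max 0 (- x))" using assms by auto
  have 1: "(\<integral>\<^sup>+x. ennreal x \<partial>\<mu>) = ennreal (\<integral>x. max 0 x \<partial>\<mu>)"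
    by (subst nn_integral_eq_integral[symmetric, OF p(1)]) (auto intro!: nn_integral_cong simp: max_def ennreal_neg)
  have 2: "(\<integral>\<^sup>+x. ennreal (- x) \<partial>\<mu>) = ennreal (\<integral>x. max 0 (- x) \<partial>\<mu>)"
    by (subst nn_integral_eq_integral[symmetric, OF p(2)]) (auto intro!: nn_integral_cong simp: max_def ennreal_neg)
  have n: "0 \<le> (\<integral>x. max 0 x \<partial>\<mu>)" "0 \<le> (\<integral>x. max 0 (- x) \<partial>\<mu>)" by (auto intro!: integral_nonneg_AE)
  have "(\<integral>x. x \<partial>\<mu>) = (\<integral>x. max 0 x - max 0 (- x) \<partial>\<mu>)" by (intro Bochner_Integration.integral_cong) (auto simp: max_def)
  also have "\<dots> = (\<integral>x. max 0 x \<partial>\<mu>) - (\<integral>x. max 0 (- x) \<partial>\<mu>)" by (rule Bochner_Integration.integral_diff[OF p])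
  finally show ?thesis unfolding ext_mean_def 1 2 using n by (simp add: enn2ereal_ennreal)
qed

lemma symmetric_mean_0:
  fixes \<mu> :: "real measure"
  assumes "distr \<mu> borel uminus = \<mu>" "sets \<mu> = sets borel"
  shows "(\<integral>x. x \<partial>\<mu>) = 0"
proof -
  have "uminus \<in> measurable borel (borel :: real measure)" by simp
  then have m: "uminus \<in> measurable \<mu> (borel :: real measure)" using measurable_cong_sets[OF assms(2) refl] by blast
  have "(\<integral>x. x \<partial>\<mu>) = (\<integral>x. x \<partial>distr \<mu> borel uminus)" unfolding assms(1) ..
  also have "\<dots> = (\<integral>x. - x \<partial>\<mu>)" by (rule integral_distr[OF m]) simp
  finally show ?thesis by simp
qed

section \<open>Empirical quantiles\<close>

text \<open>The range of y reaches n + 1 because the quantile levels below are i / (n + 1); rounding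
  down and capping at n each cost at most 1, and never both at once.\<close>

lemma card_le_real:
  assumes "0 \<le> y" "y \<le> real (Suc n)"
  shows "\<bar>real (card {i\<in>{1..n}. real i \<le> y}) - y\<bar> \<le> 1"
proof -
  have "{i\<in>{1..n}. real i \<le> y} = {1..min n (nat \<lfloor>y\<rfloor>)}"
    using assms(1) by (auto simp: le_nat_floor le_floor_iff nat_le_iff) linarith+
  then have "real (card {i\<in>{1..n}. real i \<le> y}) = real (min n (nat \<lfloor>y\<rfloor>))" by simp
  moreover obtain N where "N = nat \<lfloor>y\<rfloor>" "real N \<le> y" "y < real N + 1" using assms(1) by (rule_tac that[of "nat \<lfloor>y\<rfloor>"]) linarith+
  ultimately show ?thesis using assms(2) by (simp only: of_nat_min of_nat_Suc)
qed

text \<open>Quantiles give a deterministic approximation of the measure by n points of equal mass.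
  The second property keeps the points above every y without mass below it, and yields nonnegative
  loops in \<open>sofic_diagonal\<close>.\<close>

lemma ex_quantiles:
  assumes "real_distribution \<nu>"
  obtains x :: "nat \<Rightarrow> nat \<Rightarrow> real"
  where "\<And>f B. continuous_on UNIV f \<Longrightarrow> (\<And>y. \<bar>f y\<bar> \<le> B) \<Longrightarrow> (\<lambda>n. (\<Sum>i=1..n. f (x n i)) / real n) \<longlonglongrightarrow> (\<integral>y. f y \<partial>\<nu> :: real)"
    and "\<And>n i y. i \<in> {1..n} \<Longrightarrow> cdf \<nu> y = 0 \<Longrightarrow> y < x n i"
proof -
  interpret cdf_distribution \<nu> unfolding cdf_distribution_def by fact
  \<comment> \<open>The denominator n + 1 keeps all levels strictly between 0 and 1, where the
    generalized inverse of the distribution function is well defined.\<close>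
  define x where "x n i = Inf {y. real i / real (Suc n) \<le> cdf \<nu> y}" for n i :: nat
  have x: "real i / real (Suc n) \<le> cdf \<nu> y \<longleftrightarrow> x n i \<le> y" if "i \<in> {1..n}" for n i y
    unfolding x_def by (rule pseudoinverse) (use that in \<open>auto simp: field_simps\<close>)
  \<comment> \<open>The index is shifted by one so that the uniform measure is on a nonempty
    set.\<close>
  define P where "P n = distr (uniform_count_measure {1..Suc n}) borel (x (Suc n))" for n
  have m: "x (Suc n) \<in> measurable (uniform_count_measure {1..Suc n}) borel" for n
    by (auto simp: measurable_def sets_uniform_count_measure space_uniform_count_measure)
  have P: "real_distribution (P n)" for n
    unfolding P_def by (rule prob_space.real_distribution_distr[OF prob_space_uniform_count_measure m]) auto
  have cdf_P: "cdf (P n) y = real (card {i\<in>{1..Suc n}. real i \<le> cdf \<nu> y * real (Suc (Suc n))}) / real (Suc n)" for n y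
  proof -
    have "cdf (P n) y = measure (uniform_count_measure {1..Suc n}) (x (Suc n) -` {..y} \<inter> space (uniform_count_measure {1..Suc n}))"
      unfolding cdf_def P_def by (rule measure_distr[OF m]) simp
    also have "x (Suc n) -` {..y} \<inter> space (uniform_count_measure {1..Suc n}) = {i\<in>{1..Suc n}. real i \<le> cdf \<nu> y * real (Suc (Suc n))}"
      unfolding space_uniform_count_measure using x[of _ "Suc n" y] by (auto simp: pos_divide_le_eq)
    also have "measure (uniform_count_measure {1..Suc n}) \<dots> = real (card \<dots>) / real (card {1..Suc n})"
      by (rule measure_uniform_count_measure) auto
    finally show ?thesis by (simp only: card_atLeastAtMost diff_Suc_1)
  qed
  have "weak_conv_m P \<nu>"
    unfolding weak_conv_m_def weak_conv_def
  proof (intro allI impI)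
    fix y
    have c: "0 \<le> cdf \<nu> y" "cdf \<nu> y \<le> 1" by (auto simp: cdf_nonneg cdf_bounded_prob)
    have "\<bar>cdf (P n) y - cdf \<nu> y\<bar> \<le> 2 / real (Suc n)" for n
    proof -
      let ?C = "real (card {i\<in>{1..Suc n}. real i \<le> cdf \<nu> y * real (Suc (Suc n))})"
      have "\<bar>?C - cdf \<nu> y * real (Suc (Suc n))\<bar> \<le> 1"
        by (rule card_le_real) (use c mult_right_mono[of "cdf \<nu> y" 1 "real (Suc (Suc n))"] in auto)
      then have "\<bar>?C - cdf \<nu> y * real (Suc n)\<bar> \<le> 2" using c by (simp add: algebra_simps)
      moreover have "cdf (P n) y - cdf \<nu> y = (?C - cdf \<nu> y * real (Suc n)) / real (Suc n)"
        unfolding cdf_P by (simp add: field_simps)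
      ultimately show ?thesis by (simp add: abs_divide divide_right_mono)
    qed
    then have "(\<lambda>n. cdf (P n) y - cdf \<nu> y) \<longlonglongrightarrow> 0"
      by (intro Lim_null_comparison[OF _ LIMSEQ_Suc[OF lim_const_over_n[of 2]]]) simp
    then show "(\<lambda>n. cdf (P n) y) \<longlonglongrightarrow> cdf \<nu> y" by (rule Lim_null[THEN iffD2])
  qed
  note wc = weak_conv_imp_integral_bdd_continuous_conv[OF P assms this]
  show thesis
  proof
    fix f :: "real \<Rightarrow> real" and B assume f: "continuous_on UNIV f" "\<And>y. \<bar>f y\<bar> \<le> B"
    have "(\<lambda>n. \<integral>y. f y \<partial>P n) \<longlonglongrightarrow> (\<integral>y. f y \<partial>\<nu>)"
      by (rule wc[where B = B]) (use f in \<open>auto simp: continuous_on_eq_continuous_at\<close>)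
    moreover have eq: "(\<integral>y. f y \<partial>P n) = (\<Sum>i=1..Suc n. f (x (Suc n) i)) / real (Suc n)" for n
    proof -
      have "(\<integral>y. f y \<partial>P n) = (\<integral>i. f (x (Suc n) i) \<partial>uniform_count_measure {1..Suc n})"
        unfolding P_def by (rule integral_distr[OF m borel_measurable_continuous_onI[OF f(1)]])
      then show ?thesis by (simp add: integral_uniform_count_measure)
    qed
    ultimately have "(\<lambda>n. (\<Sum>i=1..Suc n. f (x (Suc n) i)) / real (Suc n)) \<longlonglongrightarrow> (\<integral>y. f y \<partial>\<nu>)" by (simp only:)
    then show "(\<lambda>n. (\<Sum>i=1..n. f (x n i)) / real n) \<longlonglongrightarrow> (\<integral>y. f y \<partial>\<nu>)"
      by (rule filterlim_sequentially_Suc[THEN iffD1])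
  next
    fix n i :: nat and y :: real assume i: "i \<in> {1..n}" and y: "cdf \<nu> y = 0"
    have "\<not> real i / real (Suc n) \<le> cdf \<nu> y" unfolding y using i by (simp add: field_simps)
    then show "y < x n i" unfolding x[OF i] by simp
  qed
qed

section \<open>Networks with at most two vertices\<close>

definition pairnet :: "real \<Rightarrow> complex \<Rightarrow> nat network" where
  "pairnet l z = \<lparr>verts = {0, Suc 0}, wt = \<lambda>u v. if u = 0 \<and> v = 0 then of_real l
     else if u = 0 \<and> v = Suc 0 then z else if u = Suc 0 \<and> v = 0 then cnj z else 0\<rparr>"

text \<open>For \<open>z\<close> = 0 the second vertex is cut off from the root, and this is the
  class of a single vertex with a loop. One family thus serves the constructions for (a) and
  (b).\<close>

definition paircls :: "real \<Rightarrow> complex \<Rightarrow> gstar" where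
  "paircls l z = rooted_class (pairnet l z) 0"

lemma verts_pairnet [simp]: "verts (pairnet l z) = {0, Suc 0}"
  by (simp add: pairnet_def)

lemma wt_pairnet [simp]: "wt (pairnet l z) 0 0 = of_real l" "wt (pairnet l z) 0 (Suc 0) = z"
  "wt (pairnet l z) (Suc 0) 0 = cnj z" "wt (pairnet l z) (Suc 0) (Suc 0) = 0"
  by (simp_all add: pairnet_def)

lemma is_network_pairnet: "is_network (pairnet l z)"
  unfolding is_network_def by (intro conjI) (simp_all add: pairnet_def)

lemma paircls_emb:
  obtains e where "net_emb e (gnet (paircls l z)) (pairnet l z)" "e (groot (paircls l z)) = 0"
  using gnet_rooted_class[OF is_network_pairnet, of 0 l z] that by (auto simp: paircls_def)

lemma net_emb_ball:
  assumes "net_emb e G H" "r \<in> verts G"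
  shows "bij_betw e (net_ball G r t) (net_ball H (e r) t)"
  unfolding bij_betw_def
proof
  show "inj_on e (net_ball G r t)"
    by (rule inj_on_subset[OF net_embD(1)[OF assms(1)]]) (auto simp: net_ball_def)
  show "e ` net_ball G r t = net_ball H (e r) t"
  proof (intro equalityI subsetI)
    fix y assume "y \<in> e ` net_ball G r t"
    then show "y \<in> net_ball H (e r) t"
      using net_embD(2)[OF assms(1)] net_emb_dist[OF assms] by (auto simp: net_ball_def)
  next
    fix y assume "y \<in> net_ball H (e r) t"
    then have y: "y \<in> verts H" "net_dist H (e r) y \<le> ennreal t" by (auto simp: net_ball_def)
    then have "net_dist H (e r) y < \<infinity>" by (auto intro: order_le_less_trans)
    from net_emb_dist_finite[OF assms y(1) this] obtain x where x: "x \<in> verts G" "y = e x" by blast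
    then show "y \<in> e ` net_ball G r t" using y(2) net_emb_dist[OF assms x(1)] by (auto simp: net_ball_def)
  qed
qed

lemma ball_pairnet_small:
  assumes "0 < t" "norm z < 1 / t"
  shows "net_ball (pairnet l z) 0 t = {0}"
proof -
  have "\<not> net_dist (pairnet l z) 0 (Suc 0) \<le> ennreal t"
  proof
    assume le: "net_dist (pairnet l z) 0 (Suc 0) \<le> ennreal t"
    \<comment> \<open>The distance is an infimum, so a distance at most t only yields a path shorter
      than some larger t', which must still be below the length of the single edge.\<close>
    obtain t' where t': "t < t'" "norm z * t' < 1"
    proof (cases "z = 0")
      case True
      then show ?thesis by (intro that[of "t + 1"]) auto
    next
      case False
      have "t < 1 / norm z" using assms False by (simp add: field_simps)
      then obtain t' where "t < t'" "t' < 1 / norm z" using dense by blast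
      then show ?thesis using False by (intro that[of t']) (auto simp: field_simps)
    qed
    have "net_dist (pairnet l z) 0 (Suc 0) < ennreal t'"
      using le t'(1) assms(1) by (auto intro: order_le_less_trans simp: ennreal_less_iff)
    then obtain p where p: "net_path (pairnet l z) p" "hd p = 0" "last p = Suc 0" "ennreal (path_len (pairnet l z) p) < ennreal t'"
      by (rule net_dist_lessE)
    have "p \<noteq> []" using p(1) by (simp add: net_path_def)
    then obtain q where q: "p = q @ [Suc 0]" using p(3) by (metis append_butlast_last_id)
    then have qn: "q \<noteq> []" using p(2) by (cases q) auto
    have w: "wt (pairnet l z) (last q) (Suc 0) \<noteq> 0" "net_path (pairnet l z) q"
      using p(1) unfolding q net_path_snoc[OF qn] by auto
    have "last q \<in> {0, Suc 0}" using w(2) qn unfolding net_path_def verts_pairnet using last_in_set by blast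
    then have z: "last q = 0" "z \<noteq> 0" using w(1) by auto
    have "inverse ((norm z)\<^sup>2) \<le> (path_len (pairnet l z) p)\<^sup>2"
      unfolding q path_len_snoc[OF qn] z(1) by simp
    then have "(1 / norm z)\<^sup>2 \<le> (path_len (pairnet l z) p)\<^sup>2" by (simp add: power_one_over inverse_eq_divide)
    then have "1 / norm z \<le> path_len (pairnet l z) p" by (rule power2_le_imp_le) simp
    moreover have "path_len (pairnet l z) p < t'" using p(4) by (simp add: ennreal_less_iff)
    moreover have "t' < 1 / norm z" using t'(2) z(2) by (simp add: field_simps)
    ultimately show False by linarith
  qed
  moreover have "net_dist (pairnet l z) 0 0 \<le> ennreal t" by (simp add: net_dist_self)
  ultimately show ?thesis by (auto simp: net_ball_def)
qed

lemma ball_pairnet_large: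
  assumes "z \<noteq> 0" "1 / norm z \<le> t"
  shows "net_ball (pairnet l z) 0 t = {0, Suc 0}"
proof -
  have s: "net_dist (pairnet l z) 0 0 = 0" by (rule net_dist_self) simp
  have "net_dist (pairnet l z) 0 (Suc 0) \<le> net_dist (pairnet l z) 0 0 + ennreal (1 / norm (wt (pairnet l z) 0 (Suc 0)))"
    using assms(1) by (intro net_dist_step) auto
  also have "\<dots> \<le> ennreal t" using assms(2) by (simp add: s ennreal_leI)
  finally show ?thesis using s by (auto simp: net_ball_def)
qed

lemma near_paircls:
  assumes t: "0 < t" and b: "net_ball (pairnet l z) 0 t = net_ball (pairnet l' z') 0 t"
    and le: "\<bar>l' - l\<bar> \<le> 1 / t" "norm (z' - z) \<le> 1 / t"
  shows "\<exists>\<sigma>. near t (paircls l z) (paircls l' z') \<sigma>"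
proof -
  let ?c = "paircls l z" and ?c' = "paircls l' z'"
  obtain e where e: "net_emb e (gnet ?c) (pairnet l z)" "e (groot ?c) = 0" by (rule paircls_emb)
  obtain e' where e': "net_emb e' (gnet ?c') (pairnet l' z')" "e' (groot ?c') = 0" by (rule paircls_emb)
  let ?B = "net_ball (gnet ?c) (groot ?c) t" and ?B' = "net_ball (gnet ?c') (groot ?c') t"
  have be: "bij_betw e ?B (net_ball (pairnet l z) 0 t)" using net_emb_ball[OF e(1) groot_in] unfolding e(2) .
  have be': "bij_betw e' ?B' (net_ball (pairnet l z) 0 t)" using net_emb_ball[OF e'(1) groot_in] unfolding e'(2) b .
  define \<sigma> where "\<sigma> = inv_into ?B' e' \<circ> e"
  have bs: "bij_betw \<sigma> ?B ?B'" unfolding \<sigma>_def by (rule bij_betw_trans[OF be bij_betw_inv_into[OF be']])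
  have es: "e' (\<sigma> u) = e u" if "u \<in> ?B" for u
    unfolding \<sigma>_def comp_def using bij_betw_inv_into_right[OF be'] bij_betwE[OF be] that by blast
  have sv: "\<sigma> u \<in> verts (gnet ?c')" "u \<in> verts (gnet ?c)" if "u \<in> ?B" for u
    using bij_betwE[OF bs] that by (auto simp: net_ball_def)
  have r: "groot ?c \<in> ?B" "groot ?c' \<in> ?B'" by (auto simp: net_ball_def net_dist_self)
  have "\<sigma> (groot ?c) = groot ?c'"
    unfolding \<sigma>_def comp_def e(2) using bij_betw_inv_into_left[OF be' r(2)] unfolding e'(2) .
  moreover have "norm (wt (gnet ?c') (\<sigma> u) (\<sigma> v) - wt (gnet ?c) u v) \<le> 1 / t" if uv: "u \<in> ?B" "v \<in> ?B" for u v
  proof -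
    have 1: "wt (gnet ?c') (\<sigma> u) (\<sigma> v) = wt (pairnet l' z') (e u) (e v)"
      using net_embD(3)[OF e'(1) sv(1)[OF uv(1)] sv(1)[OF uv(2)]] unfolding es[OF uv(1)] es[OF uv(2)] by (rule sym)
    have 2: "wt (gnet ?c) u v = wt (pairnet l z) (e u) (e v)"
      using net_embD(3)[OF e(1) sv(2)[OF uv(1)] sv(2)[OF uv(2)]] by (rule sym)
    have in2: "e u \<in> {0, Suc 0}" "e v \<in> {0, Suc 0}" using net_embD(2)[OF e(1)] sv(2) uv by (metis verts_pairnet)+
    have c: "norm (cnj z' - cnj z) \<le> 1 / t" using le(2) unfolding complex_cnj_diff[symmetric] complex_mod_cnj .
    have l: "norm (complex_of_real l' - of_real l) \<le> 1 / t" using le(1) unfolding of_real_diff[symmetric] norm_of_real .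
    show ?thesis unfolding 1 2 using in2 le(2) c l t by auto
  qed
  ultimately have "near t ?c ?c' \<sigma>" unfolding near_def using t bs by blast
  then show ?thesis by (intro exI[of _ \<sigma>])
qed

text \<open>The delicate point is \<open>z\<close> = 0: a weak edge is longer than the radius, so
  the ball of a nearby network consists of the root alone, as it does in the limit.\<close>

lemma continuous_paircls: "continuous_on UNIV (\<lambda>p. paircls (fst p) (snd p))"
  unfolding continuous_on_open_vimage[OF open_UNIV]
proof (intro allI impI)
  fix U :: "gstar set" assume U: "open U"
  have "\<exists>d>0. \<forall>q. dist q p < d \<longrightarrow> q \<in> (\<lambda>p. paircls (fst p) (snd p)) -` U \<inter> UNIV"
    if p: "p \<in> (\<lambda>p. paircls (fst p) (snd p)) -` U \<inter> UNIV" for p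
  proof -
    obtain l z where lz: "p = (l, z)" by (cases p)
    have "paircls l z \<in> U" using p lz by simp
    then obtain e where e: "0 < e" "\<And>c'. d_loc (paircls l z) c' < e \<Longrightarrow> c' \<in> U"
      using U unfolding open_gstar_def by blast
    \<comment> \<open>The term 1 / e makes the resulting distance of classes smaller than e; the
      term 2 / |z| keeps the neighbour in the ball even when the weight is halved. For
      \<open>z\<close> = 0 it is 0 by the convention for division.\<close>
    define t where "t = 1 / e + 1 + 2 / norm z"
    have te: "1 / e < t" "2 / norm z \<le> t" "0 < t" using e(1) by (auto simp: t_def add_pos_nonneg)
    define d where "d = (if z = 0 then 1 / t else min (1 / t) (norm z / 2))"
    have d: "0 < d" "d \<le> 1 / t" using te by (auto simp: d_def)
    show ?thesis
    proof (intro exI[of _ d] conjI allI impI d(1))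
      fix q assume q: "dist q p < d"
      obtain l' z' where lz': "q = (l', z')" by (cases q)
      have dl: "\<bar>l' - l\<bar> < d" using dist_fst_le[of q p] q by (simp add: lz lz' dist_real_def)
      have dz: "norm (z' - z) < d" using dist_snd_le[of q p] q by (simp add: lz lz' dist_norm)
      have b: "net_ball (pairnet l z) 0 t = net_ball (pairnet l' z') 0 t"
      proof (cases "z = 0")
        case True
        have "norm z' < 1 / t" using dz d(2) True by simp
        then show ?thesis using te(3) True by (simp add: ball_pairnet_small)
      next
        case False
        have "norm z \<le> norm z' + norm (z' - z)" using norm_triangle_sub[of z z'] by (simp add: norm_minus_commute)
        moreover have "d \<le> norm z / 2" using False by (simp add: d_def)
        ultimately have h: "norm z / 2 \<le> norm z'" using dz by simp
        have pos: "0 < norm z" using False by simp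
        have pos': "0 < norm z'" using h pos by linarith
        have "1 / norm z' \<le> 2 / norm z" using h pos pos' by (simp add: field_simps)
        moreover have "1 / norm z \<le> 2 / norm z" using pos by (simp add: divide_right_mono)
        moreover have "z' \<noteq> 0" using h pos by auto
        ultimately show ?thesis using te(2) False by (simp add: ball_pairnet_large)
      qed
      obtain \<sigma> where "near t (paircls l z) (paircls l' z') \<sigma>"
        using near_paircls[OF te(3) b] dl dz d(2) by fastforce
      then have "d_loc (paircls l z) (paircls l' z') \<le> 1 / (1 + t)" by (rule near_d_loc_le)
      also have "\<dots> < e" using te(1,3) e(1) by (simp add: field_simps add_pos_pos)
      finally show "q \<in> (\<lambda>p. paircls (fst p) (snd p)) -` U \<inter> UNIV" using e(2) by (simp add: lz')
    qed
  qed
  then show "open ((\<lambda>p. paircls (fst p) (snd p)) -` U \<inter> UNIV)" unfolding open_dist by blast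
qed

lemma continuous_paircls_comp:
  assumes "continuous_on UNIV l" "continuous_on UNIV z"
  shows "continuous_on UNIV (\<lambda>x. paircls (l x) (z x))"
  using continuous_on_compose2[OF continuous_paircls continuous_on_Pair[OF assms]] by simp

lemma paircls_weights:
  shows "wt (gnet (paircls l z)) (groot (paircls l z)) (groot (paircls l z)) = of_real l"
    and "0 < \<alpha> \<Longrightarrow> (\<Sum>\<^sub>\<infinity>v\<in>verts (gnet (paircls l z)) - {groot (paircls l z)}.
        ennreal (norm (wt (gnet (paircls l z)) (groot (paircls l z)) v) powr \<alpha>)) = ennreal (norm z powr \<alpha>)"
proof -
  let ?c = "paircls l z"
  obtain e where e: "net_emb e (gnet ?c) (pairnet l z)" "e (groot ?c) = 0" by (rule paircls_emb)
  have w: "wt (gnet ?c) (groot ?c) v = wt (pairnet l z) 0 (e v)" if "v \<in> verts (gnet ?c)" for v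
    using net_embD(3)[OF e(1) groot_in that] unfolding e(2) by (rule sym)
  show "wt (gnet ?c) (groot ?c) (groot ?c) = of_real l" unfolding w[OF groot_in] e(2) by simp
  assume \<alpha>: "0 < \<alpha>"
  let ?f = "\<lambda>y. if y = 0 then 0 else ennreal (norm (wt (pairnet l z) 0 y) powr \<alpha>)"
  have inj: "e v = 0 \<longleftrightarrow> v = groot ?c" if "v \<in> verts (gnet ?c)" for v
    using inj_onD[OF net_embD(1)[OF e(1)] _ that groot_in] e(2) by auto
  have "(\<Sum>\<^sub>\<infinity>v\<in>verts (gnet ?c) - {groot ?c}. ennreal (norm (wt (gnet ?c) (groot ?c) v) powr \<alpha>)) =
      (\<Sum>\<^sub>\<infinity>v\<in>verts (gnet ?c). ?f (e v))"
    by (rule infsum_cong_neutral) (auto simp: inj w)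
  also have "\<dots> = (\<Sum>\<^sub>\<infinity>y\<in>verts (pairnet l z). ?f y)"
  proof (rule net_emb_infsum[OF e(1), symmetric])
    fix y assume y: "y \<in> verts (pairnet l z)" "y \<notin> e ` verts (gnet ?c)"
    have "wt (pairnet l z) (e (groot ?c)) y = 0" by (rule net_embD(4)[OF e(1) groot_in y])
    then show "?f y = 0" unfolding e(2) by simp
  qed
  also have "\<dots> = ennreal (norm z powr \<alpha>)" by simp
  finally show "(\<Sum>\<^sub>\<infinity>v\<in>verts (gnet ?c) - {groot ?c}. ennreal (norm (wt (gnet ?c) (groot ?c) v) powr \<alpha>)) = ennreal (norm z powr \<alpha>)" .
qed

text \<open>Half a point mass at \<open>p\<close> and half at \<open>q\<close>: the spectral measure
  at one end of an edge with eigenvalues \<open>p\<close> and \<open>q\<close>, or a single point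
  mass if they agree.\<close>

definition twopoint :: "real \<Rightarrow> real \<Rightarrow> real measure" where
  "twopoint p q = distr (uniform_count_measure UNIV) borel (\<lambda>b. if b then p else q)"

lemma
  shows real_distribution_twopoint: "real_distribution (twopoint p q)"
    and integral_twopoint: "(f :: real \<Rightarrow> real) \<in> borel_measurable borel \<Longrightarrow> (\<integral>x. f x \<partial>twopoint p q) = (f p + f q) / 2"
proof -
  have m: "(\<lambda>b. if b then p else q) \<in> measurable (uniform_count_measure (UNIV :: bool set)) borel"
    by (auto simp: measurable_def)
  show "real_distribution (twopoint p q)"
    unfolding twopoint_def by (rule prob_space.real_distribution_distr[OF prob_space_uniform_count_measure m]) auto
  assume f: "f \<in> borel_measurable borel"
  have "(\<integral>x. f x \<partial>twopoint p q) = (\<integral>b. f (if b then p else q) \<partial>uniform_count_measure UNIV)"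
    unfolding twopoint_def by (rule integral_distr[OF m f])
  then show "(\<integral>x. f x \<partial>twopoint p q) = (f p + f q) / 2" by (simp add: integral_uniform_count_measure UNIV_bool)
qed

text \<open>Eventual equality, not merely convergence, so that the truncated spectral measures
  eventually coincide with the exact one.\<close>

lemma kern_eventually: "eventually (\<lambda>\<theta>. kern \<theta> 0 G u v = wt G u v) (at_right 0)"
proof (cases "wt G u v = 0")
  case True
  then show ?thesis by (simp add: kern_def tw_def)
next
  case False
  let ?D = "max (ldeg 0 G u) (ldeg 0 G v)"
  \<comment> \<open>The first bound gives \<theta> < 1 and hence (|D| + 2) \<theta>^2 \<le> 1 for
    the degree D, the second makes the weight at least 2\<theta>.\<close>
  define d where "d = min (1 / (\<bar>?D\<bar> + 2)) (norm (wt G u v) / 2)"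
  have "kern \<theta> 0 G u v = wt G u v" if \<theta>: "0 < \<theta>" "\<theta> < d" for \<theta>
    unfolding kern_def
  proof (rule tw_eq_id[OF \<theta>(1)])
    show "2 * \<theta> \<le> norm (wt G u v)" using \<theta> by (simp add: d_def)
    have "\<theta> < 1 / (\<bar>?D\<bar> + 2)" using \<theta> by (simp add: d_def)
    then have 1: "(\<bar>?D\<bar> + 2) * \<theta> < 1" by (simp add: field_simps add_pos_nonneg)
    have "2 * \<theta> \<le> (\<bar>?D\<bar> + 2) * \<theta>" using \<theta>(1) by (intro mult_right_mono) auto
    then have "\<theta> < 1" using 1 \<theta>(1) by linarith
    then have "\<theta>\<^sup>2 \<le> \<theta>" using \<theta>(1) by (simp add: power2_eq_square)
    then have "(\<bar>?D\<bar> + 2) * \<theta>\<^sup>2 \<le> (\<bar>?D\<bar> + 2) * \<theta>" by (intro mult_left_mono) auto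
    then have "(\<bar>?D\<bar> + 2) * \<theta>\<^sup>2 \<le> 1" using 1 by linarith
    then have "\<bar>?D\<bar> + 2 \<le> 1 / \<theta>\<^sup>2" using \<theta>(1) by (simp add: field_simps)
    then show "?D \<le> 1 / \<theta>\<^sup>2 - 1" by linarith
  qed
  moreover have "0 < d" using False by (simp add: d_def add_nonneg_pos)
  ultimately show ?thesis unfolding eventually_at_right_field by blast
qed

lemma wpow_cong:
  assumes "verts G = verts H" "\<And>x y. x \<in> verts H \<Longrightarrow> y \<in> verts H \<Longrightarrow> wt G x y = wt H x y" "u \<in> verts H"
  shows "wpow G k u v = wpow H k u v"
  using assms(3)
proof (induction k arbitrary: u)
  case (Suc k)
  show ?case unfolding wpow_Suc assms(1)
    by (rule infsum_cong) (simp only: Suc.IH assms(2) Suc.prems)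
qed (simp add: wpow_0)

lemma tspec_paircls:
  assumes "\<And>k. wpow (pairnet l z) k 0 0 = of_real ((p ^ k + q ^ k) / 2)"
  shows "eventually (\<lambda>\<theta>. tspec \<theta> (paircls l z) = twopoint p q) (at_right 0)"
proof -
  let ?P = "pairnet l z" and ?c = "paircls l z"
  obtain e where e: "net_emb e (gnet ?c) ?P" "e (groot ?c) = 0" by (rule paircls_emb)
  have "eventually (\<lambda>\<theta>. \<forall>x\<in>{0, Suc 0}. \<forall>y\<in>{0, Suc 0}. kern \<theta> 0 ?P x y = wt ?P x y) (at_right 0)"
    by (intro eventually_ball_finite ballI kern_eventually) auto
  moreover have "eventually (\<lambda>\<theta>::real. 0 < \<theta>) (at_right 0)" by (rule eventually_at_right_less)
  ultimately show ?thesis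
  proof eventually_elim
    case (elim \<theta>)
    note t = tspec_props[OF elim(2)]
    have m: "(\<integral>x. x ^ k \<partial>tspec \<theta> ?c) = (p ^ k + q ^ k) / 2" for k
    proof -
      have "complex_of_real (\<integral>x. x ^ k \<partial>tspec \<theta> ?c) = wpow (knet \<theta> 0 ?P) k (e (groot ?c)) (e (groot ?c))"
        unfolding t(3) by (rule net_emb_wpow[OF net_emb_knet[OF e(1)], symmetric]) simp_all
      also have "\<dots> = wpow ?P k 0 0" unfolding e(2) by (rule wpow_cong) (use elim(1) in auto)
      finally show ?thesis unfolding assms of_real_eq_iff .
    qed
    have m2: "(\<integral>x. x ^ k \<partial>twopoint p q) = (p ^ k + q ^ k) / 2" for k by (rule integral_twopoint) simp
    have i2: "integrable (twopoint p q) (\<lambda>x. x ^ k)" for k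
      unfolding twopoint_def
    proof (subst integrable_distr_eq)
      show "integrable (uniform_count_measure (UNIV :: bool set)) (\<lambda>b. (if b then p else q) ^ k)"
        unfolding uniform_count_measure_def by (rule integrable_point_measure_finite) simp
    qed (auto simp: measurable_def[of "uniform_count_measure UNIV"])
    have "AE x in tspec \<theta> ?c. \<bar>x\<bar> \<le> \<bar>sbound (tbound \<theta>)\<bar>"
      using t(2) by (rule eventually_mono) (rule order_trans[OF _ abs_ge_self])
    then have "twopoint p q = tspec \<theta> ?c"
      by (rule moments_unique[OF t(1) real_distribution_twopoint]) (simp_all only: m m2 i2 abs_ge_zero)
    then show ?case by (rule sym)
  qed
qed

lemma wpow_pairnet:
  shows "wpow (pairnet l 0) k 0 0 = of_real ((l ^ k + l ^ k) / 2)"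
    and "wpow (pairnet 0 z) k 0 0 = of_real ((norm z ^ k + (- norm z) ^ k) / 2)"
proof -
  have s: "wpow (pairnet l z) (Suc k) 0 0 = of_real l * wpow (pairnet l z) k 0 0 + z * wpow (pairnet l z) k (Suc 0) 0"
    "wpow (pairnet l z) (Suc k) (Suc 0) 0 = cnj z * wpow (pairnet l z) k 0 0" for l z k
    by (simp_all add: wpow_Suc)
  have 0: "wpow (pairnet l z) 0 0 0 = 1" "wpow (pairnet l z) 0 (Suc 0) 0 = 0" for l z
    by (simp_all add: wpow_0 unit_vec_def)
  have 1: "wpow (pairnet l 0) k 0 0 = of_real (l ^ k)" for k by (induction k) (simp_all add: 0 s)
  then show "wpow (pairnet l 0) k 0 0 = of_real ((l ^ k + l ^ k) / 2)" by simp
  show "wpow (pairnet 0 z) k 0 0 = of_real ((norm z ^ k + (- norm z) ^ k) / 2)"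
  proof (cases "z = 0")
    case True
    have "wpow (pairnet 0 0) k 0 0 = 0 ^ k" by (induction k) (simp_all add: 0 s)
    then show ?thesis unfolding True by (cases k) auto
  next
    case False
    let ?r = "complex_of_real (norm z)" and ?P = "pairnet 0 z"
    have zz: "z * cnj z = ?r * ?r" using complex_norm_square[of z] by (simp add: power2_eq_square)
    \<comment> \<open>The entries at both vertices are determined together; the factors 2 and 2r
      keep the induction free of divisions.\<close>
    have "2 * wpow ?P k 0 0 = ?r ^ k + (- ?r) ^ k \<and> 2 * ?r * wpow ?P k (Suc 0) 0 = cnj z * (?r ^ k - (- ?r) ^ k)"
    proof (induction k)
      case (Suc k)
      then have a: "2 * wpow ?P k 0 0 = ?r ^ k + (- ?r) ^ k" and b: "2 * ?r * wpow ?P k (Suc 0) 0 = cnj z * (?r ^ k - (- ?r) ^ k)" by auto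
      have "?r * (2 * wpow ?P (Suc k) 0 0) = z * (2 * ?r * wpow ?P k (Suc 0) 0)" by (simp add: s)
      also have "\<dots> = (z * cnj z) * (?r ^ k - (- ?r) ^ k)" unfolding b by (simp only: mult.assoc)
      also have "\<dots> = ?r * (?r ^ Suc k + (- ?r) ^ Suc k)" unfolding zz by (simp add: algebra_simps)
      finally have "2 * wpow ?P (Suc k) 0 0 = ?r ^ Suc k + (- ?r) ^ Suc k" using False by simp
      moreover have "2 * ?r * wpow ?P (Suc k) (Suc 0) 0 = cnj z * ?r * (2 * wpow ?P k 0 0)" by (simp add: s)
      then have "2 * ?r * wpow ?P (Suc k) (Suc 0) 0 = cnj z * (?r ^ Suc k - (- ?r) ^ Suc k)"
        unfolding a by (simp add: algebra_simps)
      ultimately show ?case ..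
    qed (simp add: 0)
    then have "2 * wpow ?P k 0 0 = ?r ^ k + (- ?r) ^ k" by (rule conjunct1)
    then have "wpow ?P k 0 0 = (?r ^ k + (- ?r) ^ k) / 2" by (simp add: eq_divide_eq mult.commute)
    then show ?thesis by simp
  qed
qed

text \<open>Truncations at the class of parameter x eventually have spectral measure (\<delta>_{p x}
  + \<delta>_{q x}) / 2, and the hypothesis \<open>sym\<close> says that averaging these over \<nu>
  gives \<nu> back.\<close>

lemma net_spectral_paircls:
  assumes \<nu>: "real_distribution \<nu>" and c: "continuous_on UNIV l" "continuous_on UNIV z"
    and pq: "p \<in> borel_measurable borel" "q \<in> borel_measurable borel"
    and w: "\<And>x k. wpow (pairnet (l x) (z x)) k 0 0 = of_real ((p x ^ k + q x ^ k) / 2)"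
    and sym: "\<And>f B. continuous_on UNIV f \<Longrightarrow> (\<And>y. \<bar>f y\<bar> \<le> B) \<Longrightarrow> (\<integral>x. (f (p x) + f (q x)) / 2 \<partial>\<nu>) = (\<integral>x. f x \<partial>\<nu> :: real)"
    and \<beta>: "0 < \<beta>" "\<beta> < 2" "(\<integral>\<^sup>+c. xi \<beta> c \<partial>distr \<nu> borel (\<lambda>x. paircls (l x) (z x))) < \<infinity>"
  shows "net_spectral (distr \<nu> borel (\<lambda>x. paircls (l x) (z x))) = \<nu>"
proof -
  interpret real_distribution \<nu> by fact
  let ?g = "\<lambda>x. paircls (l x) (z x)" let ?\<rho> = "distr \<nu> borel ?g"
  have g: "?g \<in> borel_measurable \<nu>"
    using borel_measurable_continuous_onI[OF continuous_paircls_comp[OF c]] by (simp add: borel_measurable_if_D)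
  have \<rho>: "prob_space ?\<rho>" "sets ?\<rho> = sets borel" by (auto intro: prob_space_distr g)
  show ?thesis
  proof (rule net_spectral_eqI[OF \<rho> \<beta> \<nu>])
    show "weak_lim (\<lambda>\<theta>. tmean \<theta> ?\<rho>) \<nu> (at_right 0)"
      unfolding weak_lim_def
    proof (intro allI impI, elim conjE, rule at_right_seqI)
      fix f :: "real \<Rightarrow> real" and X :: "nat \<Rightarrow> real"
      assume f: "continuous_on UNIV f" "bounded (range f)" and X: "\<And>n. 0 < X n" "X \<longlonglongrightarrow> 0"
      obtain B where B: "\<And>y. \<bar>f y\<bar> \<le> B" using f(2) by (auto simp: bounded_iff)
      have mf: "f \<in> borel_measurable borel" by (rule borel_measurable_continuous_onI[OF f(1)])
      have eq: "(\<integral>y. f y \<partial>tmean (X n) ?\<rho>) = (\<integral>x. \<integral>y. f y \<partial>tspec (X n) (?g x) \<partial>\<nu>)" for n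
      proof -
        have "(\<integral>y. f y \<partial>tmean (X n) ?\<rho>) = (\<integral>c. \<integral>y. f y \<partial>tspec (X n) c \<partial>?\<rho>)"
          by (rule integral_tmean[OF X(1) \<rho> mf B])
        also have "\<dots> = (\<integral>x. \<integral>y. f y \<partial>tspec (X n) (?g x) \<partial>\<nu>)"
        proof (rule integral_distr[OF g])
          have "(\<lambda>c. \<integral>y. f y \<partial>tspec (X n) c) \<in> borel_measurable ?\<rho>"
            by (rule measurable_integral_tspec[OF X(1) \<rho> mf])
          then show "(\<lambda>c. \<integral>y. f y \<partial>tspec (X n) c) \<in> borel_measurable borel" by simp
        qed
        finally show ?thesis .
      qed
      have "(\<lambda>n. \<integral>x. \<integral>y. f y \<partial>tspec (X n) (?g x) \<partial>\<nu>) \<longlonglongrightarrow> (\<integral>x. (f (p x) + f (q x)) / 2 \<partial>\<nu>)"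
      proof (rule integral_dominated_convergence[where w = "\<lambda>_. B"])
        have "(\<lambda>x. f (p x)) \<in> borel_measurable borel" "(\<lambda>x. f (q x)) \<in> borel_measurable borel"
          by (rule measurable_compose[OF _ mf], rule pq)+
        then show "(\<lambda>x. (f (p x) + f (q x)) / 2) \<in> borel_measurable \<nu>" by simp
        show "(\<lambda>x. \<integral>y. f y \<partial>tspec (X n) (?g x)) \<in> borel_measurable \<nu>" for n
        proof -
          have "(\<lambda>c. \<integral>y. f y \<partial>tspec (X n) c) \<in> borel_measurable ?\<rho>"
            by (rule measurable_integral_tspec[OF X(1) \<rho> mf])
          then have "(\<lambda>c. \<integral>y. f y \<partial>tspec (X n) c) \<in> borel_measurable borel" by simp
          then show ?thesis by (rule measurable_compose[OF g])
        qed
        show "AE x in \<nu>. (\<lambda>n. \<integral>y. f y \<partial>tspec (X n) (?g x)) \<longlonglongrightarrow> (f (p x) + f (q x)) / 2"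
        proof (rule AE_I2, rule tendsto_eventually)
          fix x
          have ne: "X n \<noteq> 0" for n using X(1)[of n] by simp
          have "filterlim X (at_right 0) sequentially"
            unfolding filterlim_at using X ne by simp
          moreover have "eventually (\<lambda>\<theta>. tspec \<theta> (?g x) = twopoint (p x) (q x)) (at_right 0)" by (rule tspec_paircls[OF w])
          ultimately have "eventually (\<lambda>n. tspec (X n) (?g x) = twopoint (p x) (q x)) sequentially"
            by (rule eventually_compose_filterlim[rotated])
          then
          show "eventually (\<lambda>n. (\<integral>y. f y \<partial>tspec (X n) (?g x)) = (f (p x) + f (q x)) / 2) sequentially"
            by eventually_elim (simp only: integral_twopoint[OF mf])
        qed
        show "AE x in \<nu>. norm (\<integral>y. f y \<partial>tspec (X n) (?g x)) \<le> B" for n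
        proof (rule AE_I2)
          fix x
          interpret ts: real_distribution "tspec (X n) (?g x)" by (rule tspec_props(1)[OF X(1)])
          have "norm (\<integral>y. f y \<partial>tspec (X n) (?g x)) \<le> (\<integral>y. B \<partial>tspec (X n) (?g x))"
          proof (rule integral_norm_le)
            show "integrable (tspec (X n) (?g x)) f" by (rule ts.integrable_const_bound[where B = B]) (use B mf in auto)
          qed (use B in auto)
          then show "norm (\<integral>y. f y \<partial>tspec (X n) (?g x)) \<le> B" using ts.prob_space by simp
        qed
      qed simp
      then show "(\<lambda>n. \<integral>y. f y \<partial>tmean (X n) ?\<rho>) \<longlonglongrightarrow> (\<integral>y. f y \<partial>\<nu>)" unfolding eq sym[OF f(1) B] .
    qed
  qed
qed

section \<open>Sofic laws on networks with at most two vertices\<close>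

lemma rooted_class_isolated:
  assumes G: "is_network G" and v: "v \<in> verts G" "wt G v v = of_real l" "\<And>y. y \<in> verts G \<Longrightarrow> y \<noteq> v \<Longrightarrow> wt G v y = 0"
  shows "rooted_class G v = paircls l 0"
proof -
  let ?N = "\<lparr>verts = {0::nat}, wt = \<lambda>_ _. complex_of_real l\<rparr>"
  have N: "is_network ?N" unfolding is_network_def by simp
  have "net_emb (\<lambda>_. v) ?N G" unfolding net_emb_def net_row_def using v by auto
  then have "rooted_class ?N 0 = rooted_class G v" by (rule rooted_class_eqI[OF N G]) auto
  moreover have "net_emb (\<lambda>_. 0) ?N (pairnet l 0)" unfolding net_emb_def net_row_def by auto
  then have "rooted_class ?N 0 = paircls l 0"
    unfolding paircls_def by (rule rooted_class_eqI[OF N is_network_pairnet]) auto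
  ultimately show ?thesis by simp
qed

lemma rooted_class_pair:
  assumes G: "is_network G" and v: "v \<in> verts G" "w \<in> verts G" "v \<noteq> w"
    and wt: "wt G v v = 0" "wt G w w = 0" "wt G v w = z" "wt G w v = cnj z"
    and iso: "\<And>y. y \<in> verts G \<Longrightarrow> y \<noteq> v \<Longrightarrow> y \<noteq> w \<Longrightarrow> wt G v y = 0 \<and> wt G w y = 0"
  shows "rooted_class G v = paircls 0 z"
proof -
  have "net_emb (\<lambda>i. if i = 0 then v else w) (pairnet 0 z) G"
    unfolding net_emb_def
  proof (intro conjI ballI)
    show "inj_on (\<lambda>i. if i = 0 then v else w) (verts (pairnet 0 z))" using v(3) by (auto simp: inj_on_def)
    show "(\<lambda>i. if i = 0 then v else w) ` verts (pairnet 0 z) \<subseteq> verts G" using v by auto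
    fix i assume i: "i \<in> verts (pairnet 0 z)"
    show "net_row G (if i = 0 then v else w) \<subseteq> (\<lambda>i. if i = 0 then v else w) ` verts (pairnet 0 z)"
      using iso i by (auto simp: net_row_def)
    fix j assume "j \<in> verts (pairnet 0 z)"
    with i show "wt G (if i = 0 then v else w) (if j = 0 then v else w) = wt (pairnet 0 z) i j"
      using wt by auto
  qed
  from rooted_class_eqI[OF is_network_pairnet G this] show ?thesis by (simp add: paircls_def)
qed

lemma distr_sofic:
  assumes \<nu>: "real_distribution \<nu>" and g: "continuous_on UNIV g" and H: "\<And>n. H n \<in> admissible Sa Sb n"
    and lim: "\<And>f B. continuous_on UNIV f \<Longrightarrow> (\<And>c. \<bar>f c\<bar> \<le> B) \<Longrightarrow>
      (\<lambda>n. (\<Sum>v=1..n. f (rooted_class (matrix_network n (H n)) v)) / real n) \<longlonglongrightarrow> (\<integral>x. f (g x) \<partial>\<nu> :: real)"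
  shows "distr \<nu> borel g \<in> sofic Sa Sb"
proof -
  interpret real_distribution \<nu> by fact
  have m: "g \<in> borel_measurable \<nu>" using borel_measurable_continuous_onI[OF g] by simp
  have "weak_lim (\<lambda>n. unif_law (matrix_network n (H n))) (distr \<nu> borel g) sequentially"
    unfolding weak_lim_def
  proof (intro allI impI, elim conjE)
    fix f :: "gstar \<Rightarrow> real" assume f: "continuous_on UNIV f" "bounded (range f)"
    obtain B where B: "\<And>c. \<bar>f c\<bar> \<le> B" using f(2) by (auto simp: bounded_iff)
    have "(\<integral>c. f c \<partial>distr \<nu> borel g) = (\<integral>x. f (g x) \<partial>\<nu>)"
      by (rule integral_distr[OF m borel_measurable_continuous_onI[OF f(1)]])
    then have l: "(\<lambda>n. (\<Sum>v=1..n. f (rooted_class (matrix_network n (H n)) v)) / real n) \<longlonglongrightarrow> (\<integral>c. f c \<partial>distr \<nu> borel g)"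
      using lim[OF f(1) B] by simp
    have "eventually (\<lambda>n. (\<Sum>v=1..n. f (rooted_class (matrix_network n (H n)) v)) / real n =
        (\<integral>c. f c \<partial>unif_law (matrix_network n (H n)))) sequentially"
      using eventually_gt_at_top[of 0] by eventually_elim (rule integral_unif_law[OF f(1), symmetric])
    with l show "(\<lambda>n. \<integral>c. f c \<partial>unif_law (matrix_network n (H n))) \<longlonglongrightarrow> (\<integral>c. f c \<partial>distr \<nu> borel g)"
      by (rule Lim_transform_eventually)
  qed
  moreover have "prob_space (distr \<nu> borel g)" by (rule prob_space_distr[OF m])
  ultimately show ?thesis unfolding sofic_def using H by auto
qed

lemma sofic_diagonal:
  assumes \<nu>: "real_distribution \<nu>" and neg: "\<And>y. y < 0 \<Longrightarrow> cdf \<nu> y = 0"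
  shows "distr \<nu> borel (\<lambda>x. paircls x 0) \<in> sofic Sa {1}"
proof -
  obtain x where x: "\<And>f B. continuous_on UNIV f \<Longrightarrow> (\<And>y. \<bar>f y\<bar> \<le> B) \<Longrightarrow> (\<lambda>n. (\<Sum>i=1..n. f (x n i)) / real n) \<longlonglongrightarrow> (\<integral>y. f y \<partial>\<nu> :: real)"
    and x0: "\<And>n i y. i \<in> {1..n} \<Longrightarrow> cdf \<nu> y = 0 \<Longrightarrow> y < x n i"
    by (rule ex_quantiles[OF \<nu>]) blast
  \<comment> \<open>Every negative y lies below the quantile, as the distribution function vanishes
    there.\<close>
  have pos: "0 \<le> x n i" if "i \<in> {1..n}" for n i
    by (rule dense_le) (use x0[OF that neg] in \<open>auto intro: less_imp_le\<close>)
  define H where "H n i j = (if i = j then complex_of_real (x n i) else 0)" for n i j :: nat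
  have c: "continuous_on UNIV (\<lambda>x. paircls x 0)" by (rule continuous_paircls_comp) (auto intro: continuous_intros)
  have adm: "H n \<in> admissible Sa {1} n" for n
    unfolding admissible_def H_def using pos[of _ n] by auto
  show ?thesis
  proof (rule distr_sofic[OF \<nu> c adm])
    fix f :: "gstar \<Rightarrow> real" and B assume f: "continuous_on UNIV f" "\<And>c. \<bar>f c\<bar> \<le> B"
    have "rooted_class (matrix_network n (H n)) v = paircls (x n v) 0" if "v \<in> {1..n}" for n v
      using that by (intro rooted_class_isolated is_network_matrix[OF adm]) (auto simp: H_def)
    then have "(\<Sum>v=1..n. f (rooted_class (matrix_network n (H n)) v)) = (\<Sum>v=1..n. f (paircls (x n v) 0))" for n
      by (intro sum.cong) auto
    moreover have "(\<lambda>n. (\<Sum>v=1..n. f (paircls (x n v) 0)) / real n) \<longlonglongrightarrow> (\<integral>y. f (paircls y 0) \<partial>\<nu>)"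
      by (rule x[OF continuous_on_compose2[OF f(1) c] f(2)]) auto
    ultimately show "(\<lambda>n. (\<Sum>v=1..n. f (rooted_class (matrix_network n (H n)) v)) / real n) \<longlonglongrightarrow> (\<integral>y. f (paircls y 0) \<partial>\<nu>)"
      by (simp only:)
  qed
qed

text \<open>The weight of a pair with eigenvalues \<open>x\<close> and \<open>- x\<close>: seen from one of its ends it is
  \<open>\<bar>x\<bar> * u\<close>, and from the other \<open>\<bar>x\<bar> * cnj u\<close>; the sign of \<open>x\<close> encodes which end is the root.\<close>

definition edge :: "complex \<Rightarrow> real \<Rightarrow> complex" where
  "edge u x = Complex (\<bar>x\<bar> * Re u) (x * Im u)"

lemma edge_simps: "edge u (- x) = cnj (edge u x)" "0 \<le> x \<Longrightarrow> edge u x = of_real x * u"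
  by (simp_all add: edge_def complex_eq_iff)

lemma norm_edge: "norm u = 1 \<Longrightarrow> norm (edge u x) = \<bar>x\<bar>"
proof -
  assume u: "norm u = 1"
  have "(Re u)\<^sup>2 + (Im u)\<^sup>2 = 1" using cmod_power2[of u] unfolding u by simp
  then have "(\<bar>x\<bar> * Re u)\<^sup>2 + (x * Im u)\<^sup>2 = x\<^sup>2"
    unfolding power_mult_distrib power2_abs distrib_left[symmetric] by simp
  then show ?thesis by (simp add: edge_def complex_norm)
qed

lemma continuous_edge: "continuous_on UNIV (edge u)"
  unfolding edge_def[abs_def] Complex_eq by (intro continuous_intros)

lemma sum_pairs: "(\<Sum>v=1..2 * m. F v) = (\<Sum>k=1..m. F (2 * k - 1) + F (2 * k))" for F :: "nat \<Rightarrow> real"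
  by (induction m) (simp_all add: add.assoc)

text \<open>The matrices consist of blocks on {2k - 1, 2k} whose upper entry points in the direction
  \<open>u\<close>; the direction condition concerns only entries above the diagonal, so the
  conjugate below is allowed. The two ends see the weights of |x| and of -|x|, and both signs are
  equally likely under a symmetric law.\<close>

lemma sofic_pairs:
  assumes \<nu>: "real_distribution \<nu>" "distr \<nu> borel uminus = \<nu>" and u: "u \<in> Sa" "norm u = 1"
  shows "distr \<nu> borel (\<lambda>x. paircls 0 (edge u x)) \<in> sofic Sa Sb"
proof -
  interpret real_distribution \<nu> by (rule \<nu>(1))
  obtain x where x: "\<And>f B. continuous_on UNIV f \<Longrightarrow> (\<And>y. \<bar>f y\<bar> \<le> B) \<Longrightarrow> (\<lambda>n. (\<Sum>i=1..n. f (x n i)) / real n) \<longlonglongrightarrow> (\<integral>y. f y \<partial>\<nu> :: real)"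
    by (rule ex_quantiles[OF \<nu>(1)]) blast
  \<comment> \<open>A matrix of size n has n div 2 blocks, hence the quantiles of that
    index.\<close>
  define z where "z n k = edge u \<bar>x (n div 2) k\<bar>" for n k
  define H where "H n i j = (if even j \<and> Suc i = j then z n (j div 2)
      else if even i \<and> Suc j = i then cnj (z n (i div 2)) else 0)" for n i j :: nat
  have c: "continuous_on UNIV (\<lambda>x. paircls 0 (edge u x))"
    by (rule continuous_paircls_comp) (auto intro: continuous_intros continuous_edge)
  have zdir: "z n k = 0 \<or> z n k / of_real (norm (z n k)) = u" for n k
    unfolding z_def edge_simps(2)[OF abs_ge_zero] using u(2) by (auto simp: norm_mult)
  have adm: "H n \<in> admissible Sa Sb n" for n
    unfolding admissible_def
  proof (intro CollectI conjI ballI impI)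
    fix i j
    show "H n i j = cnj (H n j i)" unfolding H_def by auto
    show "H n i j = 0 \<or> H n i j / of_real (norm (H n i j)) \<in> Sa" if "i < j"
      using zdir[of n "j div 2"] u(1) that unfolding H_def by auto
    show "H n i i = 0 \<or> H n i i / of_real (norm (H n i i)) \<in> Sb" unfolding H_def by auto
  qed
  have odd_cls: "rooted_class (matrix_network n (H n)) (2 * k - 1) = paircls 0 (z n k)"
    and even_cls: "rooted_class (matrix_network n (H n)) (2 * k) = paircls 0 (cnj (z n k))" if k: "k \<in> {1..n div 2}" for n k
  proof -
    have k': "Suc (2 * k - 1) = 2 * k" "odd (2 * k - 1)" "2 * k \<le> n" "1 \<le> 2 * k - 1" using k by auto
    have h: "H n (2 * k - 1) (2 * k) = z n k" "H n (2 * k) (2 * k - 1) = cnj (z n k)"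
      "H n (2 * k) (2 * k) = 0" "H n (2 * k - 1) (2 * k - 1) = 0"
      unfolding H_def using k' by auto
    have iso: "H n (2 * k - 1) y = 0 \<and> H n (2 * k) y = 0" if "y \<noteq> 2 * k - 1" "y \<noteq> 2 * k" for y
      unfolding H_def using k' that by auto
    show "rooted_class (matrix_network n (H n)) (2 * k - 1) = paircls 0 (z n k)"
      by (rule rooted_class_pair[where w = "2 * k"]) (use k' h iso in \<open>auto intro: is_network_matrix[OF adm]\<close>)
    show "rooted_class (matrix_network n (H n)) (2 * k) = paircls 0 (cnj (z n k))"
      by (rule rooted_class_pair[where w = "2 * k - 1"]) (use k' h iso in \<open>auto intro: is_network_matrix[OF adm]\<close>)
  qed
  \<comment> \<open>For odd n the last vertex belongs to no block and is isolated, without a loop;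
    its share of the average is of order 1 / n.\<close>
  have last_cls: "rooted_class (matrix_network n (H n)) n = paircls 0 0" if "odd n" for n
    using that odd_pos[OF that] by (intro rooted_class_isolated is_network_matrix[OF adm]) (auto simp: H_def Suc_le_eq)
  show ?thesis
  proof (rule distr_sofic[OF \<nu>(1) c adm])
    fix f :: "gstar \<Rightarrow> real" and B assume f: "continuous_on UNIV f" "\<And>c. \<bar>f c\<bar> \<le> B"
    let ?F = "\<lambda>y. f (paircls 0 (edge u y))"
    have cF: "continuous_on UNIV ?F" by (rule continuous_on_compose2[OF f(1) c]) auto
    have cF': "continuous_on UNIV (\<lambda>y. ?F (- y))"
      by (rule continuous_on_compose2[OF cF]) (auto intro: continuous_intros)
    have iF: "integrable \<nu> ?F" "integrable \<nu> (\<lambda>y. ?F (- y))"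
      using borel_measurable_continuous_onI[OF cF] borel_measurable_continuous_onI[OF cF'] f(2)
      by (auto intro!: integrable_const_bound[where B = B])
    have "(\<integral>y. ?F (- y) \<partial>\<nu>) = (\<integral>y. ?F y \<partial>distr \<nu> borel uminus)"
      by (rule integral_distr[symmetric]) (auto intro: borel_measurable_continuous_onI[OF cF])
    then have int: "(\<integral>y. ?F y + ?F (- y) \<partial>\<nu>) = 2 * (\<integral>y. ?F y \<partial>\<nu>)" using iF by (simp add: \<nu>(2))
    define A where "A m = (\<Sum>k=1..m. ?F (x m k) + ?F (- x m k)) / real m" for m
    have "A \<longlonglongrightarrow> (\<integral>y. ?F y + ?F (- y) \<partial>\<nu>)"
      unfolding A_def[abs_def]
    proof (rule x)
      show "continuous_on UNIV (\<lambda>y. ?F y + ?F (- y))" by (intro continuous_on_add cF cF')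
      fix y show "\<bar>?F y + ?F (- y)\<bar> \<le> B + B" by (rule order_trans[OF abs_triangle_ineq add_mono[OF f(2) f(2)]])
    qed
    then have A: "A \<longlonglongrightarrow> 2 * (\<integral>y. ?F y \<partial>\<nu>)" unfolding int .
    have "filterlim (\<lambda>n::nat. n div 2) at_top sequentially"
      unfolding filterlim_at_top
    proof
      fix Z :: nat
      show "eventually (\<lambda>n. Z \<le> n div 2) sequentially"
        using eventually_ge_at_top[of "2 * Z"] by eventually_elim auto
    qed
    then have A2: "(\<lambda>n. A (n div 2)) \<longlonglongrightarrow> 2 * (\<integral>y. ?F y \<partial>\<nu>)" by (rule filterlim_compose[OF A])
    have r0: "(\<lambda>n. r n / real n) \<longlonglongrightarrow> 0" if "\<And>n. \<bar>r n\<bar> \<le> C" for r :: "nat \<Rightarrow> real" and C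
    proof (rule Lim_null_comparison[OF always_eventually lim_const_over_n[of C]], rule allI)
      fix n show "norm (r n / real n) \<le> C / real n" using that[of n] by (simp add: abs_divide divide_right_mono)
    qed
    have "eventually (\<lambda>n. 1 / 2 - (real (n mod 2) / 2) / real n = real (n div 2) / real n) sequentially"
      using eventually_gt_at_top[of 0]
    proof eventually_elim
      case (elim n)
      have "real n = 2 * real (n div 2) + real (n mod 2)"
        by (metis of_nat_add of_nat_mult of_nat_numeral mult_div_mod_eq)
      moreover have "1 / 2 - (d / 2) / N = a / N" if "N = 2 * a + d" "0 < N" for N a d :: real
        using that by (simp add: field_simps)
      ultimately show ?case using elim by simp
    qed
    moreover have "(\<lambda>n. 1 / 2 - (real (n mod 2) / 2) / real n) \<longlonglongrightarrow> 1 / 2 - 0"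
    proof (intro tendsto_diff tendsto_const r0)
      fix n :: nat have "n mod 2 < 2" by simp
      then show "\<bar>real (n mod 2) / 2\<bar> \<le> 1" by simp
    qed
    ultimately have half: "(\<lambda>n. real (n div 2) / real n) \<longlonglongrightarrow> 1 / 2 - 0" by (rule Lim_transform_eventually[rotated])
    define r where "r n = (if odd n then f (paircls 0 0) else 0)" for n :: nat
    have "\<bar>r n\<bar> \<le> \<bar>B\<bar>" for n using f(2)[of "paircls 0 0"] abs_ge_zero[of B] abs_ge_self[of B] by (auto simp: r_def)
    then have r: "(\<lambda>n. r n / real n) \<longlonglongrightarrow> 0" by (rule r0)
    have eq: "(\<Sum>v=1..n. f (rooted_class (matrix_network n (H n)) v)) / real n = A (n div 2) * (real (n div 2) / real n) + r n / real n" for n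
    proof -
      let ?f = "\<lambda>v. f (rooted_class (matrix_network n (H n)) v)"
      have "(\<Sum>v=1..2 * (n div 2). ?f v) = (\<Sum>k=1..n div 2. ?F (x (n div 2) k) + ?F (- x (n div 2) k))"
        unfolding sum_pairs
      proof (rule sum.cong[OF refl])
        fix k assume k: "k \<in> {1..n div 2}"
        show "?f (2 * k - 1) + ?f (2 * k) = ?F (x (n div 2) k) + ?F (- x (n div 2) k)"
          unfolding odd_cls[OF k] even_cls[OF k] z_def edge_simps(1)[symmetric]
          \<comment> \<open>The block uses |x|, but the sum over both ends does not change with the
            sign of x.\<close>
          by (cases "0 \<le> x (n div 2) k") simp_all
      qed
      also have "\<dots> = A (n div 2) * real (n div 2)" by (cases "n div 2 = 0") (simp_all add: A_def)
      finally have s: "(\<Sum>v=1..2 * (n div 2). ?f v) = A (n div 2) * real (n div 2)" .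
      have "(\<Sum>v=1..n. ?f v) = A (n div 2) * real (n div 2) + r n"
      proof (cases "even n")
        case True
        then show ?thesis using s by (simp add: r_def)
      next
        case False
        then have n: "n = Suc (2 * (n div 2))" by simp
        have "(\<Sum>v=1..Suc (2 * (n div 2)). ?f v) = (\<Sum>v=1..2 * (n div 2). ?f v) + ?f (Suc (2 * (n div 2)))" by simp
        then show ?thesis unfolding n[symmetric] s last_cls[OF False] using False by (simp add: r_def)
      qed
      then show ?thesis by (simp add: add_divide_distrib)
    qed
    have "(\<lambda>n. A (n div 2) * (real (n div 2) / real n) + r n / real n) \<longlonglongrightarrow> 2 * (\<integral>y. ?F y \<partial>\<nu>) * (1 / 2 - 0) + 0"
      by (intro tendsto_add tendsto_mult A2 half r)
    then show "(\<lambda>n. (\<Sum>v=1..n. f (rooted_class (matrix_network n (H n)) v)) / real n) \<longlonglongrightarrow> (\<integral>y. ?F y \<partial>\<nu>)"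
      unfolding eq by simp
  qed
qed

lemma distr_paircls_integrals:
  assumes \<nu>: "real_distribution \<nu>" and c: "continuous_on UNIV l" "continuous_on UNIV z" and \<alpha>: "0 < \<alpha>"
  defines "\<rho> \<equiv> distr \<nu> borel (\<lambda>x. paircls (l x) (z x))"
  shows "(\<integral>\<^sup>+c. ennreal (norm (wt (gnet c) (groot c) (groot c)) powr \<alpha>) \<partial>\<rho>) = (\<integral>\<^sup>+x. ennreal (\<bar>l x\<bar> powr \<alpha>) \<partial>\<nu>)"
    and "(\<integral>\<^sup>+c. (\<Sum>\<^sub>\<infinity>v\<in>verts (gnet c) - {groot c}. ennreal (norm (wt (gnet c) (groot c) v) powr \<alpha>)) \<partial>\<rho>) = (\<integral>\<^sup>+x. ennreal (norm (z x) powr \<alpha>) \<partial>\<nu>)"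
proof -
  interpret real_distribution \<nu> by fact
  have m: "(\<lambda>x. paircls (l x) (z x)) \<in> borel_measurable \<nu>"
    using borel_measurable_continuous_onI[OF continuous_paircls_comp[OF c]] by simp
  have 1: "(\<lambda>c. ennreal (norm (wt (gnet c) (groot c) (groot c)) powr \<alpha>)) \<in> borel_measurable borel"
    using borel_root_wt by measurable
  have 2: "(\<lambda>c. \<Sum>\<^sub>\<infinity>v\<in>verts (gnet c) - {groot c}. ennreal (norm (wt (gnet c) (groot c) v) powr \<alpha>)) \<in> borel_measurable borel"
    using borel_weight_sum[OF \<alpha>, of True] by simp
  show "(\<integral>\<^sup>+c. ennreal (norm (wt (gnet c) (groot c) (groot c)) powr \<alpha>) \<partial>\<rho>) = (\<integral>\<^sup>+x. ennreal (\<bar>l x\<bar> powr \<alpha>) \<partial>\<nu>)"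
    unfolding \<rho>_def using 1 by (subst nn_integral_distr[OF m]) (simp_all add: paircls_weights(1))
  show "(\<integral>\<^sup>+c. (\<Sum>\<^sub>\<infinity>v\<in>verts (gnet c) - {groot c}. ennreal (norm (wt (gnet c) (groot c) v) powr \<alpha>)) \<partial>\<rho>) = (\<integral>\<^sup>+x. ennreal (norm (z x) powr \<alpha>) \<partial>\<nu>)"
    unfolding \<rho>_def using 2 by (subst nn_integral_distr[OF m]) (simp_all add: paircls_weights(2)[OF \<alpha>])
qed

section \<open>Supports of angular measures\<close>

text \<open>Points off the support have null neighbourhoods, and finitely many of them cover a
  compact set.\<close>

lemma compact_disjoint_msupp_null:
  assumes M: "sets M = sets borel" and K: "compact K" "K \<inter> msupp M = {}"
  shows "emeasure M K = 0"
proof -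
  let ?C = "{U. open U \<and> emeasure M U = 0}"
  have cov: "K \<subseteq> \<Union>?C"
  proof
    fix x assume "x \<in> K"
    then have "x \<notin> msupp M" using K(2) by auto
    then obtain U where "open U" "x \<in> U" "\<not> 0 < emeasure M U" unfolding msupp_def by blast
    then show "x \<in> \<Union>?C" by auto
  qed
  obtain D where D: "D \<subseteq> ?C" "finite D" "K \<subseteq> \<Union>D"
    by (rule compactE[OF K(1) cov]) auto
  have "emeasure M K \<le> emeasure M (\<Union>D)"
    using D(1) by (intro emeasure_mono D(3)) (auto simp: M intro!: borel_open)
  also have "\<dots> \<le> (\<Sum>U\<in>D. emeasure M U)"
  proof -
    have "(\<lambda>U. U) ` D \<subseteq> sets M" using D(1) by (auto simp: M intro: borel_open)
    from emeasure_subadditive_finite[OF D(2) this] show ?thesis by simp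
  qed
  also have "\<dots> = 0" using D(1) by (intro sum.neutral) auto
  finally show ?thesis by simp
qed

text \<open>A vanishing tail makes \<open>neg_log\<close> infinite from there on, so the exponent
  would be infinite.\<close>

lemma tail_class_tail_pos:
  assumes M: "prob_space M" and Y: "tail_class \<alpha> a M Y" and a: "a < \<infinity>"
  shows "0 < measure M {w \<in> space M. t \<le> norm (Y w)}"
proof (rule ccontr)
  interpret prob_space M by fact
  assume "\<not> ?thesis"
  then have z: "measure M {w \<in> space M. t \<le> norm (Y w)} = 0" by (metis measure_nonneg less_le)
  have mY [measurable]: "Y \<in> borel_measurable M" using Y by (simp add: tail_class_def)
  have "eventually (\<lambda>s. ennreal (s powr (- \<alpha>)) * neg_log (measure M {w \<in> space M. s \<le> norm (Y w)}) = top) at_top"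
    using eventually_gt_at_top[of "max t 0"]
  proof eventually_elim
    case (elim s)
    have "measure M {w \<in> space M. s \<le> norm (Y w)} \<le> measure M {w \<in> space M. t \<le> norm (Y w)}"
      using elim by (intro finite_measure_mono) auto
    then have "measure M {w \<in> space M. s \<le> norm (Y w)} = 0" using z by (metis measure_nonneg antisym)
    then show ?case using elim by (simp add: neg_log_def ennreal_mult_eq_top_iff)
  qed
  then have "((\<lambda>s. ennreal (s powr (- \<alpha>)) * neg_log (measure M {w \<in> space M. s \<le> norm (Y w)})) \<longlongrightarrow> top) at_top"
    by (rule tendsto_eventually)
  moreover have "((\<lambda>s. ennreal (s powr (- \<alpha>)) * neg_log (measure M {w \<in> space M. s \<le> norm (Y w)})) \<longlongrightarrow> a) at_top"
    using Y by (simp add: tail_class_def)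
  ultimately have "a = top" by (intro tendsto_unique[OF trivial_limit_at_top_linorder])
  then show False using a by simp
qed

text \<open>Resolves the definite description: dividing by a positive tail probability determines
  the measure on the circle, which carries all of its mass.\<close>

lemma angular_measure_assoc:
  assumes M: "prob_space M" and Y: "tail_class \<alpha> a M Y" and a: "a < \<infinity>"
  shows "angular_measure M Y (assoc_measure M Y)"
proof -
  have ex: "\<exists>\<theta>. angular_measure M Y \<theta>" using Y a by (simp add: tail_class_def)
  have uniq: "\<theta>1 = \<theta>2" if \<theta>: "angular_measure M Y \<theta>1" "angular_measure M Y \<theta>2" for \<theta>1 \<theta>2
  proof -
    interpret \<theta>1: prob_space \<theta>1 using \<theta>(1) by (simp add: angular_measure_def)
    interpret \<theta>2: prob_space \<theta>2 using \<theta>(2) by (simp add: angular_measure_def)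
    have s: "sets \<theta>1 = sets borel" "sets \<theta>2 = sets borel" "measure \<theta>1 (sphere 0 1) = 1" "measure \<theta>2 (sphere 0 1) = 1"
      using \<theta> by (simp_all add: angular_measure_def)
    obtain t1 where t1: "\<And>t U. t1 \<le> t \<Longrightarrow> U \<in> sets borel \<Longrightarrow> U \<subseteq> sphere 0 1 \<Longrightarrow>
        measure M {w \<in> space M. Y w / complex_of_real (norm (Y w)) \<in> U \<and> norm (Y w) \<ge> t} = measure \<theta>1 U * measure M {w \<in> space M. norm (Y w) \<ge> t}"
      using \<theta>(1) unfolding angular_measure_def by blast
    obtain t2 where t2: "\<And>t U. t2 \<le> t \<Longrightarrow> U \<in> sets borel \<Longrightarrow> U \<subseteq> sphere 0 1 \<Longrightarrow>
        measure M {w \<in> space M. Y w / complex_of_real (norm (Y w)) \<in> U \<and> norm (Y w) \<ge> t} = measure \<theta>2 U * measure M {w \<in> space M. norm (Y w) \<ge> t}"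
      using \<theta>(2) unfolding angular_measure_def by blast
    have eq: "measure \<theta>1 U = measure \<theta>2 U" if U: "U \<in> sets borel" "U \<subseteq> sphere 0 1" for U
    proof -
      have "measure \<theta>1 U * measure M {w \<in> space M. norm (Y w) \<ge> max t1 t2} = measure \<theta>2 U * measure M {w \<in> space M. norm (Y w) \<ge> max t1 t2}"
        using t1[OF _ U, of "max t1 t2"] t2[OF _ U, of "max t1 t2"] by simp
      moreover have "measure M {w \<in> space M. norm (Y w) \<ge> max t1 t2} \<noteq> 0"
        using tail_class_tail_pos[OF M Y a, of "max t1 t2"] by simp
      ultimately show ?thesis by (metis mult_right_cancel)
    qed
    have sph: "sphere 0 1 \<in> sets (borel :: complex measure)" by (simp add: borel_closed)
    show ?thesis
    proof (rule measure_eqI)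
      fix A assume "A \<in> sets \<theta>1"
      then have A: "A \<in> sets borel" "A \<inter> sphere 0 1 \<in> sets borel" using s(1) sph by auto
      have "AE x in \<theta>1. x \<in> sphere 0 1" using \<theta>1.AE_in_set_eq_1[of "sphere 0 1"] s sph by simp
      then have "measure \<theta>1 A = measure \<theta>1 (A \<inter> sphere 0 1)"
        using A s(1) by (intro \<theta>1.finite_measure_eq_AE) auto
      also have "\<dots> = measure \<theta>2 (A \<inter> sphere 0 1)" by (rule eq[OF A(2)]) auto
      also have "\<dots> = measure \<theta>2 A"
      proof -
        have "AE x in \<theta>2. x \<in> sphere 0 1" using \<theta>2.AE_in_set_eq_1[of "sphere 0 1"] s sph by simp
        then show ?thesis using A s(2) by (intro \<theta>2.finite_measure_eq_AE) auto
      qed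
      finally show "emeasure \<theta>1 A = emeasure \<theta>2 A" by (simp add: \<theta>1.emeasure_eq_measure \<theta>2.emeasure_eq_measure)
    qed (simp add: s)
  qed
  from ex obtain \<theta> where \<theta>: "angular_measure M Y \<theta>" ..
  have "assoc_measure M Y = \<theta>" unfolding assoc_measure_def
  proof (rule the_equality)
    fix \<theta>' assume "angular_measure M Y \<theta>'"
    then show "\<theta>' = \<theta>" by (rule uniq[OF _ \<theta>])
  qed (rule \<theta>)
  with \<theta> show ?thesis by simp
qed

text \<open>The circle is compact and has mass 1, so it cannot avoid the support. This supplies the
  direction of the edges for the upper bound in (b).\<close>

lemma ex_unit_dir_supp:
  assumes M: "prob_space M" and Y: "tail_class \<alpha> a M Y"
  shows "\<exists>u\<in>dir_supp a M Y. norm u = 1"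
proof (cases "a = \<infinity>")
  case True
  then show ?thesis by (intro bexI[of _ 1]) (auto simp: dir_supp_def)
next
  case False
  then have a: "a < \<infinity>" by (simp add: less_top)
  let ?\<theta> = "assoc_measure M Y"
  from angular_measure_assoc[OF M Y a] have t: "prob_space ?\<theta>" "sets ?\<theta> = sets borel" "measure ?\<theta> (sphere 0 1) = 1"
    by (simp_all add: angular_measure_def)
  interpret prob_space ?\<theta> by (rule t(1))
  have "sphere 0 1 \<inter> msupp ?\<theta> \<noteq> {}"
  proof
    assume "sphere 0 1 \<inter> msupp ?\<theta> = {}"
    then have "emeasure ?\<theta> (sphere 0 1) = 0" by (intro compact_disjoint_msupp_null t(2)) simp_all
    then show False using t(3) by (simp add: emeasure_eq_measure)
  qed
  then show ?thesis using False by (auto simp: dir_supp_def)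
qed

text \<open>The half-line is exhausted by compact intervals that miss the support.\<close>

lemma cdf_eq_0_of_msupp:
  assumes \<nu>: "real_distribution \<nu>" and s: "msupp \<nu> \<subseteq> {0..}" and y: "y < 0"
  shows "cdf \<nu> y = 0"
proof -
  interpret real_distribution \<nu> by fact
  have "emeasure \<nu> (\<Union>n. {- real n..y}) = 0"
  proof (rule emeasure_UN_eq_0)
    fix n :: nat
    show "emeasure \<nu> {- real n..y} = 0" by (rule compact_disjoint_msupp_null) (use s y in auto)
  qed auto
  moreover have "(\<Union>n. {- real n..y}) = {..y}"
  proof (intro equalityI subsetI)
    fix x assume x: "x \<in> {..y}"
    obtain n :: nat where "- x \<le> real n" using real_arch_simple by blast
    then show "x \<in> (\<Union>n. {- real n..y})" using x by (auto intro!: exI[of _ n])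
  qed auto
  ultimately show ?thesis by (simp add: cdf_def measure_def)
qed

section \<open>Assembly of the three claims\<close>

theorem theorem1p3:
  fixes \<alpha> b :: real and a :: ennreal
    and M :: "'w measure" and X12 :: "'w \<Rightarrow> complex" and X11 :: "'w \<Rightarrow> real"
  assumes "0 < \<alpha>" and "\<alpha> < 2" and "0 < a" and "0 < b"
    and "prob_space M"
    and "tail_class \<alpha> a M X12"
    and "X11 \<in> borel_measurable M"
    and "tail_class \<alpha> (ennreal b) M (\<lambda>w. complex_of_real (X11 w))"
    and "msupp (assoc_measure M (\<lambda>w. complex_of_real (X11 w))) = {1}"
  shows "(\<forall>\<nu>. real_distribution \<nu> \<and> msupp \<nu> \<subseteq> {0..} \<longrightarrow>
            Phi \<alpha> a b M X12 X11 \<nu> \<le> ennreal b * abs_moment \<alpha> \<nu>)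
       \<and> (1 < \<alpha> \<longrightarrow> (\<forall>\<nu>. real_distribution \<nu> \<and> distr \<nu> borel uminus = \<nu> \<longrightarrow>
            Phi \<alpha> a b M X12 X11 \<nu> = a / 2 * abs_moment \<alpha> \<nu>))
       \<and> (1 < \<alpha> \<longrightarrow> (\<forall>\<nu>. real_distribution \<nu> \<and> ext_mean \<nu> < 0 \<longrightarrow>
            Phi \<alpha> a b M X12 X11 \<nu> = \<infinity>))"
proof -
  note \<alpha> = assms(1,2)
  let ?Sa = "dir_supp a M X12"
  have Sb: "dir_supp (ennreal b) M (\<lambda>w. complex_of_real (X11 w)) = {1}"
    using assms(9) by (simp add: dir_supp_def)
  have Phi: "Phi \<alpha> a b M X12 X11 \<nu> = Inf {rate_I \<alpha> a b \<rho> |\<rho>. \<rho> \<in> sofic ?Sa {1} \<and> net_spectral \<rho> = \<nu>}" for \<nu>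
    unfolding Phi_def Sb ..
  have Phi_le: "Phi \<alpha> a b M X12 X11 \<nu> \<le> rate_I \<alpha> a b \<rho>" if "\<rho> \<in> sofic ?Sa {1}" "net_spectral \<rho> = \<nu>" for \<nu> \<rho>
    unfolding Phi using that by (intro Inf_lower) blast
  have upper_a: "Phi \<alpha> a b M X12 X11 \<nu> \<le> ennreal b * abs_moment \<alpha> \<nu>"
    if \<nu>: "real_distribution \<nu>" and s: "msupp \<nu> \<subseteq> {0..}" for \<nu>
  \<comment> \<open>A finite moment makes \<open>xi\<close> integrable, so that
    \<open>net_spectral\<close> is given by the weak limit; otherwise the bound is infinite because
    b > 0.\<close>
  proof (cases "abs_moment \<alpha> \<nu> = top")
    case True
    then show ?thesis using assms(4) by (simp add: ennreal_mult_top)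
  next
    case False
    let ?\<rho> = "distr \<nu> borel (\<lambda>x. paircls x 0)"
    have c: "continuous_on UNIV (\<lambda>x::real. x)" "continuous_on UNIV (\<lambda>x::real. 0::complex)" by (intro continuous_intros)+
    note i = distr_paircls_integrals[OF \<nu> c \<alpha>(1)]
    have xi: "(\<integral>\<^sup>+c. xi \<alpha> c \<partial>?\<rho>) < \<infinity>"
      using False by (subst nn_integral_xi[OF _ \<alpha>(1)]) (simp_all add: i abs_moment_def less_top)
    have "net_spectral ?\<rho> = \<nu>"
      by (rule net_spectral_paircls[OF \<nu> c, where p = "\<lambda>x. x" and q = "\<lambda>x. x", OF _ _ wpow_pairnet(1) _ \<alpha> xi]) simp_all
    then have "Phi \<alpha> a b M X12 X11 \<nu> \<le> rate_I \<alpha> a b ?\<rho>"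
      by (intro Phi_le sofic_diagonal[OF \<nu> cdf_eq_0_of_msupp[OF \<nu> s]])
    also have "\<dots> = ennreal b * abs_moment \<alpha> \<nu>" unfolding rate_I_def i by (simp add: abs_moment_def)
    finally show ?thesis .
  qed
  have upper_b: "Phi \<alpha> a b M X12 X11 \<nu> \<le> a / 2 * abs_moment \<alpha> \<nu>"
    if \<nu>: "real_distribution \<nu>" "distr \<nu> borel uminus = \<nu>" for \<nu>
  proof (cases "abs_moment \<alpha> \<nu> = top")
    case True
    then show ?thesis using assms(3) by (simp add: ennreal_mult_top ennreal_divide_eq_0_iff)
  next
    case False
    interpret real_distribution \<nu> by (rule \<nu>(1))
    obtain u where u: "u \<in> ?Sa" "norm u = 1" using ex_unit_dir_supp[OF assms(5,6)] by blast
    let ?\<rho> = "distr \<nu> borel (\<lambda>x. paircls 0 (edge u x))"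
    have c: "continuous_on UNIV (\<lambda>x::real. 0::real)" "continuous_on UNIV (edge u)" by (intro continuous_intros continuous_edge)+
    note i = distr_paircls_integrals[OF \<nu>(1) c \<alpha>(1)]
    have xi: "(\<integral>\<^sup>+c. xi \<alpha> c \<partial>?\<rho>) < \<infinity>"
      using False by (subst nn_integral_xi[OF _ \<alpha>(1)]) (simp_all add: i norm_edge[OF u(2)] abs_moment_def less_top)
    have "net_spectral ?\<rho> = \<nu>"
    proof (rule net_spectral_paircls[OF \<nu>(1) c _ _ _ _ \<alpha> xi])
      show "wpow (pairnet 0 (edge u x)) k 0 0 = of_real ((\<bar>x\<bar> ^ k + (- \<bar>x\<bar>) ^ k) / 2)" for x k
        unfolding wpow_pairnet(2) norm_edge[OF u(2)] ..
      fix f :: "real \<Rightarrow> real" and B assume f: "continuous_on UNIV f" "\<And>y. \<bar>f y\<bar> \<le> B"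
      have mf: "f \<in> borel_measurable borel" by (rule borel_measurable_continuous_onI[OF f(1)])
      have int: "integrable \<nu> f" "integrable \<nu> (\<lambda>x. f (- x))"
        using mf f(2) by (auto intro!: integrable_const_bound[where B = B])
      have "(\<integral>x. f x \<partial>distr \<nu> borel uminus) = (\<integral>x. f (- x) \<partial>\<nu>)" by (rule integral_distr[OF _ mf]) simp
      then have "(\<integral>x. (f x + f (- x)) / 2 \<partial>\<nu>) = (\<integral>x. f x \<partial>\<nu>)" unfolding \<nu>(2) using int by simp
      \<comment> \<open>The eigenvalues |x| and -|x| are x and -x in some order.\<close>
      moreover have "(f \<bar>x\<bar> + f (- \<bar>x\<bar>)) / 2 = (f x + f (- x)) / 2" for x by (cases "0 \<le> x") simp_all
      ultimately show "(\<integral>x. (f \<bar>x\<bar> + f (- \<bar>x\<bar>)) / 2 \<partial>\<nu>) = (\<integral>x. f x \<partial>\<nu>)" by (simp only:)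
    qed simp_all
    then have "Phi \<alpha> a b M X12 X11 \<nu> \<le> rate_I \<alpha> a b ?\<rho>" by (intro Phi_le sofic_pairs[OF \<nu> u])
    also have "\<dots> = a / 2 * abs_moment \<alpha> \<nu>" unfolding rate_I_def i by (simp add: abs_moment_def norm_edge[OF u(2)])
    finally show ?thesis .
  qed
  have lower_b: "a / 2 * abs_moment \<alpha> \<nu> \<le> Phi \<alpha> a b M X12 X11 \<nu>"
    if "1 < \<alpha>" "real_distribution \<nu>" "distr \<nu> borel uminus = \<nu>" for \<nu>
    unfolding Phi
  proof (rule Inf_greatest, clarify)
    fix \<rho> assume \<rho>: "\<rho> \<in> sofic ?Sa {1}" and \<nu>: "\<nu> = net_spectral \<rho>"
    show "a / 2 * abs_moment \<alpha> (net_spectral \<rho>) \<le> rate_I \<alpha> a b \<rho>"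
    proof (cases "rate_I \<alpha> a b \<rho> < \<infinity>")
      case True
      have "(\<integral>x. x \<partial>net_spectral \<rho>) = 0"
        using symmetric_mean_0[OF that(3)] that(2) by (simp add: \<nu> real_distribution.events_eq_borel)
      then show ?thesis by (rule centered_rate_ge[OF \<rho> that(1) \<alpha>(2) assms(3,4) True])
    qed (simp add: less_top[symmetric])
  qed
  have c: "Phi \<alpha> a b M X12 X11 \<nu> = \<infinity>" if "1 < \<alpha>" "ext_mean \<nu> < 0" for \<nu>
  proof -
    \<comment> \<open>Every candidate law has infinite rate; if there is none, the infimum is
      infinite as well.\<close>
    have "\<infinity> \<le> Phi \<alpha> a b M X12 X11 \<nu>"
      unfolding Phi
    proof (rule Inf_greatest, clarify)
      fix \<rho> assume \<rho>: "\<rho> \<in> sofic ?Sa {1}" and \<nu>: "\<nu> = net_spectral \<rho>"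
      have "\<not> rate_I \<alpha> a b \<rho> < \<infinity>"
      proof
        assume "rate_I \<alpha> a b \<rho> < \<infinity>"
        from net_spectral_mean_nonneg[OF \<rho> that(1) \<alpha>(2) assms(3,4) this]
        have "0 \<le> ext_mean (net_spectral \<rho>)" by (simp add: ext_mean_integrable)
        then show False using that(2) unfolding \<nu> by simp
      qed
      then show "\<infinity> \<le> rate_I \<alpha> a b \<rho>" by (simp add: less_top[symmetric])
    qed
    then show ?thesis by (simp add: top_unique)
  qed
  show ?thesis using upper_a upper_b lower_b c by (auto intro: antisym)
qed

end
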